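(* Let $G$ be a locally compact second countable group and $\Gamma$ a lattice in $G$. Then $G$ has property $(TTT)$ if and only if $\Gamma$ has property $(TTT)$.
   Context: For a locally compact group $G$ and a Hilbert space $H$, let $\mathcal{U}(H)$ be the unitary group of $H$ (with the Borel structure of the strong operator topology). A wq-cocycle on $G$ is a Borel, locally bounded (i.e. bounded on compact subsets) map $b:G\to H$, together with a Borel map $\pi:G\to\mathcal{U}(H)$ (not required to be a homomorphism), such that $\sup_{g,h\in G}\Vert b(gh)-b(g)-\pi(g)b(h)\Vert<+\infty$. If $A$ is a subgroup of $G$, the pair $(G,A)$ has relative property $(TTT)$ if every wq-cocycle on $G$ (for every Hilbert space $H$ and every $\pi$) is bounded on $A$. $G$ has property $(TTT)$ if $(G,G)$ has relative property $(TTT)$, i.e. if every wq-cocycle on $G$ is bounded. A lattice in $G$ is a discrete subgroup $\Gamma$ such that $G/\Gamma$ carries a finite nonzero $G$-invariant Borel measure (it is not assumed cocompact). *)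

theory Defs
  imports "HOL-Analysis.Analysis" "HOL-Algebra.Left_Coset" "HOL-Algebra.Module"
begin

definition borel_of :: "'a topology \<Rightarrow> 'a measure" where
  "borel_of T = sigma (topspace T) {U. openin T U}"


section \<open>Complex Hilbert spaces\<close>

text \<open>
  A Hilbert space is a record with its own carrier, not a type class instance, because the
  definition of property (TTT) has to quantify over Hilbert spaces inside a formula.
\<close>

definition complex_ring :: "complex ring" where
  "complex_ring = \<lparr>carrier = UNIV, mult = (*), one = 1, zero = 0, add = (+)\<rparr>"

text \<open>
  The fields \<open>mult\<close> and \<open>one\<close>, which every module record inherits from ring records,
  carry no meaning here.
\<close>

record 'h hilbert = "(complex, 'h) module" +
  hinner :: "'h \<Rightarrow> 'h \<Rightarrow> complex"

definition hnorm :: "('h, 'x) hilbert_scheme \<Rightarrow> 'h \<Rightarrow> real" where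
  "hnorm H x = sqrt (Re (hinner H x x))"

text \<open>The value outside the carrier is needed because \<open>Metric_space\<close> requires nonnegativity and
  symmetry on the whole type.\<close>

definition hdist :: "('h, 'x) hilbert_scheme \<Rightarrow> 'h \<Rightarrow> 'h \<Rightarrow> real" where
  "hdist H x y =
    (if x \<in> carrier H \<and> y \<in> carrier H then hnorm H (x \<ominus>\<^bsub>H\<^esub> y) else 0)"

definition htopology :: "('h, 'x) hilbert_scheme \<Rightarrow> 'h topology" where
  "htopology H = Metric_space.mtopology (carrier H) (hdist H)"

locale hilbert_space = Module.module complex_ring H
  for H :: "('h, 'x) hilbert_scheme" (structure) +
  assumes hinner_add_left:
      "\<lbrakk>x \<in> carrier H; y \<in> carrier H; z \<in> carrier H\<rbrakk> \<Longrightarrow>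
        hinner H (x \<oplus> y) z = hinner H x z + hinner H y z"
    and hinner_smult_left:
      "\<lbrakk>x \<in> carrier H; y \<in> carrier H\<rbrakk> \<Longrightarrow> hinner H (c \<odot> x) y = c * hinner H x y"
    and hinner_commute:
      "\<lbrakk>x \<in> carrier H; y \<in> carrier H\<rbrakk> \<Longrightarrow> hinner H y x = cnj (hinner H x y)"
    and hinner_nonneg:
      "x \<in> carrier H \<Longrightarrow> 0 \<le> Re (hinner H x x)"
    and hinner_definite:
      "\<lbrakk>x \<in> carrier H; hinner H x x = 0\<rbrakk> \<Longrightarrow> x = \<zero>"
    and hcomplete:
      "Metric_space.mcomplete (carrier H) (hdist H)"

text \<open>
  Operators are functions that are \<open>undefined\<close> outside the carrier, so that equality of
  operators is equality on the carrier.
\<close>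

definition unitary_group :: "('h, 'x) hilbert_scheme \<Rightarrow> ('h \<Rightarrow> 'h) set" where
  "unitary_group H =
    {U \<in> extensional (carrier H).
      bij_betw U (carrier H) (carrier H) \<and>
      (\<forall>x\<in>carrier H. \<forall>y\<in>carrier H. U (x \<oplus>\<^bsub>H\<^esub> y) = U x \<oplus>\<^bsub>H\<^esub> U y) \<and>
      (\<forall>c. \<forall>x\<in>carrier H. U (c \<odot>\<^bsub>H\<^esub> x) = c \<odot>\<^bsub>H\<^esub> U x) \<and>
      (\<forall>x\<in>carrier H. \<forall>y\<in>carrier H. hinner H (U x) (U y) = hinner H x y)}"

text \<open>
  The strong operator topology: pointwise convergence on \<open>carrier H\<close> in norm.
\<close>

definition unitary_sot :: "('h, 'x) hilbert_scheme \<Rightarrow> ('h \<Rightarrow> 'h) topology" where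
  "unitary_sot H =
    subtopology (product_topology (\<lambda>_. htopology H) (carrier H)) (unitary_group H)"


section \<open>Topological groups and lattices\<close>

locale topological_group = group G for G :: "('a, 'm) monoid_scheme" (structure) +
  fixes T :: "'a topology"
  assumes topspace_eq: "topspace T = carrier G"
    and continuous_mult: "continuous_map (prod_topology T T) T (\<lambda>(x, y). x \<otimes> y)"
    and continuous_inv: "continuous_map T T (\<lambda>x. inv x)"

text \<open>As usual, locally compact groups are Hausdorff.\<close>

locale lcsc_group = topological_group +
  assumes Hausdorff: "Hausdorff_space T"
    and locally_compact: "locally_compact_space T"
    and second_countable: "second_countable T"

definition coset_topology ::
    "('a, 'm) monoid_scheme \<Rightarrow> 'a topology \<Rightarrow> 'a set \<Rightarrow> 'a set topology" where
  "coset_topology G T \<Gamma> =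
    topology (\<lambda>\<U>. \<U> \<subseteq> lcosets\<^bsub>G\<^esub> \<Gamma> \<and> openin T (\<Union>\<U>))"

definition lattice_in ::
    "('a, 'm) monoid_scheme \<Rightarrow> 'a topology \<Rightarrow> 'a set \<Rightarrow> bool" where
  "lattice_in G T \<Gamma> \<longleftrightarrow>
    subgroup \<Gamma> G \<and>
    subtopology T \<Gamma> = discrete_topology \<Gamma> \<and>
    (\<exists>\<mu>. sets \<mu> = sets (borel_of (coset_topology G T \<Gamma>)) \<and>
      0 < emeasure \<mu> (space \<mu>) \<and> emeasure \<mu> (space \<mu>) < \<infinity> \<and>
      (\<forall>g\<in>carrier G. \<forall>A\<in>sets \<mu>. emeasure \<mu> ((\<lambda>C. g <#\<^bsub>G\<^esub> C) ` A) = emeasure \<mu> A))"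


section \<open>Property (TTT)\<close>

definition wq_cocycle ::
    "('a, 'm) monoid_scheme \<Rightarrow> 'a topology \<Rightarrow> ('h, 'x) hilbert_scheme \<Rightarrow>
      ('a \<Rightarrow> 'h) \<Rightarrow> ('a \<Rightarrow> 'h \<Rightarrow> 'h) \<Rightarrow> bool" where
  "wq_cocycle G T H b \<pi> \<longleftrightarrow>
    b \<in> measurable (borel_of T) (borel_of (htopology H)) \<and>
    (\<forall>K. compactin T K \<longrightarrow> (\<exists>C. \<forall>g\<in>K. hnorm H (b g) \<le> C)) \<and>
    \<pi> \<in> measurable (borel_of T) (borel_of (unitary_sot H)) \<and>
    (\<exists>C. \<forall>g\<in>carrier G. \<forall>h\<in>carrier G.
      hnorm H (b (g \<otimes>\<^bsub>G\<^esub> h) \<ominus>\<^bsub>H\<^esub> b g \<ominus>\<^bsub>H\<^esub> \<pi> g (b h)) \<le> C)"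

text \<open>
  A formula of HOL can quantify over all Hilbert spaces whose elements belong to one given type,
  but not over all types. That type is the first argument. The carrier may be any subset of the
  type and the operations are arbitrary, so up to isomorphism all Hilbert spaces of at most the
  cardinality of the type are covered. Every Hilbert space is covered for some type of the form
  \<open>'h \<Rightarrow> complex\<close>, and each such type has at least the cardinality of the continuum and
  therefore covers all separable Hilbert spaces.
\<close>

definition relative_property_TTT ::
    "'h itself \<Rightarrow> ('a, 'm) monoid_scheme \<Rightarrow> 'a topology \<Rightarrow> 'a set \<Rightarrow> bool" where
  "relative_property_TTT (_ :: 'h itself) G T A \<longleftrightarrow>
    (\<forall>(H :: 'h hilbert) b \<pi>. hilbert_space H \<longrightarrow> wq_cocycle G T H b \<pi> \<longrightarrow>
      (\<exists>C. \<forall>g\<in>A. hnorm H (b g) \<le> C))"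

definition property_TTT ::
    "'h itself \<Rightarrow> ('a, 'm) monoid_scheme \<Rightarrow> 'a topology \<Rightarrow> bool" where
  "property_TTT h G T \<longleftrightarrow> relative_property_TTT h G T (carrier G)"

end

theory Submission
  imports Defs "HOL-Library.Function_Algebras"
begin

text \<open>
  From \<open>\<Gamma>\<close> to \<open>G\<close>: if \<open>b\<close> is bounded on \<open>\<Gamma>\<close>, then \<open>\<parallel>b\<parallel>\<close> is, up to a bounded error, a function on \<open>G/\<Gamma>\<close>.
  It is bounded on a set of more than half of the mass of \<open>G/\<Gamma>\<close>, and this set meets each of its translates.

  From \<open>G\<close> to \<open>\<Gamma>\<close>: since \<open>\<Gamma>\<close> need not be cocompact, inducing a wq-cocycle \<open>b\<close> of \<open>\<Gamma>\<close> may give functions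
  on \<open>G/\<Gamma>\<close> that are not square integrable. Instead one induces the kernel \<open>\<Sum>\<^sub>j (1 - exp (- t\<^sub>j d\<^sup>2))\<close> of the
  distance \<open>d\<close>; it is conditionally negative definite and invariant under affine isometries, unbounded, and
  for suitable \<open>t\<close> so slowly growing that the induced cocycle is locally bounded. Boundedness of the
  latter says that \<open>\<parallel>b (\<kappa> g C)\<parallel>\<close> is tight, uniformly in \<open>g\<close>, where \<open>\<kappa>\<close> is the cocycle of \<open>G\<close> on \<open>G/\<Gamma>\<close> with
  values in \<open>\<Gamma>\<close>. Finally a length function on \<open>\<Gamma>\<close> that is tight along \<open>\<kappa>\<close> is bounded, by an almost
  minimizing argument among the convex combinations of translates of the indicator of a large ball.
\<close>

text \<open>Two obstacles shape the induction from \<Gamma> to \<open>G\<close>. First, the new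
  Hilbert space has to live on the prescribed type, which is sure to hold only separable spaces.
  Hence the isometries v \<mapsto> b(\<gamma>) + \<pi>(\<gamma>) v are followed on a countable set
  of points stable under them, the induced space is built from functions with countably many values,
  and a countable dense set is carried along. Second, \<pi> is no homomorphism, so there is no
  isometric action to induce. But each single map preserves the kernel exactly, and at the origin
  the map of a product differs from the composite of the maps by a bounded distance; a kernel that
  is a monotone function of the distance has a bounded defect there. As the kernel is unbounded,
  Markov's inequality turns its bounded integrals into tightness. In the last step the order of
  choices matters: the radius R of the ball is fixed once, and the precision of the near minimizer
  may depend on the element of \<Gamma> whose length is being estimated, because the resulting bound
  4R does not involve it.\<close>

section \<open>Semi-inner product spaces and their completion\<close>

text \<open>Vectors of a separable Hilbert space are later coded by sequences of complex numbers;
  this puts them on any type of the form \<open>'h \<Rightarrow> complex\<close>. The injection runs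
  through sets of naturals back to the reals and ends in the constant functions.\<close>

lemma ex_inj_sequences:
  "\<exists>\<phi>::(nat \<Rightarrow> complex) \<Rightarrow> ('h \<Rightarrow> complex). inj \<phi>"
proof -
  have "(UNIV::real set) \<lesssim> (UNIV::nat set set)"
    using nat_sets_eqpoll_reals eqpoll_sym eqpoll_imp_lepoll by blast
  then obtain r :: "real \<Rightarrow> nat set" where r: "inj r"
    unfolding lepoll_def by blast
  have "(UNIV::nat set set) \<lesssim> (UNIV::real set)"
    using nat_sets_eqpoll_reals eqpoll_imp_lepoll by blast
  then obtain s :: "nat set \<Rightarrow> real" where s: "inj s"
    unfolding lepoll_def by blast
  \<comment> \<open>The tag 0 or 1 keeps real and imaginary parts apart, and \<open>n\<close> is the
    index of the entry.\<close>
  define code :: "(nat \<Rightarrow> complex) \<Rightarrow> nat set" where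
    "code x = {prod_encode (n, prod_encode (k, 0)) | n k. k \<in> r (Re (x n))} \<union>
              {prod_encode (n, prod_encode (k, 1)) | n k. k \<in> r (Im (x n))}" for x
  have code_iff: "prod_encode (n, prod_encode (k, 0)) \<in> code x \<longleftrightarrow> k \<in> r (Re (x n))"
    "prod_encode (n, prod_encode (k, 1)) \<in> code x \<longleftrightarrow> k \<in> r (Im (x n))" for n k x
    by (simp_all add: code_def prod_encode_eq)
  have "inj code"
  proof (rule injI)
    fix x y assume "code x = code y"
    then have "r (Re (x n)) = r (Re (y n)) \<and> r (Im (x n)) = r (Im (y n))" for n
      using code_iff[of n _ x] code_iff[of n _ y] by blast
    then show "x = y"
      using r by (intro ext complex_eqI) (metis injD)+
  qed
  then have "inj (\<lambda>x (_::'h). complex_of_real (s (code x)))"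
    using s by (simp add: inj_def fun_eq_iff)
  then show ?thesis by blast
qed

text \<open>Definiteness is left out on purpose: null vectors are divided out only once, after
  completion, by a map into the final type. The laws for \<open>sc\<close> are demanded on the whole
  type because pointwise scaling of functions satisfies them there, whereas \<open>Q\<close> is
  controlled on \<open>V\<close> only.\<close>

locale semi_inner =
  fixes V :: "'v::ab_group_add set"
    and sc :: "complex \<Rightarrow> 'v \<Rightarrow> 'v"
    and Q :: "'v \<Rightarrow> 'v \<Rightarrow> complex"
  assumes zero_mem: "0 \<in> V"
    and add_mem: "\<lbrakk>x \<in> V; y \<in> V\<rbrakk> \<Longrightarrow> x + y \<in> V"
    and sc_mem: "x \<in> V \<Longrightarrow> sc c x \<in> V"
    and sc_add_right: "sc c (x + y) = sc c x + sc c y"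
    and sc_add_left: "sc (c + d) x = sc c x + sc d x"
    and sc_sc: "sc c (sc d x) = sc (c * d) x"
    and sc_one: "sc 1 x = x"
    and Q_add: "\<lbrakk>x \<in> V; y \<in> V; z \<in> V\<rbrakk> \<Longrightarrow> Q (x + y) z = Q x z + Q y z"
    and Q_sc: "\<lbrakk>x \<in> V; y \<in> V\<rbrakk> \<Longrightarrow> Q (sc c x) y = c * Q x y"
    and Q_commute: "\<lbrakk>x \<in> V; y \<in> V\<rbrakk> \<Longrightarrow> Q y x = cnj (Q x y)"
    and Q_nonneg: "x \<in> V \<Longrightarrow> 0 \<le> Re (Q x x)"
begin

lemma sc_zero_left: "sc 0 x = 0"
  using sc_add_left[of 0 0 x] by simp

lemma sc_minus_one: "sc (-1) x = - x"
  using sc_add_left[of "-1" 1 x] by (simp add: sc_zero_left sc_one minus_unique add.commute)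

lemma uminus_mem: "x \<in> V \<Longrightarrow> - x \<in> V"
  using sc_mem[of x "-1"] by (simp add: sc_minus_one)

lemma diff_mem: "\<lbrakk>x \<in> V; y \<in> V\<rbrakk> \<Longrightarrow> x - y \<in> V"
  using add_mem[of x "- y"] uminus_mem by simp

lemma Q_zero_left: "y \<in> V \<Longrightarrow> Q 0 y = 0"
  using Q_sc[of 0 y 0] by (simp add: sc_zero_left zero_mem)

lemma Q_uminus: "\<lbrakk>x \<in> V; y \<in> V\<rbrakk> \<Longrightarrow> Q (- x) y = - Q x y"
  using Q_sc[of x y "-1"] by (simp add: sc_minus_one)

lemma Q_diff: "\<lbrakk>x \<in> V; y \<in> V; z \<in> V\<rbrakk> \<Longrightarrow> Q (x - y) z = Q x z - Q y z"
  using Q_add[of x "- y" z] by (simp add: Q_uminus uminus_mem)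

lemma Q_add_right: "\<lbrakk>x \<in> V; y \<in> V; z \<in> V\<rbrakk> \<Longrightarrow> Q z (x + y) = Q z x + Q z y"
  by (metis Q_add Q_commute add_mem complex_cnj_add)

lemma Q_sc_right: "\<lbrakk>x \<in> V; y \<in> V\<rbrakk> \<Longrightarrow> Q x (sc c y) = cnj c * Q x y"
  by (metis Q_sc Q_commute sc_mem complex_cnj_mult)

lemma Q_diff_right: "\<lbrakk>x \<in> V; y \<in> V; z \<in> V\<rbrakk> \<Longrightarrow> Q z (x - y) = Q z x - Q z y"
  by (metis Q_diff Q_commute diff_mem complex_cnj_diff)

lemma Q_self_Im: "x \<in> V \<Longrightarrow> Im (Q x x) = 0"
  using Q_commute[of x x] by (simp add: complex_eq_iff)

definition nrm :: "'v \<Rightarrow> real" where "nrm x = sqrt (Re (Q x x))"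

lemma nrm_nonneg [simp]: "x \<in> V \<Longrightarrow> 0 \<le> nrm x"
  by (simp add: nrm_def Q_nonneg)

lemma nrm_square: "x \<in> V \<Longrightarrow> (nrm x)\<^sup>2 = Re (Q x x)"
  by (simp add: nrm_def Q_nonneg)

lemma cauchy_schwarz:
  assumes x: "x \<in> V" and y: "y \<in> V"
  shows "cmod (Q x y) \<le> nrm x * nrm y"
proof -
  define a b p where "a = Re (Q x x)" and "b = Re (Q y y)" and "p = (cmod (Q x y))\<^sup>2"
  have b0: "b \<ge> 0" and p0: "p \<ge> 0"
    using Q_nonneg x y by (auto simp: a_def b_def p_def)
  \<comment> \<open>A coefficient proportional to \<open>Q x y\<close> makes the mixed terms real,
    so that nonnegativity of \<open>Q\<close> becomes a statement about a real quadratic in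
    \<open>s\<close>.\<close>
  have key: "a - 2 * s * p + s\<^sup>2 * p * b \<ge> 0" for s :: real
  proof -
    define c where "c = of_real s * Q x y"
    have "Q (x - sc c y) (x - sc c y) = Q x x - cnj c * Q x y - c * Q y x + c * cnj c * Q y y"
      by (simp add: Q_diff Q_diff_right x y sc_mem diff_mem Q_sc Q_sc_right algebra_simps)
    moreover have "Q x y * cnj (Q x y) = of_real p"
      by (simp add: p_def complex_norm_square[symmetric] del: of_real_power)
    then have "cnj c * Q x y = of_real (s * p)" "c * Q y x = of_real (s * p)"
      "c * cnj c = of_real (s\<^sup>2 * p)"
      by (simp_all add: c_def Q_commute[OF x y] power2_eq_square algebra_simps)
    ultimately have "Re (Q (x - sc c y) (x - sc c y)) = a - 2 * s * p + s\<^sup>2 * p * b"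
      by (simp add: a_def b_def)
    then show ?thesis
      using Q_nonneg[of "x - sc c y"] x y sc_mem diff_mem by simp
  qed
  have "p \<le> a * b"
  proof (cases "b = 0")
    case True
    show ?thesis
    proof (rule ccontr)
      assume "\<not> p \<le> a * b"
      with True p0 have "p > 0" by simp
      \<comment> \<open>For b = 0 the quadratic is linear in \<open>s\<close>, and this choice gives
        it the value -1.\<close>
      with key[of "(a + 1) / (2 * p)"] True show False by simp
    qed
  next
    case False
    then have "a * b - p \<ge> 0"
      using key[of "1 / b"] b0 mult_nonneg_nonneg[OF key[of "1/b"] b0]
      by (simp add: field_simps power2_eq_square)
    then show ?thesis by simp
  qed
  then have "sqrt p \<le> sqrt (a * b)" by simp
  then show ?thesis
    by (simp add: p_def a_def b_def nrm_def real_sqrt_mult)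
qed

lemma nrm_sc: "x \<in> V \<Longrightarrow> nrm (sc c x) = cmod c * nrm x"
proof -
  assume x: "x \<in> V"
  have "Q (sc c x) (sc c x) = c * cnj c * Q x x"
    by (simp add: Q_sc Q_sc_right x sc_mem)
  then have "Re (Q (sc c x) (sc c x)) = (cmod c)\<^sup>2 * Re (Q x x)"
    by (simp add: complex_norm_square[symmetric] del: of_real_power)
  then show ?thesis by (simp add: nrm_def real_sqrt_mult)
qed

lemma nrm_uminus: "x \<in> V \<Longrightarrow> nrm (- x) = nrm x"
  using nrm_sc[of x "-1"] by (simp add: sc_minus_one)

lemma nrm_minus_commute: "\<lbrakk>x \<in> V; y \<in> V\<rbrakk> \<Longrightarrow> nrm (x - y) = nrm (y - x)"
  using nrm_uminus[of "x - y"] diff_mem by simp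

lemma nrm_zero [simp]: "nrm 0 = 0"
  by (simp add: nrm_def Q_zero_left zero_mem)

lemma nrm_triangle:
  assumes "x \<in> V" "y \<in> V"
  shows "nrm (x + y) \<le> nrm x + nrm y"
proof (rule power2_le_imp_le)
  have "(nrm (x + y))\<^sup>2 = (nrm x)\<^sup>2 + (nrm y)\<^sup>2 + 2 * Re (Q x y)"
    using assms by (simp add: nrm_square add_mem Q_add Q_add_right Q_commute[of x y])
  moreover have "Re (Q x y) \<le> nrm x * nrm y"
    using cauchy_schwarz[OF assms] complex_Re_le_cmod order_trans by blast
  ultimately show "(nrm (x + y))\<^sup>2 \<le> (nrm x + nrm y)\<^sup>2"
    by (simp add: power2_sum)
qed (use assms in auto)

lemma nrm_triangle_diff:
  assumes "x \<in> V" "y \<in> V" "z \<in> V"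
  shows "nrm (x - z) \<le> nrm (x - y) + nrm (y - z)"
  using nrm_triangle[of "x - y" "y - z"] assms diff_mem by simp

lemma nrm_reverse_triangle:
  assumes "x \<in> V" "y \<in> V"
  shows "\<bar>nrm x - nrm y\<bar> \<le> nrm (x - y)"
  using nrm_triangle[of "x - y" y] nrm_triangle[of "y - x" x] nrm_minus_commute[of x y]
    assms diff_mem by auto

lemma Q_diff_bound:
  assumes "x \<in> V" "y \<in> V" "x' \<in> V" "y' \<in> V"
  shows "cmod (Q x y - Q x' y') \<le> nrm (x - x') * nrm y + nrm x' * nrm (y - y')"
proof -
  have "Q x y - Q x' y' = Q (x - x') y + Q x' (y - y')"
    using assms by (simp add: Q_diff Q_diff_right)
  then show ?thesis
    using norm_triangle_ineq[of "Q (x - x') y" "Q x' (y - y')"]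
      cauchy_schwarz[of "x - x'" y] cauchy_schwarz[of x' "y - y'"] assms diff_mem
    by simp
qed

text \<open>A linear isometry of \<open>V\<close> onto itself, with its inverse as an explicit
  witness of surjectivity. Linearity is asked of \<open>A\<close> only and passes to
  \<open>B\<close>.\<close>

definition isometry_pair :: "('v \<Rightarrow> 'v) \<Rightarrow> ('v \<Rightarrow> 'v) \<Rightarrow> bool" where
  "isometry_pair A B \<longleftrightarrow>
    (\<forall>x\<in>V. A x \<in> V \<and> B x \<in> V \<and> A (B x) = x \<and> B (A x) = x) \<and>
    (\<forall>x\<in>V. \<forall>y\<in>V. A (x + y) = A x + A y \<and> Q (A x) (A y) = Q x y) \<and>
    (\<forall>c. \<forall>x\<in>V. A (sc c x) = sc c (A x))"

lemma isometry_pairD: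
  assumes "isometry_pair A B"
  shows "x \<in> V \<Longrightarrow> A x \<in> V" "x \<in> V \<Longrightarrow> B x \<in> V"
    "x \<in> V \<Longrightarrow> A (B x) = x" "x \<in> V \<Longrightarrow> B (A x) = x"
    "\<lbrakk>x \<in> V; y \<in> V\<rbrakk> \<Longrightarrow> A (x + y) = A x + A y"
    "\<lbrakk>x \<in> V; y \<in> V\<rbrakk> \<Longrightarrow> A (x - y) = A x - A y"
    "\<lbrakk>x \<in> V; y \<in> V\<rbrakk> \<Longrightarrow> Q (A x) (A y) = Q x y"
    "x \<in> V \<Longrightarrow> A (sc c x) = sc c (A x)"
    "x \<in> V \<Longrightarrow> nrm (A x) = nrm x"
proof -
  note d = assms[unfolded isometry_pair_def]
  show "x \<in> V \<Longrightarrow> A x \<in> V" "x \<in> V \<Longrightarrow> B x \<in> V"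
    "x \<in> V \<Longrightarrow> A (B x) = x" "x \<in> V \<Longrightarrow> B (A x) = x"
    "\<lbrakk>x \<in> V; y \<in> V\<rbrakk> \<Longrightarrow> A (x + y) = A x + A y"
    "\<lbrakk>x \<in> V; y \<in> V\<rbrakk> \<Longrightarrow> Q (A x) (A y) = Q x y"
    "x \<in> V \<Longrightarrow> A (sc c x) = sc c (A x)"
    "x \<in> V \<Longrightarrow> nrm (A x) = nrm x"
    using d by (simp_all add: nrm_def)
  show "\<lbrakk>x \<in> V; y \<in> V\<rbrakk> \<Longrightarrow> A (x - y) = A x - A y"
    using d by (metis add_diff_cancel diff_add_cancel diff_mem)
qed

section \<open>Completion by Cauchy sequences\<close>

definition cauchy_seqs :: "(nat \<Rightarrow> 'v) set" where
  "cauchy_seqs = {F. (\<forall>n. F n \<in> V) \<and> (\<forall>e>0. \<exists>N. \<forall>m\<ge>N. \<forall>n\<ge>N. nrm (F m - F n) < e)}"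

definition Qlim :: "(nat \<Rightarrow> 'v) \<Rightarrow> (nat \<Rightarrow> 'v) \<Rightarrow> complex" where
  "Qlim F G = lim (\<lambda>n. Q (F n) (G n))"

abbreviation sc_seq :: "complex \<Rightarrow> (nat \<Rightarrow> 'v) \<Rightarrow> (nat \<Rightarrow> 'v)" where
  "sc_seq c F \<equiv> (\<lambda>n. sc c (F n))"

lemma cauchy_seqs_mem: "F \<in> cauchy_seqs \<Longrightarrow> F n \<in> V"
  by (simp add: cauchy_seqs_def)

lemma cauchy_seqsD:
  assumes "F \<in> cauchy_seqs" "e > 0"
  obtains N where "\<And>m n. \<lbrakk>m \<ge> N; n \<ge> N\<rbrakk> \<Longrightarrow> nrm (F m - F n) < e"
  using assms unfolding cauchy_seqs_def by blast

lemma const_mem: "x \<in> V \<Longrightarrow> (\<lambda>_. x) \<in> cauchy_seqs"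
  by (auto simp: cauchy_seqs_def)

lemma cauchy_seqs_bounded:
  assumes F: "F \<in> cauchy_seqs"
  obtains b where "b > 0" "\<And>n. nrm (F n) \<le> b"
proof -
  have "Cauchy (\<lambda>n. nrm (F n))"
  proof (rule metric_CauchyI)
    fix e :: real assume "e > 0"
    then obtain N where "\<And>m n. \<lbrakk>m \<ge> N; n \<ge> N\<rbrakk> \<Longrightarrow> nrm (F m - F n) < e"
      using cauchy_seqsD[OF F, of e] by auto
    then show "\<exists>M. \<forall>m\<ge>M. \<forall>n\<ge>M. dist (nrm (F m)) (nrm (F n)) < e"
      unfolding dist_real_def
      by (meson nrm_reverse_triangle cauchy_seqs_mem[OF F] le_less_trans)
  qed
  then have "Bseq (\<lambda>n. nrm (F n))"
    by (rule Cauchy_Bseq)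
  then show ?thesis
    unfolding Bseq_def by (metis that abs_le_D1 real_norm_def)
qed

text \<open>Cauchy sequences are bounded in norm, so \<open>Q_diff_bound\<close> makes their inner
  products a Cauchy sequence of complex numbers.\<close>

lemma Q_seq_tendsto:
  assumes F: "F \<in> cauchy_seqs" and G: "G \<in> cauchy_seqs"
  shows "(\<lambda>n. Q (F n) (G n)) \<longlonglongrightarrow> Qlim F G"
proof -
  obtain a where a: "a > 0" "\<And>n. nrm (F n) \<le> a" by (rule cauchy_seqs_bounded[OF F]) blast
  obtain b where b: "b > 0" "\<And>n. nrm (G n) \<le> b" by (rule cauchy_seqs_bounded[OF G]) blast
  have "Cauchy (\<lambda>n. Q (F n) (G n))"
  proof (rule metric_CauchyI)
    fix e :: real assume e: "e > 0"
    obtain M where M: "\<And>m n. \<lbrakk>m \<ge> M; n \<ge> M\<rbrakk> \<Longrightarrow> nrm (F m - F n) < e / (2 * b)"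
      using cauchy_seqsD[OF F, of "e / (2 * b)"] e b by auto
    obtain N where N: "\<And>m n. \<lbrakk>m \<ge> N; n \<ge> N\<rbrakk> \<Longrightarrow> nrm (G m - G n) < e / (2 * a)"
      using cauchy_seqsD[OF G, of "e / (2 * a)"] e a by auto
    show "\<exists>K. \<forall>m\<ge>K. \<forall>n\<ge>K. dist (Q (F m) (G m)) (Q (F n) (G n)) < e"
    proof (intro exI allI impI)
      fix m n assume mn: "m \<ge> max M N" "n \<ge> max M N"
      have "nrm (F m - F n) * nrm (G m) \<le> nrm (F m - F n) * b"
        using b cauchy_seqs_mem[OF F] diff_mem by (intro mult_left_mono) auto
      also have "\<dots> < e / (2 * b) * b"
        using M[of m n] mn b by (intro mult_strict_right_mono) auto
      finally have 1: "nrm (F m - F n) * nrm (G m) < e / 2" using b by simp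
      have "nrm (F n) * nrm (G m - G n) \<le> a * nrm (G m - G n)"
        using a cauchy_seqs_mem[OF G] diff_mem by (intro mult_right_mono) auto
      also have "\<dots> < a * (e / (2 * a))"
        using N[of m n] mn a by (intro mult_strict_left_mono) auto
      finally have 2: "nrm (F n) * nrm (G m - G n) < e / 2" using a by simp
      show "dist (Q (F m) (G m)) (Q (F n) (G n)) < e"
        using Q_diff_bound[of "F m" "G m" "F n" "G n"] 1 2 cauchy_seqs_mem[OF F] cauchy_seqs_mem[OF G]
        by (simp add: dist_norm)
    qed
  qed
  then show ?thesis
    unfolding Qlim_def using Cauchy_convergent convergent_LIMSEQ_iff by blast
qed

lemma Qlim_eqI:
  assumes "F \<in> cauchy_seqs" "G \<in> cauchy_seqs" "(\<lambda>n. Q (F n) (G n)) \<longlonglongrightarrow> l"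
  shows "Qlim F G = l"
  using LIMSEQ_unique[OF Q_seq_tendsto[OF assms(1,2)] assms(3)] .

lemma add_cauchy_seqs:
  assumes F: "F \<in> cauchy_seqs" and G: "G \<in> cauchy_seqs"
  shows "F + G \<in> cauchy_seqs"
  unfolding cauchy_seqs_def
proof (intro CollectI conjI allI impI)
  fix e :: real assume e: "e > 0"
  obtain M where M: "\<And>m n. \<lbrakk>m \<ge> M; n \<ge> M\<rbrakk> \<Longrightarrow> nrm (F m - F n) < e / 2"
    using cauchy_seqsD[OF F, of "e / 2"] e by auto
  obtain N where N: "\<And>m n. \<lbrakk>m \<ge> N; n \<ge> N\<rbrakk> \<Longrightarrow> nrm (G m - G n) < e / 2"
    using cauchy_seqsD[OF G, of "e / 2"] e by auto
  show "\<exists>K. \<forall>m\<ge>K. \<forall>n\<ge>K. nrm ((F + G) m - (F + G) n) < e"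
  proof (intro exI allI impI)
    fix m n assume mn: "m \<ge> max M N" "n \<ge> max M N"
    have "nrm ((F m - F n) + (G m - G n)) \<le> nrm (F m - F n) + nrm (G m - G n)"
      using cauchy_seqs_mem[OF F] cauchy_seqs_mem[OF G] diff_mem by (intro nrm_triangle) auto
    moreover have "nrm (F m - F n) < e / 2" "nrm (G m - G n) < e / 2"
      using M N mn by auto
    ultimately show "nrm ((F + G) m - (F + G) n) < e"
      unfolding plus_fun_apply add_diff_add by linarith
  qed
qed (use assms in \<open>auto intro: add_mem cauchy_seqs_mem\<close>)

lemma sc_cauchy_seqs:
  assumes F: "F \<in> cauchy_seqs"
  shows "sc_seq c F \<in> cauchy_seqs"
  unfolding cauchy_seqs_def
proof (intro CollectI conjI allI impI)
  fix e :: real assume e: "e > 0"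
  obtain M where M: "\<And>m n. \<lbrakk>m \<ge> M; n \<ge> M\<rbrakk> \<Longrightarrow> nrm (F m - F n) < e / (cmod c + 1)"
    using cauchy_seqsD[OF F, of "e / (cmod c + 1)"] e by (auto simp: add_nonneg_pos)
  show "\<exists>K. \<forall>m\<ge>K. \<forall>n\<ge>K. nrm (sc c (F m) - sc c (F n)) < e"
  proof (intro exI allI impI)
    fix m n assume mn: "m \<ge> M" "n \<ge> M"
    have "sc c (F m) - sc c (F n) = sc c (F m - F n)"
      using sc_add_right[of c "F m - F n" "F n"] by simp
    then have "nrm (sc c (F m) - sc c (F n)) = cmod c * nrm (F m - F n)"
      using cauchy_seqs_mem[OF F] diff_mem nrm_sc by simp
    also have "\<dots> \<le> (cmod c + 1) * nrm (F m - F n)"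
      using cauchy_seqs_mem[OF F] diff_mem by (intro mult_right_mono) auto
    also have "\<dots> < (cmod c + 1) * (e / (cmod c + 1))"
      using M[OF mn] by (intro mult_strict_left_mono) (auto simp: add_nonneg_pos)
    also have "\<dots> = e" 
      by (simp add: add_nonneg_eq_0_iff)
    finally show "nrm (sc c (F m) - sc c (F n)) < e" .
  qed
qed (use assms in \<open>auto intro: sc_mem cauchy_seqs_mem\<close>)

lemma semi_inner_cauchy_seqs: "semi_inner cauchy_seqs sc_seq Qlim"
proof
  show "0 \<in> cauchy_seqs" using const_mem[OF zero_mem] by (simp add: zero_fun_def)
next
  fix F G H :: "nat \<Rightarrow> 'v" and c
  show "sc_seq c (F + G) = sc_seq c F + sc_seq c G" for c F G by (simp add: fun_eq_iff sc_add_right)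
  show "sc_seq (c + d) F = sc_seq c F + sc_seq d F" for c d F by (simp add: fun_eq_iff sc_add_left)
  show "(\<lambda>n. sc c (sc d (F n))) = sc_seq (c * d) F" for c d F by (simp add: fun_eq_iff sc_sc)
  show "sc_seq 1 F = F" for F by (simp add: fun_eq_iff sc_one)
  assume F: "F \<in> cauchy_seqs"
  show sF: "sc_seq c F \<in> cauchy_seqs" by (rule sc_cauchy_seqs[OF F])
  show "0 \<le> Re (Qlim F F)"
    by (rule LIMSEQ_le_const[OF tendsto_Re[OF Q_seq_tendsto[OF F F]]])
       (auto simp: Q_nonneg cauchy_seqs_mem[OF F])
  assume G: "G \<in> cauchy_seqs"
  show aFG: "F + G \<in> cauchy_seqs" by (rule add_cauchy_seqs[OF F G])
  show "Qlim G F = cnj (Qlim F G)"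
    by (rule Qlim_eqI[OF G F])
       (use tendsto_cnj[OF Q_seq_tendsto[OF F G]] in
         \<open>simp add: Q_commute[OF cauchy_seqs_mem[OF F] cauchy_seqs_mem[OF G]]\<close>)
  show "Qlim (sc_seq c F) G = c * Qlim F G"
    by (rule Qlim_eqI[OF sF G])
       (use tendsto_mult_left[OF Q_seq_tendsto[OF F G], of c] in
         \<open>simp add: Q_sc cauchy_seqs_mem[OF F] cauchy_seqs_mem[OF G]\<close>)
  assume H: "H \<in> cauchy_seqs"
  show "Qlim (F + G) H = Qlim F H + Qlim G H"
    by (rule Qlim_eqI[OF aFG H])
       (use tendsto_add[OF Q_seq_tendsto[OF F H] Q_seq_tendsto[OF G H]] in
         \<open>simp add: Q_add cauchy_seqs_mem[OF F] cauchy_seqs_mem[OF G] cauchy_seqs_mem[OF H]\<close>)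
qed

end

locale complete_semi_inner = semi_inner +
  assumes complete: "F \<in> cauchy_seqs \<Longrightarrow> \<exists>f\<in>V. (\<lambda>n. nrm (F n - f)) \<longlonglongrightarrow> 0"

context semi_inner
begin

interpretation C: semi_inner cauchy_seqs sc_seq Qlim
  by (rule semi_inner_cauchy_seqs)

lemma nrm_seq_tendsto: "F \<in> cauchy_seqs \<Longrightarrow> (\<lambda>n. nrm (F n)) \<longlonglongrightarrow> C.nrm F"
  unfolding nrm_def C.nrm_def by (intro tendsto_real_sqrt tendsto_Re Q_seq_tendsto)

lemma Qlim_const: "\<lbrakk>x \<in> V; y \<in> V\<rbrakk> \<Longrightarrow> Qlim (\<lambda>_. x) (\<lambda>_. y) = Q x y"
  by (rule Qlim_eqI) (auto intro: const_mem)

lemma nrm_const: "x \<in> V \<Longrightarrow> C.nrm (\<lambda>_. x) = nrm x"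
  by (simp add: C.nrm_def nrm_def Qlim_const)

lemma const_approx:
  assumes F: "F \<in> cauchy_seqs"
    and N: "\<And>m n. \<lbrakk>m \<ge> N; n \<ge> N\<rbrakk> \<Longrightarrow> nrm (F m - F n) < e" and k: "k \<ge> N"
  shows "C.nrm ((\<lambda>_. F k) - F) \<le> e"
proof -
  have "(\<lambda>_. F k) - F \<in> cauchy_seqs"
    by (intro C.diff_mem const_mem cauchy_seqs_mem F)
  from nrm_seq_tendsto[OF this] show ?thesis
    by (rule LIMSEQ_le_const2) (use N k in \<open>auto intro!: exI[of _ N] less_imp_le\<close>)
qed

text \<open>A Cauchy sequence is within e/2 of the constant sequence at a late entry, and that entry
  is within e/2 of a point of \<open>D\<close>. So a countable dense set stays one after
  completion.\<close>

lemma dense_const: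
  assumes dense: "\<And>x e. \<lbrakk>x \<in> V; e > 0\<rbrakk> \<Longrightarrow> \<exists>d\<in>D. nrm (x - d) < e" and D: "D \<subseteq> V"
    and F: "F \<in> cauchy_seqs" and e: "e > 0"
  shows "\<exists>d\<in>D. C.nrm (F - (\<lambda>_. d)) < e"
proof -
  obtain N where N: "\<And>m n. \<lbrakk>m \<ge> N; n \<ge> N\<rbrakk> \<Longrightarrow> nrm (F m - F n) < e / 2"
    using cauchy_seqsD[OF F, of "e/2"] e by auto
  obtain d where d: "d \<in> D" "nrm (F N - d) < e / 2"
    using dense[OF cauchy_seqs_mem[OF F, of N], of "e/2"] e by auto
  have dV: "d \<in> V" using d D by auto
  have cs: "(\<lambda>_. F N) \<in> cauchy_seqs" "(\<lambda>_. d) \<in> cauchy_seqs"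
    using dV F by (auto intro: const_mem cauchy_seqs_mem)
  have "C.nrm (F - (\<lambda>_. d)) \<le> C.nrm (F - (\<lambda>_. F N)) + C.nrm ((\<lambda>_. F N) - (\<lambda>_. d))"
    using C.nrm_triangle_diff F cs by blast
  moreover have "C.nrm (F - (\<lambda>_. F N)) \<le> e / 2"
    using const_approx[OF F N order_refl] C.nrm_minus_commute[OF F cs(1)] by simp
  moreover have "C.nrm ((\<lambda>_. F N) - (\<lambda>_. d)) = nrm (F N - d)"
    unfolding fun_diff_def by (intro nrm_const diff_mem cauchy_seqs_mem[OF F] dV)
  ultimately have "C.nrm (F - (\<lambda>_. d)) < e" using d(2) by linarith
  then show ?thesis using d(1) by blast
qed

text \<open>Diagonal argument: \<open>f k\<close> is an entry of the k-th sequence from which on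
  that sequence varies by less than 1/(k+1). Then \<open>f\<close> is itself Cauchy, and it is the
  limit of the given sequence of sequences.\<close>

lemma complete_cauchy_seqs: "complete_semi_inner cauchy_seqs sc_seq Qlim"
proof
  fix \<Phi> :: "nat \<Rightarrow> nat \<Rightarrow> 'v"
  assume \<Phi>: "\<Phi> \<in> C.cauchy_seqs"
  have \<Phi>k: "\<Phi> k \<in> cauchy_seqs" for k using C.cauchy_seqs_mem[OF \<Phi>] .
  have "\<exists>N. \<forall>m\<ge>N. \<forall>n\<ge>N. nrm (\<Phi> k m - \<Phi> k n) < 1 / (real k + 1)" for k
    using cauchy_seqsD[OF \<Phi>k[of k], of "1 / (real k + 1)"] by (metis add_nonneg_pos of_nat_0_le_iff zero_less_divide_1_iff zero_less_one)
  then obtain N where N: "\<And>k m n. \<lbrakk>m \<ge> N k; n \<ge> N k\<rbrakk> \<Longrightarrow> nrm (\<Phi> k m - \<Phi> k n) < 1 / (real k + 1)"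
    by metis
  define f where "f k = \<Phi> k (N k)" for k
  have fV: "f k \<in> V" for k by (simp add: f_def cauchy_seqs_mem[OF \<Phi>k])
  have fC: "(\<lambda>_. f k) \<in> cauchy_seqs" for k by (rule const_mem[OF fV])
  have f1: "C.nrm ((\<lambda>_. f k) - \<Phi> k) \<le> 1 / (real k + 1)" for k
    unfolding f_def by (rule const_approx[OF \<Phi>k N order_refl])
  have small: "\<exists>K. \<forall>k\<ge>K. 1 / (real k + 1) < e" if e0: "e > 0" for e
  proof -
    obtain n where n: "n > 0" "inverse (real n) < e" using ex_inverse_of_nat_less[OF e0] by auto
    have "1 / (real k + 1) < e" if "k \<ge> n" for k
    proof -
      have "1 / (real k + 1) \<le> 1 / real n" using n that by (intro divide_left_mono) auto
      then show ?thesis using n by (simp add: inverse_eq_divide)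
    qed
    then show ?thesis by blast
  qed
  have f: "f \<in> cauchy_seqs"
    unfolding cauchy_seqs_def
  proof (intro CollectI conjI allI impI)
    fix e :: real assume e: "e > 0"
    obtain K where K: "\<And>k. k \<ge> K \<Longrightarrow> 1 / (real k + 1) < e / 3" using small[of "e/3"] e by auto
    obtain L where L: "\<And>k l. \<lbrakk>k \<ge> L; l \<ge> L\<rbrakk> \<Longrightarrow> C.nrm (\<Phi> k - \<Phi> l) < e / 3"
      using C.cauchy_seqsD[OF \<Phi>, of "e/3"] e by auto
    show "\<exists>M. \<forall>k\<ge>M. \<forall>l\<ge>M. nrm (f k - f l) < e"
    proof (intro exI allI impI)
      fix k l assume kl: "k \<ge> max K L" "l \<ge> max K L"
      have "nrm (f k - f l) = C.nrm ((\<lambda>_. f k) - (\<lambda>_. f l))"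
        using nrm_const[OF diff_mem[OF fV[of k] fV[of l]]] by (simp add: fun_diff_def)
      also have "\<dots> \<le> C.nrm ((\<lambda>_. f k) - \<Phi> k) + C.nrm (\<Phi> k - (\<lambda>_. f l))"
        by (rule C.nrm_triangle_diff[OF fC \<Phi>k fC])
      also have "C.nrm (\<Phi> k - (\<lambda>_. f l)) \<le> C.nrm (\<Phi> k - \<Phi> l) + C.nrm (\<Phi> l - (\<lambda>_. f l))"
        by (rule C.nrm_triangle_diff[OF \<Phi>k \<Phi>k fC])
      also have "C.nrm (\<Phi> l - (\<lambda>_. f l)) = C.nrm ((\<lambda>_. f l) - \<Phi> l)"
        by (rule C.nrm_minus_commute[OF \<Phi>k fC])
      finally show "nrm (f k - f l) < e"
        using f1[of k] f1[of l] K[of k] K[of l] L[of k l] kl by linarith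
    qed
  qed (rule fV)
  show "\<exists>f\<in>cauchy_seqs. (\<lambda>n. C.nrm (\<Phi> n - f)) \<longlonglongrightarrow> 0"
  proof (rule bexI[OF _ f], rule LIMSEQ_I)
    fix e :: real assume e: "e > 0"
    obtain K where K: "\<And>k. k \<ge> K \<Longrightarrow> 1 / (real k + 1) < e / 2" using small[of "e/2"] e by auto
    obtain L where L: "\<And>k l. \<lbrakk>k \<ge> L; l \<ge> L\<rbrakk> \<Longrightarrow> nrm (f k - f l) < e / 2"
      using cauchy_seqsD[OF f, of "e/2"] e by auto
    show "\<exists>M. \<forall>k\<ge>M. norm (C.nrm (\<Phi> k - f) - 0) < e"
    proof (intro exI allI impI)
      fix k assume k: "k \<ge> max K L"
      have "C.nrm (\<Phi> k - f) \<le> C.nrm (\<Phi> k - (\<lambda>_. f k)) + C.nrm ((\<lambda>_. f k) - f)"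
        by (rule C.nrm_triangle_diff[OF \<Phi>k fC f])
      moreover have "C.nrm (\<Phi> k - (\<lambda>_. f k)) < e / 2"
        using C.nrm_minus_commute[OF \<Phi>k fC] f1[of k] K[of k] k by simp
      moreover have "C.nrm ((\<lambda>_. f k) - f) \<le> e / 2"
        using const_approx[OF f L, of k] k by simp
      ultimately show "norm (C.nrm (\<Phi> k - f) - 0) < e"
        using C.nrm_nonneg[OF C.diff_mem[OF \<Phi>k f]] by simp
    qed
  qed
qed

lemma isometry_pair_sym:
  assumes "isometry_pair A B"
  shows "isometry_pair B A"
proof -
  note d = isometry_pairD[OF assms]
  have "B (x + y) = B x + B y" if "x \<in> V" "y \<in> V" for x y
    using d(4)[of "B x + B y"] that d(5)[of "B x" "B y"] d(2,3) add_mem by simp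
  moreover have "Q (B x) (B y) = Q x y" if "x \<in> V" "y \<in> V" for x y
    using d(7)[of "B x" "B y"] that d(2,3) by simp
  moreover have "B (sc c x) = sc c (B x)" if "x \<in> V" for x c
    using d(4)[of "sc c (B x)"] that d(8)[of "B x"] d(2,3) sc_mem by simp
  ultimately show ?thesis by (simp add: isometry_pair_def d(1-4))
qed

lemma isometry_pair_lift:
  assumes "isometry_pair A B"
  shows "C.isometry_pair (\<lambda>F n. A (F n)) (\<lambda>F n. B (F n))"
proof -
  have mem: "(\<lambda>n. A (F n)) \<in> cauchy_seqs" if "isometry_pair A B" "F \<in> cauchy_seqs" for A B F
  proof -
    note d = isometry_pairD[OF that(1)]
    have "nrm (A (F m) - A (F n)) = nrm (F m - F n)" for m n
      using d(6)[of "F m" "F n"] d(9)[of "F m - F n"] cauchy_seqs_mem[OF that(2)] diff_mem by simp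
    then show ?thesis using that(2) d(1) by (simp add: cauchy_seqs_def)
  qed
  note d = isometry_pairD[OF assms]
  note c = cauchy_seqs_mem
  have m: "(\<lambda>n. A (F n)) \<in> cauchy_seqs" "(\<lambda>n. B (F n)) \<in> cauchy_seqs" if "F \<in> cauchy_seqs" for F
    using mem[OF assms that] mem[OF isometry_pair_sym[OF assms] that] by auto
  have "Qlim (\<lambda>n. A (F n)) (\<lambda>n. A (G n)) = Qlim F G" if "F \<in> cauchy_seqs" "G \<in> cauchy_seqs" for F G
    by (rule Qlim_eqI[OF m(1) m(1)])
       (use that Q_seq_tendsto[OF that] in \<open>simp_all add: d(7) c\<close>)
  then show ?thesis
    unfolding C.isometry_pair_def using m by (simp add: fun_eq_iff d c)
qed

end

section \<open>From a complete semi-inner product to a Hilbert space record\<close>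

locale hilbert_model = complete_semi_inner +
  fixes J :: "'a \<Rightarrow> 'y"
  assumes J_eq: "\<lbrakk>x \<in> V; y \<in> V\<rbrakk> \<Longrightarrow> J x = J y \<longleftrightarrow> nrm (x - y) = 0"
begin

abbreviation "rep \<equiv> inv_into V J"

text \<open>The quotient by the null vectors, realized as the image of \<open>J\<close>, which
  identifies exactly the vectors at distance 0. The operations are computed on chosen
  representatives; the lemmas below show that the choice does not matter.\<close>

definition hilbert_of :: "'y hilbert" where
  "hilbert_of = \<lparr>carrier = J ` V, mult = (\<lambda>a b. J 0), one = J 0, zero = J 0,
     add = (\<lambda>a b. J (rep a + rep b)), smult = (\<lambda>c a. J (sc c (rep a))),
     hinner = (\<lambda>a b. Q (rep a) (rep b))\<rparr>"

lemma carrier_hilbert_of: "carrier hilbert_of = J ` V"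
  by (simp add: hilbert_of_def)

lemma rep_mem: "x \<in> V \<Longrightarrow> rep (J x) \<in> V"
  by (simp add: inv_into_into)

lemma nrm_rep: "x \<in> V \<Longrightarrow> nrm (x - rep (J x)) = 0"
  using J_eq[of x "rep (J x)"] rep_mem by (simp add: f_inv_into_f)

lemma J_cong:
  assumes "x \<in> V" "y \<in> V" "nrm (x - y) = 0" shows "J x = J y"
  using assms J_eq by simp

lemma nrm_diff_zero_add:
  assumes "x \<in> V" "y \<in> V" "x' \<in> V" "y' \<in> V" "nrm (x - x') = 0" "nrm (y - y') = 0"
  shows "nrm ((x + y) - (x' + y')) = 0"
proof -
  have "nrm ((x - x') + (y - y')) \<le> 0"
    using nrm_triangle[of "x - x'" "y - y'"] assms diff_mem by simp
  moreover have "nrm ((x - x') + (y - y')) \<ge> 0"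
    using assms by (intro nrm_nonneg add_mem diff_mem)
  ultimately show ?thesis
    unfolding add_diff_add by linarith
qed

lemma add_J: "\<lbrakk>x \<in> V; y \<in> V\<rbrakk> \<Longrightarrow> J x \<oplus>\<^bsub>hilbert_of\<^esub> J y = J (x + y)"
  unfolding hilbert_of_def
  using nrm_diff_zero_add[of x y "rep (J x)" "rep (J y)"] nrm_rep rep_mem
  by (auto intro!: J_cong[symmetric] add_mem)

lemma smult_J: "x \<in> V \<Longrightarrow> c \<odot>\<^bsub>hilbert_of\<^esub> J x = J (sc c x)"
proof -
  assume x: "x \<in> V"
  have "sc c x - sc c (rep (J x)) = sc c (x - rep (J x))"
    using sc_add_right[of c "x - rep (J x)" "rep (J x)"] by simp
  then have "nrm (sc c x - sc c (rep (J x))) = 0"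
    using x by (simp add: nrm_sc diff_mem rep_mem nrm_rep)
  then show ?thesis
    unfolding hilbert_of_def using x by (auto intro!: J_cong[symmetric] sc_mem rep_mem)
qed

lemma zero_J: "\<zero>\<^bsub>hilbert_of\<^esub> = J 0"
  by (simp add: hilbert_of_def)

lemma hinner_J: "\<lbrakk>x \<in> V; y \<in> V\<rbrakk> \<Longrightarrow> hinner hilbert_of (J x) (J y) = Q x y"
proof -
  assume x: "x \<in> V" and y: "y \<in> V"
  have "cmod (Q x y - Q (rep (J x)) (rep (J y))) \<le> 0"
    using Q_diff_bound[OF x y rep_mem[OF x] rep_mem[OF y]] by (simp add: nrm_rep x y)
  then show ?thesis by (simp add: hilbert_of_def)
qed

lemma hnorm_J: "x \<in> V \<Longrightarrow> hnorm hilbert_of (J x) = nrm x"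
  by (simp add: hnorm_def nrm_def hinner_J)

lemma abelian_group_hilbert_of: "abelian_group hilbert_of"
proof (rule abelian_groupI)
  fix a assume "a \<in> carrier hilbert_of"
  then obtain x where x: "x \<in> V" "a = J x" by (auto simp: carrier_hilbert_of)
  show "\<exists>b\<in>carrier hilbert_of. b \<oplus>\<^bsub>hilbert_of\<^esub> a = \<zero>\<^bsub>hilbert_of\<^esub>"
    using x by (intro bexI[of _ "J (- x)"]) (auto simp: add_J uminus_mem zero_J carrier_hilbert_of)
qed (auto simp: carrier_hilbert_of add_J zero_J add_mem zero_mem ac_simps)

interpretation A: abelian_group hilbert_of by (rule abelian_group_hilbert_of)

lemma minus_J: "\<lbrakk>x \<in> V; y \<in> V\<rbrakk> \<Longrightarrow> J x \<ominus>\<^bsub>hilbert_of\<^esub> J y = J (x - y)"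
proof -
  assume x: "x \<in> V" and y: "y \<in> V"
  have "\<ominus>\<^bsub>hilbert_of\<^esub> J y = J (- y)"
    by (rule A.minus_equality) (auto simp: add_J uminus_mem zero_J carrier_hilbert_of y)
  then show ?thesis
    using x y by (simp add: a_minus_def add_J uminus_mem)
qed

lemma hdist_J: "\<lbrakk>x \<in> V; y \<in> V\<rbrakk> \<Longrightarrow> hdist hilbert_of (J x) (J y) = nrm (x - y)"
  by (simp add: hdist_def carrier_hilbert_of minus_J hnorm_J diff_mem)

lemma metric_hilbert_of: "Metric_space (J ` V) (hdist hilbert_of)"
proof
  fix a b c
  show "0 \<le> hdist hilbert_of a b"
    by (cases "a \<in> J ` V \<and> b \<in> J ` V") (auto simp: hdist_J diff_mem, auto simp: hdist_def carrier_hilbert_of)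
  show "hdist hilbert_of a b = hdist hilbert_of b a"
    by (cases "a \<in> J ` V \<and> b \<in> J ` V") (auto simp: hdist_J nrm_minus_commute, auto simp: hdist_def carrier_hilbert_of)
  assume a: "a \<in> J ` V" and b: "b \<in> J ` V"
  then show "hdist hilbert_of a b = 0 \<longleftrightarrow> a = b" by (auto simp: hdist_J J_eq)
  assume c: "c \<in> J ` V"
  show "hdist hilbert_of a c \<le> hdist hilbert_of a b + hdist hilbert_of b c"
    using a b c by (auto simp: hdist_J nrm_triangle_diff)
qed

interpretation M: Metric_space "J ` V" "hdist hilbert_of" by (rule metric_hilbert_of)

text \<open>Representatives of a Cauchy sequence form a Cauchy sequence in \<open>V\<close>, because
  \<open>J\<close> preserves distances; the image of its limit is the limit wanted.\<close>

lemma mcomplete_hilbert_of: "M.mcomplete"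
  unfolding M.mcomplete_def
proof (intro allI impI)
  fix \<sigma> assume \<sigma>: "M.MCauchy \<sigma>"
  then have r: "\<sigma> n \<in> J ` V" for n by (auto simp: M.MCauchy_def)
  define F where "F n = rep (\<sigma> n)" for n
  have FV: "F n \<in> V" and JF: "J (F n) = \<sigma> n" for n
    using r by (auto simp: F_def inv_into_into f_inv_into_f)
  have "F \<in> cauchy_seqs"
    unfolding cauchy_seqs_def
  proof (intro CollectI conjI allI impI)
    fix e :: real assume "e > 0"
    with \<sigma> obtain N where "\<And>m n. \<lbrakk>N \<le> m; N \<le> n\<rbrakk> \<Longrightarrow> hdist hilbert_of (\<sigma> m) (\<sigma> n) < e"
      unfolding M.MCauchy_def by blast
    then show "\<exists>N. \<forall>m\<ge>N. \<forall>n\<ge>N. nrm (F m - F n) < e"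
      using hdist_J[OF FV FV] by (auto simp: JF)
  qed (rule FV)
  then obtain f where f: "f \<in> V" "(\<lambda>n. nrm (F n - f)) \<longlonglongrightarrow> 0"
    using complete by blast
  have "limitin M.mtopology \<sigma> (J f) sequentially"
    unfolding M.limitin_metric
  proof (intro conjI allI impI)
    fix e :: real assume "e > 0"
    then have "eventually (\<lambda>n. nrm (F n - f) < e) sequentially"
      using order_tendstoD(2)[OF f(2)] by simp
    then show "\<forall>\<^sub>F n in sequentially. \<sigma> n \<in> J ` V \<and> hdist hilbert_of (\<sigma> n) (J f) < e"
      by eventually_elim (use hdist_J[OF FV f(1)] r JF in auto)
  qed (use f in auto)
  then show "\<exists>x. limitin M.mtopology \<sigma> x sequentially" by blast
qed

lemma hilbert_space_hilbert_of: "hilbert_space hilbert_of"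
proof -
  have "cring complex_ring"
    by (rule cringI, rule abelian_groupI)
       (auto simp: complex_ring_def algebra_simps intro: exI[of _ "- _"] comm_monoidI add.right_inverse
         intro!: comm_monoidI bexI add.left_inverse)
  then have "Module.module complex_ring hilbert_of"
    by (intro moduleI abelian_group_hilbert_of)
       (auto simp: carrier_hilbert_of complex_ring_def smult_J add_J sc_mem add_mem
          sc_add_left sc_add_right sc_sc sc_one)
  then show ?thesis
  proof (intro hilbert_space.intro hilbert_space_axioms.intro)
    show "a = \<zero>\<^bsub>hilbert_of\<^esub>" if "a \<in> carrier hilbert_of" "hinner hilbert_of a a = 0" for a
      using that by (auto simp: carrier_hilbert_of hinner_J zero_J J_eq zero_mem nrm_def)
    show "Metric_space.mcomplete (carrier hilbert_of) (hdist hilbert_of)"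
      by (simp add: carrier_hilbert_of mcomplete_hilbert_of)
  qed (auto simp: carrier_hilbert_of hinner_J add_J smult_J add_mem sc_mem Q_add Q_sc Q_nonneg
        intro!: Q_commute)
qed

text \<open>\<open>restrict\<close> makes the operator \<open>undefined\<close> outside the carrier,
  as membership in \<open>unitary_group\<close> demands.\<close>

definition unitary_of :: "('a \<Rightarrow> 'a) \<Rightarrow> 'y \<Rightarrow> 'y" where
  "unitary_of A = restrict (\<lambda>a. J (A (rep a))) (J ` V)"

lemma unitary_of_J:
  assumes A: "isometry_pair A B" and x: "x \<in> V"
  shows "unitary_of A (J x) = J (A x)"
proof -
  note d = isometry_pairD[OF A]
  have "nrm (A x - A (rep (J x))) = 0"
    using d(6)[OF x rep_mem[OF x]] d(9)[OF diff_mem[OF x rep_mem[OF x]]] nrm_rep[OF x] by simp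
  then show ?thesis
    using x d(1) rep_mem by (auto simp: unitary_of_def intro!: J_cong[symmetric])
qed

lemma unitary_of_mem:
  assumes A: "isometry_pair A B"
  shows "unitary_of A \<in> unitary_group hilbert_of"
proof -
  note d = isometry_pairD[OF A] and U = unitary_of_J[OF A]
  have "bij_betw (unitary_of A) (J ` V) (J ` V)"
  proof (rule bij_betw_byWitness[where f' = "unitary_of B"])
    show "\<forall>a\<in>J ` V. unitary_of B (unitary_of A a) = a" "\<forall>a\<in>J ` V. unitary_of A (unitary_of B a) = a"
      using U unitary_of_J[OF isometry_pair_sym[OF A]] d by auto
    show "unitary_of A ` J ` V \<subseteq> J ` V" "unitary_of B ` J ` V \<subseteq> J ` V"
      using U unitary_of_J[OF isometry_pair_sym[OF A]] d by auto
  qed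
  then show ?thesis
    unfolding unitary_group_def carrier_hilbert_of
    by (auto simp: U add_J smult_J hinner_J d add_mem sc_mem) (simp add: unitary_of_def)
qed

end

section \<open>Measurability into Hilbert spaces\<close>

lemma space_borel_of [simp]: "space (borel_of T) = topspace T"
  by (auto simp: borel_of_def space_measure_of_conv)

lemma sets_borel_of: "sets (borel_of T) = sigma_sets (topspace T) {U. openin T U}"
  unfolding borel_of_def by (rule sets_measure_of) (auto dest: openin_subset)

lemma openin_sets_borel_of: "openin T U \<Longrightarrow> U \<in> sets (borel_of T)"
  by (auto simp: sets_borel_of)

lemma closedin_sets_borel_of: 
  assumes "closedin T C" shows "C \<in> sets (borel_of T)"
proof -
  have "topspace T - C \<in> sets (borel_of T)"
    using assms by (intro openin_sets_borel_of) (simp add: closedin_def)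
  then have "space (borel_of T) - (topspace T - C) \<in> sets (borel_of T)" by blast
  moreover have "space (borel_of T) - (topspace T - C) = C"
    using closedin_subset[OF assms] by auto
  ultimately show ?thesis by simp
qed

lemma measurable_borel_of_open:
  assumes "f \<in> space M \<rightarrow> topspace T"
    and "\<And>U. openin T U \<Longrightarrow> f -` U \<inter> space M \<in> sets M"
  shows "f \<in> measurable M (borel_of T)"
  unfolding borel_of_def
  by (rule measurable_measure_of) (use assms openin_subset[of T] in auto)

text \<open>Every open set is the union of the countably many members of the family inside it, and
  taking preimages commutes with unions.\<close>

lemma measurable_borel_of_base:
  assumes f: "f \<in> space M \<rightarrow> topspace T" and \<B>: "countable \<B>"
    and m: "\<And>B. B \<in> \<B> \<Longrightarrow> f -` B \<inter> space M \<in> sets M"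
    and b: "\<And>U x. \<lbrakk>openin T U; x \<in> U\<rbrakk> \<Longrightarrow> \<exists>B\<in>\<B>. x \<in> B \<and> B \<subseteq> U"
  shows "f \<in> measurable M (borel_of T)"
proof (rule measurable_borel_of_open[OF f])
  fix U assume U: "openin T U"
  have "f -` U \<inter> space M = (\<Union>B\<in>{B\<in>\<B>. B \<subseteq> U}. f -` B \<inter> space M)"
    using b[OF U] by (auto; metis)
  also have "\<dots> \<in> sets M"
    using \<B> m by (intro sets.countable_UN') auto
  finally show "f -` U \<inter> space M \<in> sets M" .
qed

context hilbert_space
begin

lemma hinner_zero: "y \<in> carrier H \<Longrightarrow> hinner H \<zero> y = 0"
  using hinner_add_left[of \<zero> \<zero> y] by simp

lemma hinner_uminus: "\<lbrakk>x \<in> carrier H; y \<in> carrier H\<rbrakk> \<Longrightarrow> hinner H (\<ominus> x) y = - hinner H x y"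
  using hinner_add_left[of x "\<ominus> x" y] by (simp add: M.r_neg hinner_zero add_eq_0_iff)

lemma hinner_diff:
  "\<lbrakk>x \<in> carrier H; y \<in> carrier H; z \<in> carrier H\<rbrakk> \<Longrightarrow>
    hinner H (x \<ominus> y) z = hinner H x z - hinner H y z"
  by (simp add: a_minus_def hinner_add_left hinner_uminus)

lemma hinner_diff_right:
  "\<lbrakk>x \<in> carrier H; y \<in> carrier H; z \<in> carrier H\<rbrakk> \<Longrightarrow>
    hinner H z (x \<ominus> y) = hinner H z x - hinner H z y"
  by (metis hinner_diff hinner_commute M.minus_closed complex_cnj_diff)

lemma hnorm_nonneg [simp]: "x \<in> carrier H \<Longrightarrow> 0 \<le> hnorm H x"
  by (simp add: hnorm_def hinner_nonneg)

lemma hnorm_square: "x \<in> carrier H \<Longrightarrow> (hnorm H x)\<^sup>2 = Re (hinner H x x)"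
  by (simp add: hnorm_def hinner_nonneg)

lemma hinner_add_right:
  "\<lbrakk>x \<in> carrier H; y \<in> carrier H; z \<in> carrier H\<rbrakk> \<Longrightarrow>
    hinner H z (x \<oplus> y) = hinner H z x + hinner H z y"
  by (metis hinner_add_left hinner_commute M.add.m_closed complex_cnj_add)

lemma hinner_smult_right:
  "\<lbrakk>x \<in> carrier H; y \<in> carrier H\<rbrakk> \<Longrightarrow> hinner H y (c \<odot> x) = cnj c * hinner H y x"
  by (metis UNIV_I complex_cnj_mult complex_ring_def hinner_commute hinner_smult_left
      partial_object.select_convs(1) smult_closed)

lemma smult_mem: "x \<in> carrier H \<Longrightarrow> c \<odot> x \<in> carrier H"
  by (simp add: complex_ring_def)

text \<open>The squared norm of x + t y is a nonnegative quadratic in the real number t, and each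
  case evaluates it at one point. If y has norm 0, a t is taken at which a positive real part would
  give the value -1. If x has norm 0, the minimum forces the square of the real part to be at most
  0. Otherwise the quotient of the norms gives the bound directly.\<close>

lemma Re_hinner_le:
  assumes x: "x \<in> carrier H" and y: "y \<in> carrier H"
  shows "Re (hinner H x y) \<le> hnorm H x * hnorm H y"
proof -
  have key: "0 \<le> (hnorm H x)\<^sup>2 + 2 * t * Re (hinner H x y) + t\<^sup>2 * (hnorm H y)\<^sup>2" for t :: real
  proof -
    let ?z = "x \<oplus> complex_of_real t \<odot> y"
    have "hinner H ?z ?z = hinner H x x + complex_of_real t * hinner H x y + complex_of_real t * hinner H y x
      + complex_of_real t * (complex_of_real t * hinner H y y)"
      using x y by (simp add: hinner_add_left hinner_add_right smult_mem hinner_smult_left 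
          hinner_smult_right algebra_simps)
    moreover have "Re (hinner H y x) = Re (hinner H x y)"
      by (simp add: hinner_commute[OF x y])
    ultimately show ?thesis
      using hinner_nonneg[of ?z] x y smult_mem
      by (simp add: hnorm_square power2_eq_square[of t] algebra_simps)
  qed
  show ?thesis
  proof (cases "hnorm H y = 0")
    case True
    show ?thesis
    proof (rule ccontr)
      assume "\<not> ?thesis"
      with True have "Re (hinner H x y) > 0" by simp
      then have "2 * (- ((hnorm H x)\<^sup>2 + 1) / (2 * Re (hinner H x y))) * Re (hinner H x y)
          = - ((hnorm H x)\<^sup>2 + 1)" by simp
      with key[of "- ((hnorm H x)\<^sup>2 + 1) / (2 * Re (hinner H x y))"] True show False by simp
    qed
  next
    case False
    then have b: "hnorm H y > 0" using hnorm_nonneg[OF y] by simp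
    show ?thesis
    proof (cases "hnorm H x = 0")
      case True
      show ?thesis
      proof (rule ccontr)
        assume "\<not> ?thesis"
        with True have p: "Re (hinner H x y) > 0" by simp
        from key[of "- Re (hinner H x y) / (hnorm H y)\<^sup>2"] True b p
        have "Re (hinner H x y) * Re (hinner H x y) \<le> 0"
          by (simp add: field_simps power2_eq_square)
        with mult_pos_pos[OF p p] show False by linarith
      qed
    next
      case False
      then have a: "hnorm H x > 0" using hnorm_nonneg[OF x] by simp
      from key[of "- hnorm H x / hnorm H y"] b a
      have "2 * (hnorm H x * Re (hinner H x y) / hnorm H y) \<le> 2 * (hnorm H x)\<^sup>2"
        by (simp add: field_simps power2_eq_square)
      then show ?thesis using a b by (simp add: field_simps power2_eq_square)
    qed
  qed
qed

lemma hnorm_triangle: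
  assumes "x \<in> carrier H" "y \<in> carrier H"
  shows "hnorm H (x \<oplus> y) \<le> hnorm H x + hnorm H y"
proof (rule power2_le_imp_le)
  have "(hnorm H (x \<oplus> y))\<^sup>2 = (hnorm H x)\<^sup>2 + (hnorm H y)\<^sup>2 + 2 * Re (hinner H x y)"
    using assms by (simp add: hnorm_square hinner_add_left hinner_add_right hinner_commute[of x y])
  then show "(hnorm H (x \<oplus> y))\<^sup>2 \<le> (hnorm H x + hnorm H y)\<^sup>2"
    using Re_hinner_le[OF assms] by (simp add: power2_sum)
qed (use assms in auto)

lemma hnorm_uminus: "x \<in> carrier H \<Longrightarrow> hnorm H (\<ominus> x) = hnorm H x"
  by (simp add: hnorm_def hinner_uminus hinner_commute[of "\<ominus> x" x])

lemma hdist_eq: "\<lbrakk>x \<in> carrier H; y \<in> carrier H\<rbrakk> \<Longrightarrow> hdist H x y = hnorm H (x \<ominus> y)"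
  by (simp add: hdist_def)

lemma hdist_nonneg: "0 \<le> hdist H x y"
  by (simp add: hdist_def)

lemma hdist_commute: "hdist H x y = hdist H y x"
proof -
  have "\<ominus> (x \<ominus> y) = y \<ominus> x" if "x \<in> carrier H" "y \<in> carrier H"
    using that by (simp add: a_minus_def M.minus_add M.a_comm)
  then show ?thesis
    unfolding hdist_def by (metis hnorm_uminus M.minus_closed)
qed

lemma hdist_triangle:
  assumes "x \<in> carrier H" "y \<in> carrier H" "z \<in> carrier H"
  shows "hdist H x z \<le> hdist H x y + hdist H y z"
proof -
  have "(x \<ominus> y) \<oplus> (y \<ominus> z) = x \<ominus> z"
    using assms by (simp add: a_minus_def M.a_ac M.r_neg2 M.r_neg1)
  then show ?thesis
    using hnorm_triangle[of "x \<ominus> y" "y \<ominus> z"] assms by (simp add: hdist_eq)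
qed

lemma hdist_zero_iff:
  assumes "x \<in> carrier H" "y \<in> carrier H"
  shows "hdist H x y = 0 \<longleftrightarrow> x = y"
proof
  assume "hdist H x y = 0"
  then have "Re (hinner H (x \<ominus> y) (x \<ominus> y)) = 0"
    using assms by (simp add: hdist_eq hnorm_def hinner_nonneg)
  moreover have "Im (hinner H (x \<ominus> y) (x \<ominus> y)) = 0"
    using hinner_commute[of "x \<ominus> y" "x \<ominus> y"] assms by (simp add: complex_eq_iff)
  ultimately have "x \<ominus> y = \<zero>"
    using assms by (intro hinner_definite) (auto simp: complex_eq_iff)
  moreover have "x = (x \<ominus> y) \<oplus> y"
    using assms by (simp add: a_minus_def M.a_assoc M.l_neg)
  ultimately show "x = y" using assms by simp
next
  assume "x = y"
  then show "hdist H x y = 0"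
    using assms by (simp add: hdist_eq a_minus_def M.r_neg hnorm_def hinner_zero)
qed

lemma hnorm_eq_hdist: "x \<in> carrier H \<Longrightarrow> hnorm H x = hdist H x \<zero>"
proof -
  have z: "\<ominus> \<zero> = \<zero>" by (metis M.a_inv_closed M.l_zero M.r_neg M.zero_closed)
  show "x \<in> carrier H \<Longrightarrow> hnorm H x = hdist H x \<zero>" by (simp add: hdist_eq a_minus_def z)
qed

lemma hdist_add_left:
  assumes "x \<in> carrier H" "y \<in> carrier H" "z \<in> carrier H"
  shows "hdist H (z \<oplus> x) (z \<oplus> y) = hdist H x y"
proof -
  have "z \<oplus> (\<ominus> z \<oplus> \<ominus> y) = \<ominus> y"
    using assms by (simp add: M.r_neg2)
  then have "(z \<oplus> x) \<ominus> (z \<oplus> y) = x \<ominus> y"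
    using assms by (simp add: a_minus_def M.minus_add M.a_assoc M.a_lcomm[of z x] M.a_comm[of "\<ominus> y" "\<ominus> z"])
  then show ?thesis using assms by (simp add: hdist_eq)
qed

sublocale Metric_space "carrier H" "hdist H"
  by standard (auto simp: hdist_nonneg hdist_commute hdist_zero_iff hdist_triangle)

lemma topspace_htopology [simp]: "topspace (htopology H) = carrier H"
  by (simp add: htopology_def)

lemma htopology_eq: "htopology H = mtopology"
  by (simp add: htopology_def)

lemma measurable_hnorm:
  assumes f: "f \<in> measurable M (borel_of (htopology H))"
  shows "(\<lambda>x. hnorm H (f x)) \<in> borel_measurable M"
proof (rule borel_measurableI_less)
  fix r :: real
  have sp: "f x \<in> carrier H" if "x \<in> space M" for x using measurable_space[OF f that] by simp
  have "mball \<zero> r \<in> sets (borel_of (htopology H))"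
    by (rule openin_sets_borel_of) (simp add: htopology_eq)
  from measurable_sets[OF f this]
  have "f -` mball \<zero> r \<inter> space M \<in> sets M" .
  moreover have "f -` mball \<zero> r \<inter> space M = {x \<in> space M. hnorm H (f x) < r}"
    using sp by (auto simp: in_mball hnorm_eq_hdist hdist_commute)
  ultimately show "{x \<in> space M. hnorm H (f x) < r} \<in> sets M" by simp
qed

lemma unitary_groupD:
  assumes "U \<in> unitary_group H"
  shows "x \<in> carrier H \<Longrightarrow> U x \<in> carrier H"
    "\<lbrakk>x \<in> carrier H; y \<in> carrier H\<rbrakk> \<Longrightarrow> U (x \<oplus> y) = U x \<oplus> U y"
    "x \<in> carrier H \<Longrightarrow> hnorm H (U x) = hnorm H x"
    "\<lbrakk>x \<in> carrier H; y \<in> carrier H\<rbrakk> \<Longrightarrow> hdist H (U x) (U y) = hdist H x y"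
    "bij_betw U (carrier H) (carrier H)"
proof -
  show mem: "x \<in> carrier H \<Longrightarrow> U x \<in> carrier H" for x
    using assms by (auto simp: unitary_group_def bij_betw_def)
  show add: "\<lbrakk>x \<in> carrier H; y \<in> carrier H\<rbrakk> \<Longrightarrow> U (x \<oplus> y) = U x \<oplus> U y" for x y
    using assms by (auto simp: unitary_group_def)
  show bij: "bij_betw U (carrier H) (carrier H)"
    using assms by (auto simp: unitary_group_def)
  show n: "x \<in> carrier H \<Longrightarrow> hnorm H (U x) = hnorm H x" for x
    using assms by (auto simp: unitary_group_def hnorm_def)
  assume x: "x \<in> carrier H" and y: "y \<in> carrier H"
  have "U (x \<ominus> y) \<oplus> U y = U x"
    using add[of "x \<ominus> y" y] x y by (simp add: a_minus_def M.a_assoc M.l_neg)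
  moreover have "(U (x \<ominus> y) \<oplus> U y) \<ominus> U y = U (x \<ominus> y)"
    using x y mem by (simp add: a_minus_def M.a_assoc M.r_neg)
  ultimately have "U x \<ominus> U y = U (x \<ominus> y)" by simp
  then show "hdist H (U x) (U y) = hdist H x y"
    using x y mem n by (simp add: hdist_eq)
qed

lemma topspace_unitary_sot: "topspace (unitary_sot H) = unitary_group H"
proof -
  have "unitary_group H \<subseteq> (\<Pi>\<^sub>E x\<in>carrier H. carrier H)"
  proof
    fix U assume U: "U \<in> unitary_group H"
    then have "U \<in> extensional (carrier H)" by (simp add: unitary_group_def)
    then show "U \<in> (\<Pi>\<^sub>E x\<in>carrier H. carrier H)"
      using unitary_groupD(1)[OF U] by (simp add: PiE_iff)
  qed
  then show ?thesis by (auto simp: unitary_sot_def)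
qed

text \<open>Balls with rational radius around the points of \<open>E\<close> form a countable base,
  and their preimages are sublevel sets of the given distance functions. So measurability has to be
  tested on distances to countably many points only.\<close>

lemma measurable_htopologyI:
  assumes f: "\<And>x. x \<in> space M \<Longrightarrow> f x \<in> carrier H"
    and E: "countable E" "E \<subseteq> carrier H"
    and dense: "\<And>x r. \<lbrakk>x \<in> carrier H; r > 0\<rbrakk> \<Longrightarrow> \<exists>e\<in>E. hdist H x e < r"
    and m: "\<And>e. e \<in> E \<Longrightarrow> (\<lambda>x. hdist H (f x) e) \<in> borel_measurable M"
  shows "f \<in> measurable M (borel_of (htopology H))"
proof (rule measurable_borel_of_base)
  let ?\<B> = "(\<lambda>(e, q). mball e (of_rat q)) ` (E \<times> UNIV)"
  show "f \<in> space M \<rightarrow> topspace (htopology H)" using f by simp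
  show "countable ?\<B>" using E by (intro countable_image countable_SIGMA) auto
  show "f -` B \<inter> space M \<in> sets M" if "B \<in> ?\<B>" for B
  proof -
    from that obtain e q where B: "e \<in> E" "B = mball e (of_rat q)" by auto
    then have "f -` B \<inter> space M = {x \<in> space M. hdist H (f x) e < of_rat q}"
      using E f by (auto simp: in_mball hdist_commute)
    then show ?thesis using m[OF B(1)] by simp
  qed
  fix U x assume U: "openin (htopology H) U" "x \<in> U"
  then have x: "x \<in> carrier H" using openin_subset by fastforce
  obtain r where r: "r > 0" "mball x r \<subseteq> U"
    using U by (auto simp: htopology_eq openin_mtopology)
  obtain e where e: "e \<in> E" "hdist H x e < r / 2" using dense[OF x, of "r/2"] r by auto
  obtain q where q: "hdist H x e < of_rat q" "of_rat q < r / 2"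
    using of_rat_dense[OF e(2)] by auto
  have "mball e (of_rat q) \<subseteq> mball x r"
    using e q E x hdist_commute by (intro mball_subset) auto
  then show "\<exists>B\<in>?\<B>. x \<in> B \<and> B \<subseteq> U"
    using e q r E x by (intro bexI[of _ "mball e (of_rat q)"]) (auto simp: hdist_commute in_mball)
qed

text \<open>Finitely many conditions "U d is closer than q to e" with d, e in \<open>E\<close> and
  rational q cut out a countable base of the strong operator topology. Vectors can be replaced by
  nearby members of \<open>E\<close> because unitaries are isometries, hence equicontinuous.\<close>

lemma measurable_unitary_sotI:
  assumes f: "\<And>x. x \<in> space M \<Longrightarrow> f x \<in> unitary_group H"
    and E: "countable E" "E \<subseteq> carrier H"
    and dense: "\<And>x r. \<lbrakk>x \<in> carrier H; r > 0\<rbrakk> \<Longrightarrow> \<exists>e\<in>E. hdist H x e < r"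
    and m: "\<And>d e. \<lbrakk>d \<in> E; e \<in> E\<rbrakk> \<Longrightarrow> (\<lambda>x. hdist H (f x d) e) \<in> borel_measurable M"
  shows "f \<in> measurable M (borel_of (unitary_sot H))"
proof (rule measurable_borel_of_base)
  define N where "N L = {U \<in> unitary_group H. \<forall>t\<in>set L. hdist H (U (fst t)) (fst (snd t)) < real_of_rat (snd (snd t))}" for L
  let ?\<B> = "N ` lists (E \<times> E \<times> UNIV)"
  show "f \<in> space M \<rightarrow> topspace (unitary_sot H)" using f by (simp add: topspace_unitary_sot)
  show "countable ?\<B>" using E by (intro countable_image countable_lists countable_SIGMA) auto
  show "f -` B \<inter> space M \<in> sets M" if "B \<in> ?\<B>" for B
  proof -
    from that obtain L where L: "L \<in> lists (E \<times> E \<times> UNIV)" "B = N L" by auto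
    have "f -` B \<inter> space M = {x \<in> space M. \<forall>p\<in>set L. hdist H (f x (fst p)) (fst (snd p)) < of_rat (snd (snd p))}"
      using f L by (auto simp: N_def)
    moreover have "{x \<in> space M. hdist H (f x (fst p)) (fst (snd p)) < of_rat (snd (snd p))} \<in> sets M"
      if "p \<in> set L" for p
    proof -
      have "fst p \<in> E" "fst (snd p) \<in> E" using L that by auto
      then show ?thesis using m[of "fst p" "fst (snd p)"] by simp
    qed
    ultimately show ?thesis by (simp add: sets.sets_Collect_finite_All)
  qed
  fix W U assume W: "openin (unitary_sot H) W" and UW: "U \<in> W"
  obtain S where S: "openin (product_topology (\<lambda>_. htopology H) (carrier H)) S" "W = S \<inter> unitary_group H"
    using W unfolding unitary_sot_def openin_subtopology by blast
  have U: "U \<in> unitary_group H" and US: "U \<in> S" using UW S by auto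
  have "\<exists>X. finite {i \<in> carrier H. X i \<noteq> topspace (htopology H)} \<and>
      (\<forall>i\<in>carrier H. openin (htopology H) (X i)) \<and> U \<in> Pi\<^sub>E (carrier H) X \<and> Pi\<^sub>E (carrier H) X \<subseteq> S"
    using S(1)[unfolded openin_product_topology_alt] US by (rule bspec)
  then obtain X where X: "finite {i \<in> carrier H. X i \<noteq> topspace (htopology H)}"
      "\<And>i. i \<in> carrier H \<Longrightarrow> openin (htopology H) (X i)" "U \<in> Pi\<^sub>E (carrier H) X" "Pi\<^sub>E (carrier H) X \<subseteq> S"
    by blast
  let ?F = "{i \<in> carrier H. X i \<noteq> topspace (htopology H)}"
  note u = unitary_groupD
  have "\<exists>p\<in>E \<times> E \<times> UNIV. hdist H (U (fst p)) (fst (snd p)) < of_rat (snd (snd p)) \<and>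
      (\<forall>U'\<in>unitary_group H. hdist H (U' (fst p)) (fst (snd p)) < of_rat (snd (snd p)) \<longrightarrow> U' i \<in> X i)"
    if "i \<in> ?F" for i
  proof -
    have i: "i \<in> carrier H" using that by simp
    have "U i \<in> X i" using X(3) i by auto
    then obtain r where r: "r > 0" "mball (U i) r \<subseteq> X i"
      using X(2)[OF i] by (auto simp: htopology_eq openin_mtopology)
    \<comment> \<open>The path from U i to U' i runs through U d, e and U' d. Its four pieces are
      each shorter than r/4; the first and the last equal the distance from i to d.\<close>
    obtain d where d: "d \<in> E" "hdist H i d < r / 4" using dense[OF i, of "r/4"] r by auto
    have dc: "d \<in> carrier H" using d E by auto
    obtain e where e: "e \<in> E" "hdist H (U d) e < r / 4" using dense[OF u(1)[OF U dc], of "r/4"] r by auto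
    have ec: "e \<in> carrier H" using e E by auto
    obtain q where q: "hdist H (U d) e < of_rat q" "of_rat q < r / 4"
      using of_rat_dense[OF e(2)] by auto
    have "U' i \<in> X i" if U': "U' \<in> unitary_group H" "hdist H (U' d) e < of_rat q" for U'
    proof -
      have "hdist H (U i) (U' i) \<le> hdist H (U i) (U d) + hdist H (U d) (U' i)"
        using U U' i dc u(1) by (intro hdist_triangle) auto
      also have "hdist H (U d) (U' i) \<le> hdist H (U d) e + hdist H e (U' i)"
        using U U' i dc ec u(1) by (intro hdist_triangle) auto
      also have "hdist H e (U' i) \<le> hdist H e (U' d) + hdist H (U' d) (U' i)"
        using U U' i dc ec u(1) by (intro hdist_triangle) auto
      finally have "hdist H (U i) (U' i) < r"
        using d(2) e(2) U' q u(4)[OF U i dc] u(4)[OF U'(1) dc i] hdist_commute[of e "U' d"]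
          hdist_commute[of i d] by linarith
      then show ?thesis using r(2) u(1)[OF U i] u(1)[OF U'(1) i] by (auto simp: in_mball)
    qed
    then show ?thesis using d e q by (intro bexI[of _ "(d, e, q)"]) auto
  qed
  then have "\<forall>i\<in>?F. \<exists>p. p \<in> E \<times> E \<times> UNIV \<and>
      hdist H (U (fst p)) (fst (snd p)) < real_of_rat (snd (snd p)) \<and>
      (\<forall>U'\<in>unitary_group H. hdist H (U' (fst p)) (fst (snd p)) < real_of_rat (snd (snd p)) \<longrightarrow> U' i \<in> X i)"
    by (intro ballI) (simp only: Bex_def)
  then obtain p where p0: "\<forall>i\<in>?F. p i \<in> E \<times> E \<times> UNIV \<and>
      hdist H (U (fst (p i))) (fst (snd (p i))) < real_of_rat (snd (snd (p i))) \<and>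
      (\<forall>U'\<in>unitary_group H. hdist H (U' (fst (p i))) (fst (snd (p i))) < real_of_rat (snd (snd (p i))) \<longrightarrow> U' i \<in> X i)"
    by (rule bchoice[THEN exE]) blast
  have p: "\<And>i. i \<in> ?F \<Longrightarrow> p i \<in> E \<times> E \<times> UNIV"
     "\<And>i. i \<in> ?F \<Longrightarrow> hdist H (U (fst (p i))) (fst (snd (p i))) < of_rat (snd (snd (p i)))"
     "\<And>i U'. \<lbrakk>i \<in> ?F; U' \<in> unitary_group H; hdist H (U' (fst (p i))) (fst (snd (p i))) < of_rat (snd (snd (p i)))\<rbrakk>
        \<Longrightarrow> U' i \<in> X i"
    using p0 by blast+
  obtain K where K: "set K = ?F" using X(1) finite_list by blast
  have "N (map p K) \<in> ?\<B>" 
    unfolding lists_eq_set using p(1) by (intro imageI CollectI) (simp only: set_map K, blast)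
  moreover have "U \<in> N (map p K)" 
    unfolding N_def using U p(2) by (intro CollectI conjI) (simp_all only: set_map K ball_simps, blast)
  moreover have "N (map p K) \<subseteq> W"
  proof
    fix U' assume "U' \<in> N (map p K)"
    then have U': "U' \<in> unitary_group H" "\<And>i. i \<in> ?F \<Longrightarrow> hdist H (U' (fst (p i))) (fst (snd (p i))) < of_rat (snd (snd (p i)))"

      unfolding N_def by (simp_all only: set_map K ball_simps mem_Collect_eq, blast)
    have "U' i \<in> X i" if "i \<in> carrier H" for i
    proof (cases "i \<in> ?F")
      case True
      then show ?thesis using p(3) U' by blast
    next
      case False
      then show ?thesis using that u(1)[OF U'(1) that] by simp
    qed
    moreover have "U' \<in> extensional (carrier H)" using U'(1) by (simp add: unitary_group_def)
    ultimately have "U' \<in> Pi\<^sub>E (carrier H) X" by (auto simp: PiE_iff)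
    then show "U' \<in> W" using X(4) S(2) U'(1) by auto
  qed
  ultimately show "\<exists>B\<in>?\<B>. U \<in> B \<and> B \<subseteq> W" by blast
qed

end

text \<open>The bridge from the pre-Hilbert space to a Hilbert space on the prescribed type, with a
  vector \<open>B g\<close> and an isometry \<open>A g\<close> carried along for every parameter. No
  group enters: the last clause concerns three parameters g, x, y and will be used with y the
  product of g and x.\<close>

theorem (in semi_inner) ex_hilbert_model:
  fixes M :: "'g measure"
  assumes D: "countable D" "D \<subseteq> V"
    and dense: "\<And>x e. \<lbrakk>x \<in> V; e > 0\<rbrakk> \<Longrightarrow> \<exists>d\<in>D. nrm (x - d) < e"
    and B: "\<And>g. g \<in> space M \<Longrightarrow> B g \<in> V"
    and A: "\<And>g. g \<in> space M \<Longrightarrow> isometry_pair (A g) (A' g)"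
    and mB: "\<And>d. d \<in> D \<Longrightarrow> (\<lambda>g. nrm (B g - d)) \<in> borel_measurable M"
    and mA: "\<And>d e. \<lbrakk>d \<in> D; e \<in> D\<rbrakk> \<Longrightarrow> (\<lambda>g. nrm (A g d - e)) \<in> borel_measurable M"
  shows "\<exists>(H :: ('h \<Rightarrow> complex) hilbert) b \<pi>. hilbert_space H \<and>
    b \<in> measurable M (borel_of (htopology H)) \<and> \<pi> \<in> measurable M (borel_of (unitary_sot H)) \<and>
    (\<forall>g\<in>space M. hnorm H (b g) = nrm (B g)) \<and>
    (\<forall>g\<in>space M. \<forall>x\<in>space M. \<forall>y\<in>space M.
      hnorm H (b y \<ominus>\<^bsub>H\<^esub> b g \<ominus>\<^bsub>H\<^esub> \<pi> g (b x)) = nrm (B y - B g - A g (B x)))"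
proof -
  interpret C: semi_inner cauchy_seqs sc_seq Qlim
    by (rule semi_inner_cauchy_seqs)
  interpret C: complete_semi_inner cauchy_seqs sc_seq Qlim
    by (rule complete_cauchy_seqs)
  have "D \<noteq> {}" using dense[OF zero_mem, of 1] by auto
  then have rd: "range (from_nat_into D) = D" using D(1) by (rule range_from_nat_into)
  define c where "c n = (\<lambda>_::nat. from_nat_into D n)" for n
  have cC: "c n \<in> cauchy_seqs" for n
    unfolding c_def using rd D(2) by (intro const_mem) auto
  have cdense: "\<exists>n. C.nrm (F - c n) < e" if F: "F \<in> cauchy_seqs" and e: "e > 0" for F e
  proof -
    obtain d where "d \<in> D" "C.nrm (F - (\<lambda>_. d)) < e" using dense_const[OF dense D(2) F e] by blast
    then show ?thesis unfolding c_def using rd by (metis rangeE)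
  qed
  obtain \<phi> :: "(nat \<Rightarrow> complex) \<Rightarrow> ('h \<Rightarrow> complex)" where \<phi>: "inj \<phi>"
    using ex_inj_sequences by blast
  \<comment> \<open>A vector is coded by its inner products with a dense sequence. Two vectors have
    the same code exactly when their difference is null.\<close>
  define J where "J F = \<phi> (\<lambda>n. Qlim F (c n))" for F
  interpret Hm: hilbert_model cauchy_seqs sc_seq Qlim J
  proof
    fix F G assume F: "F \<in> cauchy_seqs" and G: "G \<in> cauchy_seqs"
    let ?z = "F - G"
    have z: "?z \<in> cauchy_seqs" using F G by (rule C.diff_mem)
    have "J F = J G \<longleftrightarrow> (\<forall>n. Qlim F (c n) = Qlim G (c n))"
      unfolding J_def using \<phi> by (auto simp: fun_eq_iff dest: injD)
    also have "\<dots> \<longleftrightarrow> (\<forall>n. Qlim ?z (c n) = 0)"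
      by (simp add: C.Q_diff F G cC)
    also have "\<dots> \<longleftrightarrow> C.nrm ?z = 0"
    proof
      assume "C.nrm ?z = 0"
      then show "\<forall>n. Qlim ?z (c n) = 0" using C.cauchy_schwarz[OF z cC] by simp
    next
      assume 0: "\<forall>n. Qlim ?z (c n) = 0"
      show "C.nrm ?z = 0"
      proof (rule ccontr)
        assume "C.nrm ?z \<noteq> 0"
        then have p: "C.nrm ?z > 0" using C.nrm_nonneg[OF z] by simp
        \<comment> \<open>The vector is orthogonal to \<open>c n\<close>, so its squared norm equals
          its inner product with \<open>?z - c n\<close>, which by Cauchy-Schwarz is too
          small.\<close>
        obtain n where n: "C.nrm (?z - c n) < C.nrm ?z" using cdense[OF z p] by blast
        have "Qlim ?z ?z = Qlim ?z (?z - c n)" using 0 by (simp add: C.Q_diff_right[OF z cC z])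
        then have "(C.nrm ?z)\<^sup>2 \<le> C.nrm ?z * C.nrm (?z - c n)"
          using C.cauchy_schwarz[OF z C.diff_mem[OF z cC[of n]]] complex_Re_le_cmod[of "Qlim ?z ?z"]
          unfolding C.nrm_square[OF z] by simp
        then show False using p n by (simp add: power2_eq_square)
      qed
    qed
    finally show "J F = J G \<longleftrightarrow> C.nrm ?z = 0" .
  qed
  let ?H = "Hm.hilbert_of"
  interpret H: hilbert_space ?H by (rule Hm.hilbert_space_hilbert_of)
  define K where "K x = (\<lambda>_::nat. x)" for x :: 'v
  have KC: "K x \<in> cauchy_seqs" if "x \<in> V" for x unfolding K_def by (rule const_mem[OF that])
  have K_diff: "K x - K y = K (x - y)" for x y by (simp add: K_def fun_diff_def)
  define A2 where "A2 g F = (\<lambda>n::nat. A g (F n))" for g F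
  have iso: "C.isometry_pair (A2 g) (\<lambda>F n. A' g (F n))" if "g \<in> space M" for g
    unfolding A2_def by (rule isometry_pair_lift[OF A[OF that]])
  define b where "b g = J (K (B g))" for g
  define \<pi> where "\<pi> g = Hm.unitary_of (A2 g)" for g
  have \<pi>J: "\<pi> g (J (K x)) = J (K (A g x))" if "g \<in> space M" "x \<in> V" for g x
    unfolding \<pi>_def using Hm.unitary_of_J[OF iso[OF that(1)] KC[OF that(2)]] by (simp add: A2_def K_def)
  have AV: "A g x \<in> V" if "g \<in> space M" "x \<in> V" for g x using isometry_pairD(1)[OF A] that by blast
  define E where "E = (\<lambda>d. J (K d)) ` D"
  have E: "countable E" "E \<subseteq> carrier ?H"
    using D KC by (auto simp: E_def Hm.carrier_hilbert_of)
  have Edense: "\<exists>e\<in>E. hdist ?H x e < r" if "x \<in> carrier ?H" "r > 0" for x r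
  proof -
    obtain F where F: "F \<in> cauchy_seqs" "x = J F" using \<open>x \<in> _\<close> by (auto simp: Hm.carrier_hilbert_of)
    obtain d where d: "d \<in> D" "C.nrm (F - K d) < r"
      using dense_const[OF dense D(2) F(1) \<open>r > 0\<close>] unfolding K_def by blast
    then show ?thesis
      using F D(2) KC by (intro bexI[of _ "J (K d)"]) (auto simp: Hm.hdist_J E_def)
  qed
  have dist_JK: "hdist ?H (J (K x)) (J (K y)) = nrm (x - y)" if "x \<in> V" "y \<in> V" for x y
    using that by (simp add: Hm.hdist_J KC K_diff) (simp add: K_def nrm_const diff_mem)
  have 1: "b \<in> measurable M (borel_of (htopology ?H))"
  proof (rule H.measurable_htopologyI[OF _ E Edense])
    show "b g \<in> carrier ?H" if "g \<in> space M" for g using B[OF that] KC by (simp add: b_def Hm.carrier_hilbert_of)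
    show "(\<lambda>g. hdist ?H (b g) e) \<in> borel_measurable M" if "e \<in> E" for e
    proof -
      from that obtain d where d: "d \<in> D" "e = J (K d)" by (auto simp: E_def)
      show ?thesis
        using mB[OF d(1)] d D(2) B by (subst measurable_cong[where g = "\<lambda>g. nrm (B g - d)"]) (auto simp: b_def dist_JK)
    qed
  qed
  have 2: "\<pi> \<in> measurable M (borel_of (unitary_sot ?H))"
  proof (rule H.measurable_unitary_sotI[OF _ E Edense])
    show "\<pi> g \<in> unitary_group ?H" if "g \<in> space M" for g unfolding \<pi>_def by (rule Hm.unitary_of_mem[OF iso[OF that]])
    show "(\<lambda>g. hdist ?H (\<pi> g e) e') \<in> borel_measurable M" if "e \<in> E" "e' \<in> E" for e e'
    proof -
      obtain d d' where d: "d \<in> D" "e = J (K d)" "d' \<in> D" "e' = J (K d')" using \<open>e \<in> E\<close> \<open>e' \<in> E\<close> by (auto simp: E_def)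
      show ?thesis
        using mA[OF d(1,3)] d D(2) AV by (subst measurable_cong[where g = "\<lambda>g. nrm (A g d - d')"]) (auto simp: \<pi>J dist_JK subset_iff)
    qed
  qed
  have 3: "hnorm ?H (b g) = nrm (B g)" if "g \<in> space M" for g
    using B[OF that] by (simp add: b_def Hm.hnorm_J KC) (simp add: K_def nrm_const)
  have 4: "hnorm ?H (b y \<ominus>\<^bsub>?H\<^esub> b g \<ominus>\<^bsub>?H\<^esub> \<pi> g (b x)) = nrm (B y - B g - A g (B x))"
    if "g \<in> space M" "x \<in> space M" "y \<in> space M" for g x y
    using that B AV by (simp add: b_def \<pi>J Hm.minus_J Hm.hnorm_J KC K_diff diff_mem) (simp add: K_def nrm_const diff_mem)
  show ?thesis
    using H.hilbert_space_axioms 1 2 3 4 by (intro exI[of _ ?H] exI[of _ b] exI[of _ \<pi>]) auto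
qed

section \<open>Positive definite kernels\<close>

definition psd_on :: "'k set \<Rightarrow> ('k \<Rightarrow> 'k \<Rightarrow> real) \<Rightarrow> bool" where
  "psd_on S K \<longleftrightarrow> (\<forall>v\<in>S. \<forall>w\<in>S. K v w = K w v) \<and>
    (\<forall>c. 0 \<le> (\<Sum>v\<in>S. \<Sum>w\<in>S. c v * c w * K v w))"

lemma psd_onD: "psd_on S K \<Longrightarrow> 0 \<le> (\<Sum>v\<in>S. \<Sum>w\<in>S. c v * c w * K v w)"
  by (simp add: psd_on_def)

lemma psd_on_sym: "\<lbrakk>psd_on S K; v \<in> S; w \<in> S\<rbrakk> \<Longrightarrow> K v w = K w v"
  by (simp add: psd_on_def)

lemma psd_on_insert_form:
  assumes S: "finite S" "s \<notin> S" and K: "psd_on (insert s S) K"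
  shows "(\<Sum>v\<in>insert s S. \<Sum>w\<in>insert s S. c v * c w * K v w) =
    (c s)\<^sup>2 * K s s + 2 * c s * (\<Sum>v\<in>S. c v * K v s) + (\<Sum>v\<in>S. \<Sum>w\<in>S. c v * c w * K v w)"
proof -
  have "(\<Sum>w\<in>S. c s * c w * K s w) = c s * (\<Sum>v\<in>S. c v * K v s)"
    unfolding sum_distrib_left by (intro sum.cong) (auto simp: psd_on_sym[OF K, of s])
  moreover have "(\<Sum>v\<in>S. c v * c s * K v s) = c s * (\<Sum>v\<in>S. c v * K v s)"
    unfolding sum_distrib_left by (intro sum.cong) auto
  ultimately show ?thesis
    using S by (simp add: sum.distrib power2_eq_square algebra_simps)
qed

text \<open>Cholesky factorization: the induction splits off one point \<open>s\<close> and passes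
  to the Schur complement \<open>K'\<close>. If \<open>K s s = 0\<close>, positivity forces the
  whole row of \<open>s\<close> to vanish, and \<open>K\<close> itself is factored on the remaining
  points.\<close>

lemma psd_on_decomposition:
  assumes "finite S" "psd_on S K"
  shows "\<exists>(n::nat) u. \<forall>v\<in>S. \<forall>w\<in>S. K v w = (\<Sum>k<n. u k v * u k w)"
  using assms
proof (induction S arbitrary: K rule: finite_induct)
  case empty
  then show ?case by simp
next
  case (insert s S)
  note form = psd_on_insert_form[OF insert.hyps insert.prems]
  note sym = psd_on_sym[OF insert.prems]
  have pos: "0 \<le> (c s)\<^sup>2 * K s s + 2 * c s * (\<Sum>v\<in>S. c v * K v s) + (\<Sum>v\<in>S. \<Sum>w\<in>S. c v * c w * K v w)" for c
    using psd_onD[OF insert.prems, of c] unfolding form .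
  have K0: "0 \<le> K s s"
  proof -
    define e where "e = (\<lambda>v. 0)(s := 1 :: real)"
    have "e v = 0" if "v \<in> S" for v using that insert.hyps(2) by (auto simp: e_def)
    then show ?thesis using pos[of e] by (simp add: e_def)
  qed
  define K' where "K' v w = K v w - K v s * K w s / K s s" for v w
  show ?case
  proof (cases "K s s = 0")
    case True
    have z: "K v s = 0" if v: "v \<in> S" for v
    proof (rule ccontr)
      assume "K v s \<noteq> 0"
      \<comment> \<open>Weight \<open>t\<close> at \<open>s\<close> and weight 1 at \<open>v\<close>
        would give the quadratic form the value 2 t \<open>K v s\<close> + \<open>K v v\<close> =
        -1.\<close>
      define t where "t = - (K v v + 1) / (2 * K v s)"
      define c where "c x = (if x = s then t else if x = v then 1 else 0)" for x
      have cv: "c x = (if x = v then 1 else 0)" if "x \<in> S" for x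
        using that insert.hyps(2) by (auto simp: c_def)
      have "(\<Sum>x\<in>S. c x * K x s) = (\<Sum>x\<in>S. if x = v then K x s else 0)"
        by (intro sum.cong) (auto simp: cv)
      moreover have "(\<Sum>x\<in>S. \<Sum>w\<in>S. c x * c w * K x w) = (\<Sum>x\<in>S. if x = v then (\<Sum>w\<in>S. if w = v then K x w else 0) else 0)"
        by (intro sum.cong) (auto simp: cv intro!: sum.cong)
      ultimately have "0 \<le> 2 * t * K v s + K v v"
        using pos[of c] True v insert.hyps(1) by (simp add: c_def sum.delta')
      moreover have "2 * t * K v s = - (K v v + 1)"
        using \<open>K v s \<noteq> 0\<close> by (simp add: t_def)
      ultimately show False by simp
    qed
    have z': "K s v = 0" if v: "v \<in> S" for v
      using z[OF v] sym[of s v] v by simp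
    have "psd_on S K"
      unfolding psd_on_def
    proof (intro conjI allI)
      fix c
      have "(\<Sum>v\<in>S. \<Sum>w\<in>S. (c(s:=0)) v * (c(s:=0)) w * K v w) = (\<Sum>v\<in>S. \<Sum>w\<in>S. c v * c w * K v w)"
        using insert.hyps(2) by (intro sum.cong refl) auto
      then show "0 \<le> (\<Sum>v\<in>S. \<Sum>w\<in>S. c v * c w * K v w)"
        using pos[of "c(s:=0)"] by simp
    qed (use sym in auto)
    from insert.IH[OF this] obtain n :: nat and u where u: "\<forall>v\<in>S. \<forall>w\<in>S. K v w = (\<Sum>k<n. u k v * u k w)"
      by blast
    show ?thesis
    proof (intro exI[of _ n] exI[of _ "\<lambda>k. (u k)(s := 0)"] ballI)
      fix v w assume v: "v \<in> insert s S" and w: "w \<in> insert s S"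
      show "K v w = (\<Sum>k<n. ((u k)(s := 0)) v * ((u k)(s := 0)) w)"
        using v w u z z' True insert.hyps(2) by (cases "v = s"; cases "w = s") auto
    qed
  next
    case False
    then have Kp: "K s s > 0" using K0 by simp
    have "psd_on S K'"
      unfolding psd_on_def
    proof (intro conjI allI ballI)
      fix v w assume "v \<in> S" "w \<in> S"
      then show "K' v w = K' w v" by (simp add: K'_def sym[of v w] mult.commute)
    next
      fix c
      define p where "p = (\<Sum>v\<in>S. c v * K v s)"
      \<comment> \<open>This value at \<open>s\<close> minimizes the quadratic form with the other
        coefficients fixed; the minimum is the form of the Schur complement.\<close>
      define d where "d = c(s := - p / K s s)"
      have dS: "d x = c x" if "x \<in> S" for x using that insert.hyps(2) by (auto simp: d_def)
      have p: "(\<Sum>v\<in>S. d v * K v s) = p" by (simp add: p_def dS)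
      have q: "(\<Sum>v\<in>S. \<Sum>w\<in>S. d v * d w * K v w) = (\<Sum>v\<in>S. \<Sum>w\<in>S. c v * c w * K v w)" by (simp add: dS)
      have "(\<Sum>v\<in>S. \<Sum>w\<in>S. c v * c w * K' v w) =
          (\<Sum>v\<in>S. \<Sum>w\<in>S. c v * c w * K v w) - (\<Sum>v\<in>S. \<Sum>w\<in>S. (c v * K v s) * (c w * K w s)) / K s s"
        by (simp add: K'_def right_diff_distrib sum_subtractf sum_divide_distrib mult.assoc mult.left_commute)
      also have "(\<Sum>v\<in>S. \<Sum>w\<in>S. (c v * K v s) * (c w * K w s)) = p * p"
        by (simp add: p_def sum_product)
      finally have e: "(\<Sum>v\<in>S. \<Sum>w\<in>S. c v * c w * K' v w) = (\<Sum>v\<in>S. \<Sum>w\<in>S. c v * c w * K v w) - p * p / K s s" .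
      have "0 \<le> (d s)\<^sup>2 * K s s + 2 * d s * p + (\<Sum>v\<in>S. \<Sum>w\<in>S. c v * c w * K v w)"
        using pos[of d] unfolding p q .
      moreover have "(d s)\<^sup>2 * K s s = p * p / K s s" "2 * d s * p = - 2 * (p * p / K s s)"
        using Kp by (simp_all add: d_def power2_eq_square)
      ultimately show "0 \<le> (\<Sum>v\<in>S. \<Sum>w\<in>S. c v * c w * K' v w)"
        unfolding e by linarith
    qed
    from insert.IH[OF this] obtain n :: nat and u where u: "\<forall>v\<in>S. \<forall>w\<in>S. K' v w = (\<Sum>k<n. u k v * u k w)"
      by blast
    \<comment> \<open>The old vectors are extended by 0 to \<open>s\<close>, and the new last one
      restores the rank-one part that the Schur complement removed.\<close>
    define u' where "u' k v = (if k < n then if v = s then 0 else u k v else K v s / sqrt (K s s))" for k v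
    show ?thesis
    proof (intro exI[of _ "Suc n"] exI[of _ u'] ballI)
      fix v w assume v: "v \<in> insert s S" and w: "w \<in> insert s S"
      have "(\<Sum>k<n. u' k v * u' k w) = (if v = s \<or> w = s then 0 else \<Sum>k<n. u k v * u k w)"
        by (auto simp: u'_def)
      also have "\<dots> = (if v = s \<or> w = s then 0 else K' v w)"
        using u v w by auto
      finally have "(\<Sum>k<Suc n. u' k v * u' k w) = (if v = s \<or> w = s then 0 else K' v w) + K v s * K w s / K s s"
        using Kp by (simp add: u'_def)
      then show "K v w = (\<Sum>k<Suc n. u' k v * u' k w)"
        using Kp sym[of s w] v w by (cases "v = s"; cases "w = s") (auto simp: K'_def)
    qed
  qed
qed

text \<open>Schur product theorem: after factorizing one kernel, the product is a sum of rescalings of the other.\<close>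

lemma psd_on_mult:
  assumes S: "finite S" and K: "psd_on S K" and L: "psd_on S L"
  shows "psd_on S (\<lambda>v w. K v w * L v w)"
  unfolding psd_on_def
proof (intro conjI allI ballI)
  fix v w assume "v \<in> S" "w \<in> S"
  then show "K v w * L v w = K w v * L w v" using K L by (simp add: psd_on_sym)
next
  fix c
  obtain n :: nat and u where u: "\<forall>v\<in>S. \<forall>w\<in>S. L v w = (\<Sum>k<n. u k v * u k w)"
    using psd_on_decomposition[OF S L] by blast
  have "(\<Sum>v\<in>S. \<Sum>w\<in>S. c v * c w * (K v w * L v w)) =
      (\<Sum>v\<in>S. \<Sum>w\<in>S. \<Sum>k<n. (c v * u k v) * (c w * u k w) * K v w)"
    using u by (intro sum.cong refl) (simp add: sum_distrib_left mult.assoc mult.left_commute mult.commute)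
  also have "\<dots> = (\<Sum>v\<in>S. \<Sum>k<n. \<Sum>w\<in>S. (c v * u k v) * (c w * u k w) * K v w)"
    by (intro sum.cong refl sum.swap)
  also have "\<dots> = (\<Sum>k<n. \<Sum>v\<in>S. \<Sum>w\<in>S. (c v * u k v) * (c w * u k w) * K v w)"
    by (rule sum.swap)
  also have "\<dots> \<ge> 0"
  proof (rule sum_nonneg)
    show "0 \<le> (\<Sum>v\<in>S. \<Sum>w\<in>S. (c v * u k v) * (c w * u k w) * K v w)" for k
      by (rule psd_onD[OF K, of "\<lambda>v. c v * u k v"])
  qed
  finally show "0 \<le> (\<Sum>v\<in>S. \<Sum>w\<in>S. c v * c w * (K v w * L v w))" .
qed

lemma psd_on_power:
  assumes S: "finite S" and K: "psd_on S K"
  shows "psd_on S (\<lambda>v w. K v w ^ n)"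
proof (induction n)
  case 0
  have "(\<Sum>v\<in>S. \<Sum>w\<in>S. c v * c w) = (sum c S)\<^sup>2" for c :: "'a \<Rightarrow> real"
    by (simp add: power2_eq_square sum_product)
  then show ?case by (simp add: psd_on_def)
next
  case (Suc n)
  then show ?case using psd_on_mult[OF S K Suc.IH] by simp
qed

text \<open>The exponential series has nonnegative coefficients, and powers of the kernel are
  positive by the Schur product theorem.\<close>

lemma psd_on_exp:
  assumes S: "finite S" and K: "psd_on S K"
  shows "psd_on S (\<lambda>v w. exp (K v w))"
  unfolding psd_on_def
proof (intro conjI allI ballI)
  fix v w assume "v \<in> S" "w \<in> S"
  then show "exp (K v w) = exp (K w v)" using K by (simp add: psd_on_sym)
next
  fix c
  have sums: "(\<lambda>n. \<Sum>v\<in>S. \<Sum>w\<in>S. c v * c w * (K v w ^ n /\<^sub>R fact n)) sums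
      (\<Sum>v\<in>S. \<Sum>w\<in>S. c v * c w * exp (K v w))"
    by (intro sums_sum sums_mult exp_converges)
  have "0 \<le> (\<Sum>v\<in>S. \<Sum>w\<in>S. c v * c w * (K v w ^ n /\<^sub>R fact n))" for n
  proof -
    have "(\<Sum>v\<in>S. \<Sum>w\<in>S. c v * c w * (K v w ^ n /\<^sub>R fact n)) =
        (\<Sum>v\<in>S. \<Sum>w\<in>S. c v * c w * K v w ^ n) / fact n"
      unfolding sum_divide_distrib by (intro sum.cong refl) (simp add: field_simps)
    then show ?thesis using psd_onD[OF psd_on_power[OF S K]] by simp
  qed
  then show "0 \<le> (\<Sum>v\<in>S. \<Sum>w\<in>S. c v * c w * exp (K v w))"
    by (rule sums_le[OF _ sums_zero sums])
qed

lemma psd_on_scale: "\<lbrakk>psd_on S K; t \<ge> 0\<rbrakk> \<Longrightarrow> psd_on S (\<lambda>v w. t * K v w)"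
proof -
  assume K: "psd_on S K" and t: "t \<ge> 0"
  have "(\<Sum>v\<in>S. \<Sum>w\<in>S. c v * c w * (t * K v w)) = t * (\<Sum>v\<in>S. \<Sum>w\<in>S. c v * c w * K v w)" for c
    by (simp add: sum_distrib_left mult.left_commute)
  then show ?thesis using K t by (simp add: psd_on_def)
qed

text \<open>The exponential factors into exp(2 t K(v,w)) and two factors depending on a single
  variable each; the latter are absorbed into the coefficients.\<close>

lemma psd_on_gaussian:
  assumes S: "finite S" and K: "psd_on S K" and t: "t \<ge> 0"
  shows "psd_on S (\<lambda>v w. exp (- t * (K v v + K w w - 2 * K v w)))"
  unfolding psd_on_def
proof (intro conjI allI ballI)
  fix v w assume "v \<in> S" "w \<in> S"
  then show "exp (- t * (K v v + K w w - 2 * K v w)) = exp (- t * (K w w + K v v - 2 * K w v))"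
    using K by (simp add: psd_on_sym[of S K v w] add.commute)
next
  fix c
  have E: "psd_on S (\<lambda>v w. exp (2 * t * K v w))"
    by (intro psd_on_exp psd_on_scale S K) (use t in simp)
  have "exp (- t * (K v v + K w w - 2 * K v w)) = exp (- t * K v v) * exp (- t * K w w) * exp (2 * t * K v w)" for v w
    by (simp add: algebra_simps flip: exp_add)
  then have "(\<Sum>v\<in>S. \<Sum>w\<in>S. c v * c w * exp (- t * (K v v + K w w - 2 * K v w))) =
    (\<Sum>v\<in>S. \<Sum>w\<in>S. (c v * exp (- t * K v v)) * (c w * exp (- t * K w w)) * exp (2 * t * K v w))"
    by (simp add: mult.assoc mult.left_commute mult.commute)
  also have "\<dots> \<ge> 0" by (rule psd_onD[OF E, of "\<lambda>v. c v * exp (- t * K v v)"])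
  finally show "0 \<le> (\<Sum>v\<in>S. \<Sum>w\<in>S. c v * c w * exp (- t * (K v v + K w w - 2 * K v w)))" .
qed

text \<open>The quadratic form is the squared norm of the vector with coefficients \<open>c\<close>.
  The induction produces this vector and records its inner products with all others.\<close>

lemma (in hilbert_space) psd_on_Re_hinner:
  assumes S: "finite S" "S \<subseteq> carrier H"
  shows "psd_on S (\<lambda>v w. Re (hinner H v w))"
  unfolding psd_on_def
proof (intro conjI allI ballI)
  fix v w assume "v \<in> S" "w \<in> S"
  then show "Re (hinner H v w) = Re (hinner H w v)" 
    by (subst hinner_commute[of v w]) (use S in auto)
next
  fix c :: "_ \<Rightarrow> real"
  have "\<exists>x\<in>carrier H. \<forall>y\<in>carrier H. Re (hinner H x y) = (\<Sum>v\<in>S. c v * Re (hinner H v y))"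
    using S
  proof (induction S rule: finite_induct)
    case empty
    then show ?case by (intro bexI[of _ \<zero>]) (auto simp: hinner_zero)
  next
    case (insert s S)
    then obtain x where x: "x \<in> carrier H" "\<forall>y\<in>carrier H. Re (hinner H x y) = (\<Sum>v\<in>S. c v * Re (hinner H v y))"
      by auto
    show ?case
      using insert x
      by (intro bexI[of _ "complex_of_real (c s) \<odot> s \<oplus> x"]) (auto simp: hinner_add_left hinner_smult_left smult_mem)
  qed
  then obtain x where x: "x \<in> carrier H" "\<forall>y\<in>carrier H. Re (hinner H x y) = (\<Sum>v\<in>S. c v * Re (hinner H v y))"
    by blast
  have comm: "Re (hinner H x w) = Re (hinner H w x)" if "w \<in> S" for w
  proof -
    have "w \<in> carrier H" using that S by blast
    from hinner_commute[OF this x(1)] show ?thesis by (metis complex_cnj_cancel_iff cnj.simps(1))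
  qed
  have "(\<Sum>v\<in>S. \<Sum>w\<in>S. c v * c w * Re (hinner H v w)) = (\<Sum>w\<in>S. \<Sum>v\<in>S. c v * c w * Re (hinner H v w))"
    by (rule sum.swap)
  also have "\<dots> = (\<Sum>w\<in>S. c w * Re (hinner H x w))"
    using x S by (intro sum.cong refl) (auto simp: sum_distrib_left mult.left_commute mult.commute)
  also have "\<dots> = (\<Sum>w\<in>S. c w * Re (hinner H w x))"
    by (intro sum.cong refl) (simp only: comm)
  also have "\<dots> = Re (hinner H x x)" using x by simp
  also have "\<dots> \<ge> 0" using x(1) by (rule hinner_nonneg)
  finally show "0 \<le> (\<Sum>v\<in>S. \<Sum>w\<in>S. c v * c w * Re (hinner H v w))" .
qed

text \<open>
  A Bernstein function of the squared distance: a sum of kernels \<open>1 - gaussian\<close>, whose growth is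
  as slow as one likes depending on the weights \<open>t\<close>.
\<close>

definition slow_kernel :: "(nat \<Rightarrow> real) \<Rightarrow> real \<Rightarrow> real" where
  "slow_kernel t r = (\<Sum>j. 1 - exp (- t j * r\<^sup>2))"

locale slow_weights =
  fixes t :: "nat \<Rightarrow> real"
  assumes t_pos: "0 < t j" and t_summable: "summable t"
begin

lemma term_bounds: "0 \<le> 1 - exp (- t j * r\<^sup>2)" "1 - exp (- t j * r\<^sup>2) \<le> t j * r\<^sup>2"
  "1 - exp (- t j * r\<^sup>2) \<le> 1"
  using t_pos[of j] exp_ge_add_one_self[of "- t j * r\<^sup>2"] by (auto simp: less_imp_le)

lemma summable_terms: "summable (\<lambda>j. 1 - exp (- t j * r\<^sup>2))"
  by (rule summable_comparison_test[OF _ summable_mult2[OF t_summable, of "r\<^sup>2"]])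
     (use term_bounds in auto)

lemma slow_kernel_nonneg: "0 \<le> slow_kernel t r"
  unfolding slow_kernel_def by (rule suminf_nonneg[OF summable_terms term_bounds(1)])

lemma slow_kernel_zero: "slow_kernel t 0 = 0"
  by (simp add: slow_kernel_def)

lemma slow_kernel_mono: "\<lbrakk>0 \<le> r; r \<le> s\<rbrakk> \<Longrightarrow> slow_kernel t r \<le> slow_kernel t s"
  unfolding slow_kernel_def
  by (rule suminf_le[OF _ summable_terms summable_terms])
     (use t_pos in \<open>auto intro!: mult_left_mono power_mono simp: less_imp_le\<close>)

lemma slow_kernel_unbounded: "\<exists>r>0. slow_kernel t r \<ge> B"
proof -
  obtain n :: nat where n: "real n > 2 * B" using reals_Archimedean2 by blast
  \<comment> \<open>With r^2 = 1/m the first \<open>n\<close> exponents are at least 1, so each of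
    these terms is at least 1 - 1/e, hence at least 1/2, and n/2 exceeds \<open>B\<close>. The
    inserted 1 keeps the set nonempty for n = 0.\<close>
  define m where "m = Min (insert 1 (t ` {..<n}))"
  have m: "m > 0" "\<And>j. j < n \<Longrightarrow> m \<le> t j" using t_pos by (auto simp: m_def)
  define r where "r = sqrt (1 / m)"
  have r: "r > 0" "r\<^sup>2 = 1 / m" using m by (auto simp: r_def)
  have "1 / 2 \<le> 1 - exp (- t j * r\<^sup>2)" if "j < n" for j
  proof -
    have "m * r\<^sup>2 \<le> t j * r\<^sup>2" using m(2)[OF that] by (intro mult_right_mono) auto
    then have "t j * r\<^sup>2 \<ge> 1" using m(1) r by simp
    then have "exp (- t j * r\<^sup>2) \<le> exp (-1)" by simp
    also have "exp (-1) \<le> 1 / (2::real)" using exp_ge_add_one_self[of "1::real"] by (simp add: exp_minus field_simps)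
    finally show ?thesis by simp
  qed
  then have "(\<Sum>j<n. 1 / 2) \<le> (\<Sum>j<n. 1 - exp (- t j * r\<^sup>2))" by (intro sum_mono) auto
  also have "\<dots> \<le> slow_kernel t r"
    unfolding slow_kernel_def by (rule sum_le_suminf[OF summable_terms]) (use term_bounds in auto)
  finally show ?thesis using n r(1) by (intro exI[of _ r]) simp
qed

text \<open>In each term the constant 1 contributes the square of the sum of the coefficients, which
  is 0; what remains is minus a Gaussian kernel.\<close>

lemma slow_kernel_cond_negative:
  assumes S: "finite S" and K: "psd_on S K" and c: "sum c S = 0"
    and D: "\<And>v w. \<lbrakk>v \<in> S; w \<in> S\<rbrakk> \<Longrightarrow> (D v w)\<^sup>2 = K v v + K w w - 2 * K v w"
  shows "(\<Sum>v\<in>S. \<Sum>w\<in>S. c v * c w * slow_kernel t (D v w)) \<le> 0"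
proof -
  have sums: "(\<lambda>j. \<Sum>v\<in>S. \<Sum>w\<in>S. c v * c w * (1 - exp (- t j * (D v w)\<^sup>2))) sums
      (\<Sum>v\<in>S. \<Sum>w\<in>S. c v * c w * slow_kernel t (D v w))"
    unfolding slow_kernel_def by (intro sums_sum sums_mult summable_sums summable_terms)
  have "(\<Sum>v\<in>S. \<Sum>w\<in>S. c v * c w * (1 - exp (- t j * (D v w)\<^sup>2))) \<le> 0" for j
  proof -
    have "(\<Sum>v\<in>S. \<Sum>w\<in>S. c v * c w * (1 - exp (- t j * (D v w)\<^sup>2))) =
      (\<Sum>v\<in>S. \<Sum>w\<in>S. c v * c w) - (\<Sum>v\<in>S. \<Sum>w\<in>S. c v * c w * exp (- t j * (K v v + K w w - 2 * K v w)))"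
      using D by (simp add: right_diff_distrib sum_subtractf)
    moreover have "(\<Sum>v\<in>S. \<Sum>w\<in>S. c v * c w) = sum c S * sum c S" by (simp add: sum_product)
    ultimately show ?thesis
      using c psd_onD[OF psd_on_gaussian[OF S K, of "t j"], of c] t_pos[of j] by simp
  qed
  then show ?thesis by (rule sums_le[OF _ sums sums_zero])
qed

end

section \<open>The coset space of a lattice and its cocycle\<close>

lemma continuous_map_measurable_borel_of:
  assumes "continuous_map S T f"
  shows "f \<in> measurable (borel_of S) (borel_of T)"
proof (rule measurable_borel_of_open)
  show "f \<in> space (borel_of S) \<rightarrow> topspace T"
    using continuous_map_funspace[OF assms] by simp
  fix U assume "openin T U"
  then have "openin S {x \<in> topspace S. f x \<in> U}" using assms by (simp add: continuous_map_def)
  moreover have "f -` U \<inter> space (borel_of S) = {x \<in> topspace S. f x \<in> U}" by auto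
  ultimately show "f -` U \<inter> space (borel_of S) \<in> sets (borel_of S)"
    by (simp add: openin_sets_borel_of)
qed

lemma second_countable_base:
  assumes "second_countable T"
  obtains \<B> where "countable \<B>" "\<And>B. B \<in> \<B> \<Longrightarrow> openin T B"
    "\<And>U x. \<lbrakk>openin T U; x \<in> U\<rbrakk> \<Longrightarrow> \<exists>B\<in>\<B>. x \<in> B \<and> B \<subseteq> U"
proof -
  obtain \<B> where \<B>: "countable \<B> \<and> (\<forall>V\<in>\<B>. openin T V) \<and>
      (\<forall>U x. openin T U \<and> x \<in> U \<longrightarrow> (\<exists>V\<in>\<B>. x \<in> V \<and> V \<subseteq> U))"
    using assms unfolding second_countable_def by (rule exE)
  show thesis by (rule that[of \<B>]) (simp_all add: \<B>)
qed

text \<open>An open subset of the product is a countable union of basic rectangles. This is what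
  makes the group multiplication jointly measurable.\<close>

lemma openin_prod_topology_sets:
  assumes S: "second_countable S" and T: "second_countable T"
    and W: "openin (prod_topology S T) W"
  shows "W \<in> sets (borel_of S \<Otimes>\<^sub>M borel_of T)"
proof -
  obtain \<A> where A: "countable \<A>" "\<And>B. B \<in> \<A> \<Longrightarrow> openin S B"
    "\<And>U x. \<lbrakk>openin S U; x \<in> U\<rbrakk> \<Longrightarrow> \<exists>B\<in>\<A>. x \<in> B \<and> B \<subseteq> U"
    using second_countable_base[OF S] by metis
  obtain \<B> where B: "countable \<B>" "\<And>B. B \<in> \<B> \<Longrightarrow> openin T B"
    "\<And>U x. \<lbrakk>openin T U; x \<in> U\<rbrakk> \<Longrightarrow> \<exists>B\<in>\<B>. x \<in> B \<and> B \<subseteq> U"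
    using second_countable_base[OF T] by metis
  let ?\<C> = "{P \<in> (\<lambda>(U, V). U \<times> V) ` (\<A> \<times> \<B>). P \<subseteq> W}"
  have "W \<subseteq> \<Union>?\<C>"
  proof
    fix z assume "z \<in> W"
    then obtain U V where UV: "openin S U" "openin T V" "fst z \<in> U" "snd z \<in> V" "U \<times> V \<subseteq> W"
      using W unfolding openin_prod_topology_alt by (metis prod.collapse)
    obtain U' where U': "U' \<in> \<A>" "fst z \<in> U'" "U' \<subseteq> U" using A(3)[OF UV(1,3)] by blast
    obtain V' where V': "V' \<in> \<B>" "snd z \<in> V'" "V' \<subseteq> V" using B(3)[OF UV(2,4)] by blast
    have "U' \<times> V' \<in> ?\<C>" using U' V' UV(5) by blast
    moreover have "z \<in> U' \<times> V'" using U' V' by (simp add: mem_Times_iff)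
    ultimately show "z \<in> \<Union>?\<C>" by blast
  qed
  then have "W = \<Union>?\<C>" by blast
  moreover have "\<Union>?\<C> \<in> sets (borel_of S \<Otimes>\<^sub>M borel_of T)"
  proof (rule sets.countable_Union)
    show "countable ?\<C>" using A(1) B(1) by (intro countable_Collect countable_image countable_SIGMA) auto
    show "?\<C> \<subseteq> sets (borel_of S \<Otimes>\<^sub>M borel_of T)"
      using A(2) B(2) by (auto intro!: pair_measureI openin_sets_borel_of)
  qed
  ultimately show ?thesis by simp
qed

section \<open>Continuity and measurability of the group operations\<close>

context topological_group
begin

lemma carrier_eq: "carrier G = topspace T"
  by (simp add: topspace_eq)

lemma continuous_map_mult:
  assumes "continuous_map S T f" "continuous_map S T g"
  shows "continuous_map S T (\<lambda>x. f x \<otimes> g x)"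
  using continuous_map_compose[OF continuous_map_pairedI[OF assms] continuous_mult]
  by (simp add: o_def)

lemma continuous_map_l_translate: "g \<in> carrier G \<Longrightarrow> continuous_map T T (\<lambda>x. g \<otimes> x)"
  by (rule continuous_map_mult) (auto simp: topspace_eq)

lemma continuous_map_r_translate: "g \<in> carrier G \<Longrightarrow> continuous_map T T (\<lambda>x. x \<otimes> g)"
  by (rule continuous_map_mult) (auto simp: topspace_eq)

lemma openin_l_translate: "\<lbrakk>g \<in> carrier G; openin T U\<rbrakk> \<Longrightarrow> openin T {x \<in> carrier G. g \<otimes> x \<in> U}"
  using openin_continuous_map_preimage[OF continuous_map_l_translate] by (simp add: topspace_eq)

lemma openin_r_translate: "\<lbrakk>g \<in> carrier G; openin T U\<rbrakk> \<Longrightarrow> openin T {x \<in> carrier G. x \<otimes> g \<in> U}"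
  using openin_continuous_map_preimage[OF continuous_map_r_translate] by (simp add: topspace_eq)

lemma openin_inv: "openin T U \<Longrightarrow> openin T {x \<in> carrier G. inv x \<in> U}"
  using openin_continuous_map_preimage[OF continuous_inv] by (simp add: topspace_eq)

lemma openin_carrier: "openin T (carrier G)"
  by (simp add: carrier_eq)

lemma symmetric_neighbourhood:
  assumes "openin T W" "\<one> \<in> W"
  obtains V where "openin T V" "\<one> \<in> V" "V \<subseteq> W" "\<And>x. x \<in> V \<Longrightarrow> inv x \<in> V"
    "\<And>x y. \<lbrakk>x \<in> V; y \<in> V\<rbrakk> \<Longrightarrow> x \<otimes> y \<in> W"
proof -
  have "openin (prod_topology T T) {z \<in> topspace (prod_topology T T). (case z of (x, y) \<Rightarrow> x \<otimes> y) \<in> W}"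
    by (rule openin_continuous_map_preimage[OF continuous_mult assms(1)])
  moreover have "(\<one>, \<one>) \<in> {z \<in> topspace (prod_topology T T). (case z of (x, y) \<Rightarrow> x \<otimes> y) \<in> W}"
    using assms by (simp add: topspace_eq)
  ultimately obtain A B where AB: "openin T A" "openin T B" "\<one> \<in> A" "\<one> \<in> B"
    "A \<times> B \<subseteq> {z \<in> topspace (prod_topology T T). (case z of (x, y) \<Rightarrow> x \<otimes> y) \<in> W}"
    unfolding openin_prod_topology_alt by meson
  define U where "U = A \<inter> B \<inter> W"
  have U: "openin T U" unfolding U_def using AB assms by (intro openin_Int)
  define V where "V = U \<inter> {x \<in> carrier G. inv x \<in> U}"
  show ?thesis
  proof
    show "openin T V" 
      unfolding V_def using U by (intro openin_Int openin_inv)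
    show "\<one> \<in> V" using AB assms by (simp add: V_def U_def)
    show "V \<subseteq> W" by (auto simp: V_def U_def)
    show "inv x \<in> V" if "x \<in> V" for x using that by (auto simp: V_def)
    show "x \<otimes> y \<in> W" if "x \<in> V" "y \<in> V" for x y
    proof -
      have "(x, y) \<in> A \<times> B" using that by (simp add: V_def U_def)
      from subsetD[OF AB(5) this] show ?thesis by simp
    qed
  qed
qed

end

context lcsc_group
begin

lemma space_BG: "space (borel_of T) = carrier G"
  by (simp add: topspace_eq)

lemma singleton_sets: "g \<in> carrier G \<Longrightarrow> {g} \<in> sets (borel_of T)"
  by (rule closedin_sets_borel_of) (simp add: closedin_Hausdorff_sing_eq[OF Hausdorff] topspace_eq)

lemma measurable_mult:
  assumes f: "f \<in> measurable M (borel_of T)" and g: "g \<in> measurable M (borel_of T)"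
  shows "(\<lambda>x. f x \<otimes> g x) \<in> measurable M (borel_of T)"
proof -
  have "(\<lambda>(x, y). x \<otimes> y) \<in> measurable (borel_of T \<Otimes>\<^sub>M borel_of T) (borel_of T)"
  proof (rule measurable_borel_of_open)
    fix U assume "openin T U"
    then have "openin (prod_topology T T) {z \<in> topspace (prod_topology T T). (case z of (x, y) \<Rightarrow> x \<otimes> y) \<in> U}"
      by (rule openin_continuous_map_preimage[OF continuous_mult])
    then have "{z \<in> topspace (prod_topology T T). (case z of (x, y) \<Rightarrow> x \<otimes> y) \<in> U} \<in> sets (borel_of T \<Otimes>\<^sub>M borel_of T)"
      by (rule openin_prod_topology_sets[OF second_countable second_countable])
    moreover have "(\<lambda>(x, y). x \<otimes> y) -` U \<inter> space (borel_of T \<Otimes>\<^sub>M borel_of T) =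
        {z \<in> topspace (prod_topology T T). (case z of (x, y) \<Rightarrow> x \<otimes> y) \<in> U}"
      by (auto simp: space_pair_measure)
    ultimately show "(\<lambda>(x, y). x \<otimes> y) -` U \<inter> space (borel_of T \<Otimes>\<^sub>M borel_of T) \<in> sets (borel_of T \<Otimes>\<^sub>M borel_of T)"
      by simp
  qed (auto simp: space_pair_measure topspace_eq)
  from measurable_compose[OF measurable_Pair[OF f g] this] show ?thesis by simp
qed

lemma measurable_inv:
  assumes f: "f \<in> measurable M (borel_of T)"
  shows "(\<lambda>x. inv (f x)) \<in> measurable M (borel_of T)"
  using measurable_compose[OF f continuous_map_measurable_borel_of[OF continuous_inv]] .

lemma compactin_mult_image:
  assumes "compactin T K" "compactin T L"
  shows "compactin T ((\<lambda>(x, y). x \<otimes> y) ` (K \<times> L))"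
  by (rule image_compactin[OF _ continuous_mult]) (use assms in \<open>auto simp: compactin_Times\<close>)

lemma compactin_inv_image: "compactin T K \<Longrightarrow> compactin T ((\<lambda>x. inv x) ` K)"
  by (rule image_compactin[OF _ continuous_inv])

end

section \<open>Small neighbourhoods and a Borel section of the coset space\<close>

locale lcsc_lattice = lcsc_group +
  fixes \<Gamma>
  assumes lattice: "lattice_in G T \<Gamma>"
begin

lemma subgroup_\<Gamma>: "subgroup \<Gamma> G"
  using lattice by (simp add: lattice_in_def)

lemma \<Gamma>_carrier: "\<gamma> \<in> \<Gamma> \<Longrightarrow> \<gamma> \<in> carrier G"
  using subgroup.subset[OF subgroup_\<Gamma>] by blast

lemmas \<Gamma>_closed = subgroup.m_closed[OF subgroup_\<Gamma>] subgroup.m_inv_closed[OF subgroup_\<Gamma>]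
  subgroup.one_closed[OF subgroup_\<Gamma>]

lemma countable_\<Gamma>: "countable \<Gamma>"
  using lattice second_countable_subtopology[OF second_countable, of \<Gamma>]
  by (simp add: lattice_in_def second_countable_discrete_topology)

lemma ex_small_neighbourhood:
  "\<exists>V. openin T V \<and> \<one> \<in> V \<and> (\<forall>x\<in>V. inv x \<in> V) \<and>
    (\<forall>x\<in>V. \<forall>y\<in>V. x \<otimes> y \<in> \<Gamma> \<longrightarrow> x \<otimes> y = \<one>) \<and> (\<exists>K. compactin T K \<and> V \<subseteq> K)"
proof -
  have "openin (subtopology T \<Gamma>) {\<one>}"
    using lattice \<Gamma>_closed by (simp add: lattice_in_def)
  then obtain U where U: "openin T U" "{\<one>} = U \<inter> \<Gamma>" by (auto simp: openin_subtopology)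
  obtain U' K where K: "openin T U'" "compactin T K" "\<one> \<in> U'" "U' \<subseteq> K"
    using locally_compact unfolding locally_compact_space_def by (metis one_closed topspace_eq)
  have "openin T (U \<inter> U')" "\<one> \<in> U \<inter> U'" using U K by auto
  then obtain V where V: "openin T V" "\<one> \<in> V" "V \<subseteq> U \<inter> U'" "\<And>x. x \<in> V \<Longrightarrow> inv x \<in> V"
    "\<And>x y. \<lbrakk>x \<in> V; y \<in> V\<rbrakk> \<Longrightarrow> x \<otimes> y \<in> U \<inter> U'"
    by (rule symmetric_neighbourhood) blast
  have VK: "V \<subseteq> K" using V(3) K(4) by blast
  have V1: "x \<otimes> y = \<one>" if "x \<in> V" "y \<in> V" "x \<otimes> y \<in> \<Gamma>" for x y
    using V(5)[OF that(1,2)] that(3) U(2) by blast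
  show ?thesis
  proof (rule exI[of _ V], intro conjI ballI impI)
    show "\<exists>K. compactin T K \<and> V \<subseteq> K" using K(2) VK by (intro exI[of _ K] conjI)
    show "inv x \<in> V" if "x \<in> V" for x by (rule V(4)[OF that])
    show "x \<otimes> y = \<one>" if "x \<in> V" "y \<in> V" "x \<otimes> y \<in> \<Gamma>" for x y by (rule V1[OF that])
  qed (rule V(1), rule V(2))
qed

text \<open>Symmetric and relatively compact, with products of two elements meeting \<Gamma> only in
  the identity. By symmetry two points of \<open>V\<close> in the same coset coincide, so
  \<open>V\<close> embeds in the coset space.\<close>

definition V where
  "V = (SOME V. openin T V \<and> \<one> \<in> V \<and> (\<forall>x\<in>V. inv x \<in> V) \<and>
    (\<forall>x\<in>V. \<forall>y\<in>V. x \<otimes> y \<in> \<Gamma> \<longrightarrow> x \<otimes> y = \<one>) \<and> (\<exists>K. compactin T K \<and> V \<subseteq> K))"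

lemma V: "openin T V" "\<one> \<in> V" "x \<in> V \<Longrightarrow> inv x \<in> V"
    "\<lbrakk>x \<in> V; y \<in> V; x \<otimes> y \<in> \<Gamma>\<rbrakk> \<Longrightarrow> x \<otimes> y = \<one>" "\<exists>K. compactin T K \<and> V \<subseteq> K"
  using someI_ex[OF ex_small_neighbourhood, folded V_def] by simp_all

lemma V_carrier: "x \<in> V \<Longrightarrow> x \<in> carrier G"
  using openin_subset[OF V(1)] by (auto simp: topspace_eq)

lemma V_sets: "V \<in> sets (borel_of T)"
  by (rule openin_sets_borel_of[OF V(1)])

text \<open>Separability gives countably many translates of \<open>V\<close> that cover the group.
  The translate of index 0 is \<open>V\<close> itself, so that the section defined below fixes every
  point of \<open>V\<close>.\<close>

lemma ex_translates:
  "\<exists>h::nat \<Rightarrow> 'a. h 0 = \<one> \<and> (\<forall>n. h n \<in> carrier G) \<and> (\<forall>x\<in>carrier G. \<exists>n. inv (h n) \<otimes> x \<in> V)"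
proof -
  obtain C where C: "countable C" "C \<subseteq> topspace T" "T closure_of C = topspace T"
    using second_countable_imp_separable_space[OF second_countable] by (auto simp: separable_space_def)
  define h where "h = case_nat \<one> (from_nat_into (insert \<one> C))"
  have C': "insert \<one> C \<noteq> {}" "countable (insert \<one> C)" using C by auto
  have "insert \<one> C \<subseteq> carrier G" using C(2) by (simp add: topspace_eq)
  then have "from_nat_into (insert \<one> C) n \<in> carrier G" for n
    using from_nat_into[OF C'(1), of n] by blast
  then have "h n \<in> carrier G" for n
    by (cases n) (simp_all add: h_def)
  moreover have "\<exists>n. inv (h n) \<otimes> x \<in> V" if x: "x \<in> carrier G" for x
  proof -
    let ?U = "{y \<in> carrier G. inv x \<otimes> y \<in> V}"
    have "openin T ?U" using x by (intro openin_l_translate V) auto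
    moreover have "x \<in> ?U" using x V(2) by simp
    ultimately obtain c where c: "c \<in> C" "c \<in> ?U" using C(3) unfolding dense_intersects_open by blast
    obtain n where "from_nat_into (insert \<one> C) n = c" using from_nat_into_surj[OF C'(2)] c by blast
    then have "h (Suc n) = c" by (simp add: h_def)
    \<comment> \<open>The dense set supplies c with \<open>inv x \<otimes> c \<in> V\<close>;
      inversion, under which \<open>V\<close> is stable, exchanges the roles of c and x.\<close>
    moreover have "inv c \<otimes> x = inv (inv x \<otimes> c)" using c x by (simp add: inv_mult_group)
    ultimately show ?thesis using c V(3) by (metis (no_types, lifting) mem_Collect_eq)
  qed
  ultimately show ?thesis by (intro exI[of _ h]) (simp add: h_def)
qed

definition tr :: "nat \<Rightarrow> 'a" where
  "tr = (SOME h. h 0 = \<one> \<and> (\<forall>n. h n \<in> carrier G) \<and> (\<forall>x\<in>carrier G. \<exists>n. inv (h n) \<otimes> x \<in> V))"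

lemma tr: "tr 0 = \<one>" "tr n \<in> carrier G" "x \<in> carrier G \<Longrightarrow> \<exists>n. inv (tr n) \<otimes> x \<in> V"
  using someI_ex[OF ex_translates, folded tr_def] by simp_all

definition VV :: "nat \<Rightarrow> 'a set" where "VV n = {x \<in> carrier G. inv (tr n) \<otimes> x \<in> V}"

lemma VV_open: "openin T (VV n)"
  unfolding VV_def by (intro openin_l_translate V inv_closed tr)

lemma VV_carrier: "x \<in> VV n \<Longrightarrow> x \<in> carrier G"
  by (simp add: VV_def)

lemma VV_0: "VV 0 = V"
  using V_carrier by (auto simp: VV_def tr)

lemma VV_cover: "x \<in> carrier G \<Longrightarrow> \<exists>n. x \<in> VV n"
  using tr(3) by (auto simp: VV_def)

lemma VV_inj:
  assumes "x \<in> VV n" "x \<otimes> \<gamma> \<in> VV n" "\<gamma> \<in> \<Gamma>"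
  shows "\<gamma> = \<one>"
proof -
  have x: "x \<in> carrier G" and g: "\<gamma> \<in> carrier G" using assms by (auto simp: VV_def \<Gamma>_carrier)
  let ?h = "inv (tr n)"
  have h: "?h \<in> carrier G" using tr(2) by simp
  have "inv (?h \<otimes> x) \<otimes> (?h \<otimes> (x \<otimes> \<gamma>)) = \<gamma>"
    using x g h by (simp add: inv_mult_group m_assoc) (simp add: m_assoc[symmetric])
  then show ?thesis
    using V(4)[of "inv (?h \<otimes> x)" "?h \<otimes> (x \<otimes> \<gamma>)"] V(3) assms by (auto simp: VV_def)
qed

lemma VV_compact: "\<exists>K. compactin T K \<and> VV n \<subseteq> K"
proof -
  obtain K where K: "compactin T K" "V \<subseteq> K" using V(5) by blast
  have "compactin T ((\<lambda>x. tr n \<otimes> x) ` K)"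
    by (rule image_compactin[OF K(1) continuous_map_l_translate[OF tr(2)]])
  moreover have "VV n \<subseteq> (\<lambda>x. tr n \<otimes> x) ` K"
  proof
    fix x assume x: "x \<in> VV n"
    then have "x = tr n \<otimes> (inv (tr n) \<otimes> x)" using tr(2) by (simp add: VV_def m_assoc[symmetric])
    then show "x \<in> (\<lambda>x. tr n \<otimes> x) ` K" using x K by (auto simp: VV_def)
  qed
  ultimately show ?thesis by blast
qed

lemma compact_finite_cover:
  assumes "compactin T K"
  obtains N where "finite N" "K \<subseteq> (\<Union>n\<in>N. VV n)"
proof -
  have "K \<subseteq> \<Union>(range VV)" using assms VV_cover by (auto simp: compactin_def topspace_eq)
  moreover have "openin T U" if "U \<in> range VV" for U using that VV_open by blast
  ultimately obtain \<F> where F: "finite \<F>" "\<F> \<subseteq> range VV" "K \<subseteq> \<Union>\<F>"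
    using compactinD[OF assms, of "range VV"] by blast
  obtain N where "finite N" "\<F> = VV ` N"
    using finite_subset_image[OF F(1,2)] by blast
  with F(3) show ?thesis using that by simp
qed

text \<open>Each \<open>VV n\<close> contains at most one element of \<Gamma>, and finitely many of
  these sets cover a compact set.\<close>

lemma compact_Int_\<Gamma>_finite:
  assumes "compactin T K" shows "finite (K \<inter> \<Gamma>)"
proof -
  obtain N where N: "finite N" "K \<subseteq> (\<Union>n\<in>N. VV n)" using compact_finite_cover[OF assms] .
  have "finite (VV n \<inter> \<Gamma>)" for n
  proof (cases "VV n \<inter> \<Gamma> = {}")
    case False
    then obtain a where a: "a \<in> VV n" "a \<in> \<Gamma>" by blast
    have "b = a" if "b \<in> VV n" "b \<in> \<Gamma>" for b
    proof -
      have "a \<otimes> (inv a \<otimes> b) = b" using a that \<Gamma>_carrier by (simp add: m_assoc[symmetric])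
      then have "inv a \<otimes> b = \<one>" using VV_inj[of a n "inv a \<otimes> b"] a that \<Gamma>_closed by simp
      then show "b = a" using \<open>a \<otimes> (inv a \<otimes> b) = b\<close> a \<Gamma>_carrier by simp
    qed
    then have "VV n \<inter> \<Gamma> \<subseteq> {a}" by blast
    then show ?thesis using finite_subset by blast
  qed simp
  then have "finite (\<Union>n\<in>N. VV n \<inter> \<Gamma>)" using N by blast
  then show ?thesis by (rule rev_finite_subset) (use N in blast)
qed

abbreviation X where "X \<equiv> lcosets \<Gamma>"
abbreviation BX where "BX \<equiv> borel_of (coset_topology G T \<Gamma>)"
abbreviation p where "p x \<equiv> l_coset G x \<Gamma>"
abbreviation act where "act g C \<equiv> l_coset G g C"

lemma p_X: "x \<in> carrier G \<Longrightarrow> p x \<in> X"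
  by (auto simp: LCOSETS_def)

lemma X_cases: "C \<in> X \<Longrightarrow> \<exists>x\<in>carrier G. C = p x"
  by (auto simp: LCOSETS_def)

lemma mem_p_iff: "x \<in> carrier G \<Longrightarrow> y \<in> p x \<longleftrightarrow> (\<exists>\<gamma>\<in>\<Gamma>. y = x \<otimes> \<gamma>)"
  by (auto simp: l_coset_def)

lemma mem_p_self: "x \<in> carrier G \<Longrightarrow> x \<in> p x"
  using lcos_self[OF _ subgroup_\<Gamma>] .

lemma X_eq_p: "\<lbrakk>C \<in> X; x \<in> C\<rbrakk> \<Longrightarrow> C = p x"
  using X_cases l_repr_independence[OF _ _ subgroup_\<Gamma>] by metis

lemma X_carrier: "\<lbrakk>C \<in> X; x \<in> C\<rbrakk> \<Longrightarrow> x \<in> carrier G"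
  using lcosets_part_G[OF subgroup_\<Gamma>] by blast

lemma p_mult: "\<lbrakk>x \<in> carrier G; \<gamma> \<in> \<Gamma>\<rbrakk> \<Longrightarrow> p (x \<otimes> \<gamma>) = p x"
  using X_eq_p[of "p x" "x \<otimes> \<gamma>"] p_X mem_p_iff by metis

lemma act_p: "\<lbrakk>g \<in> carrier G; x \<in> carrier G\<rbrakk> \<Longrightarrow> act g (p x) = p (g \<otimes> x)"
  by (rule lcos_m_assoc[OF subgroup.subset[OF subgroup_\<Gamma>]])

lemma act_X: "\<lbrakk>g \<in> carrier G; C \<in> X\<rbrakk> \<Longrightarrow> act g C \<in> X"
  using X_cases act_p p_X by (metis m_closed)

lemma act_act: "\<lbrakk>g \<in> carrier G; h \<in> carrier G; C \<in> X\<rbrakk> \<Longrightarrow> act g (act h C) = act (g \<otimes> h) C"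
  using X_cases[of C] by (auto simp: act_p m_assoc)

lemma act_one: "C \<in> X \<Longrightarrow> act \<one> C = C"
  using X_cases[of C] by (auto simp: act_p)

text \<open>Distinct cosets are disjoint, so forming unions commutes with intersecting two families
  of cosets; this is the one axiom of a topology that is not immediate.\<close>

lemma openin_coset_topology:
  "openin (coset_topology G T \<Gamma>) \<U> \<longleftrightarrow> \<U> \<subseteq> X \<and> openin T (\<Union>\<U>)"
proof -
  have I: "\<Union>(\<U> \<inter> \<W>) = \<Union>\<U> \<inter> \<Union>\<W>" if "\<U> \<subseteq> X" "\<W> \<subseteq> X" for \<U> \<W>
  proof
    show "\<Union>\<U> \<inter> \<Union>\<W> \<subseteq> \<Union>(\<U> \<inter> \<W>)"
    proof
      fix x assume "x \<in> \<Union>\<U> \<inter> \<Union>\<W>"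
      then obtain A B where "A \<in> \<U>" "x \<in> A" "B \<in> \<W>" "x \<in> B" by blast
      moreover from this have "A = B" using X_eq_p that by (metis subsetD)
      ultimately show "x \<in> \<Union>(\<U> \<inter> \<W>)" by blast
    qed
  qed blast
  have "istopology (\<lambda>\<U>. \<U> \<subseteq> X \<and> openin T (\<Union>\<U>))"
    unfolding istopology_def
  proof (intro conjI allI impI)
    fix S S' assume "S \<subseteq> X \<and> openin T (\<Union>S)" "S' \<subseteq> X \<and> openin T (\<Union>S')"
    then show "S \<inter> S' \<subseteq> X" "openin T (\<Union>(S \<inter> S'))" using I[of S S'] by auto
  next
    fix K assume K: "\<forall>\<U>\<in>K. \<U> \<subseteq> X \<and> openin T (\<Union>\<U>)"
    show "\<Union>K \<subseteq> X" using K by blast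
    have "\<Union>(\<Union>K) = \<Union>((\<lambda>\<U>. \<Union>\<U>) ` K)" by blast
    moreover have "openin T (\<Union>((\<lambda>\<U>. \<Union>\<U>) ` K))" by (rule openin_Union) (use K in auto)
    ultimately show "openin T (\<Union>(\<Union>K))" by simp
  qed
  then show ?thesis unfolding coset_topology_def by simp
qed

lemma topspace_coset_topology: "topspace (coset_topology G T \<Gamma>) = X"
proof -
  have "openin (coset_topology G T \<Gamma>) X"
    unfolding openin_coset_topology using lcosets_part_G[OF subgroup_\<Gamma>] openin_carrier by simp
  then show ?thesis
    using openin_subset openin_topspace openin_coset_topology by (metis subset_antisym)
qed

lemma space_BX: "space BX = X"
  by (simp add: topspace_coset_topology)

text \<open>The saturation of \<open>U\<close> as a union of right translates, from which it follows
  that the projection is open.\<close>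

lemma Union_p_image: 
  assumes "U \<subseteq> carrier G" 
  shows "\<Union>(p ` U) = (\<Union>\<gamma>\<in>\<Gamma>. {x \<in> carrier G. x \<otimes> \<gamma> \<in> U})"
proof (intro equalityI subsetI)
  fix x assume "x \<in> \<Union>(p ` U)"
  then obtain y \<gamma> where "y \<in> U" "\<gamma> \<in> \<Gamma>" "x = y \<otimes> \<gamma>" using assms mem_p_iff by blast
  moreover from this have "x \<otimes> inv \<gamma> = y" "x \<in> carrier G"
    using assms \<Gamma>_carrier by (auto simp: m_assoc)
  ultimately show "x \<in> (\<Union>\<gamma>\<in>\<Gamma>. {x \<in> carrier G. x \<otimes> \<gamma> \<in> U})"
    by (intro UN_I[of "inv \<gamma>"] CollectI conjI) (simp_all only: \<Gamma>_closed)
next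
  fix x assume "x \<in> (\<Union>\<gamma>\<in>\<Gamma>. {x \<in> carrier G. x \<otimes> \<gamma> \<in> U})"
  then obtain \<gamma> where "\<gamma> \<in> \<Gamma>" "x \<in> carrier G" "x \<otimes> \<gamma> \<in> U" by blast
  then show "x \<in> \<Union>(p ` U)" using p_mult mem_p_self by blast
qed

lemma p_image_open: 
  assumes "openin T U" shows "openin (coset_topology G T \<Gamma>) (p ` U)"
proof -
  have U: "U \<subseteq> carrier G" using openin_subset[OF assms] by (simp add: topspace_eq)
  have "openin T (\<Union>\<gamma>\<in>\<Gamma>. {x \<in> carrier G. x \<otimes> \<gamma> \<in> U})"
    using assms \<Gamma>_carrier openin_r_translate by (intro openin_Union) auto
  then show ?thesis unfolding openin_coset_topology Union_p_image[OF U] using U p_X by auto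
qed

lemma measurable_p: "p \<in> measurable (borel_of T) BX"
proof (rule measurable_borel_of_open)
  show "p \<in> space (borel_of T) \<rightarrow> topspace (coset_topology G T \<Gamma>)"
    using p_X by (auto simp: topspace_coset_topology topspace_eq)
  fix \<U> assume U: "openin (coset_topology G T \<Gamma>) \<U>"
  have "p -` \<U> \<inter> space (borel_of T) = \<Union>\<U>"
  proof (intro equalityI subsetI)
    fix x assume "x \<in> \<Union>\<U>"
    then obtain C where "C \<in> \<U>" "x \<in> C" by blast
    then show "x \<in> p -` \<U> \<inter> space (borel_of T)"
      using U X_eq_p[of C x] X_carrier[of C x] by (auto simp: openin_coset_topology topspace_eq)
  qed (use mem_p_self in \<open>auto simp: topspace_eq\<close>)
  then show "p -` \<U> \<inter> space (borel_of T) \<in> sets (borel_of T)"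
    using U by (simp add: openin_coset_topology openin_sets_borel_of)
qed

lemma p_inj_VV: "inj_on p (VV n)"
proof (rule inj_onI)
  fix x y assume x: "x \<in> VV n" and y: "y \<in> VV n" and "p x = p y"
  then obtain \<gamma> where "\<gamma> \<in> \<Gamma>" "y = x \<otimes> \<gamma>"
    using mem_p_self[of y] mem_p_iff[of x y] VV_carrier by auto
  then show "x = y" using VV_inj[of x n \<gamma>] x y VV_carrier by auto
qed

text \<open>The projection is injective on \<open>VV n\<close>, so images commute with complements
  there and the induction over the sigma-algebra goes through.\<close>

lemma p_image_VV_sets:
  assumes "E \<in> sets (borel_of T)" shows "p ` (E \<inter> VV n) \<in> sets BX"
proof -
  have "E \<in> sigma_sets (topspace T) {U. openin T U}" using assms by (simp add: sets_borel_of)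
  then show ?thesis
  proof induction
    case (Basic U)
    then show ?case by (intro openin_sets_borel_of p_image_open openin_Int VV_open) auto
  next
    case Empty
    then show ?case by simp
  next
    case (Compl E)
    have "p ` ((topspace T - E) \<inter> VV n) = p ` (VV n - E \<inter> VV n)"
      using VV_carrier by (intro arg_cong[of _ _ "image p"]) (auto simp: topspace_eq)
    also have "\<dots> = p ` VV n - p ` (E \<inter> VV n)"
      by (rule inj_on_image_set_diff[OF p_inj_VV]) auto
    finally show ?case using Compl.IH openin_sets_borel_of[OF p_image_open[OF VV_open]] by simp
  next
    case (Union E)
    have "p ` (\<Union>(range E) \<inter> VV n) = (\<Union>i. p ` (E i \<inter> VV n))" by blast
    then show ?case using Union.IH by auto
  qed
qed

text \<open>The part of \<open>VV n\<close> lying over the cosets that no earlier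
  \<open>VV j\<close> meets. The union of all \<open>\<Omega> n\<close> is a Borel fundamental
  domain.\<close>

definition \<Omega> :: "nat \<Rightarrow> 'a set" where
  "\<Omega> n = {x \<in> VV n. \<forall>j<n. \<forall>\<gamma>\<in>\<Gamma>. x \<otimes> \<gamma> \<notin> VV j}"

lemma \<Omega>_sets: "\<Omega> n \<in> sets (borel_of T)"
proof -
  have "\<Omega> n = VV n - (\<Union>j<n. \<Union>\<gamma>\<in>\<Gamma>. {x \<in> carrier G. x \<otimes> \<gamma> \<in> VV j})"
    by (auto simp: \<Omega>_def VV_carrier)
  also have "\<dots> \<in> sets (borel_of T)"
    by (intro sets.Diff openin_sets_borel_of VV_open openin_Union openin_r_translate)
       (auto intro!: openin_Union openin_r_translate VV_open \<Gamma>_carrier)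
  finally show ?thesis .
qed

text \<open>A coset meets some \<open>VV n\<close>, and for the least such \<open>n\<close> it meets
  that set in one point only.\<close>

lemma ex1_section: "C \<in> X \<Longrightarrow> \<exists>!x. x \<in> C \<and> (\<exists>n. x \<in> \<Omega> n)"
proof -
  assume C: "C \<in> X"
  then obtain c where c: "c \<in> carrier G" "C = p c" using X_cases by blast
  have C\<gamma>: "x \<otimes> \<gamma> \<in> C" if "x \<in> C" "\<gamma> \<in> \<Gamma>" for x \<gamma>
    using X_eq_p[OF C that(1)] mem_p_iff X_carrier[OF C that(1)] that(2) by auto
  define n where "n = (LEAST n. C \<inter> VV n \<noteq> {})"
  have "\<exists>n. C \<inter> VV n \<noteq> {}" using c VV_cover[of c] mem_p_self by blast
  then have "C \<inter> VV n \<noteq> {}" unfolding n_def by (rule LeastI_ex)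
  then obtain x where x: "x \<in> C" "x \<in> VV n" by blast
  have "x \<in> \<Omega> n"
    using x C\<gamma>[OF x(1)] not_less_Least[of _ "\<lambda>n. C \<inter> VV n \<noteq> {}", folded n_def] by (auto simp: \<Omega>_def)
  moreover have "x = y" if x: "x \<in> C" "x \<in> \<Omega> n" and y: "y \<in> C" "y \<in> \<Omega> m" for x y n m
  proof -
    obtain \<gamma> where g: "\<gamma> \<in> \<Gamma>" "y = x \<otimes> \<gamma>" using X_eq_p[OF C x(1)] y(1) mem_p_iff X_carrier[OF C x(1)] by auto
    have xc: "x \<in> carrier G" using X_carrier[OF C x(1)] .
    have g': "x = y \<otimes> inv \<gamma>" using g xc \<Gamma>_carrier by (simp add: m_assoc)
    have "\<not> m < n" using x y g by (auto simp: \<Omega>_def)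
    moreover have "\<not> n < m" using x y g' \<Gamma>_closed(2)[OF g(1)] by (auto simp: \<Omega>_def)
    ultimately have "m = n" by simp
    then have "\<gamma> = \<one>" using VV_inj[of x n \<gamma>] x y g by (auto simp: \<Omega>_def)
    then show "x = y" using g xc by simp
  qed
  ultimately show ?thesis using x by blast
qed

definition s :: "'a set \<Rightarrow> 'a" where "s C = (THE x. x \<in> C \<and> (\<exists>n. x \<in> \<Omega> n))"

lemma s_mem: "C \<in> X \<Longrightarrow> s C \<in> C" and s_\<Omega>: "C \<in> X \<Longrightarrow> \<exists>n. s C \<in> \<Omega> n"
  using theI'[OF ex1_section, folded s_def] by auto

lemma s_eqI: "\<lbrakk>C \<in> X; x \<in> C; x \<in> \<Omega> n\<rbrakk> \<Longrightarrow> s C = x"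
  unfolding s_def using ex1_section by (intro the1_equality) auto

lemma s_carrier: "C \<in> X \<Longrightarrow> s C \<in> carrier G"
  using s_mem X_carrier by blast

lemma p_s: "C \<in> X \<Longrightarrow> p (s C) = C"
  using X_eq_p s_mem by metis

lemma s_p_V: "x \<in> V \<Longrightarrow> s (p x) = x"
  by (rule s_eqI[where n = 0]) (auto simp: p_X V_carrier mem_p_self \<Omega>_def VV_0)

text \<open>The preimage of an open set is a countable union of images of Borel subsets of the sets
  \<open>VV n\<close>, on which the projection preserves Borel sets.\<close>

lemma measurable_s: "s \<in> measurable BX (borel_of T)"
proof (rule measurable_borel_of_open)
  show "s \<in> space BX \<rightarrow> topspace T" using s_carrier by (auto simp: topspace_coset_topology topspace_eq)
  fix U assume U: "openin T U"
  have "s -` U \<inter> space BX = (\<Union>n. p ` ((U \<inter> \<Omega> n) \<inter> VV n))"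
  proof (intro equalityI subsetI)
    fix C assume "C \<in> s -` U \<inter> space BX"
    then have C: "s C \<in> U" "C \<in> X" by (auto simp: topspace_coset_topology)
    then obtain n where "s C \<in> \<Omega> n" using s_\<Omega> by blast
    then have "s C \<in> (U \<inter> \<Omega> n) \<inter> VV n" using C by (auto simp: \<Omega>_def)
    from imageI[OF this, of p] show "C \<in> (\<Union>n. p ` ((U \<inter> \<Omega> n) \<inter> VV n))"
      unfolding p_s[OF C(2)] by blast
  next
    fix C assume "C \<in> (\<Union>n. p ` ((U \<inter> \<Omega> n) \<inter> VV n))"
    then obtain n x where x: "x \<in> U" "x \<in> \<Omega> n" "x \<in> VV n" "C = p x" by blast
    then have "s C = x" using VV_carrier by (intro s_eqI) (auto simp: p_X mem_p_self)
    then show "C \<in> s -` U \<inter> space BX" using x p_X VV_carrier by (auto simp: topspace_coset_topology)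
  qed
  also have "\<dots> \<in> sets BX"
    by (intro sets.countable_UN p_image_VV_sets image_subsetI sets.Int openin_sets_borel_of[OF U] \<Omega>_sets)
  finally show "s -` U \<inter> space BX \<in> sets BX" .
qed

text \<open>Through the section the action reads \<open>p (g \<otimes> s C)\<close>, a composite of
  maps whose measurability is known.\<close>

lemma measurable_act_pair:
  assumes g: "g \<in> measurable M (borel_of T)" and C: "C \<in> measurable M BX"
  shows "(\<lambda>x. act (g x) (C x)) \<in> measurable M BX"
proof -
  have "(\<lambda>x. p (g x \<otimes> s (C x))) \<in> measurable M BX"
    by (rule measurable_compose[OF measurable_mult[OF g measurable_compose[OF C measurable_s]] measurable_p])
  moreover have "p (g x \<otimes> s (C x)) = act (g x) (C x)" if "x \<in> space M" for x
    using measurable_space[OF g that] measurable_space[OF C that]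
    by (simp add: topspace_eq space_BX act_p[symmetric] s_carrier p_s topspace_coset_topology)
  ultimately show ?thesis by (subst measurable_cong[of M _ "\<lambda>x. p (g x \<otimes> s (C x))"]) simp_all
qed

lemma measurable_act: "g \<in> carrier G \<Longrightarrow> act g \<in> measurable BX BX"
  using measurable_act_pair[of "\<lambda>_. g" BX "\<lambda>C. C"] by (simp add: topspace_eq)

text \<open>The \<Gamma>-component of a group element once the cosets are represented by the
  section.\<close>

definition lam :: "'a \<Rightarrow> 'a" where "lam x = inv (s (p x)) \<otimes> x"

lemma lam_\<Gamma>: "x \<in> carrier G \<Longrightarrow> lam x \<in> \<Gamma>" and s_lam: "x \<in> carrier G \<Longrightarrow> s (p x) \<otimes> lam x = x"
proof -
  assume x: "x \<in> carrier G"
  obtain \<gamma> where g: "\<gamma> \<in> \<Gamma>" "s (p x) = x \<otimes> \<gamma>" using s_mem[OF p_X[OF x]] mem_p_iff[OF x] by blast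
  have gc: "\<gamma> \<in> carrier G" using g \<Gamma>_carrier by simp
  have "lam x = inv \<gamma>" using g(2) x gc by (simp add: lam_def inv_mult_group m_assoc)
  then show "lam x \<in> \<Gamma>" "s (p x) \<otimes> lam x = x" using g x gc \<Gamma>_closed by (auto simp: m_assoc)
qed

lemma lam_mult: "\<lbrakk>x \<in> carrier G; \<gamma> \<in> \<Gamma>\<rbrakk> \<Longrightarrow> lam (x \<otimes> \<gamma>) = lam x \<otimes> \<gamma>"
  using s_carrier[OF p_X] \<Gamma>_carrier by (simp add: lam_def p_mult m_assoc)

lemma lam_s: "C \<in> X \<Longrightarrow> lam (s C) = \<one>"
  by (simp add: lam_def p_s s_carrier)

lemma measurable_lam: "lam \<in> measurable (borel_of T) (count_space \<Gamma>)"
proof (subst measurable_count_space_eq_countable[OF countable_\<Gamma>], intro conjI ballI)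
  show "lam \<in> space (borel_of T) \<rightarrow> \<Gamma>" using lam_\<Gamma> by (auto simp: topspace_eq)
  fix \<gamma> assume "\<gamma> \<in> \<Gamma>"
  have "(\<lambda>x. inv (s (p x)) \<otimes> x) \<in> measurable (borel_of T) (borel_of T)"
    by (intro measurable_mult measurable_inv measurable_compose[OF measurable_p measurable_s] measurable_ident_sets refl)
  from measurable_sets[OF this singleton_sets[OF \<Gamma>_carrier[OF \<open>\<gamma> \<in> \<Gamma>\<close>]]]
  show "lam -` {\<gamma>} \<inter> space (borel_of T) \<in> sets (borel_of T)" by (simp add: lam_def[abs_def])
qed

text \<open>This equals \<open>inv (s (act g C)) \<otimes> (g \<otimes> s C)\<close>, the cocycle
  with values in \<Gamma> that the section attaches to the action on the coset space.\<close>

definition \<kappa> :: "'a \<Rightarrow> 'a set \<Rightarrow> 'a" where "\<kappa> g C = lam (g \<otimes> s C)"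

lemma \<kappa>_\<Gamma>: "\<lbrakk>g \<in> carrier G; C \<in> X\<rbrakk> \<Longrightarrow> \<kappa> g C \<in> \<Gamma>"
  by (simp add: \<kappa>_def lam_\<Gamma> s_carrier)

lemma p_mult_s: "\<lbrakk>g \<in> carrier G; C \<in> X\<rbrakk> \<Longrightarrow> p (g \<otimes> s C) = act g C"
  by (simp add: act_p[symmetric] s_carrier p_s)

lemma s_act: "\<lbrakk>g \<in> carrier G; C \<in> X\<rbrakk> \<Longrightarrow> g \<otimes> s C = s (act g C) \<otimes> \<kappa> g C"
  using s_lam[of "g \<otimes> s C"] by (simp add: \<kappa>_def s_carrier p_mult_s)

lemma \<kappa>_mult:
  assumes g: "g \<in> carrier G" and h: "h \<in> carrier G" and C: "C \<in> X"
  shows "\<kappa> (g \<otimes> h) C = \<kappa> g (act h C) \<otimes> \<kappa> h C"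
proof -
  have "(g \<otimes> h) \<otimes> s C = (g \<otimes> s (act h C)) \<otimes> \<kappa> h C"
    using s_act[OF h C] g h C \<kappa>_\<Gamma>[OF h C] \<Gamma>_carrier by (simp add: m_assoc s_carrier act_X)
  then show ?thesis
    using lam_mult[of "g \<otimes> s (act h C)" "\<kappa> h C"] g h C \<kappa>_\<Gamma> by (simp add: \<kappa>_def[of "g \<otimes> h"] \<kappa>_def[of g] s_carrier act_X)
qed

lemma \<kappa>_one: "C \<in> X \<Longrightarrow> \<kappa> \<one> C = \<one>"
  by (simp add: \<kappa>_def s_carrier lam_s)

lemma measurable_\<kappa>:
  assumes g: "g \<in> measurable M (borel_of T)" and C: "C \<in> measurable M BX"
  shows "(\<lambda>x. \<kappa> (g x) (C x)) \<in> measurable M (count_space \<Gamma>)"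
  unfolding \<kappa>_def
  by (rule measurable_compose[OF measurable_mult[OF g measurable_compose[OF C measurable_s]] measurable_lam])

section \<open>The invariant measure on the coset space and Haar measure\<close>

definition \<mu> :: "'a set measure" where
  "\<mu> = (SOME \<mu>. sets \<mu> = sets BX \<and> 0 < emeasure \<mu> (space \<mu>) \<and> emeasure \<mu> (space \<mu>) < \<infinity> \<and>
      (\<forall>g\<in>carrier G. \<forall>A\<in>sets \<mu>. emeasure \<mu> ((\<lambda>C. act g C) ` A) = emeasure \<mu> A))"

lemma \<mu>: "sets \<mu> = sets BX" "0 < emeasure \<mu> (space \<mu>)" "emeasure \<mu> (space \<mu>) < \<infinity>"
  "\<lbrakk>g \<in> carrier G; A \<in> sets \<mu>\<rbrakk> \<Longrightarrow> emeasure \<mu> ((\<lambda>C. act g C) ` A) = emeasure \<mu> A"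
proof -
  have "\<exists>\<mu>. sets \<mu> = sets BX \<and> 0 < emeasure \<mu> (space \<mu>) \<and> emeasure \<mu> (space \<mu>) < \<infinity> \<and>
      (\<forall>g\<in>carrier G. \<forall>A\<in>sets \<mu>. emeasure \<mu> ((\<lambda>C. act g C) ` A) = emeasure \<mu> A)"
    using lattice by (simp add: lattice_in_def)
  from someI_ex[OF this, folded \<mu>_def]
  show "sets \<mu> = sets BX" "0 < emeasure \<mu> (space \<mu>)" "emeasure \<mu> (space \<mu>) < \<infinity>"
    "\<lbrakk>g \<in> carrier G; A \<in> sets \<mu>\<rbrakk> \<Longrightarrow> emeasure \<mu> ((\<lambda>C. act g C) ` A) = emeasure \<mu> A"
    by simp_all
qed

lemma space_\<mu>: "space \<mu> = X"
  using sets_eq_imp_space_eq[OF \<mu>(1)] space_BX by simp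

sublocale \<mu>: finite_measure \<mu>
  by standard (use \<mu>(3) in auto)

lemma measurable_\<mu>_eq: "measurable \<mu> N = measurable BX N"
  by (rule measurable_cong_sets[OF \<mu>(1) refl])

lemma measurable_act_\<mu>: "g \<in> carrier G \<Longrightarrow> act g \<in> measurable \<mu> \<mu>"
  using measurable_act measurable_cong_sets[OF \<mu>(1) \<mu>(1)] by blast

text \<open>The preimage of a set under the action of \<open>g\<close> is its image under the
  inverse of \<open>g\<close>, and invariance of the lattice measure is stated for images.\<close>

lemma distr_act: 
  assumes g: "g \<in> carrier G" shows "distr \<mu> \<mu> (act g) = \<mu>"
proof (rule measure_eqI)
  fix A assume "A \<in> sets (distr \<mu> \<mu> (act g))"
  then have A: "A \<in> sets \<mu>" by simp
  have AX: "A \<subseteq> X" using sets.sets_into_space[OF A] space_\<mu> by simp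
  have "act g -` A \<inter> X = (\<lambda>C. act (inv g) C) ` A"
  proof (intro equalityI subsetI)
    fix C assume "C \<in> act g -` A \<inter> X"
    moreover from this have "C = act (inv g) (act g C)" using g act_act[of "inv g" g C] act_one by simp
    ultimately show "C \<in> (\<lambda>C. act (inv g) C) ` A" by blast
  next
    fix C assume "C \<in> (\<lambda>C. act (inv g) C) ` A"
    then obtain D where "D \<in> A" "C = act (inv g) D" by blast
    then show "C \<in> act g -` A \<inter> X" using AX g act_X act_act[of g "inv g" D] act_one by auto
  qed
  then show "emeasure (distr \<mu> \<mu> (act g)) A = emeasure \<mu> A"
    using \<mu>(4)[of "inv g" A] g A by (simp add: emeasure_distr[OF measurable_act_\<mu>[OF g] A] space_\<mu>)
qed simp

lemma nn_integral_act:
  assumes "g \<in> carrier G" "f \<in> borel_measurable \<mu>"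
  shows "(\<integral>\<^sup>+C. f (act g C) \<partial>\<mu>) = (\<integral>\<^sup>+C. f C \<partial>\<mu>)"
  using nn_integral_distr[OF measurable_act_\<mu>[OF assms(1)], of f] assms by (simp add: distr_act)

text \<open>Haar measure on \<open>G\<close>: the integral over \<open>G/\<Gamma>\<close> of the counting measures of the cosets.\<close>

definition haar :: "'a measure" where
  "haar = distr (\<mu> \<Otimes>\<^sub>M count_space \<Gamma>) (borel_of T) (\<lambda>(C, \<gamma>). s C \<otimes> \<gamma>)"

lemma sets_haar [simp]: "sets haar = sets (borel_of T)" and space_haar [simp]: "space haar = carrier G"
  by (simp_all add: haar_def topspace_eq)

lemma measurable_s_mult: "(\<lambda>(C, \<gamma>). s C \<otimes> \<gamma>) \<in> measurable (\<mu> \<Otimes>\<^sub>M count_space \<Gamma>) (borel_of T)"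
proof -
  have 1: "s \<in> measurable \<mu> (borel_of T)" by (simp add: measurable_\<mu>_eq measurable_s)
  have 2: "(\<lambda>\<gamma>. \<gamma>) \<in> measurable (count_space \<Gamma>) (borel_of T)"
    using \<Gamma>_carrier by (auto simp: measurable_def topspace_eq)
  show ?thesis unfolding split_beta'
    by (intro measurable_mult measurable_compose[OF measurable_fst 1] measurable_compose[OF measurable_snd 2])
qed

lemma measurable_haar_eq: "measurable haar N = measurable (borel_of T) N"
  by (rule measurable_cong_sets) simp_all

lemma nn_integral_haar:
  assumes f: "f \<in> borel_measurable (borel_of T)"
  shows "(\<integral>\<^sup>+x. f x \<partial>haar) = (\<integral>\<^sup>+C. (\<integral>\<^sup>+\<gamma>. f (s C \<otimes> \<gamma>) \<partial>count_space \<Gamma>) \<partial>\<mu>)"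
proof -
  interpret c: sigma_finite_measure "count_space \<Gamma>" by (rule sigma_finite_measure_count_space_countable[OF countable_\<Gamma>])
  have m: "(\<lambda>z. f (case z of (C, \<gamma>) \<Rightarrow> s C \<otimes> \<gamma>)) \<in> borel_measurable (\<mu> \<Otimes>\<^sub>M count_space \<Gamma>)"
    by (rule measurable_compose[OF measurable_s_mult f])
  show ?thesis
    unfolding haar_def using nn_integral_distr[OF measurable_s_mult, of f] f c.nn_integral_fst[OF m] by simp
qed

lemma measurable_count_integral:
  assumes f: "f \<in> borel_measurable (borel_of T)"
  shows "(\<lambda>C. \<integral>\<^sup>+\<gamma>. f (s C \<otimes> \<gamma>) \<partial>count_space \<Gamma>) \<in> borel_measurable \<mu>"
proof -
  interpret c: sigma_finite_measure "count_space \<Gamma>" by (rule sigma_finite_measure_count_space_countable[OF countable_\<Gamma>])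
  have m: "(\<lambda>z. f (case z of (C, \<gamma>) \<Rightarrow> s C \<otimes> \<gamma>)) \<in> borel_measurable (\<mu> \<Otimes>\<^sub>M count_space \<Gamma>)"
    by (rule measurable_compose[OF measurable_s_mult f])
  from c.borel_measurable_nn_integral_fst[OF m] show ?thesis by simp
qed

lemma \<Gamma>_bij_left: 
  assumes "\<gamma> \<in> \<Gamma>" shows "bij_betw (\<lambda>x. \<gamma> \<otimes> x) \<Gamma> \<Gamma>"
  by (rule bij_betwI[where g = "\<lambda>x. inv \<gamma> \<otimes> x"])
     (use assms \<Gamma>_closed \<Gamma>_carrier in \<open>auto simp: m_assoc[symmetric]\<close>)

lemma \<Gamma>_bij_right:
  assumes "\<gamma> \<in> \<Gamma>" shows "bij_betw (\<lambda>x. x \<otimes> \<gamma>) \<Gamma> \<Gamma>"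
  by (rule bij_betwI[where g = "\<lambda>x. x \<otimes> inv \<gamma>"])
     (use assms \<Gamma>_closed \<Gamma>_carrier in \<open>auto simp: m_assoc\<close>)

lemma count_integral_shift:
  assumes "x \<in> carrier G" "\<gamma> \<in> \<Gamma>"
  shows "(\<integral>\<^sup>+\<gamma>'. f ((x \<otimes> \<gamma>) \<otimes> \<gamma>') \<partial>count_space \<Gamma>) = (\<integral>\<^sup>+\<gamma>'. f (x \<otimes> \<gamma>') \<partial>count_space \<Gamma>)"
proof -
  have "(\<integral>\<^sup>+\<gamma>'. f ((x \<otimes> \<gamma>) \<otimes> \<gamma>') \<partial>count_space \<Gamma>) = (\<integral>\<^sup>+\<gamma>'. f (x \<otimes> (\<gamma> \<otimes> \<gamma>')) \<partial>count_space \<Gamma>)"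
    using assms \<Gamma>_carrier by (intro nn_integral_cong) (simp add: m_assoc)
  also have "\<dots> = (\<integral>\<^sup>+\<gamma>'. f (x \<otimes> \<gamma>') \<partial>count_space \<Gamma>)"
    by (rule nn_integral_bij_count_space[OF \<Gamma>_bij_left[OF assms(2)]])
  finally show ?thesis .
qed

lemma measurable_l_translate: "g \<in> carrier G \<Longrightarrow> (\<lambda>x. g \<otimes> x) \<in> measurable (borel_of T) (borel_of T)"
  by (rule continuous_map_measurable_borel_of[OF continuous_map_l_translate])

lemma measurable_r_translate: "g \<in> carrier G \<Longrightarrow> (\<lambda>x. x \<otimes> g) \<in> measurable (borel_of T) (borel_of T)"
  by (rule continuous_map_measurable_borel_of[OF continuous_map_r_translate])

text \<open>Translation by \<open>g\<close> carries the coset \<open>C\<close> to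
  \<open>act g C\<close> and shifts the representative by \<open>\<kappa> g C\<close>. The counting
  measure on \<Gamma> absorbs the shift, and \<mu> is invariant under the action.\<close>

lemma haar_left_invariant:
  assumes g: "g \<in> carrier G" and f: "f \<in> borel_measurable (borel_of T)"
  shows "(\<integral>\<^sup>+x. f (g \<otimes> x) \<partial>haar) = (\<integral>\<^sup>+x. f x \<partial>haar)"
proof -
  have "(\<integral>\<^sup>+x. f (g \<otimes> x) \<partial>haar) = (\<integral>\<^sup>+C. (\<integral>\<^sup>+\<gamma>. f (g \<otimes> (s C \<otimes> \<gamma>)) \<partial>count_space \<Gamma>) \<partial>\<mu>)"
    by (rule nn_integral_haar) (rule measurable_compose[OF measurable_l_translate[OF g] f])
  also have "\<dots> = (\<integral>\<^sup>+C. (\<integral>\<^sup>+\<gamma>. f (s (act g C) \<otimes> \<gamma>) \<partial>count_space \<Gamma>) \<partial>\<mu>)"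
  proof (rule nn_integral_cong)
    fix C assume "C \<in> space \<mu>"
    then have C: "C \<in> X" by (simp add: space_\<mu>)
    have "(\<integral>\<^sup>+\<gamma>. f (g \<otimes> (s C \<otimes> \<gamma>)) \<partial>count_space \<Gamma>) = (\<integral>\<^sup>+\<gamma>. f ((s (act g C) \<otimes> \<kappa> g C) \<otimes> \<gamma>) \<partial>count_space \<Gamma>)"
    proof (rule nn_integral_cong)
      fix \<gamma> assume "\<gamma> \<in> space (count_space \<Gamma>)"
      then have "g \<otimes> (s C \<otimes> \<gamma>) = (g \<otimes> s C) \<otimes> \<gamma>" using g s_carrier[OF C] \<Gamma>_carrier by (simp add: m_assoc)
      then show "f (g \<otimes> (s C \<otimes> \<gamma>)) = f ((s (act g C) \<otimes> \<kappa> g C) \<otimes> \<gamma>)" by (simp add: s_act[OF g C])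
    qed
    also have "\<dots> = (\<integral>\<^sup>+\<gamma>. f (s (act g C) \<otimes> \<gamma>) \<partial>count_space \<Gamma>)"
      by (rule count_integral_shift[OF s_carrier[OF act_X[OF g C]] \<kappa>_\<Gamma>[OF g C]])
    finally show "(\<integral>\<^sup>+\<gamma>. f (g \<otimes> (s C \<otimes> \<gamma>)) \<partial>count_space \<Gamma>) = (\<integral>\<^sup>+\<gamma>. f (s (act g C) \<otimes> \<gamma>) \<partial>count_space \<Gamma>)" .
  qed
  also have "\<dots> = (\<integral>\<^sup>+C. (\<integral>\<^sup>+\<gamma>. f (s C \<otimes> \<gamma>) \<partial>count_space \<Gamma>) \<partial>\<mu>)"
    by (rule nn_integral_act[OF g measurable_count_integral[OF f]])
  also have "\<dots> = (\<integral>\<^sup>+x. f x \<partial>haar)" by (rule nn_integral_haar[OF f, symmetric])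
  finally show ?thesis .
qed

text \<open>Right translation by an element of \<Gamma> permutes the points of each coset.\<close>

lemma haar_right_invariant:
  assumes g: "\<gamma> \<in> \<Gamma>" and f: "f \<in> borel_measurable (borel_of T)"
  shows "(\<integral>\<^sup>+x. f (x \<otimes> \<gamma>) \<partial>haar) = (\<integral>\<^sup>+x. f x \<partial>haar)"
proof -
  have "(\<integral>\<^sup>+x. f (x \<otimes> \<gamma>) \<partial>haar) = (\<integral>\<^sup>+C. (\<integral>\<^sup>+\<gamma>'. f ((s C \<otimes> \<gamma>') \<otimes> \<gamma>) \<partial>count_space \<Gamma>) \<partial>\<mu>)"
    by (rule nn_integral_haar) (rule measurable_compose[OF measurable_r_translate[OF \<Gamma>_carrier[OF g]] f])
  also have "\<dots> = (\<integral>\<^sup>+C. (\<integral>\<^sup>+\<gamma>'. f (s C \<otimes> (\<gamma>' \<otimes> \<gamma>)) \<partial>count_space \<Gamma>) \<partial>\<mu>)"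
    using g \<Gamma>_carrier s_carrier by (intro nn_integral_cong) (simp add: m_assoc space_\<mu>)
  also have "\<dots> = (\<integral>\<^sup>+C. (\<integral>\<^sup>+\<gamma>'. f (s C \<otimes> \<gamma>') \<partial>count_space \<Gamma>) \<partial>\<mu>)"
    by (intro nn_integral_cong nn_integral_bij_count_space[OF \<Gamma>_bij_right[OF g], of "\<lambda>x. f (s _ \<otimes> x)"])
  also have "\<dots> = (\<integral>\<^sup>+x. f x \<partial>haar)" by (rule nn_integral_haar[OF f, symmetric])
  finally show ?thesis .
qed

text \<open>A coset meets \<open>V\<close> at most in its representative, because the section fixes
  the points of \<open>V\<close>. So on \<open>V\<close> Haar measure is \<mu> transported by the
  section; this moves estimates between the coset space and the group.\<close>

lemma nn_integral_haar_V:
  assumes f: "f \<in> borel_measurable (borel_of T)"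
  shows "(\<integral>\<^sup>+x. f x * indicator V x \<partial>haar) = (\<integral>\<^sup>+C. f (s C) * indicator V (s C) \<partial>\<mu>)"
proof -
  have "(\<integral>\<^sup>+x. f x * indicator V x \<partial>haar) = (\<integral>\<^sup>+C. (\<integral>\<^sup>+\<gamma>. f (s C \<otimes> \<gamma>) * indicator V (s C \<otimes> \<gamma>) \<partial>count_space \<Gamma>) \<partial>\<mu>)"
    by (rule nn_integral_haar) (use f V_sets in measurable)
  also have "\<dots> = (\<integral>\<^sup>+C. f (s C) * indicator V (s C) \<partial>\<mu>)"
  proof (rule nn_integral_cong)
    fix C assume "C \<in> space \<mu>"
    then have C: "C \<in> X" by (simp add: space_\<mu>)
    have "f (s C \<otimes> \<gamma>) * indicator V (s C \<otimes> \<gamma>) = f (s C) * indicator V (s C) * indicator {\<one>} \<gamma>" if "\<gamma> \<in> \<Gamma>" for \<gamma>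
    proof (cases "\<gamma> = \<one>")
      case False
      have "s C \<otimes> \<gamma> \<notin> V"
      proof
        assume "s C \<otimes> \<gamma> \<in> V"
        then have "s (p (s C \<otimes> \<gamma>)) = s C \<otimes> \<gamma>" by (rule s_p_V)
        then have "s C = s C \<otimes> \<gamma>" using p_mult[OF s_carrier[OF C] that] p_s[OF C] by simp
        then show False using False s_carrier[OF C] \<Gamma>_carrier[OF that] by simp
      qed
      then show ?thesis using False by simp
    qed (use s_carrier[OF C] in simp)
    then have "(\<integral>\<^sup>+\<gamma>. f (s C \<otimes> \<gamma>) * indicator V (s C \<otimes> \<gamma>) \<partial>count_space \<Gamma>) =
        (\<integral>\<^sup>+\<gamma>. f (s C) * indicator V (s C) * indicator {\<one>} \<gamma> \<partial>count_space \<Gamma>)"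
      by (intro nn_integral_cong) auto
    also have "\<dots> = f (s C) * indicator V (s C)"
      using \<Gamma>_closed by (simp add: nn_integral_cmult_indicator emeasure_count_space)
    finally show "(\<integral>\<^sup>+\<gamma>. f (s C \<otimes> \<gamma>) * indicator V (s C \<otimes> \<gamma>) \<partial>count_space \<Gamma>) = f (s C) * indicator V (s C)" .
  qed
  finally show ?thesis .
qed

text \<open>The set meets every coset at most once, so its Haar measure is at most the total mass of
  \<mu>.\<close>

lemma emeasure_haar_VV: "emeasure haar (VV n) < \<infinity>"
proof -
  have VVs: "VV n \<in> sets (borel_of T)" by (rule openin_sets_borel_of[OF VV_open])
  have "emeasure haar (VV n) = (\<integral>\<^sup>+x. indicator (VV n) x \<partial>haar)" using VVs by simp
  also have "\<dots> = (\<integral>\<^sup>+C. (\<integral>\<^sup>+\<gamma>. indicator (VV n) (s C \<otimes> \<gamma>) \<partial>count_space \<Gamma>) \<partial>\<mu>)"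
    by (rule nn_integral_haar) (use VVs in simp)
  also have "\<dots> \<le> (\<integral>\<^sup>+C. 1 \<partial>\<mu>)"
  proof (rule nn_integral_mono)
    fix C assume "C \<in> space \<mu>"
    then have C: "C \<in> X" by (simp add: space_\<mu>)
    show "(\<integral>\<^sup>+\<gamma>. indicator (VV n) (s C \<otimes> \<gamma>) \<partial>count_space \<Gamma>) \<le> 1"
    proof (cases "\<exists>\<gamma>0\<in>\<Gamma>. s C \<otimes> \<gamma>0 \<in> VV n")
      case True
      then obtain \<gamma>0 where g0: "\<gamma>0 \<in> \<Gamma>" "s C \<otimes> \<gamma>0 \<in> VV n" by blast
      have "\<gamma> = \<gamma>0" if g: "\<gamma> \<in> \<Gamma>" "s C \<otimes> \<gamma> \<in> VV n" for \<gamma>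
      proof -
        have e: "\<gamma>0 \<otimes> (inv \<gamma>0 \<otimes> \<gamma>) = \<gamma>" using g g0 \<Gamma>_carrier by (simp add: m_assoc[symmetric])
        have "(s C \<otimes> \<gamma>0) \<otimes> (inv \<gamma>0 \<otimes> \<gamma>) = s C \<otimes> \<gamma>" 
          using e g(1) g0(1) \<Gamma>_carrier s_carrier[OF C] by (simp add: m_assoc)
        then have "inv \<gamma>0 \<otimes> \<gamma> = \<one>" using VV_inj[OF g0(2), of "inv \<gamma>0 \<otimes> \<gamma>"] g g0 \<Gamma>_closed by simp
        then show ?thesis using e g0 \<Gamma>_carrier by simp
      qed
      then have "(\<integral>\<^sup>+\<gamma>. indicator (VV n) (s C \<otimes> \<gamma>) \<partial>count_space \<Gamma>) \<le> (\<integral>\<^sup>+\<gamma>. indicator {\<gamma>0} \<gamma> \<partial>count_space \<Gamma>)"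
        by (intro nn_integral_mono) (auto split: split_indicator)
      also have "\<dots> = 1" using g0 by (simp add: emeasure_count_space)
      finally show ?thesis .
    next
      case False
      then have "(\<integral>\<^sup>+\<gamma>. indicator (VV n) (s C \<otimes> \<gamma>) \<partial>count_space \<Gamma>) = (\<integral>\<^sup>+\<gamma>. 0 \<partial>count_space \<Gamma>)"
        by (intro nn_integral_cong) (auto split: split_indicator)
      then show ?thesis by simp
    qed
  qed
  also have "\<dots> < \<infinity>" using \<mu>(3) by simp
  finally show ?thesis .
qed

sublocale haar: sigma_finite_measure haar
proof
  show "\<exists>A. countable A \<and> A \<subseteq> sets haar \<and> \<Union>A = space haar \<and> (\<forall>a\<in>A. emeasure haar a \<noteq> \<infinity>)"
  proof (intro exI[of _ "range VV"] conjI ballI)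
    show "range VV \<subseteq> sets haar" using openin_sets_borel_of[OF VV_open] by auto
    show "\<Union>(range VV) = space haar" using VV_carrier VV_cover by auto
    show "emeasure haar a \<noteq> \<infinity>" if "a \<in> range VV" for a using that emeasure_haar_VV by (auto simp: less_top)
  qed simp
qed

lemma emeasure_haar_compact: 
  assumes "compactin T K" "A \<subseteq> K" shows "emeasure haar A < \<infinity>"
proof -
  obtain N where N: "finite N" "K \<subseteq> (\<Union>n\<in>N. VV n)" by (rule compact_finite_cover[OF assms(1)])
  have VVs: "VV n \<in> sets haar" for n by (simp add: openin_sets_borel_of[OF VV_open])
  have "emeasure haar A \<le> emeasure haar (\<Union>n\<in>N. VV n)"
    using N assms VVs by (intro emeasure_mono) auto
  also have "\<dots> \<le> (\<Sum>n\<in>N. emeasure haar (VV n))"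
    using N VVs by (intro emeasure_subadditive_finite) auto
  also have "\<dots> < \<infinity>" using emeasure_haar_VV N by (simp add: less_top)
  finally show ?thesis .
qed

text \<open>If \<open>V\<close> were null, so would be the countably many translates of it that
  cover the group; but Haar measure has at least the total mass of \<mu>.\<close>

lemma emeasure_haar_V_pos: "0 < emeasure haar V"
proof (rule ccontr)
  assume "\<not> 0 < emeasure haar V"
  then have 0: "emeasure haar V = 0" by (simp add: zero_less_iff_neq_zero)
  have VVs: "VV n \<in> sets haar" for n by (simp add: openin_sets_borel_of[OF VV_open])
  have "emeasure haar (VV n) = 0" for n
  proof -
    have "emeasure haar (VV n) = (\<integral>\<^sup>+x. indicator (VV n) x \<partial>haar)" using VVs by simp
    also have "\<dots> = (\<integral>\<^sup>+x. indicator V (inv (tr n) \<otimes> x) \<partial>haar)"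
      by (intro nn_integral_cong) (auto simp: VV_def split: split_indicator)
    also have "\<dots> = (\<integral>\<^sup>+x. indicator V x \<partial>haar)"
      by (rule haar_left_invariant) (use tr(2) V_sets in simp_all)
    finally show ?thesis using 0 V_sets by simp
  qed
  then have "emeasure haar (\<Union>n. VV n) = 0" using VVs by (intro emeasure_UN_eq_0) auto
  moreover have "(\<Union>n. VV n) = space haar" using VV_carrier VV_cover by auto
  ultimately have "(\<integral>\<^sup>+x. 1 \<partial>haar) = 0" by simp
  then have z: "(\<integral>\<^sup>+C. (\<integral>\<^sup>+\<gamma>. 1 \<partial>count_space \<Gamma>) \<partial>\<mu>) = 0" using nn_integral_haar[of "\<lambda>_. 1"] by simp
  have "(\<integral>\<^sup>+C. 1 \<partial>\<mu>) \<le> (\<integral>\<^sup>+C. (\<integral>\<^sup>+\<gamma>. 1 \<partial>count_space \<Gamma>) \<partial>\<mu>)"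
  proof (rule nn_integral_mono)
    fix C
    have "(1::ennreal) = (\<integral>\<^sup>+\<gamma>. indicator {\<one>} \<gamma> \<partial>count_space \<Gamma>)"
      using \<Gamma>_closed by (simp add: emeasure_count_space)
    also have "\<dots> \<le> (\<integral>\<^sup>+\<gamma>. 1 \<partial>count_space \<Gamma>)" by (intro nn_integral_mono) (auto split: split_indicator)
    finally show "(1::ennreal) \<le> (\<integral>\<^sup>+\<gamma>. 1 \<partial>count_space \<Gamma>)" .
  qed
  then have "(\<integral>\<^sup>+C. 1 \<partial>\<mu>) = 0" unfolding z by simp
  then show False using \<mu>(2) by simp
qed

text \<open>Up to a set \<open>B\<close> of measure below e/2 the representatives lie in a compact
  set \<open>L\<close>. If neither \<open>C\<close> nor \<open>act g C\<close> belongs to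
  \<open>B\<close>, then \<open>\<kappa> g C\<close> is a product of an inverse from
  \<open>L\<close>, an element of \<open>K\<close> and an element of \<open>L\<close>; such products
  form a compact set, which meets \<Gamma> in a finite set.\<close>

lemma cocycle_tight:
  assumes K: "compactin T K" and e: "e > 0"
  shows "\<exists>F. finite F \<and> F \<subseteq> \<Gamma> \<and> (\<forall>g\<in>K. measure \<mu> {C \<in> X. \<kappa> g C \<notin> F} \<le> e)"
proof -
  define A where "A n = {C \<in> X. s C \<in> (\<Union>i\<le>n. VV i)}" for n
  have As: "A n \<in> sets \<mu>" for n
  proof -
    have "s -` (\<Union>i\<le>n. VV i) \<inter> space BX \<in> sets BX"
      by (rule measurable_sets[OF measurable_s]) (auto intro: openin_sets_borel_of[OF VV_open])
    moreover have "s -` (\<Union>i\<le>n. VV i) \<inter> space BX = A n" by (auto simp: A_def topspace_coset_topology)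
    ultimately show ?thesis by (simp add: \<mu>(1))
  qed
  have "incseq A" by (force simp: incseq_def A_def)
  then have "(\<lambda>n. measure \<mu> (A n)) \<longlonglongrightarrow> measure \<mu> (\<Union>n. A n)"
    using As by (intro \<mu>.finite_Lim_measure_incseq) auto
  moreover have "(\<Union>n. A n) = X"
  proof (intro equalityI subsetI)
    fix C assume C: "C \<in> X"
    then obtain i where "s C \<in> VV i" using VV_cover[OF s_carrier[OF C]] by blast
    then have "C \<in> A i" using C by (auto simp: A_def)
    then show "C \<in> (\<Union>n. A n)" by blast
  qed (simp add: A_def)
  ultimately have "\<forall>\<^sub>F n in sequentially. measure \<mu> X - e / 2 < measure \<mu> (A n)"
    using e by (intro order_tendstoD(1)) auto
  then obtain n where n: "measure \<mu> X - e / 2 < measure \<mu> (A n)"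
    by (auto simp: eventually_sequentially)
  define B where "B = X - A n"
  have Bs: "B \<in> sets \<mu>" using As[of n] sets.top[of \<mu>] by (auto simp: B_def space_\<mu>)
  have "A n \<subseteq> X" by (auto simp: A_def)
  then have mB: "measure \<mu> B < e / 2"
    using n \<mu>.finite_measure_Diff[of X "A n"] As[of n] sets.top[of \<mu>] by (simp add: B_def space_\<mu>)
  have "\<exists>L. compactin T L \<and> (\<Union>i\<le>n. VV i) \<subseteq> L"
  proof -
    obtain k where k: "\<And>i. compactin T (k i) \<and> VV i \<subseteq> k i" using VV_compact by metis
    have "compactin T (\<Union>(k ` {..n}))" by (rule compactin_Union) (use k in auto)
    then show ?thesis using k by (intro exI[of _ "\<Union>(k ` {..n})"]) auto
  qed
  then obtain L where L: "compactin T L" "(\<Union>i\<le>n. VV i) \<subseteq> L" by blast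
  define M where "M = (\<lambda>(x, y). x \<otimes> y) ` ((\<lambda>x. inv x) ` L \<times> (\<lambda>(x, y). x \<otimes> y) ` (K \<times> L))"
  have M: "compactin T M" unfolding M_def by (intro compactin_mult_image compactin_inv_image K L)
  define F where "F = M \<inter> \<Gamma>"
  have F: "finite F" "F \<subseteq> \<Gamma>" using compact_Int_\<Gamma>_finite[OF M] by (auto simp: F_def)
  have "measure \<mu> {C \<in> X. \<kappa> g C \<notin> F} \<le> e" if g: "g \<in> K" for g
  proof -
    have gc: "g \<in> carrier G" using g K by (auto simp: compactin_def topspace_eq)
    have "{C \<in> X. \<kappa> g C \<notin> F} \<subseteq> B \<union> (act g -` B \<inter> space \<mu>)"
    proof
      fix C assume "C \<in> {C \<in> X. \<kappa> g C \<notin> F}"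
      then have C: "C \<in> X" "\<kappa> g C \<notin> F" by auto
      show "C \<in> B \<union> (act g -` B \<inter> space \<mu>)"
      proof (rule ccontr)
        assume "C \<notin> B \<union> (act g -` B \<inter> space \<mu>)"
        then have "s C \<in> L" "s (act g C) \<in> L" using C act_X[OF gc C(1)] L(2) by (auto simp: B_def A_def space_\<mu>)
        then have "inv (s (act g C)) \<otimes> (g \<otimes> s C) \<in> M" using g by (auto simp: M_def image_iff)
        moreover have "inv (s (act g C)) \<otimes> (g \<otimes> s C) = \<kappa> g C"
          by (simp add: \<kappa>_def lam_def p_mult_s[OF gc C(1)])
        ultimately show False using C \<kappa>_\<Gamma>[OF gc C(1)] by (simp add: F_def)
      qed
    qed
    then have "measure \<mu> {C \<in> X. \<kappa> g C \<notin> F} \<le> measure \<mu> (B \<union> (act g -` B \<inter> space \<mu>))"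
      using Bs measurable_sets[OF measurable_act_\<mu>[OF gc] Bs] by (intro \<mu>.finite_measure_mono) auto
    also have "\<dots> \<le> measure \<mu> B + measure \<mu> (act g -` B \<inter> space \<mu>)"
      using Bs measurable_sets[OF measurable_act_\<mu>[OF gc] Bs] by (intro measure_Un_le) auto
    also have "measure \<mu> (act g -` B \<inter> space \<mu>) = measure \<mu> B"
      using measure_distr[OF measurable_act_\<mu>[OF gc] Bs] by (simp add: distr_act[OF gc])
    finally show ?thesis using mB by simp
  qed
  then show ?thesis using F by blast
qed

section \<open>Convex combinations of translates and the rigidity argument\<close>

inductive mid_hull :: "('a \<Rightarrow> real) \<Rightarrow> ('a \<Rightarrow> real) \<Rightarrow> bool" for f where
  translate: "g \<in> carrier G \<Longrightarrow> mid_hull f (\<lambda>x. f (g \<otimes> x))"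
| midpoint: "\<lbrakk>mid_hull f k; mid_hull f k'\<rbrakk> \<Longrightarrow> mid_hull f (\<lambda>x. (k x + k' x) / 2)"

lemma mid_hull_measurable:
  assumes "mid_hull f k" "f \<in> borel_measurable (borel_of T)"
  shows "k \<in> borel_measurable (borel_of T)"
  using assms
proof (induction)
  case (translate g)
  then show ?case using measurable_compose[OF measurable_l_translate] by blast
qed auto

text \<open>Only midpoints are formed, so each member is a finite dyadic combination of translates
  and takes finitely many values. This is why suprema over cosets will be attained.\<close>

lemma mid_hull_bounds:
  assumes "mid_hull f k" "\<And>x. f x \<in> {0, 1}"
  shows "0 \<le> k x" "k x \<le> 1" "finite (range k)"
proof -
  have "0 \<le> k x \<and> k x \<le> 1" for x
    using assms(1)
  proof (induction arbitrary: x)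
    case (translate g)
    then show ?case using assms(2)[of "g \<otimes> x"] by auto
  next
    case (midpoint k k')
    have "0 \<le> k x" "k x \<le> 1" "0 \<le> k' x" "k' x \<le> 1" using midpoint.IH by blast+
    then show ?case by (simp add: field_simps)
  qed
  then show "0 \<le> k x" "k x \<le> 1" by auto
  show "finite (range k)"
    using assms(1)
  proof induction
    case (translate g)
    have "range (\<lambda>x. f (g \<otimes> x)) \<subseteq> {0, 1}" using assms(2) by blast
    then show ?case by (rule finite_subset) simp
  next
    case (midpoint k k')
    have "range (\<lambda>x. (k x + k' x) / 2) \<subseteq> (\<lambda>(a, b). (a + b) / 2) ` (range k \<times> range k')" by auto
    then show ?case by (rule finite_subset) (use midpoint.IH in simp)
  qed
qed

text \<open>Agreement is claimed on the carrier only, because associativity holds there and the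
  functions are total on the type.\<close>

lemma mid_hull_translate:
  assumes "mid_hull f k" "h \<in> carrier G"
  shows "\<exists>k'. mid_hull f k' \<and> (\<forall>x\<in>carrier G. k' x = k (h \<otimes> x))"
  using assms(1)
proof induction
  case (translate g)
  then show ?case
    using assms(2) mid_hull.translate[of "g \<otimes> h"] by (intro exI[of _ "\<lambda>x. f ((g \<otimes> h) \<otimes> x)"]) (auto simp: m_assoc)
next
  case (midpoint k k')
  then obtain a b where "mid_hull f a" "mid_hull f b" "\<forall>x\<in>carrier G. a x = k (h \<otimes> x)" "\<forall>x\<in>carrier G. b x = k' (h \<otimes> x)"
    by blast
  then show ?case
    using mid_hull.midpoint[of f a b] by (intro exI[of _ "\<lambda>x. (a x + b x) / 2"]) auto
qed

text \<open>Right translation by \<gamma> commutes with left translations, so the bound passes from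
  \<open>f\<close> to its translates, and averaging keeps it.\<close>

lemma mid_hull_exclusive:
  assumes "mid_hull f k" "x \<in> carrier G" "\<gamma> \<in> \<Gamma>"
    and "\<And>y. y \<in> carrier G \<Longrightarrow> f y + f (y \<otimes> \<gamma>) \<le> 1"
  shows "k x + k (x \<otimes> \<gamma>) \<le> 1"
  using assms(1)
proof induction
  case (translate g)
  then show ?case using assms(4)[of "g \<otimes> x"] assms(2,3) \<Gamma>_carrier by (simp add: m_assoc)
qed (simp add: field_simps)

text \<open>The lower bound is uniform over all left translates of \<open>f\<close>, hence survives
  averaging.\<close>

lemma mid_hull_integral:
  assumes "mid_hull f k" "f \<in> borel_measurable (borel_of T)" "\<And>x. f x \<in> {0, 1}"
    and "\<And>g. g \<in> carrier G \<Longrightarrow> c \<le> (\<integral>C. f (g \<otimes> s C) \<partial>\<mu>)" and "h \<in> carrier G"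
  shows "integrable \<mu> (\<lambda>C. k (h \<otimes> s C)) \<and> c \<le> (\<integral>C. k (h \<otimes> s C) \<partial>\<mu>)"
proof -
  have s: "s \<in> measurable \<mu> (borel_of T)" by (simp add: measurable_\<mu>_eq measurable_s)
  have int: "integrable \<mu> (\<lambda>C. k (h \<otimes> s C))" if "mid_hull f k" "h \<in> carrier G" for k h
  proof (rule \<mu>.integrable_const_bound[where B = 1])
    show "AE C in \<mu>. norm (k (h \<otimes> s C)) \<le> 1" using mid_hull_bounds[OF that(1) assms(3)] by auto
    show "(\<lambda>C. k (h \<otimes> s C)) \<in> borel_measurable \<mu>"
      by (rule measurable_compose[OF measurable_compose[OF s measurable_l_translate[OF that(2)]] mid_hull_measurable[OF that(1) assms(2)]])
  qed
  have "c \<le> (\<integral>C. k (h \<otimes> s C) \<partial>\<mu>)" if "h \<in> carrier G" for h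
    using assms(1) that
  proof induction
    case (translate g)
    have "(\<integral>C. f (g \<otimes> (h \<otimes> s C)) \<partial>\<mu>) = (\<integral>C. f ((g \<otimes> h) \<otimes> s C) \<partial>\<mu>)"
      using translate s_carrier by (intro Bochner_Integration.integral_cong) (auto simp: space_\<mu> m_assoc)
    then show ?case using assms(4)[of "g \<otimes> h"] translate by simp
  next
    case (midpoint k k')
    then show ?case using int[OF midpoint.hyps(1) midpoint.prems] int[OF midpoint.hyps(2) midpoint.prems] by simp
  qed
  then show ?thesis using int assms(1,5) by blast
qed

lemma sets_haar_pair: "sets (haar \<Otimes>\<^sub>M haar) = sets (borel_of T \<Otimes>\<^sub>M borel_of T)"
  by (rule sets_pair_measure_cong) simp_all

lemma measurable_haar_pair: "measurable (haar \<Otimes>\<^sub>M haar) N = measurable (borel_of T \<Otimes>\<^sub>M borel_of T) N"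
  by (rule measurable_cong_sets[OF sets_haar_pair refl])

sublocale haar2: pair_sigma_finite haar haar ..

text \<open>The map \<open>(g, x) \<mapsto> (x\<^sup>-\<^sup>1, g x)\<close> preserves the product of left Haar measures; this replaces any use of
  the modular function.\<close>

lemma haar_pair_swap:
  assumes H: "(\<lambda>(x, y). H x y) \<in> borel_measurable (borel_of T \<Otimes>\<^sub>M borel_of T)"
  shows "(\<integral>\<^sup>+g. (\<integral>\<^sup>+x. H (inv x) (g \<otimes> x) \<partial>haar) \<partial>haar) = (\<integral>\<^sup>+a. (\<integral>\<^sup>+b. H a b \<partial>haar) \<partial>haar)"
proof -
  have Hm: "(\<lambda>z. H (a z) (b z)) \<in> borel_measurable N"
    if "a \<in> measurable N (borel_of T)" "b \<in> measurable N (borel_of T)" for a b and N :: "'x measure"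
    using measurable_compose[OF measurable_Pair[OF that] H] by simp
  have mf: "fst \<in> measurable (borel_of T \<Otimes>\<^sub>M borel_of T) (borel_of T)"
    and ms: "snd \<in> measurable (borel_of T \<Otimes>\<^sub>M borel_of T) (borel_of T)" by simp_all
  have mc: "(\<lambda>_. x) \<in> measurable N (borel_of T)" if "x \<in> carrier G" for x and N :: "'x measure"
    using that by (simp add: topspace_eq)
  have mi: "(\<lambda>x. x) \<in> measurable (borel_of T) (borel_of T)" by simp
  have "(\<integral>\<^sup>+g. (\<integral>\<^sup>+x. H (inv x) (g \<otimes> x) \<partial>haar) \<partial>haar) = (\<integral>\<^sup>+g. (\<integral>\<^sup>+t. H (inv t \<otimes> g) t \<partial>haar) \<partial>haar)"
  proof (rule nn_integral_cong)
    fix g assume "g \<in> space haar"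
    then have g: "g \<in> carrier G" by simp
    have "(\<integral>\<^sup>+x. H (inv x) (g \<otimes> x) \<partial>haar) = (\<integral>\<^sup>+x. (\<lambda>t. H (inv t \<otimes> g) t) (g \<otimes> x) \<partial>haar)"
      using g by (intro nn_integral_cong) (simp add: inv_mult_group m_assoc)
    also have "\<dots> = (\<integral>\<^sup>+t. H (inv t \<otimes> g) t \<partial>haar)"
      by (rule haar_left_invariant[OF g]) (intro Hm measurable_mult measurable_inv mc mi g)
    finally show "(\<integral>\<^sup>+x. H (inv x) (g \<otimes> x) \<partial>haar) = (\<integral>\<^sup>+t. H (inv t \<otimes> g) t \<partial>haar)" .
  qed
  also have "\<dots> = (\<integral>\<^sup>+t. (\<integral>\<^sup>+g. H (inv t \<otimes> g) t \<partial>haar) \<partial>haar)"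
  proof (rule haar2.Fubini')
    show "(\<lambda>(t, g). H (inv t \<otimes> g) t) \<in> borel_measurable (haar \<Otimes>\<^sub>M haar)"
      unfolding measurable_haar_pair split_beta' by (intro Hm measurable_mult measurable_inv mf ms)
  qed
  also have "\<dots> = (\<integral>\<^sup>+t. (\<integral>\<^sup>+a. H a t \<partial>haar) \<partial>haar)"
    by (intro nn_integral_cong haar_left_invariant[where f = "\<lambda>a. H a _"]) (auto intro!: Hm mi mc)
  also have "\<dots> = (\<integral>\<^sup>+a. (\<integral>\<^sup>+b. H a b \<partial>haar) \<partial>haar)"
    by (rule haar2.Fubini') (simp add: measurable_haar_pair H)
  finally show ?thesis .
qed

lemma markov_le:
  assumes "integrable \<mu> f" "\<And>C. C \<in> X \<Longrightarrow> 0 \<le> f C" "(\<integral>C. f C \<partial>\<mu>) \<le> e" "c > 0"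
  shows "measure \<mu> {C \<in> X. c \<le> f C} \<le> e / c"
proof -
  have "measure \<mu> {C \<in> space \<mu>. f C \<ge> c} \<le> (\<integral>C. f C \<partial>\<mu>) / c"
    using assms by (intro integral_Markov_inequality_measure[where A = "{}"]) (auto simp: space_\<mu>)
  also have "\<dots> \<le> e / c" using assms by (intro divide_right_mono) auto
  finally show ?thesis by (simp add: space_\<mu>)
qed

text \<open>
  The core of the rigidity argument. Among the convex combinations of the left translates of \<open>f\<close>,
  consider one that almost minimizes the \<open>L\<^sup>2\<close>-norm of the function \<open>u\<close> of suprema over
  \<open>\<Gamma>\<close>-cosets. Comparing \<open>k\<close> with its midpoint with a translate shows that, up to a set of
  small measure, \<open>k\<close> and the translate nearly attain their suprema at the same point.
\<close>

lemma near_minimizer: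
  fixes f :: "'a \<Rightarrow> real"
  assumes fm: "f \<in> borel_measurable (borel_of T)" and f01: "\<And>x. f x \<in> {0, 1}" and d: "d > 0"
  shows "\<exists>k. mid_hull f k \<and> (\<exists>Bad. {(g, C). Bad g C} \<inter> (carrier G \<times> X) \<in> sets (borel_of T \<Otimes>\<^sub>M BX) \<and>
    (\<forall>g\<in>carrier G. measure \<mu> {C \<in> X. Bad g C} \<le> d) \<and>
    (\<forall>g\<in>carrier G. \<forall>x\<in>carrier G. k x > 9 / 10 \<longrightarrow> \<not> Bad g (p x) \<longrightarrow>
      (\<exists>\<gamma>\<in>\<Gamma>. k (x \<otimes> \<gamma>) > 2 / 3 \<and> k (g \<otimes> (x \<otimes> \<gamma>)) > 2 / 3)))"
proof -
  define u :: "('a \<Rightarrow> real) \<Rightarrow> 'a set \<Rightarrow> real" where "u k C = (SUP \<gamma>\<in>\<Gamma>. k (s C \<otimes> \<gamma>))" for k C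
  have \<Gamma>ne: "\<Gamma> \<noteq> {}" using \<Gamma>_closed by blast
  note kb = mid_hull_bounds[OF _ f01]
  have fin: "finite ((\<lambda>\<gamma>. k (y \<gamma>)) ` \<Gamma>)" if "mid_hull f k" for k and y :: "'a \<Rightarrow> 'a"
    by (rule finite_subset[OF _ kb(3)[OF that]]) auto
  have bdd: "bdd_above ((\<lambda>\<gamma>. k (y \<gamma>)) ` \<Gamma>)" if "mid_hull f k" for k and y :: "'a \<Rightarrow> 'a"
    using fin[OF that] by (rule bdd_above_finite)
  have sm: "s \<in> measurable BX (borel_of T)" by (rule measurable_s)
  have m\<Gamma>: "(\<lambda>x. y x \<otimes> \<gamma>) \<in> measurable N (borel_of T)" if "y \<in> measurable N (borel_of T)" "\<gamma> \<in> \<Gamma>" for y \<gamma> and N :: "'z measure"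
    using measurable_compose[OF that(1) measurable_r_translate[OF \<Gamma>_carrier[OF that(2)]]] .
  have um: "u k \<in> borel_measurable BX" if k: "mid_hull f k" for k
    unfolding u_def
    by (rule borel_measurable_cSUP[OF countable_\<Gamma>])
       (auto intro!: measurable_compose[OF m\<Gamma>[OF sm] mid_hull_measurable[OF k fm]] bdd[OF k])
  have u01: "0 \<le> u k C \<and> u k C \<le> 1" if k: "mid_hull f k" for k C
  proof
    show "u k C \<le> 1" unfolding u_def using \<Gamma>ne kb(2)[OF k] by (intro cSUP_least)
    have "0 \<le> k (s C \<otimes> \<one>)" using kb(1)[OF k] .
    also have "\<dots> \<le> u k C" unfolding u_def by (rule cSUP_upper[OF _ bdd[OF k]]) (rule \<Gamma>_closed)
    finally show "0 \<le> u k C" .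
  qed
  have u_upper: "k x \<le> u k (p x)" if k: "mid_hull f k" and x: "x \<in> carrier G" for k x
  proof -
    have "k (s (p x) \<otimes> lam x) \<le> u k (p x)" unfolding u_def by (rule cSUP_upper[OF lam_\<Gamma>[OF x] bdd[OF k]])
    then show ?thesis by (simp add: s_lam[OF x])
  qed
  \<comment> \<open>The supremum is a maximum by finiteness of the range. \<open>lam x\<close> moves
    the maximizer from the representative of the coset to the given point x.\<close>
  have u_att: "\<exists>\<gamma>\<in>\<Gamma>. u k (p x) = k (x \<otimes> \<gamma>)" if k: "mid_hull f k" and x: "x \<in> carrier G" for k x
  proof -
    have "u k (p x) = Max ((\<lambda>\<gamma>. k (s (p x) \<otimes> \<gamma>)) ` \<Gamma>)"
      unfolding u_def using fin[OF k] \<Gamma>ne by (intro cSup_eq_Max) auto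
    then have "u k (p x) \<in> (\<lambda>\<gamma>. k (s (p x) \<otimes> \<gamma>)) ` \<Gamma>"
      using Max_in[OF fin[OF k, of "\<lambda>\<gamma>. s (p x) \<otimes> \<gamma>"]] \<Gamma>ne by simp
    then obtain \<gamma> where g: "\<gamma> \<in> \<Gamma>" "u k (p x) = k (s (p x) \<otimes> \<gamma>)" by blast
    have l: "lam x \<in> \<Gamma>" by (rule lam_\<Gamma>[OF x])
    have "x \<otimes> (inv (lam x) \<otimes> \<gamma>) = (s (p x) \<otimes> lam x) \<otimes> (inv (lam x) \<otimes> \<gamma>)" by (simp add: s_lam[OF x])
    also have "\<dots> = s (p x) \<otimes> (lam x \<otimes> (inv (lam x) \<otimes> \<gamma>))"
      using s_carrier[OF p_X[OF x]] \<Gamma>_carrier[OF l] \<Gamma>_carrier[OF g(1)] by (simp add: m_assoc)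
    also have "lam x \<otimes> (inv (lam x) \<otimes> \<gamma>) = \<gamma>"
      using \<Gamma>_carrier[OF l] \<Gamma>_carrier[OF g(1)] by (simp add: m_assoc[symmetric])
    finally show ?thesis using g l \<Gamma>_closed by (intro bexI[of _ "inv (lam x) \<otimes> \<gamma>"]) auto
  qed
  define \<Phi> where "\<Phi> k = (\<integral>C. (u k C)\<^sup>2 \<partial>\<mu>)" for k
  have u2int: "integrable \<mu> (\<lambda>C. (u k C)\<^sup>2)" if k: "mid_hull f k" for k
  proof (rule \<mu>.integrable_const_bound[where B = 1])
    show "AE C in \<mu>. norm ((u k C)\<^sup>2) \<le> 1" using u01[OF k] by (auto simp: power_le_one)
    show "(\<lambda>C. (u k C)\<^sup>2) \<in> borel_measurable \<mu>" using um[OF k] by (simp add: measurable_\<mu>_eq)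
  qed
  have \<Phi>0: "0 \<le> \<Phi> k" for k unfolding \<Phi>_def by simp
  let ?S = "\<Phi> ` {k. mid_hull f k}"
  have ne: "?S \<noteq> {}" using mid_hull.translate[OF one_closed, of f] by blast
  have bb: "bdd_below ?S" using \<Phi>0 by (intro bdd_belowI[of _ 0]) auto
  \<comment> \<open>The margins are as follows: (U - Ug)^2 < 4c = (1/50)^2 keeps Ug above 0.88 once
    U > 0.9, and then (U^2 + Ug^2)/2 - c still exceeds 0.88^2. The infimum is approached up to d c,
    so that Markov's inequality at level c gives exactly d.\<close>
  define c :: real where "c = 1 / 10000"
  have "Inf ?S < Inf ?S + d * c" using d by (simp add: c_def)
  then obtain k where k: "mid_hull f k" and kmin: "\<Phi> k < Inf ?S + d * c"
    using cInf_lessD[OF ne] by blast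
  have kle: "\<Phi> k \<le> \<Phi> k' + d * c" if "mid_hull f k'" for k'
    using kmin cInf_lower[OF _ bb, of "\<Phi> k'"] that by auto
  \<comment> \<open>\<open>w g\<close> is the function \<open>u\<close> of the midpoint of
    \<open>k\<close> and its translate. \<open>I g\<close> is what the midpoint gains in the squared
    norm: pointwise it is nonnegative, and its integral is the difference of two values of
    \<open>\<Phi>\<close>, at most d c by the choice of \<open>k\<close>.\<close>
  define w where "w g C = (SUP \<gamma>\<in>\<Gamma>. (k (s C \<otimes> \<gamma>) + k (g \<otimes> (s C \<otimes> \<gamma>))) / 2)" for g C
  define I where "I g C = ((u k C)\<^sup>2 + (u k (act g C))\<^sup>2) / 2 - (w g C)\<^sup>2" for g C
  have w_eq: "\<exists>k'. mid_hull f k' \<and> (\<forall>C\<in>X. w g C = u k' C) \<and> (\<forall>x\<in>carrier G. k' x = (k x + k (g \<otimes> x)) / 2)"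
    if g: "g \<in> carrier G" for g
  proof -
    obtain kg where kg: "mid_hull f kg" "\<forall>x\<in>carrier G. kg x = k (g \<otimes> x)" using mid_hull_translate[OF k g] by blast
    have "w g C = u (\<lambda>x. (k x + kg x) / 2) C" if "C \<in> X" for C
      unfolding w_def u_def using kg(2) s_carrier[OF that] \<Gamma>_carrier by (intro SUP_cong) auto
    then show ?thesis using mid_hull.midpoint[OF k kg(1)] kg(2)
      by (intro exI[of _ "\<lambda>x. (k x + kg x) / 2"]) auto
  qed
  have w_le: "w g C \<le> (u k C + u k (act g C)) / 2" and w0: "0 \<le> w g C" if g: "g \<in> carrier G" and C: "C \<in> X" for g C
  proof -
    obtain k' where k': "mid_hull f k'" "\<forall>C\<in>X. w g C = u k' C" using w_eq[OF g] by blast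
    then show "0 \<le> w g C" using u01 C by auto
    show "w g C \<le> (u k C + u k (act g C)) / 2"
      unfolding w_def
    proof (rule cSUP_least[OF \<Gamma>ne])
      fix \<gamma> assume \<gamma>: "\<gamma> \<in> \<Gamma>"
      have sc: "s C \<otimes> \<gamma> \<in> carrier G" using s_carrier[OF C] \<Gamma>_carrier[OF \<gamma>] by simp
      have "k (s C \<otimes> \<gamma>) \<le> u k C" using u_upper[OF k sc] p_mult[OF s_carrier[OF C] \<gamma>] p_s[OF C] by simp
      moreover have "k (g \<otimes> (s C \<otimes> \<gamma>)) \<le> u k (act g C)"
        using u_upper[OF k, of "g \<otimes> (s C \<otimes> \<gamma>)"] act_p[OF g sc, symmetric] p_mult[OF s_carrier[OF C] \<gamma>] p_s[OF C] g sc by simp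
      ultimately show "(k (s C \<otimes> \<gamma>) + k (g \<otimes> (s C \<otimes> \<gamma>))) / 2 \<le> (u k C + u k (act g C)) / 2" by simp
    qed
  qed
  have Ige: "I g C \<ge> (u k C - u k (act g C))\<^sup>2 / 4" if g: "g \<in> carrier G" and C: "C \<in> X" for g C
  proof -
    have "(w g C)\<^sup>2 \<le> ((u k C + u k (act g C)) / 2)\<^sup>2" by (rule power_mono[OF w_le[OF that] w0[OF that]])
    then show ?thesis unfolding I_def by (simp add: power2_eq_square field_simps)
  qed
  have um2: "(\<lambda>(g, C). u k (act g C)) \<in> borel_measurable (borel_of T \<Otimes>\<^sub>M BX)"
    unfolding split_beta' by (rule measurable_compose[OF measurable_act_pair[OF measurable_fst measurable_snd] um[OF k]])
  have wm: "(\<lambda>(g, C). w g C) \<in> borel_measurable (borel_of T \<Otimes>\<^sub>M BX)"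
    unfolding w_def split_beta'
  proof (rule borel_measurable_cSUP[OF countable_\<Gamma>])
    fix \<gamma> assume \<gamma>: "\<gamma> \<in> \<Gamma>"
    have 1: "(\<lambda>z. s (snd z) \<otimes> \<gamma>) \<in> measurable (borel_of T \<Otimes>\<^sub>M BX) (borel_of T)"
      by (rule m\<Gamma>[OF measurable_compose[OF measurable_snd sm] \<gamma>])
    have 2: "(\<lambda>z. fst z \<otimes> (s (snd z) \<otimes> \<gamma>)) \<in> measurable (borel_of T \<Otimes>\<^sub>M BX) (borel_of T)"
      by (rule measurable_mult[OF measurable_fst 1])
    show "(\<lambda>z. (k (s (snd z) \<otimes> \<gamma>) + k (fst z \<otimes> (s (snd z) \<otimes> \<gamma>))) / 2) \<in> borel_measurable (borel_of T \<Otimes>\<^sub>M BX)"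
      using measurable_compose[OF 1 mid_hull_measurable[OF k fm]] measurable_compose[OF 2 mid_hull_measurable[OF k fm]] by simp
  next
    fix z
    show "bdd_above ((\<lambda>\<gamma>. (k (s (snd z) \<otimes> \<gamma>) + k (fst z \<otimes> (s (snd z) \<otimes> \<gamma>))) / 2) ` \<Gamma>)"
    proof -
      have "(k a + k b) / 2 \<le> 1" for a b using kb(2)[OF k, of a] kb(2)[OF k, of b] by simp
      then show ?thesis by (intro bdd_aboveI[of _ 1]) auto
    qed
  qed
  have Im: "(\<lambda>(g, C). I g C) \<in> borel_measurable (borel_of T \<Otimes>\<^sub>M BX)"
  proof -
    have "(\<lambda>z. u k (snd z)) \<in> borel_measurable (borel_of T \<Otimes>\<^sub>M BX)"
      by (rule measurable_compose[OF measurable_snd um[OF k]])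
    with um2 wm show ?thesis unfolding I_def split_beta' by simp
  qed
  have Ibad: "measure \<mu> {C \<in> X. c \<le> I g C} \<le> d" if g: "g \<in> carrier G" for g
  proof -
    obtain k' where k': "mid_hull f k'" "\<forall>C\<in>X. w g C = u k' C" using w_eq[OF g] by blast
    have am: "act g \<in> measurable \<mu> \<mu>" by (rule measurable_act_\<mu>[OF g])
    have i2: "integrable \<mu> (\<lambda>C. (u k (act g C))\<^sup>2)" "(\<integral>C. (u k (act g C))\<^sup>2 \<partial>\<mu>) = \<Phi> k"
    proof -
      have m: "(\<lambda>C. (u k C)\<^sup>2) \<in> borel_measurable \<mu>" using um[OF k] by (simp add: measurable_\<mu>_eq)
      show "integrable \<mu> (\<lambda>C. (u k (act g C))\<^sup>2)"
        using integrable_distr[OF am, of "\<lambda>C. (u k C)\<^sup>2"] u2int[OF k] by (simp add: distr_act[OF g])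
      show "(\<integral>C. (u k (act g C))\<^sup>2 \<partial>\<mu>) = \<Phi> k"
        using integral_distr[OF am m] by (simp add: distr_act[OF g] \<Phi>_def)
    qed
    let ?I = "\<lambda>C. ((u k C)\<^sup>2 + (u k (act g C))\<^sup>2) / 2 - (u k' C)\<^sup>2"
    have II: "I g C = ?I C" if "C \<in> X" for C using k'(2) that by (simp add: I_def)
    have "{C \<in> X. c \<le> I g C} = {C \<in> X. c \<le> ?I C}" using II by auto
    also have "measure \<mu> \<dots> \<le> (d * c) / c"
    proof (rule markov_le)
      show "integrable \<mu> ?I" using u2int[OF k] i2(1) u2int[OF k'(1)] by simp
      show "0 \<le> ?I C" if "C \<in> X" for C using Ige[OF g that] II[OF that] by (smt (verit) zero_le_power2 divide_nonneg_nonneg)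
      have "(\<integral>C. ?I C \<partial>\<mu>) = (\<Phi> k + \<Phi> k) / 2 - \<Phi> k'"
        using u2int[OF k] i2 u2int[OF k'(1)] by (simp add: \<Phi>_def)
      also have "\<dots> \<le> d * c" using kle[OF k'(1)] by simp
      finally show "(\<integral>C. ?I C \<partial>\<mu>) \<le> d * c" .
    qed (simp add: c_def)
    finally show ?thesis by (simp add: c_def)
  qed
  have good: "\<exists>\<gamma>\<in>\<Gamma>. k (x \<otimes> \<gamma>) > 2 / 3 \<and> k (g \<otimes> (x \<otimes> \<gamma>)) > 2 / 3"
    if g: "g \<in> carrier G" and x: "x \<in> carrier G" and kx: "k x > 9 / 10" and nb: "\<not> c \<le> I g (p x)" for g x
  proof -
    have C: "p x \<in> X" by (rule p_X[OF x])
    obtain k' where k': "mid_hull f k'" "\<forall>C\<in>X. w g C = u k' C" "\<forall>x\<in>carrier G. k' x = (k x + k (g \<otimes> x)) / 2"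
      using w_eq[OF g] by blast
    \<comment> \<open>The point of the coset at which the midpoint is largest serves
      \<open>k\<close> and its translate at the same time.\<close>
    obtain \<gamma> where \<gamma>: "\<gamma> \<in> \<Gamma>" "u k' (p x) = k' (x \<otimes> \<gamma>)" using u_att[OF k'(1) x] by blast
    define U Ug where "U = u k (p x)" and "Ug = u k (act g (p x))"
    have U: "U > 9 / 10" using u_upper[OF k x] kx by (simp add: U_def)
    have "(U - Ug)\<^sup>2 / 4 < c" using Ige[OF g C] nb by (simp add: U_def Ug_def)
    then have "(U - Ug)\<^sup>2 < (1 / 50)\<^sup>2" by (simp add: c_def power2_eq_square)
    then have "\<bar>U - Ug\<bar> < 1 / 50" by (metis abs_of_pos power2_abs power_less_imp_less_base zero_less_divide_1_iff zero_less_numeral abs_ge_zero less_eq_real_def)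
    then have Ug: "Ug > 88 / 100" using U by linarith
    have "U\<^sup>2 > (9 / 10)\<^sup>2" using U by (intro power_strict_mono) auto
    moreover have "Ug\<^sup>2 > (88 / 100)\<^sup>2" using Ug by (intro power_strict_mono) auto
    moreover have "(w g (p x))\<^sup>2 > (U\<^sup>2 + Ug\<^sup>2) / 2 - c" using nb by (simp add: I_def U_def Ug_def)
    ultimately have "(w g (p x))\<^sup>2 > (88 / 100)\<^sup>2" by (simp add: c_def power2_eq_square add_divide_distrib)
    then have "w g (p x) > 88 / 100" using w0[OF g C] by (rule power_less_imp_less_base)
    moreover have "w g (p x) = (k (x \<otimes> \<gamma>) + k (g \<otimes> (x \<otimes> \<gamma>))) / 2"
      using k'(2,3) C \<gamma> x \<Gamma>_carrier by simp
    \<comment> \<open>The average of the two values exceeds 0.88 and both are at most 1, so each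
      exceeds 0.76.\<close>
    ultimately show ?thesis using kb(2)[OF k, of "x \<otimes> \<gamma>"] kb(2)[OF k, of "g \<otimes> (x \<otimes> \<gamma>)"] \<gamma>(1) by (intro bexI[of _ \<gamma>]) auto
  qed
  have "{(g, C). c \<le> I g C} \<inter> (carrier G \<times> X) \<in> sets (borel_of T \<Otimes>\<^sub>M BX)"
  proof -
    have "{(g, C). c \<le> I g C} \<inter> (carrier G \<times> X) = (\<lambda>(g, C). I g C) -` {c..} \<inter> space (borel_of T \<Otimes>\<^sub>M BX)"
      by (auto simp: space_pair_measure topspace_eq topspace_coset_topology)
    then show ?thesis using measurable_sets[OF Im, of "{c..}"] by simp
  qed
  then show ?thesis
    using k Ibad good by (intro exI[of _ k] conjI exI[of _ "\<lambda>g C. c \<le> I g C"]) auto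
qed

lemma compactin_sets: "compactin T K \<Longrightarrow> K \<in> sets (borel_of T)"
  by (rule closedin_sets_borel_of[OF compactin_imp_closedin[OF Hausdorff]])

lemma measure_haar_V_pos: "0 < measure haar V" and emeasure_haar_V: "emeasure haar V = ennreal (measure haar V)"
proof -
  have "emeasure haar V < \<infinity>" using V(5) emeasure_haar_compact by blast
  then show e: "emeasure haar V = ennreal (measure haar V)" by (intro emeasure_eq_ennreal_measure) auto
  show "0 < measure haar V" using emeasure_haar_V_pos e by (metis ennreal_less_zero_iff)
qed

text \<open>On \<open>V\<close> Haar measure is \<mu> seen through the section, and Markov's
  inequality for 1 - k at level 1/10 produces the factor 10.\<close>

lemma haar_V_translate_bound:
  assumes k: "mid_hull f k" and fm: "f \<in> borel_measurable (borel_of T)" and f01: "\<And>x. f x \<in> {0, 1}"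
    and c: "\<And>g. g \<in> carrier G \<Longrightarrow> measure \<mu> X - e \<le> (\<integral>C. f (g \<otimes> s C) \<partial>\<mu>)" and h: "h \<in> carrier G"
  shows "emeasure haar {x \<in> V. k (h \<otimes> x) \<le> 9 / 10} \<le> ennreal (10 * e)"
proof -
  have km: "k \<in> borel_measurable (borel_of T)" by (rule mid_hull_measurable[OF k fm])
  have khm: "(\<lambda>x. k (h \<otimes> x)) \<in> borel_measurable (borel_of T)" by (rule measurable_compose[OF measurable_l_translate[OF h] km])
  have P: "{x \<in> carrier G. k (h \<otimes> x) \<le> 9 / 10} \<in> sets (borel_of T)"
    using measurable_sets[OF khm, of "{..9/10}"] by (simp add: vimage_def Int_def topspace_eq conj_commute)
  have VP: "{x \<in> V. k (h \<otimes> x) \<le> 9 / 10} = {x \<in> carrier G. k (h \<otimes> x) \<le> 9 / 10} \<inter> V"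
    using V_carrier by auto
  have i: "integrable \<mu> (\<lambda>C. k (h \<otimes> s C))" "measure \<mu> X - e \<le> (\<integral>C. k (h \<otimes> s C) \<partial>\<mu>)"
    using mid_hull_integral[OF k fm f01 c h] by auto
  have "emeasure haar {x \<in> V. k (h \<otimes> x) \<le> 9 / 10} = (\<integral>\<^sup>+x. indicator {x \<in> carrier G. k (h \<otimes> x) \<le> 9 / 10} x * indicator V x \<partial>haar)"
    unfolding VP using P V_sets by (simp add: indicator_inter_arith[symmetric])
  also have "\<dots> = (\<integral>\<^sup>+C. indicator {x \<in> carrier G. k (h \<otimes> x) \<le> 9 / 10} (s C) * indicator V (s C) \<partial>\<mu>)"
    by (rule nn_integral_haar_V) (use P in simp)
  also have "\<dots> \<le> (\<integral>\<^sup>+C. indicator {C \<in> X. 1 / 10 \<le> 1 - k (h \<otimes> s C)} C \<partial>\<mu>)"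
    by (intro nn_integral_mono) (auto split: split_indicator simp: space_\<mu>)
  also have "\<dots> = emeasure \<mu> {C \<in> X. 1 / 10 \<le> 1 - k (h \<otimes> s C)}"
  proof -
    have [measurable]: "(\<lambda>C. k (h \<otimes> s C)) \<in> borel_measurable \<mu>" by (rule borel_measurable_integrable[OF i(1)])
    have "{C \<in> space \<mu>. 1 / 10 \<le> 1 - k (h \<otimes> s C)} \<in> sets \<mu>" by measurable
    then show ?thesis by (simp add: space_\<mu>)
  qed
  also have "\<dots> = ennreal (measure \<mu> {C \<in> X. 1 / 10 \<le> 1 - k (h \<otimes> s C)})" by (rule \<mu>.emeasure_eq_measure)
  also have "\<dots> \<le> ennreal (e / (1 / 10))"
  proof (intro ennreal_leI markov_le)
    show "integrable \<mu> (\<lambda>C. 1 - k (h \<otimes> s C))" using i(1) by simp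
    show "0 \<le> 1 - k (h \<otimes> s C)" for C using mid_hull_bounds(2)[OF k f01] by simp
    show "(\<integral>C. 1 - k (h \<otimes> s C) \<partial>\<mu>) \<le> e" using i by (simp add: space_\<mu>)
  qed simp
  finally show ?thesis by (simp add: mult.commute)
qed

text \<open>Passes from left translates to inverses by counting the pairs (r, w) with w in
  \<open>V\<close>, r in \<open>N\<close> and \<open>inv r \<otimes> w \<in> P\<close> in both
  orders. For fixed w the substitution r = w x shows the set of inverses; for fixed r the bound
  \<open>b\<close> applies.\<close>

lemma haar_V_inverse_bound:
  assumes P: "P \<in> sets (borel_of T)" and N: "compactin T N" "\<And>x y. \<lbrakk>x \<in> V; y \<in> V\<rbrakk> \<Longrightarrow> x \<otimes> y \<in> N"
    and b: "\<And>h. h \<in> carrier G \<Longrightarrow> emeasure haar {x \<in> V. h \<otimes> x \<in> P} \<le> b"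
  shows "emeasure haar V * emeasure haar {x \<in> V. inv x \<in> P} \<le> emeasure haar N * b"
proof -
  have Ns: "N \<in> sets (borel_of T)" by (rule compactin_sets[OF N(1)])
  let ?F = "\<lambda>r w. indicator N r * indicator V w * indicator P (inv r \<otimes> w) :: ennreal"
  have mm: "(\<lambda>z. ?F (a z) (c z)) \<in> borel_measurable M"
    if "a \<in> measurable M (borel_of T)" "c \<in> measurable M (borel_of T)" for a c and M :: "'z measure"
    using that Ns V_sets P measurable_mult[OF measurable_inv[OF that(1)] that(2)] by measurable
  have mP: "{x \<in> V. inv x \<in> P} \<in> sets (borel_of T)"
  proof -
    have "(\<lambda>x. inv x) -` P \<inter> space (borel_of T) \<in> sets (borel_of T)"
      by (rule measurable_sets[OF measurable_inv P]) simp
    then have "V \<inter> ((\<lambda>x. inv x) -` P \<inter> space (borel_of T)) \<in> sets (borel_of T)" using V_sets by blast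
    moreover have "{x \<in> V. inv x \<in> P} = V \<inter> ((\<lambda>x. inv x) -` P \<inter> space (borel_of T))"
      using V_carrier by (auto simp: topspace_eq)
    ultimately show ?thesis by simp
  qed
  have mc: "(\<lambda>_. x) \<in> measurable (borel_of T) (borel_of T)" if "x \<in> carrier G" for x
    using that by (simp add: topspace_eq)
  have mi: "(\<lambda>x. x) \<in> measurable (borel_of T) (borel_of T)" by simp
  have hP: "{w \<in> V. h \<otimes> w \<in> P} \<in> sets (borel_of T)" if "h \<in> carrier G" for h
  proof -
    have "(\<lambda>x. h \<otimes> x) -` P \<inter> space (borel_of T) \<in> sets (borel_of T)"
      by (rule measurable_sets[OF measurable_l_translate[OF that] P])
    then have "V \<inter> ((\<lambda>x. h \<otimes> x) -` P \<inter> space (borel_of T)) \<in> sets (borel_of T)" using V_sets by blast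
    moreover have "{x \<in> V. h \<otimes> x \<in> P} = V \<inter> ((\<lambda>x. h \<otimes> x) -` P \<inter> space (borel_of T))"
      using V_carrier by (auto simp: topspace_eq)
    ultimately show ?thesis by simp
  qed
  have "emeasure haar V * emeasure haar {x \<in> V. inv x \<in> P} = (\<integral>\<^sup>+w. emeasure haar {x \<in> V. inv x \<in> P} * indicator V w \<partial>haar)"
    using nn_integral_cmult_indicator[of V haar "emeasure haar {x \<in> V. inv x \<in> P}"] V_sets by (simp add: mult.commute)
  also have "\<dots> \<le> (\<integral>\<^sup>+w. (\<integral>\<^sup>+r. ?F r w \<partial>haar) \<partial>haar)"
  proof (rule nn_integral_mono)
    fix w assume "w \<in> space haar"
    then have w: "w \<in> carrier G" by simp
    have "emeasure haar {x \<in> V. inv x \<in> P} * indicator V w = (\<integral>\<^sup>+x. indicator {x \<in> V. inv x \<in> P} x * indicator V w \<partial>haar)"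
    proof -
      have mPh: "{x \<in> V. inv x \<in> P} \<in> sets haar" using mP by simp
      show ?thesis
        using nn_integral_multc[OF borel_measurable_indicator[OF mPh], of "indicator V w"] nn_integral_indicator[OF mPh] by simp
    qed
    also have "\<dots> \<le> (\<integral>\<^sup>+x. (\<lambda>r. ?F r w) (w \<otimes> x) \<partial>haar)"
    proof (rule nn_integral_mono)
      fix x assume "x \<in> space haar"
      then have x: "x \<in> carrier G" by simp
      have "inv (w \<otimes> x) \<otimes> w = inv x" using w x by (simp add: inv_mult_group m_assoc)
      then show "indicator {x \<in> V. inv x \<in> P} x * indicator V w \<le> (\<lambda>r. ?F r w) (w \<otimes> x)"
        using N(2) by (auto split: split_indicator)
    qed
    also have "\<dots> = (\<integral>\<^sup>+r. ?F r w \<partial>haar)"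
      by (rule haar_left_invariant[OF w mm[OF mi mc[OF w]]])
    finally show "emeasure haar {x \<in> V. inv x \<in> P} * indicator V w \<le> (\<integral>\<^sup>+r. ?F r w \<partial>haar)" .
  qed
  also have "\<dots> = (\<integral>\<^sup>+r. (\<integral>\<^sup>+w. ?F r w \<partial>haar) \<partial>haar)"
  proof (rule haar2.Fubini')
    show "(\<lambda>(r, w). ?F r w) \<in> borel_measurable (haar \<Otimes>\<^sub>M haar)"
      unfolding measurable_haar_pair split_beta' by (rule mm) simp_all
  qed
  also have "\<dots> \<le> (\<integral>\<^sup>+r. b * indicator N r \<partial>haar)"
  proof (rule nn_integral_mono)
    fix r assume "r \<in> space haar"
    then have r: "r \<in> carrier G" by simp
    have "(\<integral>\<^sup>+w. ?F r w \<partial>haar) = (\<integral>\<^sup>+w. indicator N r * indicator {w \<in> V. inv r \<otimes> w \<in> P} w \<partial>haar)"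
      by (intro nn_integral_cong) (auto split: split_indicator)
    also have "\<dots> = indicator N r * emeasure haar {w \<in> V. inv r \<otimes> w \<in> P}"
      using nn_integral_cmult_indicator[of "{w \<in> V. inv r \<otimes> w \<in> P}" haar "indicator N r"] hP[of "inv r"] r by simp
    also have "\<dots> \<le> b * indicator N r"
      using b[of "inv r"] r by (auto split: split_indicator)
    finally show "(\<integral>\<^sup>+w. ?F r w \<partial>haar) \<le> b * indicator N r" .
  qed
  also have "\<dots> = emeasure haar N * b"
    using nn_integral_cmult_indicator[of N haar b] Ns by (simp add: mult.commute)
  finally show ?thesis .
qed

text \<open>A pair of \<open>inv x\<close> in \<open>A\<close> and z in \<open>B\<close> determines
  the element g = z \<gamma> \<open>inv x\<close>, which lies in \<open>N\<close> and is bad at the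
  coset of x. Right invariance under \<Gamma> replaces z by z \<gamma>, and
  \<open>haar_pair_swap\<close> rewrites the product of the two measures as an integral over g in
  \<open>N\<close> of the measure of the bad x in \<open>V\<close>, which is at most d.\<close>

lemma haar_bad_pairs_bound:
  assumes Bad: "{(g, C). Bad g C} \<inter> (carrier G \<times> X) \<in> sets (borel_of T \<Otimes>\<^sub>M BX)"
    and d: "\<And>g. g \<in> carrier G \<Longrightarrow> measure \<mu> {C \<in> X. Bad g C} \<le> d"
    and \<gamma>: "\<gamma> \<in> \<Gamma>" and N: "compactin T N" "\<And>x y. \<lbrakk>x \<in> V; y \<in> V\<rbrakk> \<Longrightarrow> (x \<otimes> \<gamma>) \<otimes> y \<in> N"
    and A: "A \<in> sets (borel_of T)" "A \<subseteq> V" and B: "B \<in> sets (borel_of T)" "B \<subseteq> V"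
    and AB: "\<And>x z. \<lbrakk>x \<in> carrier G; inv x \<in> A; z \<in> B\<rbrakk> \<Longrightarrow> Bad ((z \<otimes> \<gamma>) \<otimes> inv x) (p x)"
  shows "emeasure haar A * emeasure haar B \<le> ennreal d * emeasure haar N"
proof -
  have \<gamma>c: "\<gamma> \<in> carrier G" "inv \<gamma> \<in> carrier G" "inv \<gamma> \<in> \<Gamma>" using \<gamma> \<Gamma>_carrier \<Gamma>_closed by auto
  have Ns: "N \<in> sets (borel_of T)" by (rule compactin_sets[OF N(1)])
  let ?H = "\<lambda>a t. indicator A a * indicator B (t \<otimes> inv \<gamma>) :: ennreal"
  have Hm: "(\<lambda>(a, t). ?H a t) \<in> borel_measurable (borel_of T \<Otimes>\<^sub>M borel_of T)"
  proof -
    have "(\<lambda>z. snd z \<otimes> inv \<gamma>) \<in> measurable (borel_of T \<Otimes>\<^sub>M borel_of T) (borel_of T)"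
      by (rule measurable_compose[OF measurable_snd measurable_r_translate[OF \<gamma>c(2)]])
    then show ?thesis unfolding split_beta' using A(1) B(1) by measurable
  qed
  have "(\<integral>\<^sup>+t. indicator B (t \<otimes> inv \<gamma>) \<partial>haar) = emeasure haar B"
    using haar_right_invariant[OF \<gamma>c(3), of "indicator B"] B(1) by simp
  then have "emeasure haar A * emeasure haar B = (\<integral>\<^sup>+a. (\<integral>\<^sup>+t. ?H a t \<partial>haar) \<partial>haar)"
  proof -
    have m: "(\<lambda>t. indicator B (t \<otimes> inv \<gamma>) :: ennreal) \<in> borel_measurable haar"
      unfolding measurable_haar_eq
      by (rule measurable_compose[OF measurable_r_translate[OF \<gamma>c(2)]]) (use B(1) in simp)
    have "(\<integral>\<^sup>+a. (\<integral>\<^sup>+t. ?H a t \<partial>haar) \<partial>haar) = (\<integral>\<^sup>+a. indicator A a * emeasure haar B \<partial>haar)"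
      using m by (simp add: nn_integral_cmult \<open>(\<integral>\<^sup>+t. indicator B (t \<otimes> inv \<gamma>) \<partial>haar) = emeasure haar B\<close>)
    also have "\<dots> = emeasure haar A * emeasure haar B" 
    proof -
      have Ah: "A \<in> sets haar" using A(1) by simp
      show ?thesis
        using nn_integral_multc[OF borel_measurable_indicator[OF Ah], of "emeasure haar B"] nn_integral_indicator[OF Ah] by simp
    qed
    finally show ?thesis by simp
  qed
  also have "\<dots> = (\<integral>\<^sup>+g. (\<integral>\<^sup>+x. ?H (inv x) (g \<otimes> x) \<partial>haar) \<partial>haar)"
    by (rule haar_pair_swap[OF Hm, symmetric])
  also have "\<dots> \<le> (\<integral>\<^sup>+g. ennreal d * indicator N g \<partial>haar)"
  proof (rule nn_integral_mono)
    fix g assume "g \<in> space haar"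
    then have g: "g \<in> carrier G" by simp
    define D where "D = {C \<in> X. Bad g C}"
    have Ds: "D \<in> sets BX"
    proof -
      have "Pair g -` ({(g, C). Bad g C} \<inter> (carrier G \<times> X)) \<in> sets BX" by (rule sets_Pair1[OF Bad])
      moreover have "Pair g -` ({(g, C). Bad g C} \<inter> (carrier G \<times> X)) = D" using g by (auto simp: D_def)
      ultimately show ?thesis by simp
    qed
    have pD: "p -` D \<inter> space (borel_of T) \<in> sets (borel_of T)" by (rule measurable_sets[OF measurable_p Ds])
    have "(\<integral>\<^sup>+x. indicator (p -` D \<inter> space (borel_of T)) x * indicator V x \<partial>haar) =
        (\<integral>\<^sup>+C. indicator (p -` D \<inter> space (borel_of T)) (s C) * indicator V (s C) \<partial>\<mu>)"
      by (rule nn_integral_haar_V) (use pD in simp)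
    also have "\<dots> \<le> (\<integral>\<^sup>+C. indicator D C \<partial>\<mu>)"
      by (intro nn_integral_mono) (auto split: split_indicator simp: space_\<mu> p_s)
    also have "\<dots> = ennreal (measure \<mu> D)" using Ds by (simp add: \<mu>(1) \<mu>.emeasure_eq_measure)
    also have "\<dots> \<le> ennreal d" using d[OF g] by (intro ennreal_leI) (simp add: D_def)
    finally have inner: "(\<integral>\<^sup>+x. indicator (p -` D \<inter> space (borel_of T)) x * indicator V x \<partial>haar) \<le> ennreal d" .
    have "(\<integral>\<^sup>+x. ?H (inv x) (g \<otimes> x) \<partial>haar) \<le> (\<integral>\<^sup>+x. indicator N g * (indicator (p -` D \<inter> space (borel_of T)) x * indicator V x) \<partial>haar)"
    proof (rule nn_integral_mono)
      fix x assume "x \<in> space haar"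
      then have x: "x \<in> carrier G" by simp
      show "?H (inv x) (g \<otimes> x) \<le> indicator N g * (indicator (p -` D \<inter> space (borel_of T)) x * indicator V x)"
      proof (cases "inv x \<in> A \<and> (g \<otimes> x) \<otimes> inv \<gamma> \<in> B")
        case True
        define z where "z = (g \<otimes> x) \<otimes> inv \<gamma>"
        have z: "z \<in> B" "z \<in> V" "z \<in> carrier G" using True B V_carrier by (auto simp: z_def)
        have ix: "inv x \<in> V" using True A by auto
        then have xV: "x \<in> V" using V(3)[of "inv x"] x by simp
        have "z \<otimes> \<gamma> = g \<otimes> x" using g x \<gamma>c by (simp add: z_def m_assoc)
        then have geq: "(z \<otimes> \<gamma>) \<otimes> inv x = g" using g x by (simp add: m_assoc)
        have "g \<in> N" using N(2)[OF z(2) ix] geq by simp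
        moreover have "Bad g (p x)" using AB[of x z] True x z geq by simp
        ultimately show ?thesis using xV x p_X[OF x] by (simp add: D_def topspace_eq indicator_def)
      next
        case False
        then have "?H (inv x) (g \<otimes> x) = 0" by (auto split: split_indicator)
        then show ?thesis by (simp only: zero_le)
      qed
    qed
    also have "\<dots> = indicator N g * (\<integral>\<^sup>+x. indicator (p -` D \<inter> space (borel_of T)) x * indicator V x \<partial>haar)"
      by (rule nn_integral_cmult, unfold measurable_haar_eq) (use pD V_sets in measurable)
    also have "\<dots> \<le> indicator N g * ennreal d"
      by (rule mult_left_mono[OF inner]) simp
    finally show "(\<integral>\<^sup>+x. ?H (inv x) (g \<otimes> x) \<partial>haar) \<le> ennreal d * indicator N g"
      by (simp add: mult.commute)
  qed
  also have "\<dots> = ennreal d * emeasure haar N" using nn_integral_cmult_indicator[of N haar "ennreal d"] Ns by simp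
  finally show ?thesis .
qed

text \<open>Suppose \<open>len \<gamma>\<close> exceeds 4R, and take x, z at which \<open>k\<close>
  exceeds 9/10. If g = z \<gamma> \<open>inv x\<close> were not bad at the coset of x, there would
  be \<beta> in \<Gamma> with \<open>k\<close> above 2/3 both at x \<beta> and at z \<gamma>
  \<beta>. Two such large values exclude a displacement longer than 2R, so \<beta> and \<gamma>
  \<beta> have length at most 2R, contradicting the assumption. Hence all these pairs are bad, but
  they have too large a measure for that.\<close>

theorem tight_length_bounded:
  fixes len :: "'a \<Rightarrow> real"
  assumes l_add: "\<And>\<alpha> \<beta>. \<lbrakk>\<alpha> \<in> \<Gamma>; \<beta> \<in> \<Gamma>\<rbrakk> \<Longrightarrow> len (\<alpha> \<otimes> \<beta>) \<le> len \<alpha> + len \<beta>"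
    and l_inv: "\<And>\<alpha>. \<alpha> \<in> \<Gamma> \<Longrightarrow> len (inv \<alpha>) = len \<alpha>"
    and tight: "\<And>e. e > 0 \<Longrightarrow> \<exists>R. \<forall>g\<in>carrier G. measure \<mu> {C \<in> X. len (\<kappa> g C) > R} \<le> e"
  shows "\<exists>B. \<forall>\<gamma>\<in>\<Gamma>. len \<gamma> \<le> B"
proof -
  obtain K where K: "compactin T K" "V \<subseteq> K" using V(5) by blast
  define N where "N = (\<lambda>(x, y). x \<otimes> y) ` (K \<times> K)"
  have N: "compactin T N" "\<And>x y. \<lbrakk>x \<in> V; y \<in> V\<rbrakk> \<Longrightarrow> x \<otimes> y \<in> N"
    unfolding N_def using compactin_mult_image[OF K(1) K(1)] K(2) by auto
  define v n where "v = measure haar V" and "n = measure haar N"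
  have v: "v > 0" "emeasure haar V = ennreal v" using measure_haar_V_pos emeasure_haar_V by (auto simp: v_def)
  have n: "n \<ge> 0" "emeasure haar N = ennreal n"
    using emeasure_haar_compact[OF N(1) order_refl] by (auto simp: n_def intro!: emeasure_eq_ennreal_measure)
  \<comment> \<open>Chosen so that the points with k \<le> 9/10 fill at most half of
    \<open>V\<close>, both directly, where the loss factor is 10, and after inversion, where it is
    10 n / v.\<close>
  define e where "e = min (v / 20) (v\<^sup>2 / (20 * (n + 1)))"
  have e: "e > 0" "10 * e \<le> v / 2" "n * (10 * e) \<le> v * (v / 2)"
  proof -
    show "e > 0" using v n by (auto simp: e_def intro!: divide_pos_pos add_nonneg_pos)
    have "e \<le> v / 20" unfolding e_def by (rule min.cobounded1)
    then show "10 * e \<le> v / 2" by simp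
    have "n * (10 * e) \<le> n * (10 * (v\<^sup>2 / (20 * (n + 1))))" using n by (intro mult_left_mono) (auto simp: e_def)
    also have "\<dots> = (n / (n + 1)) * (v\<^sup>2 / 2)" using n by (simp add: field_simps)
    also have "\<dots> \<le> 1 * (v\<^sup>2 / 2)" using n by (intro mult_right_mono) auto
    finally show "n * (10 * e) \<le> v * (v / 2)" by (simp add: power2_eq_square)
  qed
  obtain R where R: "\<And>g. g \<in> carrier G \<Longrightarrow> measure \<mu> {C \<in> X. len (\<kappa> g C) > R} \<le> e" using tight[OF e(1)] by blast
  \<comment> \<open>The indicator of the ball of radius R in \<Gamma>, pulled back to the group. At
    \<open>g \<otimes> s C\<close> it tests the length of \<open>\<kappa> g C\<close>, so tightness
    bounds its averages from below uniformly in g.\<close>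
  define f where "f x = (if len (lam x) \<le> R then 1 else 0 :: real)" for x
  have fm: "f \<in> borel_measurable (borel_of T)"
    unfolding f_def by (rule measurable_compose[OF measurable_lam]) simp
  have f01: "f x \<in> {0, 1}" for x by (simp add: f_def)
  have f_int: "measure \<mu> X - e \<le> (\<integral>C. f (g \<otimes> s C) \<partial>\<mu>)" if g: "g \<in> carrier G" for g
  proof -
    have km: "(\<lambda>C. \<kappa> g C) \<in> measurable \<mu> (count_space \<Gamma>)"
      unfolding measurable_\<mu>_eq by (rule measurable_\<kappa>) (use g in \<open>simp_all add: topspace_eq\<close>)
    have "{C \<in> space \<mu>. len (\<kappa> g C) > R} \<in> sets \<mu>"
      using measurable_sets[OF km, of "{\<gamma> \<in> \<Gamma>. len \<gamma> > R}"] \<kappa>_\<Gamma>[OF g]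
      by (auto simp: vimage_def Int_def space_\<mu> conj_commute cong: conj_cong)
    then have D: "{C \<in> X. len (\<kappa> g C) > R} \<in> sets \<mu>" by (simp add: space_\<mu>)
    have "(\<integral>C. f (g \<otimes> s C) \<partial>\<mu>) = (\<integral>C. 1 - indicator {C \<in> X. len (\<kappa> g C) > R} C \<partial>\<mu>)"
      by (intro Bochner_Integration.integral_cong) (auto simp: f_def \<kappa>_def space_\<mu>)
    also have "\<dots> = measure \<mu> X - measure \<mu> {C \<in> X. len (\<kappa> g C) > R}"
    proof -
      have "{C \<in> X. len (\<kappa> g C) > R} \<inter> X = {C \<in> X. len (\<kappa> g C) > R}" by blast
      then show ?thesis using D by (simp add: space_\<mu> \<mu>.emeasure_eq_measure)
    qed
    finally show ?thesis using R[OF g] by simp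
  qed
  have f_excl: "f y + f (y \<otimes> \<gamma>) \<le> 1" if y: "y \<in> carrier G" and \<gamma>: "\<gamma> \<in> \<Gamma>" "len \<gamma> > 2 * R" for y \<gamma>
  proof (rule ccontr)
    assume "\<not> ?thesis"
    then have l: "len (lam y) \<le> R" "len (lam y \<otimes> \<gamma>) \<le> R" by (auto simp: f_def lam_mult[OF y \<gamma>(1)] split: if_splits)
    have ly: "lam y \<in> \<Gamma>" "lam y \<otimes> \<gamma> \<in> \<Gamma>" "inv (lam y) \<in> \<Gamma>" using lam_\<Gamma>[OF y] \<gamma> \<Gamma>_closed by auto
    have "\<gamma> = inv (lam y) \<otimes> (lam y \<otimes> \<gamma>)" using \<Gamma>_carrier[OF ly(1)] \<Gamma>_carrier[OF \<gamma>(1)] by (simp add: m_assoc[symmetric])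
    then have "len \<gamma> \<le> len (lam y) + len (lam y \<otimes> \<gamma>)" using l_add[OF ly(3,2)] l_inv[OF ly(1)] by simp
    then show False using l \<gamma> by simp
  qed
  have "len \<gamma> \<le> 4 * R" if \<gamma>: "\<gamma> \<in> \<Gamma>" for \<gamma>
  proof (rule ccontr)
    assume big: "\<not> len \<gamma> \<le> 4 * R"
    have \<gamma>c: "\<gamma> \<in> carrier G" using \<gamma> \<Gamma>_carrier by simp
    define N' where "N' = (\<lambda>(x, y). x \<otimes> y) ` ((\<lambda>x. x \<otimes> \<gamma>) ` K \<times> K)"
    have N': "compactin T N'" "\<And>x y. \<lbrakk>x \<in> V; y \<in> V\<rbrakk> \<Longrightarrow> (x \<otimes> \<gamma>) \<otimes> y \<in> N'"
      unfolding N'_def using compactin_mult_image[OF image_compactin[OF K(1) continuous_map_r_translate[OF \<gamma>c]] K(1)] K(2)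
      by auto
    define n' where "n' = measure haar N'"
    have n': "n' \<ge> 0" "emeasure haar N' = ennreal n'"
      using emeasure_haar_compact[OF N'(1) order_refl] by (auto simp: n'_def intro!: emeasure_eq_ennreal_measure)
    \<comment> \<open>The precision depends on \<gamma> through \<open>N'\<close>, while R and e
      were fixed before. It makes d n' at most v^2/8, below (v/2)^2, the lower bound for the product
      of the measures of \<open>A\<close> and \<open>B\<close>.\<close>
    define d where "d = v\<^sup>2 / (8 * (n' + 1))"
    have d: "d > 0" using v n' by (auto simp: d_def intro!: divide_pos_pos)
    obtain k Bad where k: "mid_hull f k"
      and Bad: "{(g, C). Bad g C} \<inter> (carrier G \<times> X) \<in> sets (borel_of T \<Otimes>\<^sub>M BX)"
      and Badd: "\<forall>g\<in>carrier G. measure \<mu> {C \<in> X. Bad g C} \<le> d"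
      and good: "\<forall>g\<in>carrier G. \<forall>x\<in>carrier G. k x > 9 / 10 \<longrightarrow> \<not> Bad g (p x) \<longrightarrow>
        (\<exists>\<gamma>\<in>\<Gamma>. k (x \<otimes> \<gamma>) > 2 / 3 \<and> k (g \<otimes> (x \<otimes> \<gamma>)) > 2 / 3)"
      using near_minimizer[OF fm f01 d] by blast
    have km: "k \<in> borel_measurable (borel_of T)" by (rule mid_hull_measurable[OF k fm])
    have excl: "len \<beta> \<le> 2 * R" if "x \<in> carrier G" "\<beta> \<in> \<Gamma>" "k x > 9 / 10" "k (x \<otimes> \<beta>) > 2 / 3" for x \<beta>
    proof (rule ccontr)
      assume "\<not> len \<beta> \<le> 2 * R"
      then have "k x + k (x \<otimes> \<beta>) \<le> 1" using mid_hull_exclusive[OF k that(1,2)] f_excl[OF _ that(2)] by auto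
      with that(3,4) show False by simp
    qed
    define P where "P = {x \<in> carrier G. k x \<le> 9 / 10}"
    have Ps: "P \<in> sets (borel_of T)"
      using measurable_sets[OF km, of "{..9/10}"] by (simp add: P_def vimage_def Int_def topspace_eq conj_commute)
    have trb: "emeasure haar {x \<in> V. h \<otimes> x \<in> P} \<le> ennreal (10 * e)" if h: "h \<in> carrier G" for h
    proof -
      have "{x \<in> V. h \<otimes> x \<in> P} = {x \<in> V. k (h \<otimes> x) \<le> 9 / 10}" using h V_carrier by (auto simp: P_def)
      then show ?thesis using haar_V_translate_bound[OF k fm f01 f_int h] by simp
    qed
    define B where "B = V - P"
    \<comment> \<open>Inverses of points at which \<open>k\<close> is large, the form in which the
      measure-preserving swap sees them.\<close>
    define A where "A = {x \<in> V. inv x \<notin> P}"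
    have Bs: "B \<in> sets (borel_of T)" using V_sets Ps by (simp add: B_def sets.Diff)
    have B: "emeasure haar B \<ge> ennreal (v / 2)"
    proof -
      have VP: "V \<inter> P \<in> sets haar" "V \<inter> P \<subseteq> V" using V_sets Ps by auto
      have "{x \<in> V. \<one> \<otimes> x \<in> P} = V \<inter> P" using V_carrier by auto
      then have "emeasure haar (V \<inter> P) \<le> ennreal (10 * e)" using trb[OF one_closed] by simp
      also have "\<dots> \<le> ennreal (v / 2)" using e by (intro ennreal_leI)
      finally have le: "emeasure haar (V \<inter> P) \<le> ennreal (v / 2)" .
      have "ennreal v = emeasure haar (V \<inter> P) + emeasure haar B"
      proof -
        have "(V \<inter> P) \<inter> B = {}" "(V \<inter> P) \<union> B = V" by (auto simp: B_def)
        then show ?thesis using plus_emeasure[of "V \<inter> P" haar B] VP Bs v by simp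
      qed
      also have "\<dots> \<le> ennreal (v / 2) + emeasure haar B" using le by (rule add_right_mono)
      finally have "ennreal (v / 2) + ennreal (v / 2) \<le> ennreal (v / 2) + emeasure haar B"
        using v by (simp add: ennreal_plus[symmetric] del: ennreal_plus)
      then show ?thesis by (simp add: ennreal_add_left_cancel_le)
    qed
    have Q: "{x \<in> V. inv x \<in> P} \<in> sets (borel_of T)"
    proof -
      have "(\<lambda>x. inv x) -` P \<inter> space (borel_of T) \<in> sets (borel_of T)"
        by (rule measurable_sets[OF measurable_inv Ps]) simp
      then have "V \<inter> ((\<lambda>x. inv x) -` P \<inter> space (borel_of T)) \<in> sets (borel_of T)" using V_sets by blast
      moreover have "{x \<in> V. inv x \<in> P} = V \<inter> ((\<lambda>x. inv x) -` P \<inter> space (borel_of T))"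
        using V_carrier by (auto simp: topspace_eq)
      ultimately show ?thesis by simp
    qed
    have Aeq: "A = V - {x \<in> V. inv x \<in> P}" by (auto simp: A_def)
    have As: "A \<in> sets (borel_of T)" using V_sets Q unfolding Aeq by (rule sets.Diff)
    have A: "emeasure haar A \<ge> ennreal (v / 2)"
    proof -
      have "ennreal v * emeasure haar {x \<in> V. inv x \<in> P} \<le> ennreal n * ennreal (10 * e)"
        using haar_V_inverse_bound[OF Ps N trb] v n by simp
      also have "\<dots> = ennreal (n * (10 * e))" using n e by (simp add: ennreal_mult)
      also have "\<dots> \<le> ennreal (v * (v / 2))" using e by (intro ennreal_leI)
      also have "\<dots> = ennreal v * ennreal (v / 2)" by (rule ennreal_mult) (use v in simp_all)
      finally have le: "emeasure haar {x \<in> V. inv x \<in> P} \<le> ennreal (v / 2)"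
        using v by (simp add: ennreal_mult_le_mult_iff)
      have "ennreal v = emeasure haar {x \<in> V. inv x \<in> P} + emeasure haar A"
        using plus_emeasure[of "{x \<in> V. inv x \<in> P}" haar A] Q As v by (simp add: Aeq Un_absorb1)
      also have "\<dots> \<le> ennreal (v / 2) + emeasure haar A" using le by (rule add_right_mono)
      finally have "ennreal (v / 2) + ennreal (v / 2) \<le> ennreal (v / 2) + emeasure haar A"
        using v by (simp add: ennreal_plus[symmetric] del: ennreal_plus)
      then show ?thesis by (simp add: ennreal_add_left_cancel_le)
    qed
    have AB: "Bad ((z \<otimes> \<gamma>) \<otimes> inv x) (p x)" if x: "x \<in> carrier G" "inv x \<in> A" and z: "z \<in> B" for x z
    proof (rule ccontr)
      assume nb: "\<not> Bad ((z \<otimes> \<gamma>) \<otimes> inv x) (p x)"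
      have kx: "k x > 9 / 10" using x by (simp add: A_def P_def)
      have zc: "z \<in> carrier G" and kz: "k z > 9 / 10" using z V_carrier by (auto simp: B_def P_def)
      define g where "g = (z \<otimes> \<gamma>) \<otimes> inv x"
      have g: "g \<in> carrier G" using zc \<gamma>c x by (simp add: g_def)
      obtain \<beta> where \<beta>: "\<beta> \<in> \<Gamma>" "k (x \<otimes> \<beta>) > 2 / 3" "k (g \<otimes> (x \<otimes> \<beta>)) > 2 / 3"
        using good g x(1) kx nb unfolding g_def[symmetric] by blast
      have \<beta>c: "\<beta> \<in> carrier G" using \<beta> \<Gamma>_carrier by simp
      have gx: "g \<otimes> x = z \<otimes> \<gamma>" using zc \<gamma>c x by (simp add: g_def m_assoc)
      have "g \<otimes> (x \<otimes> \<beta>) = (g \<otimes> x) \<otimes> \<beta>" using g x \<beta>c by (simp add: m_assoc)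
      also have "\<dots> = z \<otimes> (\<gamma> \<otimes> \<beta>)" unfolding gx using zc \<gamma>c \<beta>c by (simp add: m_assoc)
      finally have "k (z \<otimes> (\<gamma> \<otimes> \<beta>)) > 2 / 3" using \<beta>(3) by simp
      then have 1: "len (\<gamma> \<otimes> \<beta>) \<le> 2 * R" using excl[OF zc _ kz] \<gamma> \<beta>(1) \<Gamma>_closed by blast
      have 2: "len \<beta> \<le> 2 * R" by (rule excl[OF x(1) \<beta>(1) kx \<beta>(2)])
      have "(\<gamma> \<otimes> \<beta>) \<otimes> inv \<beta> = \<gamma>" using \<gamma>c \<beta>c by (simp add: m_assoc)
      then have "len \<gamma> \<le> len (\<gamma> \<otimes> \<beta>) + len \<beta>"
        using l_add[of "\<gamma> \<otimes> \<beta>" "inv \<beta>"] l_inv[OF \<beta>(1)] \<gamma> \<beta>(1) \<Gamma>_closed by simp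
      then show False using 1 2 big by simp
    qed
    have "emeasure haar A * emeasure haar B \<le> ennreal d * emeasure haar N'"
      by (rule haar_bad_pairs_bound[OF Bad _ \<gamma> N' As _ Bs _ AB]) (use Badd in \<open>auto simp: A_def B_def\<close>)
    moreover have "ennreal (v / 2) * ennreal (v / 2) \<le> emeasure haar A * emeasure haar B"
      by (rule mult_mono[OF A B]) simp_all
    ultimately have "ennreal (v / 2) * ennreal (v / 2) \<le> ennreal d * ennreal n'"
      unfolding n'(2) by (rule order_trans[rotated])
    moreover have "ennreal (v / 2) * ennreal (v / 2) = ennreal (v / 2 * (v / 2))"
      by (rule ennreal_mult[symmetric]) (use v in simp_all)
    moreover have "ennreal d * ennreal n' = ennreal (d * n')"
      by (rule ennreal_mult[symmetric]) (use d n' in simp_all)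
    ultimately have "v / 2 * (v / 2) \<le> d * n'"
      using d n' by (simp only: ennreal_le_iff mult_nonneg_nonneg less_imp_le)
    moreover have "d * n' \<le> v\<^sup>2 / 8"
    proof -
      have "d * n' = (n' / (n' + 1)) * (v\<^sup>2 / 8)" using n' by (simp add: d_def field_simps)
      also have "\<dots> \<le> 1 * (v\<^sup>2 / 8)" using n' by (intro mult_right_mono) auto
      finally show ?thesis by simp
    qed
    ultimately show False using mult_pos_pos[OF v(1) v(1)] by (simp add: power2_eq_square)
  qed
  then show ?thesis by blast
qed

end

section \<open>From the lattice to the group\<close>

context hilbert_space
begin

lemma diff_diff_eq_add: 
  assumes "x \<in> carrier H" "y \<in> carrier H" "z \<in> carrier H"
  shows "x \<ominus> y \<ominus> z = x \<ominus> (y \<oplus> z)"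
  using assms by (simp add: a_minus_def M.minus_add M.a_assoc)

lemma hnorm_diff_diff:
  assumes "x \<in> carrier H" "y \<in> carrier H" "z \<in> carrier H"
  shows "hnorm H (x \<ominus> y \<ominus> z) = hdist H x (y \<oplus> z)"
  using assms by (simp add: diff_diff_eq_add hdist_eq)

lemma hnorm_le_of_diff:
  assumes "x \<in> carrier H" "y \<in> carrier H" "z \<in> carrier H"
  shows "hnorm H x \<le> hnorm H (x \<ominus> y \<ominus> z) + hnorm H y + hnorm H z"
    and "hnorm H y \<le> hnorm H (x \<ominus> y \<ominus> z) + hnorm H x + hnorm H z"
proof -
  have "hnorm H x \<le> hdist H x (y \<oplus> z) + hnorm H (y \<oplus> z)"
    using hdist_triangle[of x "y \<oplus> z" \<zero>] assms by (simp add: hnorm_eq_hdist)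
  then show "hnorm H x \<le> hnorm H (x \<ominus> y \<ominus> z) + hnorm H y + hnorm H z"
    using hnorm_triangle[of y z] assms by (simp add: hnorm_diff_diff)
  have "hnorm H y = hdist H (y \<oplus> z) (\<zero> \<oplus> z)"
    using hdist_add_left[of y \<zero> z] assms by (simp add: hnorm_eq_hdist M.a_comm)
  also have "\<dots> \<le> hdist H (y \<oplus> z) x + hdist H x z"
    using hdist_triangle[of "y \<oplus> z" x z] assms by simp
  also have "hdist H x z \<le> hnorm H x + hnorm H z"
    using hdist_triangle[of x \<zero> z] assms by (simp add: hnorm_eq_hdist hdist_commute)
  finally show "hnorm H y \<le> hnorm H (x \<ominus> y \<ominus> z) + hnorm H x + hnorm H z"
    using assms by (simp add: hnorm_diff_diff hdist_commute)
qed

end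

lemma measurable_borel_of_discrete:
  assumes "f \<in> S \<rightarrow> topspace T"
  shows "f \<in> measurable (borel_of (discrete_topology S)) (borel_of T)"
proof (rule measurable_borel_of_open)
  show "f \<in> space (borel_of (discrete_topology S)) \<rightarrow> topspace T" using assms by simp
  show "f -` U \<inter> space (borel_of (discrete_topology S)) \<in> sets (borel_of (discrete_topology S))" for U
    by (rule openin_sets_borel_of) simp
qed

context lcsc_lattice
begin

lemma subtopology_\<Gamma>: "subtopology T \<Gamma> = discrete_topology \<Gamma>"
  using lattice by (simp add: lattice_in_def)

text \<open>On the discrete group \<Gamma> every map is Borel, and compact subsets of \<Gamma> are
  compact in the ambient group.\<close>

lemma wq_cocycle_restrict:
  assumes "wq_cocycle G T H b \<pi>"
  shows "wq_cocycle (G\<lparr>carrier := \<Gamma>\<rparr>) (subtopology T \<Gamma>) H b \<pi>"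
proof -
  note d = assms[unfolded wq_cocycle_def]
  have "b \<in> \<Gamma> \<rightarrow> topspace (htopology H)" "\<pi> \<in> \<Gamma> \<rightarrow> topspace (unitary_sot H)"
    using d \<Gamma>_carrier by (auto simp: measurable_def topspace_eq)
  moreover have "\<exists>c. \<forall>g\<in>K. hnorm H (b g) \<le> c" if "compactin (subtopology T \<Gamma>) K" for K
    using d that by (simp add: compactin_subtopology)
  moreover obtain c where "\<forall>g\<in>carrier G. \<forall>h\<in>carrier G. hnorm H (b (g \<otimes> h) \<ominus>\<^bsub>H\<^esub> b g \<ominus>\<^bsub>H\<^esub> \<pi> g (b h)) \<le> c"
    using d by blast
  ultimately show ?thesis
    unfolding wq_cocycle_def using \<Gamma>_carrier
    by (auto simp: subtopology_\<Gamma> intro!: measurable_borel_of_discrete exI[of _ c])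
qed

theorem TTT_of_lattice:
  assumes "property_TTT TYPE('k) (G\<lparr>carrier := \<Gamma>\<rparr>) (subtopology T \<Gamma>)"
  shows "property_TTT TYPE('k) G T"
  unfolding property_TTT_def relative_property_TTT_def
proof (intro allI impI)
  fix H :: "'k hilbert" and b \<pi>
  assume H: "hilbert_space H" and w: "wq_cocycle G T H b \<pi>"
  interpret hilbert_space H by (rule H)
  note d = w[unfolded wq_cocycle_def]
  have bm: "b \<in> measurable (borel_of T) (borel_of (htopology H))" and \<pi>m: "\<pi> \<in> measurable (borel_of T) (borel_of (unitary_sot H))"
    using d by auto
  have bc: "b g \<in> carrier H" if "g \<in> carrier G" for g using measurable_space[OF bm, of g] that by (simp add: topspace_eq)
  have \<pi>U: "\<pi> g \<in> unitary_group H" if "g \<in> carrier G" for g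
    using measurable_space[OF \<pi>m, of g] that by (simp add: topspace_eq topspace_unitary_sot)
  have \<pi>c: "\<pi> g x \<in> carrier H" "hnorm H (\<pi> g x) = hnorm H x" if "g \<in> carrier G" "x \<in> carrier H" for g x
    using unitary_groupD[OF \<pi>U[OF that(1)]] that(2) by auto
  obtain c where c: "\<And>g h. \<lbrakk>g \<in> carrier G; h \<in> carrier G\<rbrakk> \<Longrightarrow> hnorm H (b (g \<otimes> h) \<ominus>\<^bsub>H\<^esub> b g \<ominus>\<^bsub>H\<^esub> \<pi> g (b h)) \<le> c"
    using d by blast
  obtain m where m: "\<And>\<gamma>. \<gamma> \<in> \<Gamma> \<Longrightarrow> hnorm H (b \<gamma>) \<le> m"
    using assms wq_cocycle_restrict[OF w] H unfolding property_TTT_def relative_property_TTT_def by fastforce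
  define A where "A n = {C \<in> X. hnorm H (b (s C)) \<le> real n}" for n :: nat
  have As: "A n \<in> sets \<mu>" for n
  proof -
    have [measurable]: "(\<lambda>C. hnorm H (b (s C))) \<in> borel_measurable \<mu>"
      unfolding measurable_\<mu>_eq by (rule measurable_compose[OF measurable_s measurable_hnorm[OF bm]])
    have "{C \<in> space \<mu>. hnorm H (b (s C)) \<le> real n} \<in> sets \<mu>" by measurable
    then show ?thesis by (simp add: A_def space_\<mu>)
  qed
  have "incseq A" by (force simp: incseq_def A_def)
  then have "(\<lambda>n. measure \<mu> (A n)) \<longlonglongrightarrow> measure \<mu> (\<Union>n. A n)"
    using As by (intro \<mu>.finite_Lim_measure_incseq) auto
  moreover have "(\<Union>n. A n) = X"
  proof (intro equalityI subsetI)
    fix C assume C: "C \<in> X"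
    obtain n :: nat where "hnorm H (b (s C)) \<le> real n" using real_arch_simple by blast
    then have "C \<in> A n" using C by (simp add: A_def)
    then show "C \<in> (\<Union>n. A n)" by blast
  qed (simp add: A_def)
  moreover have "0 < measure \<mu> X"
    using \<mu>(2) by (simp add: space_\<mu> \<mu>.emeasure_eq_measure)
  ultimately have "\<forall>\<^sub>F n in sequentially. measure \<mu> X / 2 < measure \<mu> (A n)"
    by (intro order_tendstoD(1)) auto
  then obtain n where n: "measure \<mu> X / 2 < measure \<mu> (A n)"
    by (auto simp: eventually_sequentially)
  \<comment> \<open>The cocycle inequality is used twice: g x = y \<open>\<kappa> g C\<close> bounds
    b(g x) by c + n + m, and then b g is bounded through b(g x) and b x.\<close>
  have "hnorm H (b g) \<le> c + (c + real n + m) + real n" if g: "g \<in> carrier G" for g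
  proof -
    let ?B = "act g -` A n \<inter> space \<mu>"
    have Bs: "?B \<in> sets \<mu>" by (rule measurable_sets[OF measurable_act_\<mu>[OF g] As])
    have mB: "measure \<mu> ?B = measure \<mu> (A n)"
      using measure_distr[OF measurable_act_\<mu>[OF g] As[of n]] by (simp add: distr_act[OF g])
    have "A n \<inter> ?B \<noteq> {}"
    proof
      assume "A n \<inter> ?B = {}"
      then have "measure \<mu> (A n \<union> ?B) = measure \<mu> (A n) + measure \<mu> ?B"
        by (rule \<mu>.finite_measure_Union[OF As Bs])
      moreover have "measure \<mu> (A n \<union> ?B) \<le> measure \<mu> X"
        using \<mu>.bounded_measure by (simp add: space_\<mu>)
      ultimately show False using n mB by simp
    qed
    then obtain C where C: "C \<in> A n" "act g C \<in> A n" by auto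
    have CX: "C \<in> X" "act g C \<in> X" using C by (auto simp: A_def)
    define x y where "x = s C" and "y = s (act g C)"
    have xy: "x \<in> carrier G" "y \<in> carrier G" using s_carrier CX by (auto simp: x_def y_def)
    have bx: "hnorm H (b x) \<le> n" "hnorm H (b y) \<le> n" using C by (auto simp: A_def x_def y_def)
    have \<kappa>: "\<kappa> g C \<in> \<Gamma>" "\<kappa> g C \<in> carrier G" using \<kappa>_\<Gamma>[OF g CX(1)] \<Gamma>_carrier by auto
    have gx: "g \<otimes> x = y \<otimes> \<kappa> g C" using s_act[OF g CX(1)] by (simp add: x_def y_def)
    have "hnorm H (b (y \<otimes> \<kappa> g C)) \<le> c + real n + m"
      using hnorm_le_of_diff(1)[of "b (y \<otimes> \<kappa> g C)" "b y" "\<pi> y (b (\<kappa> g C))"] c[OF xy(2) \<kappa>(2)] bx m[OF \<kappa>(1)]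
        \<pi>c[OF xy(2) bc[OF \<kappa>(2)]] bc[OF xy(2)] bc[of "y \<otimes> \<kappa> g C"] xy \<kappa> by simp
    then have "hnorm H (b (g \<otimes> x)) \<le> c + real n + m" by (simp add: gx)
    then show ?thesis
      using hnorm_le_of_diff(2)[of "b (g \<otimes> x)" "b g" "\<pi> g (b x)"] c[OF g xy(1)] bx
        \<pi>c[OF g bc[OF xy(1)]] bc[OF g] bc[of "g \<otimes> x"] xy g by simp
  qed
  then show "\<exists>C. \<forall>g\<in>carrier G. hnorm H (b g) \<le> C" by blast
qed

end

section \<open>Finitely supported functions with a conditionally negative kernel\<close>

locale negative_kernel =
  fixes I :: "'k set" and \<psi> :: "'k \<Rightarrow> 'k \<Rightarrow> real"
  assumes countable_I: "countable I"
    and \<psi>_self: "v \<in> I \<Longrightarrow> \<psi> v v = 0"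
    and \<psi>_sym: "\<lbrakk>v \<in> I; w \<in> I\<rbrakk> \<Longrightarrow> \<psi> v w = \<psi> w v"
    and \<psi>_neg: "\<lbrakk>finite S; S \<subseteq> I; sum c S = 0\<rbrakk> \<Longrightarrow> (\<Sum>v\<in>S. \<Sum>w\<in>S. c v * c w * \<psi> v w) \<le> 0"
begin

abbreviation supp :: "('k \<Rightarrow> complex) \<Rightarrow> 'k set" where "supp a \<equiv> {v. a v \<noteq> 0}"

text \<open>Coefficients of sum 0 are the ones for which conditional negativity says something; on
  them the form \<open>q\<close> is nonnegative.\<close>

definition Fin :: "('k \<Rightarrow> complex) set" where
  "Fin = {a. finite (supp a) \<and> supp a \<subseteq> I \<and> (\<Sum>v\<in>supp a. a v) = 0}"

text \<open>Schoenberg's construction. If \<psi> is the squared distance of a real Hilbert space,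
  this is twice the inner product of the corresponding combinations of points.\<close>

definition q :: "('k \<Rightarrow> complex) \<Rightarrow> ('k \<Rightarrow> complex) \<Rightarrow> complex" where
  "q a b = - (\<Sum>v\<in>supp a. \<Sum>w\<in>supp b. a v * cnj (b w) * complex_of_real (\<psi> v w))"

lemma q_superset:
  assumes "finite S" "supp a \<subseteq> S" "supp b \<subseteq> S"
  shows "q a b = - (\<Sum>v\<in>S. \<Sum>w\<in>S. a v * cnj (b w) * complex_of_real (\<psi> v w))"
proof -
  have "(\<Sum>v\<in>S. \<Sum>w\<in>S. a v * cnj (b w) * complex_of_real (\<psi> v w)) =
      (\<Sum>v\<in>supp a. \<Sum>w\<in>S. a v * cnj (b w) * complex_of_real (\<psi> v w))"
    using assms by (intro sum.mono_neutral_right) auto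
  also have "\<dots> = (\<Sum>v\<in>supp a. \<Sum>w\<in>supp b. a v * cnj (b w) * complex_of_real (\<psi> v w))"
    using assms by (intro sum.cong refl sum.mono_neutral_right) auto
  finally show ?thesis by (simp add: q_def)
qed

lemma FinI:
  assumes "finite S" "S \<subseteq> I" "supp a \<subseteq> S" "sum a S = 0"
  shows "a \<in> Fin"
proof -
  have "sum a S = (\<Sum>v\<in>supp a. a v)" using assms by (intro sum.mono_neutral_right) auto
  then show ?thesis using assms finite_subset[of "supp a" S] by (auto simp: Fin_def)
qed

lemma FinD:
  assumes "a \<in> Fin" shows "finite (supp a)" "supp a \<subseteq> I"
  using assms by (auto simp: Fin_def)

lemma Fin_sum:
  assumes "a \<in> Fin" "finite S" "supp a \<subseteq> S" shows "sum a S = 0"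
proof -
  have "sum a S = (\<Sum>v\<in>supp a. a v)" using assms by (intro sum.mono_neutral_right) auto
  then show ?thesis using assms by (simp add: Fin_def)
qed

abbreviation fsc :: "complex \<Rightarrow> ('k \<Rightarrow> complex) \<Rightarrow> ('k \<Rightarrow> complex)" where
  "fsc c a \<equiv> (\<lambda>v. c * a v)"

lemma semi_inner_Fin: "semi_inner Fin fsc q"
proof
  fix a b c' :: "'k \<Rightarrow> complex" and c d :: complex
  show "0 \<in> Fin" by (rule FinI[of "{}"]) auto
  show "fsc c (a + b) = fsc c a + fsc c b" by (simp add: fun_eq_iff algebra_simps)
  show "fsc (c + d) a = fsc c a + fsc d a" by (simp add: fun_eq_iff algebra_simps)
  show "(\<lambda>v. c * (d * a v)) = fsc (c * d) a" by (simp add: fun_eq_iff)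
  show "fsc 1 a = a" by simp
  assume a: "a \<in> Fin"
  show "fsc c a \<in> Fin"
    by (rule FinI[OF FinD[OF a]]) (use Fin_sum[OF a FinD(1)[OF a] order_refl] in \<open>auto simp: sum_distrib_left[symmetric]\<close>)
  show "0 \<le> Re (q a a)"
  proof -
    let ?S = "supp a"
    have S: "finite ?S" "?S \<subseteq> I" by (rule FinD[OF a])+
    have 0: "(\<Sum>v\<in>?S. Re (a v)) = 0" "(\<Sum>v\<in>?S. Im (a v)) = 0"
      using Fin_sum[OF a S(1) order_refl] by (simp_all flip: Re_sum Im_sum)
    have "Re (q a a) = - (\<Sum>v\<in>?S. \<Sum>w\<in>?S. Re (a v) * Re (a w) * \<psi> v w + Im (a v) * Im (a w) * \<psi> v w)"
      by (simp add: q_def algebra_simps)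
    also have "\<dots> = - ((\<Sum>v\<in>?S. \<Sum>w\<in>?S. Re (a v) * Re (a w) * \<psi> v w) + (\<Sum>v\<in>?S. \<Sum>w\<in>?S. Im (a v) * Im (a w) * \<psi> v w))"
      by (simp add: sum.distrib)
    finally show ?thesis using \<psi>_neg[OF S 0(1)] \<psi>_neg[OF S 0(2)] by simp
  qed
  assume b: "b \<in> Fin"
  let ?S = "supp a \<union> supp b"
  have S: "finite ?S" "?S \<subseteq> I" using FinD[OF a] FinD[OF b] by auto
  show "a + b \<in> Fin"
    by (rule FinI[OF S]) (use Fin_sum[OF a S(1)] Fin_sum[OF b S(1)] in \<open>auto simp: sum.distrib\<close>)
  show "q (fsc c a) b = c * q a b"
    using q_superset[OF S(1), of "fsc c a" b] q_superset[OF S(1), of a b]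
    by (auto simp: sum_distrib_left mult.assoc)
  show "q b a = cnj (q a b)"
  proof -
    have "q b a = - (\<Sum>w\<in>?S. \<Sum>v\<in>?S. b v * cnj (a w) * complex_of_real (\<psi> v w))"
      unfolding q_superset[OF S(1) Un_upper2 Un_upper1] by (subst sum.swap) simp
    also have "\<dots> = - (\<Sum>w\<in>?S. \<Sum>v\<in>?S. cnj (a w * cnj (b v) * complex_of_real (\<psi> w v)))"
      using \<psi>_sym S(2) by (intro arg_cong[of _ _ uminus] sum.cong refl) (auto simp: subset_iff mult.commute)
    also have "\<dots> = cnj (q a b)" unfolding q_superset[OF S(1) Un_upper1 Un_upper2] by simp
    finally show ?thesis .
  qed
  assume c': "c' \<in> Fin"
  let ?R = "?S \<union> supp c'"
  have R: "finite ?R" using S FinD[OF c'] by auto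
  have "supp (a + b) \<subseteq> ?R" "supp a \<subseteq> ?R" "supp b \<subseteq> ?R" "supp c' \<subseteq> ?R" by auto
  then show "q (a + b) c' = q a c' + q b c'"
    using q_superset[OF R, of _ c'] by (simp add: sum.distrib algebra_simps)
qed

sublocale F: semi_inner Fin fsc q by (rule semi_inner_Fin)

definition dl :: "'k \<Rightarrow> 'k \<Rightarrow> 'k \<Rightarrow> complex" where
  "dl v w = (\<lambda>x. (if x = v then 1 else 0) - (if x = w then 1 else 0))"

lemma dl_Fin: 
  assumes "v \<in> I" "w \<in> I" shows "dl v w \<in> Fin"
proof (rule FinI[of "{v, w}"])
  show "sum (dl v w) {v, w} = 0" by (cases "v = w") (auto simp: dl_def)
qed (use assms in \<open>auto simp: dl_def\<close>)

lemma q_dl: 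
  assumes "v \<in> I" "w \<in> I" shows "q (dl v w) (dl v w) = complex_of_real (2 * \<psi> v w)"
proof (cases "v = w")
  case True
  then have "dl v w = 0" by (simp add: dl_def fun_eq_iff)
  then show ?thesis using True assms \<psi>_self F.Q_zero_left[OF F.zero_mem] by simp
next
  case False
  have "q (dl v w) (dl v w) = - (\<Sum>x\<in>{v, w}. \<Sum>y\<in>{v, w}. dl v w x * cnj (dl v w y) * complex_of_real (\<psi> x y))"
    by (rule q_superset) (auto simp: dl_def)
  then show ?thesis using False assms \<psi>_self \<psi>_sym[of w v] by (simp add: dl_def)
qed

lemma \<psi>_nonneg: "\<lbrakk>v \<in> I; w \<in> I\<rbrakk> \<Longrightarrow> 0 \<le> \<psi> v w"
  using F.Q_nonneg[OF dl_Fin] q_dl by fastforce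

text \<open>As the coefficients sum to 0, subtracting the point mass at \<open>w\<close> from each
  point mass changes nothing in total.\<close>

lemma Fin_expand:
  assumes a: "a \<in> Fin" and w: "w \<in> I"
  shows "a = (\<Sum>v\<in>supp a. fsc (a v) (dl v w))"
proof
  fix x
  have f: "finite (supp a)" by (rule FinD(1)[OF a])
  have "(\<Sum>v\<in>supp a. fsc (a v) (dl v w)) x = (\<Sum>v\<in>supp a. a v * dl v w x)"
    by (induction rule: infinite_finite_induct) auto
  also have "\<dots> = (\<Sum>v\<in>supp a. if x = v then a v else 0) - (\<Sum>v\<in>supp a. a v) * (if x = w then 1 else 0)"
    unfolding sum_distrib_right sum_subtractf[symmetric] by (intro sum.cong) (auto simp: dl_def)
  also have "\<dots> = a x" using f Fin_sum[OF a f order_refl] by (simp add: sum.delta)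
  finally show "a x = (\<Sum>v\<in>supp a. fsc (a v) (dl v w)) x" by simp
qed

text \<open>The push-forward of \<open>a\<close> under a permutation of \<open>I\<close> with inverse \<open>B\<close>.\<close>

definition push :: "('k \<Rightarrow> 'k) \<Rightarrow> ('k \<Rightarrow> complex) \<Rightarrow> ('k \<Rightarrow> complex)" where
  "push B a = (\<lambda>v. if v \<in> I then a (B v) else 0)"

definition kernel_pair :: "('k \<Rightarrow> 'k) \<Rightarrow> ('k \<Rightarrow> 'k) \<Rightarrow> bool" where
  "kernel_pair A B \<longleftrightarrow> (\<forall>v\<in>I. A v \<in> I \<and> B v \<in> I \<and> A (B v) = v \<and> B (A v) = v) \<and>
    (\<forall>v\<in>I. \<forall>w\<in>I. \<psi> (A v) (A w) = \<psi> v w)"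

lemma kernel_pair_sym: 
  assumes "kernel_pair A B" shows "kernel_pair B A"
proof -
  have "\<psi> (B v) (B w) = \<psi> v w" if "v \<in> I" "w \<in> I" for v w
  proof -
    have "B v \<in> I" "B w \<in> I" using assms that by (simp_all add: kernel_pair_def)
    moreover have "\<forall>v\<in>I. \<forall>w\<in>I. \<psi> (A v) (A w) = \<psi> v w" using assms by (simp add: kernel_pair_def)
    ultimately have "\<psi> (A (B v)) (A (B w)) = \<psi> (B v) (B w)" by blast
    moreover have "A (B v) = v" "A (B w) = w" using assms that by (simp_all add: kernel_pair_def)
    ultimately show ?thesis by (simp only:)
  qed
  then show ?thesis using assms by (simp add: kernel_pair_def)
qed

lemma push_supp:
  assumes AB: "kernel_pair A B" and a: "a \<in> Fin"
  shows "supp (push B a) = A ` supp a"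
  using AB FinD(2)[OF a] unfolding kernel_pair_def push_def by (force simp: image_iff)

lemma push_isometry:
  assumes AB: "kernel_pair A B"
  shows "F.isometry_pair (push B) (push A)"
proof -
  have inj: "inj_on A S" if "S \<subseteq> I" for S
    using AB that by (intro inj_on_inverseI[of _ B]) (auto simp: kernel_pair_def)
  have Fin: "push B a \<in> Fin" if AB: "kernel_pair A B" and inj: "inj_on A (supp a)" and a: "a \<in> Fin" for A B a
  proof (rule FinI)
    show "finite (A ` supp a)" "A ` supp a \<subseteq> I" "supp (push B a) \<subseteq> A ` supp a"
      using FinD[OF a] AB push_supp[OF AB a] by (auto simp: kernel_pair_def)
    have "sum (push B a) (A ` supp a) = (\<Sum>v\<in>supp a. push B a (A v))"
      by (simp add: sum.reindex[OF inj])
    also have "\<dots> = (\<Sum>v\<in>supp a. a v)"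
      using FinD(2)[OF a] AB by (intro sum.cong refl) (auto simp: push_def kernel_pair_def)
    finally show "sum (push B a) (A ` supp a) = 0" using Fin_sum[OF a FinD(1)[OF a] order_refl] by simp
  qed
  have inv: "push B (push A a) = a" if AB: "kernel_pair A B" and a: "a \<in> Fin" for A B a
    using AB FinD(2)[OF a] by (force simp: push_def kernel_pair_def fun_eq_iff)
  have q: "q (push B a) (push B b) = q a b" if a: "a \<in> Fin" and b: "b \<in> Fin" for a b
  proof -
    have sa: "supp a \<subseteq> I" and sb: "supp b \<subseteq> I" using FinD a b by auto
    have "q (push B a) (push B b) = - (\<Sum>v\<in>supp a. \<Sum>w\<in>supp b. push B a (A v) * cnj (push B b (A w)) * complex_of_real (\<psi> (A v) (A w)))"
      unfolding q_def push_supp[OF AB a] push_supp[OF AB b] by (simp add: sum.reindex[OF inj[OF sa]] sum.reindex[OF inj[OF sb]])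
    also have "\<dots> = q a b"
      unfolding q_def using sa sb AB
      by (intro arg_cong[of _ _ uminus] sum.cong refl) (auto simp: push_def kernel_pair_def subset_iff)
    finally show ?thesis .
  qed
  have injB: "inj_on B S" if "S \<subseteq> I" for S
    using AB that by (intro inj_on_inverseI[of _ A]) (auto simp: kernel_pair_def)
  have "push B a \<in> Fin" "push A a \<in> Fin" "push B (push A a) = a" "push A (push B a) = a" if "a \<in> Fin" for a
    using Fin[OF AB inj[OF FinD(2)[OF that]] that] Fin[OF kernel_pair_sym[OF AB] injB[OF FinD(2)[OF that]] that]
      inv[OF AB that] inv[OF kernel_pair_sym[OF AB] that] by auto
  moreover have "push B (a + b) = push B a + push B b" "push B (fsc c a) = fsc c (push B a)" for a b c
    by (auto simp: push_def fun_eq_iff)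
  ultimately show ?thesis using q by (simp add: F.isometry_pair_def)
qed

lemma push_dl:
  assumes AB: "kernel_pair A B" and v: "v \<in> I" and w: "w \<in> I"
  shows "push B (dl v w) = dl (A v) (A w)"
  using assms by (force simp: push_def dl_def kernel_pair_def fun_eq_iff)

end

lemma sum_fun_apply:
  fixes g :: "'b \<Rightarrow> 'c \<Rightarrow> 'd::comm_monoid_add"
  shows "sum g B x = (\<Sum>b\<in>B. g b x)"
  by (induction B rule: infinite_finite_induct) auto

lemma measurable_count_space_pair:
  assumes "countable A" "countable B" "f \<in> measurable M (count_space A)" "g \<in> measurable M (count_space B)"
  shows "(\<lambda>x. (f x, g x)) \<in> measurable M (count_space (A \<times> B))"
proof (subst measurable_count_space_eq_countable, intro countable_SIGMA assms(1,2), intro conjI ballI)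
  show "(\<lambda>x. (f x, g x)) \<in> space M \<rightarrow> A \<times> B"
    using measurable_space[OF assms(3)] measurable_space[OF assms(4)] by auto
  fix z assume z: "z \<in> A \<times> B"
  have "(\<lambda>x. (f x, g x)) -` {z} \<inter> space M = (f -` {fst z} \<inter> space M) \<inter> (g -` {snd z} \<inter> space M)" by auto
  also have "\<dots> \<in> sets M"
    by (rule sets.Int; rule measurable_sets) (use assms z in auto)
  finally show "(\<lambda>x. (f x, g x)) -` {z} \<inter> space M \<in> sets M" .
qed

text \<open>Every map out of a countable discrete space is measurable, so any expression in two
  measurable functions with countably many values is measurable.\<close>

lemma measurable_count_space_pair_compose:
  assumes "countable A" "countable B" "f \<in> measurable M (count_space A)" "g \<in> measurable M (count_space B)"
    and "\<And>a b. \<lbrakk>a \<in> A; b \<in> B\<rbrakk> \<Longrightarrow> h a b \<in> space N"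
  shows "(\<lambda>x. h (f x) (g x)) \<in> measurable M N"
proof -
  have "(\<lambda>z. h (fst z) (snd z)) \<in> measurable (count_space (A \<times> B)) N" using assms(5) by auto
  from measurable_compose[OF measurable_count_space_pair[OF assms(1-4)] this] show ?thesis by simp
qed

lemma measurable_count_space_compose:
  assumes "f \<in> measurable M (count_space A)" "\<And>a. a \<in> A \<Longrightarrow> h a \<in> space N"
  shows "(\<lambda>x. h (f x)) \<in> measurable M N"
  by (rule measurable_compose[OF assms(1)]) (use assms(2) in auto)

lemma measurable_count_space_image:
  assumes "countable A" "f \<in> measurable M (count_space A)" "g \<in> measurable M (count_space B)" "countable B"
  shows "(\<lambda>x. h (f x) (g x)) \<in> measurable M (count_space ((\<lambda>(a, b). h a b) ` (A \<times> B)))"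
  by (rule measurable_count_space_pair_compose[OF assms(1,4,2,3)]) auto

section \<open>Square-integrable functions with values in \<open>Fin\<close>\<close>

locale kernel_sections = negative_kernel I \<psi> + finite_measure M
  for I :: "'k set" and \<psi> and M :: "'x measure" +
  fixes base :: 'k and \<G> :: "'x set set"
  assumes base: "base \<in> I"
    and \<G>: "countable \<G>" "\<G> \<subseteq> Pow (space M)" "Int_stable \<G>" "space M \<in> \<G>"
    and sets_M: "sets M = sigma_sets (space M) \<G>"
begin

text \<open>Functions with countably many values can be composed with arbitrary maps, so no
  measurable structure on \<open>Fin\<close> has to be chosen. The space need not be complete at
  this stage, and this class is dense enough.\<close>

definition cvalued :: "('x \<Rightarrow> 'k \<Rightarrow> complex) \<Rightarrow> bool" where
  "cvalued f \<longleftrightarrow> (\<exists>A. countable A \<and> A \<subseteq> Fin \<and> f \<in> measurable M (count_space A))"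

text \<open>Vanishing outside the space makes equality of two members a pointwise statement on the
  space.\<close>

definition VS :: "('x \<Rightarrow> 'k \<Rightarrow> complex) set" where
  "VS = {f. cvalued f \<and> (\<forall>x. x \<notin> space M \<longrightarrow> f x = 0) \<and> integrable M (\<lambda>x. (F.nrm (f x))\<^sup>2)}"

definition QS :: "('x \<Rightarrow> 'k \<Rightarrow> complex) \<Rightarrow> ('x \<Rightarrow> 'k \<Rightarrow> complex) \<Rightarrow> complex" where
  "QS f g = (\<integral>x. q (f x) (g x) \<partial>M)"

abbreviation ssc :: "complex \<Rightarrow> ('x \<Rightarrow> 'k \<Rightarrow> complex) \<Rightarrow> ('x \<Rightarrow> 'k \<Rightarrow> complex)" where
  "ssc c f \<equiv> (\<lambda>x v. c * f x v)"

lemma cvalued_Fin: "\<lbrakk>cvalued f; x \<in> space M\<rbrakk> \<Longrightarrow> f x \<in> Fin"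
  unfolding cvalued_def using measurable_space[of f M "count_space _" x] by fastforce

lemma VS_Fin: "f \<in> VS \<Longrightarrow> f x \<in> Fin"
  using cvalued_Fin[of f x] F.zero_mem by (cases "x \<in> space M") (auto simp: VS_def)

lemma VS_cvalued: "f \<in> VS \<Longrightarrow> cvalued f"
  by (simp add: VS_def)

lemma VS_integrable: "f \<in> VS \<Longrightarrow> integrable M (\<lambda>x. (F.nrm (f x))\<^sup>2)"
  by (simp add: VS_def)

lemma cvalued_measurable2:
  assumes "cvalued f" "cvalued g" "\<And>a b. h a b \<in> space N"
  shows "(\<lambda>x. h (f x) (g x)) \<in> measurable M N"
proof -
  obtain A B where A: "countable A" "f \<in> measurable M (count_space A)"
    and B: "countable B" "g \<in> measurable M (count_space B)"
    using assms(1,2) unfolding cvalued_def by blast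
  show ?thesis by (rule measurable_count_space_pair_compose[OF A(1) B(1) A(2) B(2)]) (rule assms(3))
qed

lemma cvalued_measurable:
  assumes "cvalued f" "\<And>a. h a \<in> space N" shows "(\<lambda>x. h (f x)) \<in> measurable M N"
  using cvalued_measurable2[OF assms(1,1), of "\<lambda>a b. h a"] assms(2) by simp

lemma cvalued_comb:
  assumes "cvalued f" "cvalued g" "\<And>a b. \<lbrakk>a \<in> Fin; b \<in> Fin\<rbrakk> \<Longrightarrow> h a b \<in> Fin"
  shows "cvalued (\<lambda>x. h (f x) (g x))"
proof -
  obtain A B where A: "countable A" "A \<subseteq> Fin" "f \<in> measurable M (count_space A)"
    and B: "countable B" "B \<subseteq> Fin" "g \<in> measurable M (count_space B)"
    using assms(1,2) unfolding cvalued_def by blast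
  have "(\<lambda>(a, b). h a b) ` (A \<times> B) \<subseteq> Fin" using assms(3) A(2) B(2) by auto
  moreover have "countable ((\<lambda>(a, b). h a b) ` (A \<times> B))" using A B by auto
  ultimately show ?thesis
    unfolding cvalued_def
    by (intro exI[of _ "(\<lambda>(a, b). h a b) ` (A \<times> B)"] conjI measurable_count_space_image[OF A(1,3) B(3,1)])
qed

lemma integrable_q:
  assumes f: "f \<in> VS" and g: "g \<in> VS"
  shows "integrable M (\<lambda>x. q (f x) (g x))"
proof (rule Bochner_Integration.integrable_bound)
  show "integrable M (\<lambda>x. (F.nrm (f x))\<^sup>2 + (F.nrm (g x))\<^sup>2)" using VS_integrable f g by simp
  show "(\<lambda>x. q (f x) (g x)) \<in> borel_measurable M"
    by (rule cvalued_measurable2) (use f g VS_cvalued in auto)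
  have "cmod (q (f x) (g x)) \<le> norm ((F.nrm (f x))\<^sup>2 + (F.nrm (g x))\<^sup>2)" for x
  proof -
    have "cmod (q (f x) (g x)) \<le> F.nrm (f x) * F.nrm (g x)" by (rule F.cauchy_schwarz[OF VS_Fin[OF f] VS_Fin[OF g]])
    also have "\<dots> \<le> 2 * F.nrm (f x) * F.nrm (g x)"
      using F.nrm_nonneg VS_Fin f g by simp
    also have "\<dots> \<le> (F.nrm (f x))\<^sup>2 + (F.nrm (g x))\<^sup>2" by (rule sum_squares_bound)
    finally show ?thesis by simp
  qed
  then show "AE x in M. cmod (q (f x) (g x)) \<le> norm ((F.nrm (f x))\<^sup>2 + (F.nrm (g x))\<^sup>2)" by simp
qed

lemma VS_I:
  assumes "cvalued f" "\<And>x. x \<notin> space M \<Longrightarrow> f x = 0" "integrable M g" "\<And>x. x \<in> space M \<Longrightarrow> (F.nrm (f x))\<^sup>2 \<le> g x"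
  shows "f \<in> VS"
proof -
  have "integrable M (\<lambda>x. (F.nrm (f x))\<^sup>2)"
  proof (rule Bochner_Integration.integrable_bound[OF assms(3)])
    show "(\<lambda>x. (F.nrm (f x))\<^sup>2) \<in> borel_measurable M" by (rule cvalued_measurable[OF assms(1)]) simp
    show "AE x in M. norm ((F.nrm (f x))\<^sup>2) \<le> norm (g x)" using assms(4) by (intro AE_I2) force
  qed
  then show ?thesis using assms by (simp add: VS_def)
qed

lemma cvalued_zero: "cvalued (\<lambda>x. 0)"
  unfolding cvalued_def by (rule exI[of _ "{0}"]) (auto simp: F.zero_mem)

lemma semi_inner_VS: "semi_inner VS ssc QS"
proof
  fix f g h :: "'x \<Rightarrow> 'k \<Rightarrow> complex" and c d :: complex
  show "0 \<in> VS"
  proof (rule VS_I[where g = "\<lambda>x. 0"])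
    show "cvalued 0" using cvalued_zero by (simp add: zero_fun_def)
  qed simp_all
  show "ssc c (f + g) = ssc c f + ssc c g" by (simp add: fun_eq_iff algebra_simps)
  show "ssc (c + d) f = ssc c f + ssc d f" by (simp add: fun_eq_iff algebra_simps)
  show "(\<lambda>x v. c * (d * f x v)) = ssc (c * d) f" by (simp add: fun_eq_iff)
  show "ssc 1 f = f" by simp
  assume f: "f \<in> VS"
  note fF = VS_Fin[OF f]
  show cf: "ssc c f \<in> VS"
  proof (rule VS_I[where g = "\<lambda>x. (cmod c)\<^sup>2 * (F.nrm (f x))\<^sup>2"])
    show "cvalued (ssc c f)"
      using cvalued_comb[OF VS_cvalued[OF f] VS_cvalued[OF f], of "\<lambda>a b. fsc c a"] F.sc_mem by simp
    show "ssc c f x = 0" if "x \<notin> space M" for x using f that by (simp add: VS_def fun_eq_iff)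
    show "integrable M (\<lambda>x. (cmod c)\<^sup>2 * (F.nrm (f x))\<^sup>2)" using VS_integrable[OF f] by simp
    show "(F.nrm (ssc c f x))\<^sup>2 \<le> (cmod c)\<^sup>2 * (F.nrm (f x))\<^sup>2" for x
      by (simp add: F.nrm_sc fF power_mult_distrib)
  qed
  show "0 \<le> Re (QS f f)"
    unfolding QS_def using integrable_q[OF f f] F.Q_nonneg[OF fF] by (simp flip: integral_Re)
  assume g: "g \<in> VS"
  note gF = VS_Fin[OF g]
  show fg: "f + g \<in> VS"
  proof (rule VS_I[where g = "\<lambda>x. 2 * ((F.nrm (f x))\<^sup>2 + (F.nrm (g x))\<^sup>2)"])
    show "cvalued (f + g)"
      using cvalued_comb[OF VS_cvalued[OF f] VS_cvalued[OF g], of "(+)"] F.add_mem by (simp add: plus_fun_def[where 'a = 'x])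
    show "(f + g) x = 0" if "x \<notin> space M" for x using f g that by (simp add: VS_def)
    show "integrable M (\<lambda>x. 2 * ((F.nrm (f x))\<^sup>2 + (F.nrm (g x))\<^sup>2))" using VS_integrable[OF f] VS_integrable[OF g] by simp
    show "(F.nrm ((f + g) x))\<^sup>2 \<le> 2 * ((F.nrm (f x))\<^sup>2 + (F.nrm (g x))\<^sup>2)" for x
    proof -
      have "(F.nrm ((f + g) x))\<^sup>2 \<le> (F.nrm (f x) + F.nrm (g x))\<^sup>2"
        using F.nrm_triangle[OF fF[of x] gF[of x]] F.nrm_nonneg[OF F.add_mem[OF fF[of x] gF[of x]]]
        by (intro power_mono) simp_all
      then show ?thesis using sum_squares_bound[of "F.nrm (f x)" "F.nrm (g x)"] by (simp add: power2_sum)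
    qed
  qed
  show "QS (ssc c f) g = c * QS f g"
    unfolding QS_def using F.Q_sc[OF fF gF] by simp
  show "QS g f = cnj (QS f g)"
    unfolding QS_def integral_cnj[symmetric] using F.Q_commute[OF fF gF] by (simp cong: Bochner_Integration.integral_cong)
  assume h: "h \<in> VS"
  show "QS (f + g) h = QS f h + QS g h"
    unfolding QS_def using F.Q_add[OF fF gF VS_Fin[OF h]] integrable_q f g h by simp
qed

sublocale S: semi_inner VS ssc QS by (rule semi_inner_VS)

lemma S_nrm: "f \<in> VS \<Longrightarrow> (S.nrm f)\<^sup>2 = (\<integral>x. (F.nrm (f x))\<^sup>2 \<partial>M)"
  unfolding S.nrm_square QS_def using integrable_q[of f f] F.nrm_square[OF VS_Fin]
  by (simp flip: integral_Re)

definition elem :: "'x set \<Rightarrow> complex \<Rightarrow> 'k \<Rightarrow> 'x \<Rightarrow> 'k \<Rightarrow> complex" where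
  "elem E c v = (\<lambda>x. if x \<in> E then fsc c (dl v base) else 0)"

lemma elem_cvalued:
  assumes "E \<in> sets M" "v \<in> I" shows "cvalued (elem E c v)"
  unfolding cvalued_def
proof (intro exI[of _ "{fsc c (dl v base), 0}"] conjI)
  show "{fsc c (dl v base), 0} \<subseteq> Fin" using F.sc_mem[OF dl_Fin[OF assms(2) base]] F.zero_mem by simp
  show "elem E c v \<in> measurable M (count_space {fsc c (dl v base), 0})"
    unfolding elem_def using assms(1) by (intro measurable_If_set) auto
qed simp

lemma elem_nrm2: "v \<in> I \<Longrightarrow> (F.nrm (elem E c v x))\<^sup>2 = (cmod c)\<^sup>2 * (2 * \<psi> v base) * indicator E x"
  using F.nrm_sc[OF dl_Fin[OF _ base], of v c] F.nrm_square[OF dl_Fin[OF _ base], of v] q_dl[OF _ base, of v]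
  by (simp add: elem_def power_mult_distrib indicator_def)

lemma elem_VS: 
  assumes "E \<in> sets M" "v \<in> I" shows "elem E c v \<in> VS"
proof (rule VS_I[where g = "\<lambda>x. (cmod c)\<^sup>2 * (2 * \<psi> v base) * indicator E x"])
  show "integrable M (\<lambda>x. (cmod c)\<^sup>2 * (2 * \<psi> v base) * indicator E x)"
    using assms by (intro integrable_mult_right integrable_real_indicator) (auto simp: less_top[symmetric])
qed (use assms elem_cvalued elem_nrm2 sets.sets_into_space[OF assms(1)] in \<open>auto simp: elem_def\<close>)

lemma elem_S_nrm: 
  assumes "E \<in> sets M" "v \<in> I" shows "(S.nrm (elem E c v))\<^sup>2 = (cmod c)\<^sup>2 * (2 * \<psi> v base) * measure M E"
proof -
  have "(S.nrm (elem E c v))\<^sup>2 = (\<integral>x. (cmod c)\<^sup>2 * (2 * \<psi> v base) * indicator E x \<partial>M)"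
    by (simp only: S_nrm[OF elem_VS[OF assms]] elem_nrm2[OF assms(2)])
  also have "\<dots> = (cmod c)\<^sup>2 * (2 * \<psi> v base) * measure M (E \<inter> space M)" by simp
  also have "E \<inter> space M = E" using sets.sets_into_space[OF assms(1)] by auto
  finally show ?thesis .
qed

definition rats :: "complex set" where "rats = (\<lambda>(a, b). Complex (of_rat a) (of_rat b)) ` UNIV"

text \<open>Simple functions over the countable generator with rational coefficients: the candidate
  for a countable dense set.\<close>

definition DS :: "('x \<Rightarrow> 'k \<Rightarrow> complex) set" where
  "DS = (\<lambda>L. sum_list (map (\<lambda>(E, c, v). elem E c v) L)) ` lists (\<G> \<times> rats \<times> I)"

lemma countable_DS: "countable DS"
  unfolding DS_def rats_def using \<G>(1) countable_I by (intro countable_image countable_lists countable_SIGMA) auto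

lemma \<G>_sets: "E \<in> \<G> \<Longrightarrow> E \<in> sets M"
  unfolding sets_M by blast

lemma DS_VS: "DS \<subseteq> VS"
proof -
  have "sum_list (map (\<lambda>(E, c, v). elem E c v) L) \<in> VS" if "L \<in> lists (\<G> \<times> rats \<times> I)" for L
    using that
  proof (induction L)
    case Nil
    show ?case by (simp only: list.map sum_list.Nil S.zero_mem)
  next
    case (Cons z L)
    obtain E c v where z: "z = (E, c, v)" by (cases z) auto
    have "E \<in> sets M" "v \<in> I" using Cons z \<G>_sets by auto
    then have "elem E c v + sum_list (map (\<lambda>(E, c, v). elem E c v) L) \<in> VS"
      by (intro S.add_mem elem_VS Cons.IH)
    then show ?case by (simp only: z list.map sum_list.Cons prod.case)
  qed
  then show ?thesis by (auto simp: DS_def)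
qed

definition cl :: "('x \<Rightarrow> 'k \<Rightarrow> complex) set" where
  "cl = {f \<in> VS. \<forall>e>0. \<exists>d\<in>DS. S.nrm (f - d) < e}"

lemma cl_VS: "f \<in> cl \<Longrightarrow> f \<in> VS" by (simp add: cl_def)

lemma DS_add: "\<lbrakk>d \<in> DS; d' \<in> DS\<rbrakk> \<Longrightarrow> d + d' \<in> DS"
proof -
  assume "d \<in> DS" "d' \<in> DS"
  then obtain L L' where "L \<in> lists (\<G> \<times> rats \<times> I)" "d = sum_list (map (\<lambda>(E, c, v). elem E c v) L)"
    "L' \<in> lists (\<G> \<times> rats \<times> I)" "d' = sum_list (map (\<lambda>(E, c, v). elem E c v) L')"
    by (auto simp: DS_def)
  then show ?thesis unfolding DS_def by (intro image_eqI[of _ _ "L @ L'"]) (auto simp: sum_list_append)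
qed

lemma cl_limit:
  assumes "f \<in> VS" "\<And>e. e > 0 \<Longrightarrow> \<exists>h\<in>cl. S.nrm (f - h) < e"
  shows "f \<in> cl"
  unfolding cl_def
proof (intro CollectI conjI allI impI)
  fix e :: real assume e: "e > 0"
  obtain h where h: "h \<in> cl" "S.nrm (f - h) < e / 2" using assms(2)[of "e/2"] e by auto
  obtain d where d: "d \<in> DS" "S.nrm (h - d) < e / 2" using h(1) half_gt_zero[OF e] unfolding cl_def by blast
  have "S.nrm (f - d) \<le> S.nrm (f - h) + S.nrm (h - d)"
    using S.nrm_triangle_diff assms(1) cl_VS[OF h(1)] d(1) DS_VS by blast
  then show "\<exists>d\<in>DS. S.nrm (f - d) < e" using d h by (intro bexI[of _ d]) simp_all
qed (rule assms(1))

lemma DS_cl: "d \<in> DS \<Longrightarrow> d \<in> cl"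
  using DS_VS S.nrm_zero unfolding cl_def by (auto intro!: bexI[of _ d])

lemma cl_add: assumes "f \<in> cl" "g \<in> cl" shows "f + g \<in> cl"
  unfolding cl_def
proof (intro CollectI conjI allI impI)
  show "f + g \<in> VS" using assms S.add_mem cl_VS by blast
  fix e :: real assume e: "e > 0"
  obtain d where d: "d \<in> DS" "S.nrm (f - d) < e / 2" using assms(1) half_gt_zero[OF e] unfolding cl_def by blast
  obtain d' where d': "d' \<in> DS" "S.nrm (g - d') < e / 2" using assms(2) half_gt_zero[OF e] unfolding cl_def by blast
  have "f - d \<in> VS" "g - d' \<in> VS" using S.diff_mem cl_VS assms d d' DS_VS by blast+
  then have "S.nrm ((f - d) + (g - d')) \<le> S.nrm (f - d) + S.nrm (g - d')" by (rule S.nrm_triangle)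
  then have "S.nrm ((f + g) - (d + d')) < e" unfolding add_diff_add using d(2) d'(2) by linarith
  then show "\<exists>d\<in>DS. S.nrm (f + g - d) < e" using DS_add[OF d(1) d'(1)] by blast
qed

lemma cl_zero: "0 \<in> cl"
proof (rule DS_cl)
  show "0 \<in> DS" unfolding DS_def by (rule image_eqI[of _ _ "[]"]) auto
qed

lemma cl_sum: "(\<And>i. i \<in> A \<Longrightarrow> f i \<in> cl) \<Longrightarrow> sum f A \<in> cl"
  by (induction A rule: infinite_finite_induct) (auto simp: cl_zero cl_add)

lemma elem_diff: "elem E c v - elem E c' v = elem E (c - c') v"
  by (auto simp: elem_def fun_eq_iff algebra_simps)

lemma rats_dense:
  assumes "e > 0" shows "\<exists>r\<in>rats. cmod (c - r) < e"
proof -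
  obtain a where a: "Re c - e / 2 < of_rat a" "of_rat a < Re c" using of_rat_dense[of "Re c - e / 2" "Re c"] assms by auto
  obtain b where b: "Im c - e / 2 < of_rat b" "of_rat b < Im c" using of_rat_dense[of "Im c - e / 2" "Im c"] assms by auto
  have "cmod (c - Complex (of_rat a) (of_rat b)) \<le> \<bar>Re c - of_rat a\<bar> + \<bar>Im c - of_rat b\<bar>"
    using cmod_le[of "c - Complex (of_rat a) (of_rat b)"] by simp
  also have "\<dots> < e" using a b by simp
  finally show ?thesis by (intro bexI[of _ "Complex (of_rat a) (of_rat b)"]) (auto simp: rats_def)
qed

text \<open>Dynkin's argument: for fixed \<open>v\<close>, the sets that work for all coefficients
  contain the intersection-stable generator and are closed under complements and countable disjoint
  unions. For unions, the measure of the part left over by the first n sets tends to 0.\<close>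

lemma elem_cl:
  assumes "E \<in> sets M" and v: "v \<in> I"
  shows "elem E c v \<in> cl"
proof -
  have "E \<in> sigma_sets (space M) \<G>" using assms(1) sets_M by simp
  then show ?thesis
  proof (induction arbitrary: c rule: sigma_sets_induct_disjoint[OF \<G>(3,2), consumes 1, case_names basic empty compl union])
    case (basic E)
    show ?case
    proof (rule cl_limit[OF elem_VS[OF \<G>_sets[OF basic] v]])
      fix e :: real assume e: "e > 0"
      \<comment> \<open>K is the norm of \<open>elem E 1 v\<close>, so rounding c to r costs |c - r|
        K. Dividing by K + 1 covers the case K = 0.\<close>
      define K where "K = sqrt (2 * \<psi> v base * measure M E)"
      have K: "K \<ge> 0" using \<psi>_nonneg[OF v base] by (simp add: K_def)
      obtain r where r: "r \<in> rats" "cmod (c - r) < e / (K + 1)" using rats_dense[of "e / (K + 1)" c] e K by auto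
      have "elem E r v \<in> DS" unfolding DS_def
        using basic r v by (intro image_eqI[of _ _ "[(E, r, v)]"]) auto
      moreover have "S.nrm (elem E c v - elem E r v) < e"
      proof -
        have "(S.nrm (elem E (c - r) v))\<^sup>2 = (cmod (c - r) * K)\<^sup>2"
          using elem_S_nrm[OF \<G>_sets[OF basic] v, of "c - r"] \<psi>_nonneg[OF v base] by (simp add: K_def power_mult_distrib)
        then have "S.nrm (elem E (c - r) v) = cmod (c - r) * K"
          using K S.nrm_nonneg[OF elem_VS[OF \<G>_sets[OF basic] v]] by (simp add: power2_eq_iff_nonneg)
        also have "\<dots> \<le> cmod (c - r) * (K + 1)" by (intro mult_left_mono) auto
        also have "\<dots> < e / (K + 1) * (K + 1)" using r K by (intro mult_strict_right_mono) auto
        finally show ?thesis using K by (simp add: elem_diff)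
      qed
      ultimately show "\<exists>h\<in>cl. S.nrm (elem E c v - h) < e" using DS_cl by blast
    qed
  next
    case empty
    have "elem {} c v = 0" by (simp add: elem_def fun_eq_iff)
    then show ?case by (simp only: cl_zero)
  next
    case (compl E)
    have sp: "elem (space M) c v \<in> cl"
    proof (rule cl_limit[OF elem_VS[OF sets.top v]])
      fix e :: real assume e: "e > 0"
      define K where "K = sqrt (2 * \<psi> v base * measure M (space M))"
      have K: "K \<ge> 0" using \<psi>_nonneg[OF v base] by (simp add: K_def)
      obtain r where r: "r \<in> rats" "cmod (c - r) < e / (K + 1)" using rats_dense[of "e / (K + 1)" c] e K by auto
      have "elem (space M) r v \<in> DS" unfolding DS_def
        using \<G>(4) r v by (intro image_eqI[of _ _ "[(space M, r, v)]"]) auto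
      moreover have "S.nrm (elem (space M) c v - elem (space M) r v) < e"
      proof -
        have "(S.nrm (elem (space M) (c - r) v))\<^sup>2 = (cmod (c - r) * K)\<^sup>2"
          using elem_S_nrm[OF sets.top v, of "c - r"] \<psi>_nonneg[OF v base] by (simp add: K_def power_mult_distrib)
        then have "S.nrm (elem (space M) (c - r) v) = cmod (c - r) * K"
          using K S.nrm_nonneg[OF elem_VS[OF sets.top v]] by (simp add: power2_eq_iff_nonneg)
        also have "\<dots> \<le> cmod (c - r) * (K + 1)" by (intro mult_left_mono) auto
        also have "\<dots> < e / (K + 1) * (K + 1)" using r K by (intro mult_strict_right_mono) auto
        finally show ?thesis using K by (simp add: elem_diff)
      qed
      ultimately show "\<exists>h\<in>cl. S.nrm (elem (space M) c v - h) < e" using DS_cl by blast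
    qed
    have "E \<subseteq> space M" using compl.hyps sets.sets_into_space sets_M by blast
    then have "elem (space M - E) c v = elem (space M) c v + elem E (- c) v"
      by (auto simp: elem_def fun_eq_iff)
    then show ?case by (simp only: cl_add[OF sp compl.IH])
  next
    case (union A)
    have As: "A i \<in> sets M" for i using union.hyps sets_M by auto
    have U: "(\<Union>i. A i) \<in> sets M" using As by auto
    show ?case
    proof (rule cl_limit[OF elem_VS[OF U v]])
      fix e :: real assume e: "e > 0"
      define R where "R n = (\<Union>i. A i) - (\<Union>i<n. A i)" for n
      have Rs: "R n \<in> sets M" for n using As by (auto simp: R_def)
      have eq: "elem (\<Union>i. A i) c v - (\<Sum>i<n. elem (A i) c v) = elem (R n) c v" for n
      proof (intro ext)
        fix x y
        have s: "(\<Sum>i<n. elem (A i) c v) x y = (\<Sum>i<n. elem (A i) c v x y)" by (induction n) auto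
        show "(elem (\<Union>i. A i) c v - (\<Sum>i<n. elem (A i) c v)) x y = elem (R n) c v x y"
        proof (cases "\<exists>i<n. x \<in> A i")
          case True
          then obtain i where i: "i < n" "x \<in> A i" by blast
          have out: "x \<notin> A j" if "j \<noteq> i" for j
            using disjoint_family_onD[OF union.hyps(1), of i j] i(2) that by blast
          have "elem (A j) c v x y = (if j = i then fsc c (dl v base) y else 0)" for j
          proof (cases "j = i")
            case True
            then show ?thesis using i(2) unfolding elem_def by simp
          next
            case False
            then show ?thesis using out[OF False] unfolding elem_def by (simp only: if_False zero_fun_apply)
          qed
          then have "(\<Sum>j<n. elem (A j) c v x y) = (\<Sum>j<n. if j = i then fsc c (dl v base) y else 0)"
            by (simp only:)
          also have "\<dots> = fsc c (dl v base) y" using i by simp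
          finally have "(\<Sum>j<n. elem (A j) c v x y) = fsc c (dl v base) y" .
          moreover have "x \<in> (\<Union>i. A i)" "x \<notin> R n" using i by (auto simp: R_def)
          ultimately show ?thesis unfolding minus_apply s by (simp add: elem_def)
        next
          case False
          then have "(\<Sum>j<n. elem (A j) c v x y) = 0" by (intro sum.neutral) (auto simp: elem_def)
          moreover have "x \<in> R n \<longleftrightarrow> x \<in> (\<Union>i. A i)" using False by (auto simp: R_def)
          ultimately show ?thesis unfolding minus_apply s by (simp add: elem_def)
        qed
      qed
      have "(\<lambda>n. measure M (R n)) \<longlonglongrightarrow> measure M (\<Inter>n. R n)"
        using Rs by (intro finite_Lim_measure_decseq) (auto simp: decseq_def R_def)
      moreover have "(\<Inter>n. R n) = {}" by (auto simp: R_def)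
      ultimately have "(\<lambda>n. (cmod c)\<^sup>2 * (2 * \<psi> v base) * measure M (R n)) \<longlonglongrightarrow> (cmod c)\<^sup>2 * (2 * \<psi> v base) * 0"
        by (intro tendsto_mult tendsto_const) simp
      then have "\<forall>\<^sub>F n in sequentially. (cmod c)\<^sup>2 * (2 * \<psi> v base) * measure M (R n) < e\<^sup>2"
        using e by (intro order_tendstoD(2)) auto
      then obtain n where "(S.nrm (elem (R n) c v))\<^sup>2 < e\<^sup>2"
        unfolding elem_S_nrm[OF Rs v] by (auto simp: eventually_sequentially)
      then have "S.nrm (elem (R n) c v) < e" by (rule power_less_imp_less_base) (use e in simp)
      then show "\<exists>h\<in>cl. S.nrm (elem (\<Union>i. A i) c v - h) < e"
        unfolding eq[symmetric] by (rule bexI[where x = "\<Sum>i<n. elem (A i) c v"]) (rule cl_sum, rule union.IH)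
    qed
  qed
qed

text \<open>The function is split along its nonzero values, and each value is split by
  \<open>Fin_expand\<close> into differences of point masses.\<close>

lemma finite_valued_cl:
  assumes f: "f \<in> VS" and A: "finite A" "\<And>x. x \<in> space M \<Longrightarrow> f x \<noteq> 0 \<Longrightarrow> f x \<in> A"
  shows "f \<in> cl"
proof -
  let ?A = "A \<inter> Fin - {0}"
  define E where "E a = {x \<in> space M. f x = a}" for a
  have Es: "E a \<in> sets M" for a
  proof -
    have "(\<lambda>x. f x = a) \<in> measurable M (count_space UNIV)"
      by (rule cvalued_measurable[OF VS_cvalued[OF f]]) simp
    then show ?thesis unfolding E_def by measurable
  qed
  have "f = (\<Sum>a\<in>?A. \<Sum>v\<in>supp a. elem (E a) (a v) v)"
  proof
    fix x
    have ap: "(\<Sum>a\<in>?A. \<Sum>v\<in>supp a. elem (E a) (a v) v) x = (\<Sum>a\<in>?A. \<Sum>v\<in>supp a. elem (E a) (a v) v x)"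
      by (simp only: sum_fun_apply)
    have in1: "(\<Sum>v\<in>supp a. elem (E a) (a v) v x) = (if x \<in> E a then a else 0)" if "a \<in> ?A" for a
    proof (cases "x \<in> E a")
      case True
      then show ?thesis using Fin_expand[of a base] that base by (simp add: elem_def)
    qed (simp add: elem_def)
    have "(\<Sum>a\<in>?A. \<Sum>v\<in>supp a. elem (E a) (a v) v) x = (\<Sum>a\<in>?A. if x \<in> E a then a else 0)"
      unfolding ap by (intro sum.cong refl in1)
    also have "\<dots> = f x"
    proof (cases "x \<in> space M")
      case True
      have "(\<Sum>a\<in>?A. if x \<in> E a then a else 0) = (\<Sum>a\<in>?A. if a = f x then a else 0)"
        using True by (intro sum.cong) (auto simp: E_def)
      also have "\<dots> = (if f x \<in> ?A then f x else 0)" using A(1) by (simp add: sum.delta)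
      also have "\<dots> = f x" using A(2)[OF True] VS_Fin[OF f, of x] by auto
      finally show ?thesis .
    next
      case False
      then show ?thesis using f by (simp add: E_def VS_def)
    qed
    finally show "f x = (\<Sum>a\<in>?A. \<Sum>v\<in>supp a. elem (E a) (a v) v) x" by simp
  qed
  moreover have "(\<Sum>a\<in>?A. \<Sum>v\<in>supp a. elem (E a) (a v) v) \<in> cl"
  proof (intro cl_sum elem_cl Es)
    fix a v assume "a \<in> ?A" "v \<in> supp a"
    then show "v \<in> I" using FinD(2)[of a] by auto
  qed
  ultimately show ?thesis by simp
qed

text \<open>Only the first n of the countably many values are kept; dominated convergence, with the
  squared norm of \<open>f\<close> as bound, shows that these truncations converge.\<close>

lemma VS_cl: 
  assumes f: "f \<in> VS" shows "f \<in> cl"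
proof (rule cl_limit[OF f])
  fix e :: real assume e: "e > 0"
  obtain A where A: "countable A" "A \<subseteq> Fin" "f \<in> measurable M (count_space A)"
    using VS_cvalued[OF f] unfolding cvalued_def by blast
  define P where "P n = insert 0 (from_nat_into (insert 0 A) ` {..n})" for n
  define fn where "fn n = (\<lambda>x. if f x \<in> P n then f x else 0)" for n
  have fle: "F.nrm (fn n x) \<le> F.nrm (f x)" "F.nrm (f x - fn n x) \<le> F.nrm (f x)" for n x
    using F.nrm_nonneg[OF VS_Fin[OF f]] by (auto simp: fn_def)
  have fnV: "fn n \<in> VS" for n
  proof (rule VS_I[OF _ _ VS_integrable[OF f]])
    show "cvalued (fn n)"
      unfolding fn_def using cvalued_comb[OF VS_cvalued[OF f] VS_cvalued[OF f], of "\<lambda>a b. if a \<in> P n then a else 0"] F.zero_mem by simp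
    show "fn n x = 0" if "x \<notin> space M" for x using f that by (simp add: fn_def VS_def)
    show "(F.nrm (fn n x))\<^sup>2 \<le> (F.nrm (f x))\<^sup>2" for x
      using fle F.nrm_nonneg[OF VS_Fin[OF f]] by (intro power_mono) (auto simp: fn_def)
  qed
  have fn_cl: "fn n \<in> cl" for n
    by (rule finite_valued_cl[OF fnV, of "P n"]) (auto simp: P_def fn_def)
  have dV: "f - fn n \<in> VS" for n using S.diff_mem f fnV by blast
  have "(\<lambda>n. \<integral>x. (F.nrm (f x - fn n x))\<^sup>2 \<partial>M) \<longlonglongrightarrow> (\<integral>x. 0 \<partial>M)"
  proof (rule integral_dominated_convergence)
    show "integrable M (\<lambda>x. (F.nrm (f x))\<^sup>2)" by (rule VS_integrable[OF f])
    show "(\<lambda>x. (F.nrm (f x - fn n x))\<^sup>2) \<in> borel_measurable M" for n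
      using VS_integrable[OF dV[of n]] by simp
    show "AE x in M. (\<lambda>n. (F.nrm (f x - fn n x))\<^sup>2) \<longlonglongrightarrow> 0"
    proof (rule AE_I2)
      fix x assume "x \<in> space M"
      then have "f x \<in> insert 0 A" using measurable_space[OF A(3)] by auto
      then obtain k where k: "from_nat_into (insert 0 A) k = f x"
        using from_nat_into_surj[of "insert 0 A" "f x"] A(1) by auto
      have "f x \<in> P n" if "n \<ge> k" for n
        unfolding P_def k[symmetric] using that by blast
      then have "(F.nrm (f x - fn n x))\<^sup>2 = 0" if "n \<ge> k" for n
        using that by (simp add: fn_def)
      then have "\<forall>\<^sub>F n in sequentially. (F.nrm (f x - fn n x))\<^sup>2 = 0"
        unfolding eventually_sequentially by blast
      then show "(\<lambda>n. (F.nrm (f x - fn n x))\<^sup>2) \<longlonglongrightarrow> 0" by (rule tendsto_eventually)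
    qed
    show "AE x in M. norm ((F.nrm (f x - fn n x))\<^sup>2) \<le> (F.nrm (f x))\<^sup>2" for n
      using fle(2) F.nrm_nonneg[OF VS_Fin[OF dV[of n]]] by (intro AE_I2) (auto intro!: power_mono)
  qed simp
  then have "\<forall>\<^sub>F n in sequentially. (\<integral>x. (F.nrm (f x - fn n x))\<^sup>2 \<partial>M) < e\<^sup>2"
    using e by (intro order_tendstoD(2)) auto
  then obtain n where "(\<integral>x. (F.nrm (f x - fn n x))\<^sup>2 \<partial>M) < e\<^sup>2" by (auto simp: eventually_sequentially)
  then have "(S.nrm (f - fn n))\<^sup>2 < e\<^sup>2" by (simp add: S_nrm[OF dV])
  then have "S.nrm (f - fn n) < e" by (rule power_less_imp_less_base) (use e in simp)
  then show "\<exists>h\<in>cl. S.nrm (f - h) < e" using fn_cl by blast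
qed

lemma DS_dense: "\<lbrakk>f \<in> VS; e > 0\<rbrakk> \<Longrightarrow> \<exists>d\<in>DS. S.nrm (f - d) < e"
  using VS_cl by (auto simp: cl_def)

end

text \<open>The projection is open, so the images of a countable base of the group form a countable
  base of the coset space. Finite intersections make it intersection-stable, and the empty one
  contributes the whole space.\<close>

lemma (in lcsc_lattice) ex_generator:
  "\<exists>\<G>. countable \<G> \<and> \<G> \<subseteq> Pow X \<and> Int_stable \<G> \<and> X \<in> \<G> \<and> sets \<mu> = sigma_sets X \<G>"
proof -
  obtain \<B> where B: "countable \<B>" "\<And>B. B \<in> \<B> \<Longrightarrow> openin T B"
    "\<And>U x. \<lbrakk>openin T U; x \<in> U\<rbrakk> \<Longrightarrow> \<exists>B\<in>\<B>. x \<in> B \<and> B \<subseteq> U"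
    by (rule second_countable_base[OF second_countable]) blast
  define \<A> where "\<A> = (\<lambda>B. p ` B) ` \<B>"
  define \<G> where "\<G> = (\<lambda>F. X \<inter> \<Inter>F) ` {F. finite F \<and> F \<subseteq> \<A>}"
  have \<A>: "countable \<A>" "\<And>A. A \<in> \<A> \<Longrightarrow> openin (coset_topology G T \<Gamma>) A"
    using B(1,2) p_image_open by (auto simp: \<A>_def)
  have \<A>X: "A \<subseteq> X" if "A \<in> \<A>" for A using openin_subset[OF \<A>(2)[OF that]] by (simp add: topspace_coset_topology)
  have 1: "countable \<G>"
    unfolding \<G>_def using countable_Collect_finite_subset[OF \<A>(1)] by (intro countable_image)
  have 2: "\<G> \<subseteq> Pow X" by (auto simp: \<G>_def)
  have 3: "Int_stable \<G>"
  proof (rule Int_stableI)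
    fix a b assume "a \<in> \<G>" "b \<in> \<G>"
    then obtain F F' where F: "finite F" "F \<subseteq> \<A>" "a = X \<inter> \<Inter>F" and F': "finite F'" "F' \<subseteq> \<A>" "b = X \<inter> \<Inter>F'"
      by (auto simp: \<G>_def)
    show "a \<inter> b \<in> \<G>"
      unfolding \<G>_def by (rule image_eqI[of _ _ "F \<union> F'"]) (use F F' in auto)
  qed
  have 4: "X \<in> \<G>" unfolding \<G>_def by (rule image_eqI[of _ _ "{}"]) auto
  have "\<G> \<subseteq> sets BX"
  proof
    fix a assume "a \<in> \<G>"
    then obtain F where F: "finite F" "F \<subseteq> \<A>" "a = X \<inter> \<Inter>F" by (auto simp: \<G>_def)
    have "X \<inter> \<Inter>F \<in> sets BX"
      using F(1,2)
    proof (induction F)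
      case empty
      then show ?case using sets.top[of BX] by (simp add: topspace_coset_topology)
    next
      case (insert A F)
      have "X \<inter> \<Inter>(insert A F) = A \<inter> (X \<inter> \<Inter>F)" by blast
      then show ?case using insert \<A>(2)[of A] by (auto intro: openin_sets_borel_of)
    qed
    then show "a \<in> sets BX" using F by simp
  qed
  then have "sigma_sets X \<G> \<subseteq> sets BX"
    using sets.sigma_sets_subset[of \<G> BX] by (simp add: topspace_coset_topology)
  moreover have "sets BX \<subseteq> sigma_sets X \<G>"
    unfolding sets_borel_of topspace_coset_topology
  proof (rule sigma_sets_mono, rule subsetI)
    fix \<U> assume "\<U> \<in> {U. openin (coset_topology G T \<Gamma>) U}"
    then have U: "\<U> \<subseteq> X" "openin T (\<Union>\<U>)" by (auto simp: openin_coset_topology)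
    have "\<U> = \<Union>{A \<in> \<A>. A \<subseteq> \<U>}"
    proof (intro equalityI subsetI)
      fix C assume C: "C \<in> \<U>"
      then obtain x where x: "x \<in> carrier G" "C = p x" using X_cases U(1) by blast
      have "x \<in> \<Union>\<U>" using C x mem_p_self by blast
      then obtain B' where B': "B' \<in> \<B>" "x \<in> B'" "B' \<subseteq> \<Union>\<U>" using B(3)[OF U(2)] by blast
      have "p ` B' \<subseteq> \<U>"
      proof
        fix D assume "D \<in> p ` B'"
        then obtain y E where "y \<in> B'" "D = p y" "E \<in> \<U>" "y \<in> E" using B'(3) by blast
        then show "D \<in> \<U>" using X_eq_p[of E y] U(1) by (metis subsetD)
      qed
      then show "C \<in> \<Union>{A \<in> \<A>. A \<subseteq> \<U>}" using B' x by (auto simp: \<A>_def)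
    qed blast
    moreover have "\<Union>{A \<in> \<A>. A \<subseteq> \<U>} \<in> sigma_sets X \<G>"
    proof (rule sigma_sets_UNION)
      show "countable {A \<in> \<A>. A \<subseteq> \<U>}" using \<A>(1) by (rule countable_Collect)
      fix A assume "A \<in> {A \<in> \<A>. A \<subseteq> \<U>}"
      then have "A \<in> \<A>" by simp
      then have "A \<in> \<G>" unfolding \<G>_def using \<A>X by (intro image_eqI[of _ _ "{A}"]) auto
      then show "A \<in> sigma_sets X \<G>" by blast
    qed
    ultimately show "\<U> \<in> sigma_sets X \<G>" by simp
  qed
  ultimately have "sets \<mu> = sigma_sets X \<G>" using \<mu>(1) by blast
  then show ?thesis using 1 2 3 4 by blast
qed

section \<open>Induction of an almost action by isometries\<close>

text \<open>Each \<open>A \<gamma>\<close> permutes \<open>I\<close> and preserves \<psi>, but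
  nothing is said about products. How far \<open>A\<close> is from an action enters only in
  \<open>BB_quasi_cocycle\<close>.\<close>

locale induced = lcsc_lattice G T \<Gamma> + kernel_sections I \<psi> "lcsc_lattice.\<mu> G T \<Gamma>" base \<G>
  for G :: "('a, 'm) monoid_scheme" (structure) and T \<Gamma> and I :: "'k set" and \<psi> base \<G> +
  fixes A A' :: "'a \<Rightarrow> 'k \<Rightarrow> 'k"
  assumes kernel_pair: "\<gamma> \<in> \<Gamma> \<Longrightarrow> kernel_pair (A \<gamma>) (A' \<gamma>)"
begin

text \<open>The common shape of the induced operators and of their inverses; \<open>P\<close> will
  be a family of isometries of \<open>Fin\<close>.\<close>

definition twist :: "('a \<Rightarrow> ('k \<Rightarrow> complex) \<Rightarrow> ('k \<Rightarrow> complex)) \<Rightarrow> 'a \<Rightarrow> ('a set \<Rightarrow> 'k \<Rightarrow> complex) \<Rightarrow> 'a set \<Rightarrow> 'k \<Rightarrow> complex" where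
  "twist P h f = (\<lambda>C. if C \<in> X then P (\<kappa> h C) (f (act h C)) else 0)"

lemma measurable_\<kappa>_\<mu>: "h \<in> carrier G \<Longrightarrow> (\<lambda>C. \<kappa> h C) \<in> measurable \<mu> (count_space \<Gamma>)"
  unfolding measurable_\<mu>_eq by (rule measurable_\<kappa>) (simp_all add: topspace_eq)

lemma measurable_\<mu>_if: 
  "f \<in> measurable \<mu> N \<Longrightarrow> (\<lambda>C. if C \<in> X then f C else a) \<in> measurable \<mu> N"
  by (subst measurable_cong[where g = f]) (auto simp: space_\<mu>)

lemma twist_VS:
  assumes P: "\<And>\<gamma>. \<gamma> \<in> \<Gamma> \<Longrightarrow> F.isometry_pair (P \<gamma>) (P' \<gamma>)" and h: "h \<in> carrier G" and f: "f \<in> VS"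
  shows "twist P h f \<in> VS"
proof -
  note iso = F.isometry_pairD[OF P]
  have cv: "cvalued (twist P h f)"
  proof -
    obtain D where D: "countable D" "D \<subseteq> Fin" "f \<in> measurable \<mu> (count_space D)"
      using VS_cvalued[OF f] unfolding cvalued_def by blast
    let ?D = "(\<lambda>(a, b). P a b) ` (\<Gamma> \<times> D)"
    have "(\<lambda>C. P (\<kappa> h C) (f (act h C))) \<in> measurable \<mu> (count_space ?D)"
      by (rule measurable_count_space_image[OF countable_\<Gamma> measurable_\<kappa>_\<mu>[OF h] measurable_compose[OF measurable_act_\<mu>[OF h] D(3)] D(1)])
    then have "twist P h f \<in> measurable \<mu> (count_space ?D)"
      unfolding twist_def by (rule measurable_\<mu>_if)
    moreover have "countable ?D" using countable_\<Gamma> D(1) by auto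
    moreover have "?D \<subseteq> Fin" using iso(1) D(2) by auto
    ultimately show ?thesis unfolding cvalued_def by blast
  qed
  have int: "integrable \<mu> (\<lambda>C. (F.nrm (f (act h C)))\<^sup>2)"
    using integrable_distr[OF measurable_act_\<mu>[OF h], of "\<lambda>C. (F.nrm (f C))\<^sup>2"] VS_integrable[OF f] by (simp add: distr_act[OF h])
  show ?thesis
    by (rule VS_I[OF cv _ int]) (auto simp: twist_def space_\<mu> iso(9)[OF \<kappa>_\<Gamma>[OF h] VS_Fin[OF f]])
qed

lemma twist_QS:
  assumes P: "\<And>\<gamma>. \<gamma> \<in> \<Gamma> \<Longrightarrow> F.isometry_pair (P \<gamma>) (P' \<gamma>)" and h: "h \<in> carrier G" and f: "f \<in> VS" and g: "g \<in> VS"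
  shows "QS (twist P h f) (twist P h g) = QS f g"
proof -
  note iso = F.isometry_pairD[OF P]
  have "QS (twist P h f) (twist P h g) = (\<integral>C. q (f (act h C)) (g (act h C)) \<partial>\<mu>)"
    unfolding QS_def
    by (rule Bochner_Integration.integral_cong) (auto simp: twist_def space_\<mu> iso(7)[OF \<kappa>_\<Gamma>[OF h] VS_Fin[OF f] VS_Fin[OF g]])
  also have "\<dots> = (\<integral>C. q (f C) (g C) \<partial>distr \<mu> \<mu> (act h))"
    by (rule integral_distr[OF measurable_act_\<mu>[OF h], symmetric])
       (rule borel_measurable_integrable[OF integrable_q[OF f g]])
  finally show ?thesis by (simp add: distr_act[OF h] QS_def)
qed

text \<open>Induced representation. \<open>push\<close> takes the inverse permutation as argument,
  so the value at \<open>C\<close> is the push-forward of \<open>f (act (inv g) C)\<close> under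
  \<open>A\<close> of \<open>inv (\<kappa> (inv g) C)\<close>, and this element of \<Gamma> equals
  \<open>\<kappa> g (act (inv g) C)\<close>. Multiplicativity in \<open>g\<close> is lost together
  with that of \<open>A\<close>.\<close>

definition TT :: "'a \<Rightarrow> ('a set \<Rightarrow> 'k \<Rightarrow> complex) \<Rightarrow> ('a set \<Rightarrow> 'k \<Rightarrow> complex)" where
  "TT g = twist (\<lambda>\<gamma>. push (A' (inv \<gamma>))) (inv g)"

definition TT' :: "'a \<Rightarrow> ('a set \<Rightarrow> 'k \<Rightarrow> complex) \<Rightarrow> ('a set \<Rightarrow> 'k \<Rightarrow> complex)" where
  "TT' g = twist (\<lambda>\<gamma>. push (A \<gamma>)) g"

lemma push_A': "\<gamma> \<in> \<Gamma> \<Longrightarrow> F.isometry_pair (push (A' (inv \<gamma>))) (push (A (inv \<gamma>)))"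
  by (rule push_isometry[OF kernel_pair]) (rule \<Gamma>_closed)

lemma push_A: "\<gamma> \<in> \<Gamma> \<Longrightarrow> F.isometry_pair (push (A \<gamma>)) (push (A' \<gamma>))"
  by (rule F.isometry_pair_sym[OF push_isometry[OF kernel_pair]])

lemma \<kappa>_inverse:
  assumes g: "g \<in> carrier G" and C: "C \<in> X"
  shows "\<kappa> g (act (inv g) C) = inv (\<kappa> (inv g) C)" "\<kappa> (inv g) (act g C) = inv (\<kappa> g C)"
proof -
  have gen: "\<kappa> h (act (inv h) C) = inv (\<kappa> (inv h) C)" if h: "h \<in> carrier G" for h
  proof -
    have "\<kappa> h (act (inv h) C) \<otimes> \<kappa> (inv h) C = \<one>" using \<kappa>_mult[OF h inv_closed[OF h] C] \<kappa>_one[OF C] h by simp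
    moreover have "\<kappa> h (act (inv h) C) \<in> carrier G" "\<kappa> (inv h) C \<in> carrier G"
      using \<kappa>_\<Gamma> \<Gamma>_carrier h C act_X by auto
    ultimately show ?thesis by (metis inv_equality)
  qed
  show "\<kappa> g (act (inv g) C) = inv (\<kappa> (inv g) C)" by (rule gen[OF g])
  show "\<kappa> (inv g) (act g C) = inv (\<kappa> g C)" using gen[OF inv_closed[OF g]] g by simp
qed

text \<open>\<open>A\<close> need not be multiplicative, yet \<open>TT g\<close> is invertible: by
  \<open>\<kappa>_inverse\<close>, \<open>TT g\<close> and \<open>TT' g\<close> use one and the same
  element of \<Gamma> at corresponding points, so a permutation meets its own inverse and
  cancels.\<close>

lemma TT_isometry:
  assumes g: "g \<in> carrier G" shows "S.isometry_pair (TT g) (TT' g)"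
  unfolding S.isometry_pair_def
proof (intro conjI ballI allI)
  have ig: "inv g \<in> carrier G" using g by simp
  fix f assume f: "f \<in> VS"
  note fF = VS_Fin[OF f] and P = F.isometry_pairD[OF push_A'] and P' = F.isometry_pairD[OF push_A]
  show "TT g f \<in> VS" unfolding TT_def by (rule twist_VS[OF push_A' ig f])
  show "TT' g f \<in> VS" unfolding TT'_def by (rule twist_VS[OF push_A g f])
  show "TT g (TT' g f) = f"
  proof
    fix C
    show "TT g (TT' g f) C = f C"
    proof (cases "C \<in> X")
      case True
      have k: "\<kappa> (inv g) C \<in> \<Gamma>" by (rule \<kappa>_\<Gamma>[OF ig True])
      have "TT g (TT' g f) C = push (A' (inv (\<kappa> (inv g) C))) (push (A (inv (\<kappa> (inv g) C))) (f C))"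
        using True act_X[OF ig True] act_act[OF g ig True] act_one[OF True] g
        by (simp add: TT_def TT'_def twist_def \<kappa>_inverse(1)[OF g True])
      then show ?thesis using P(3)[OF k fF] by simp
    qed (use f in \<open>simp add: TT_def twist_def VS_def space_\<mu>\<close>)
  qed
  show "TT' g (TT g f) = f"
  proof
    fix C
    show "TT' g (TT g f) C = f C"
    proof (cases "C \<in> X")
      case True
      have k: "\<kappa> g C \<in> \<Gamma>" by (rule \<kappa>_\<Gamma>[OF g True])
      have "TT' g (TT g f) C = push (A (\<kappa> g C)) (push (A' (\<kappa> g C)) (f C))"
        using True act_X[OF g True] act_act[OF ig g True] act_one[OF True] g k \<Gamma>_carrier
        by (simp add: TT_def TT'_def twist_def \<kappa>_inverse(2)[OF g True])
      then show ?thesis using P'(3)[OF k fF] by simp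
    qed (use f in \<open>simp add: TT'_def twist_def VS_def space_\<mu>\<close>)
  qed
  show "TT g (ssc c f) = ssc c (TT g f)" for c
  proof
    fix C show "TT g (ssc c f) C = ssc c (TT g f) C"
      using P(8)[OF \<kappa>_\<Gamma>[OF ig] fF, of C c] by (simp add: TT_def twist_def fun_eq_iff)
  qed
  fix f' assume f': "f' \<in> VS"
  show "TT g (f + f') = TT g f + TT g f'"
  proof
    fix C show "TT g (f + f') C = (TT g f + TT g f') C"
      using P(5)[OF \<kappa>_\<Gamma>[OF ig] fF VS_Fin[OF f'], of C] by (simp add: TT_def twist_def)
  qed
  show "QS (TT g f) (TT g f') = QS f f'" unfolding TT_def by (rule twist_QS[OF push_A' ig f f'])
qed

text \<open>The induced orbit map: at each coset the base point is moved by the same element of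
  \<Gamma> as in \<open>TT g\<close>. Taking the formal difference with the base point puts the
  value into \<open>Fin\<close>.\<close>

definition BB :: "'a \<Rightarrow> 'a set \<Rightarrow> 'k \<Rightarrow> complex" where
  "BB g = (\<lambda>C. if C \<in> X then dl (A (inv (\<kappa> (inv g) C)) base) base else 0)"

lemma A_I: "\<lbrakk>\<gamma> \<in> \<Gamma>; v \<in> I\<rbrakk> \<Longrightarrow> A \<gamma> v \<in> I"
  using kernel_pair by (simp add: kernel_pair_def)

lemma BB_cvalued: 
  assumes g: "g \<in> carrier G" shows "cvalued (BB g)"
proof -
  let ?D = "(\<lambda>\<gamma>. dl (A (inv \<gamma>) base) base) ` \<Gamma>"
  have "(\<lambda>C. dl (A (inv (\<kappa> (inv g) C)) base) base) \<in> measurable \<mu> (count_space ?D)"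
    by (rule measurable_count_space_compose[OF measurable_\<kappa>_\<mu>, where h = "\<lambda>\<gamma>. dl (A (inv \<gamma>) base) base"]) (use g in auto)
  then have "BB g \<in> measurable \<mu> (count_space ?D)" unfolding BB_def by (rule measurable_\<mu>_if)
  moreover have "?D \<subseteq> Fin" using dl_Fin A_I base \<Gamma>_closed by auto
  ultimately show ?thesis using countable_\<Gamma> unfolding cvalued_def by (intro exI[of _ ?D]) simp
qed

lemma F_nrm_dl: "\<lbrakk>v \<in> I; w \<in> I\<rbrakk> \<Longrightarrow> (F.nrm (dl v w))\<^sup>2 = 2 * \<psi> v w"
  by (simp add: F.nrm_square[OF dl_Fin] q_dl)

lemma BB_nrm: "\<lbrakk>g \<in> carrier G; C \<in> X\<rbrakk> \<Longrightarrow> (F.nrm (BB g C))\<^sup>2 = 2 * \<psi> (A (inv (\<kappa> (inv g) C)) base) base"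
  using F_nrm_dl[OF A_I base] base \<kappa>_\<Gamma>[of "inv g" C] \<Gamma>_closed by (simp add: BB_def)

lemma BB_VS:
  assumes "g \<in> carrier G" "integrable \<mu> (\<lambda>C. \<psi> (A (inv (\<kappa> (inv g) C)) base) base)"
  shows "BB g \<in> VS"
  by (rule VS_I[OF BB_cvalued[OF assms(1)], where g = "\<lambda>C. 2 * \<psi> (A (inv (\<kappa> (inv g) C)) base) base"])
     (use assms BB_nrm in \<open>auto simp: BB_def space_\<mu>\<close>)

lemma BB_S_nrm:
  assumes "g \<in> carrier G" "BB g \<in> VS"
  shows "(S.nrm (BB g))\<^sup>2 = 2 * (\<integral>C. \<psi> (A (inv (\<kappa> (inv g) C)) base) base \<partial>\<mu>)"
proof -
  have "(S.nrm (BB g))\<^sup>2 = (\<integral>C. 2 * \<psi> (A (inv (\<kappa> (inv g) C)) base) base \<partial>\<mu>)"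
    unfolding S_nrm[OF assms(2)] by (rule Bochner_Integration.integral_cong) (auto simp: space_\<mu> BB_nrm assms(1))
  then show ?thesis by simp
qed

text \<open>The cocycle identity writes the element of \<Gamma> belonging to g h as a product
  \<alpha> \<beta>. Point by point the three terms then telescope to the formal difference of
  \<open>A (\<alpha> \<otimes> \<beta>) base\<close> and \<open>A \<alpha> (A \<beta> base)\<close>,
  whose squared norm is 2 \<psi>.\<close>

lemma BB_quasi_cocycle:
  assumes g: "g \<in> carrier G" and h: "h \<in> carrier G" and BB: "\<And>x. x \<in> carrier G \<Longrightarrow> BB x \<in> VS"
    and c: "\<And>\<alpha> \<beta>. \<lbrakk>\<alpha> \<in> \<Gamma>; \<beta> \<in> \<Gamma>\<rbrakk> \<Longrightarrow> \<psi> (A (\<alpha> \<otimes> \<beta>) base) (A \<alpha> (A \<beta> base)) \<le> c"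
  shows "(S.nrm (BB (g \<otimes> h) - BB g - TT g (BB h)))\<^sup>2 \<le> 2 * c * measure \<mu> X"
proof -
  have gh: "g \<otimes> h \<in> carrier G" "inv g \<in> carrier G" "inv h \<in> carrier G" using g h by auto
  let ?D = "BB (g \<otimes> h) - BB g - TT g (BB h)"
  have D: "?D \<in> VS"
    by (intro S.diff_mem BB gh(1) g h S.isometry_pairD(1)[OF TT_isometry[OF g]])
  have "(F.nrm (?D C))\<^sup>2 \<le> 2 * c" if C: "C \<in> X" for C
  proof -
    have gC: "act (inv g) C \<in> X" by (rule act_X[OF gh(2) C])
    define \<alpha> where "\<alpha> = inv (\<kappa> (inv g) C)"
    define \<beta> where "\<beta> = inv (\<kappa> (inv h) (act (inv g) C))"
    have ab: "\<alpha> \<in> \<Gamma>" "\<beta> \<in> \<Gamma>" using \<kappa>_\<Gamma>[OF gh(2) C] \<kappa>_\<Gamma>[OF gh(3) gC] \<Gamma>_closed by (auto simp: \<alpha>_def \<beta>_def)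
    have "inv (\<kappa> (inv (g \<otimes> h)) C) = \<alpha> \<otimes> \<beta>"
      using \<kappa>_mult[OF gh(3,2) C] \<kappa>_\<Gamma>[OF gh(2) C] \<kappa>_\<Gamma>[OF gh(3) gC] \<Gamma>_carrier g h
      by (simp add: inv_mult_group \<alpha>_def \<beta>_def)
    then have e1: "BB (g \<otimes> h) C = dl (A (\<alpha> \<otimes> \<beta>) base) base" using C by (simp add: BB_def)
    have e2: "BB g C = dl (A \<alpha> base) base" using C by (simp add: BB_def \<alpha>_def)
    have "TT g (BB h) C = push (A' \<alpha>) (dl (A \<beta> base) base)"
      using C gC by (simp add: TT_def twist_def BB_def \<alpha>_def \<beta>_def)
    also have "\<dots> = dl (A \<alpha> (A \<beta> base)) (A \<alpha> base)"
      by (rule push_dl[OF kernel_pair[OF ab(1)] A_I[OF ab(2) base] base])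
    finally have e3: "TT g (BB h) C = dl (A \<alpha> (A \<beta> base)) (A \<alpha> base)" .
    have "?D C = dl (A (\<alpha> \<otimes> \<beta>) base) (A \<alpha> (A \<beta> base))"
      unfolding minus_apply e1 e2 e3 by (simp add: dl_def fun_eq_iff)
    moreover have "A (\<alpha> \<otimes> \<beta>) base \<in> I" "A \<alpha> (A \<beta> base) \<in> I" using ab \<Gamma>_closed A_I base by auto
    ultimately have "(F.nrm (?D C))\<^sup>2 = 2 * \<psi> (A (\<alpha> \<otimes> \<beta>) base) (A \<alpha> (A \<beta> base))" by (simp add: F_nrm_dl)
    then show ?thesis using c[OF ab] by simp
  qed
  then have "(\<integral>C. (F.nrm (?D C))\<^sup>2 \<partial>\<mu>) \<le> (\<integral>C. 2 * c \<partial>\<mu>)"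
    by (intro integral_mono VS_integrable[OF D]) (auto simp: space_\<mu>)
  then show ?thesis unfolding S_nrm[OF D] by (simp add: space_\<mu> mult.commute)
qed

text \<open>The squared norm is an integral over \<open>C\<close> of a function of (g, C). That
  function is jointly measurable because it is an expression in \<open>\<kappa>\<close>,
  \<open>d\<close> and \<open>e\<close>, all of which take countably many values.\<close>

lemma measurable_TT_diff:
  assumes d: "d \<in> VS" and e: "e \<in> VS"
  shows "(\<lambda>g. S.nrm (TT g d - e)) \<in> borel_measurable (borel_of T)"
proof -
  obtain D where D: "countable D" "D \<subseteq> Fin" "d \<in> measurable \<mu> (count_space D)"
    using VS_cvalued[OF d] unfolding cvalued_def by blast
  obtain E where E: "countable E" "E \<subseteq> Fin" "e \<in> measurable \<mu> (count_space E)"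
    using VS_cvalued[OF e] unfolding cvalued_def by blast
  let ?M = "borel_of T \<Otimes>\<^sub>M \<mu>"
  have fm: "(\<lambda>z. inv (fst z)) \<in> measurable ?M (borel_of T)" by (rule measurable_inv) simp
  have sm: "snd \<in> measurable ?M BX"
    using measurable_snd[of "borel_of T" \<mu>] measurable_cong_sets[OF refl \<mu>(1)] by blast
  have 1: "(\<lambda>z. \<kappa> (inv (fst z)) (snd z)) \<in> measurable ?M (count_space \<Gamma>)" by (rule measurable_\<kappa>[OF fm sm])
  have "(\<lambda>z. act (inv (fst z)) (snd z)) \<in> measurable ?M \<mu>"
    using measurable_act_pair[OF fm sm] measurable_cong_sets[OF refl \<mu>(1)] by blast
  from measurable_compose[OF this D(3)]
  have 2: "(\<lambda>z. d (act (inv (fst z)) (snd z))) \<in> measurable ?M (count_space D)" .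
  have 3: "(\<lambda>z. e (snd z)) \<in> measurable ?M (count_space E)" by (rule measurable_compose[OF measurable_snd E(3)])
  have "(\<lambda>z. (\<lambda>w b. (F.nrm (push (A' (inv (fst w))) (snd w) - b))\<^sup>2) (\<kappa> (inv (fst z)) (snd z), d (act (inv (fst z)) (snd z))) (e (snd z)))
      \<in> borel_measurable ?M"
    by (rule measurable_count_space_pair_compose[OF _ E(1) measurable_count_space_pair[OF countable_\<Gamma> D(1) 1 2] 3])
       (use countable_\<Gamma> D(1) in auto)
  then have "(\<lambda>(g, C). (F.nrm (push (A' (inv (\<kappa> (inv g) C))) (d (act (inv g) C)) - e C))\<^sup>2) \<in> borel_measurable ?M"
    by (simp add: split_beta')
  from \<mu>.borel_measurable_lebesgue_integral[OF this]
  have m: "(\<lambda>g. \<integral>C. (F.nrm (push (A' (inv (\<kappa> (inv g) C))) (d (act (inv g) C)) - e C))\<^sup>2 \<partial>\<mu>) \<in> borel_measurable (borel_of T)" .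
  have "S.nrm (TT g d - e) = sqrt (\<integral>C. (F.nrm (push (A' (inv (\<kappa> (inv g) C))) (d (act (inv g) C)) - e C))\<^sup>2 \<partial>\<mu>)"
    if g: "g \<in> carrier G" for g
  proof -
    have V: "TT g d - e \<in> VS" by (intro S.diff_mem S.isometry_pairD(1)[OF TT_isometry[OF g]] d e)
    have "(S.nrm (TT g d - e))\<^sup>2 = (\<integral>C. (F.nrm (push (A' (inv (\<kappa> (inv g) C))) (d (act (inv g) C)) - e C))\<^sup>2 \<partial>\<mu>)"
      unfolding S_nrm[OF V] by (rule Bochner_Integration.integral_cong) (auto simp: TT_def twist_def space_\<mu>)
    then show ?thesis using S.nrm_nonneg[OF V] by (metis real_sqrt_unique)
  qed
  then show ?thesis
    using m by (subst measurable_cong[where g = "\<lambda>g. sqrt (\<integral>C. (F.nrm (push (A' (inv (\<kappa> (inv g) C))) (d (act (inv g) C)) - e C))\<^sup>2 \<partial>\<mu>)"])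
      (auto simp: topspace_eq)
qed

lemma measurable_BB_diff:
  assumes BB: "\<And>x. x \<in> carrier G \<Longrightarrow> BB x \<in> VS" and e: "e \<in> VS"
  shows "(\<lambda>g. S.nrm (BB g - e)) \<in> borel_measurable (borel_of T)"
proof -
  obtain E where E: "countable E" "E \<subseteq> Fin" "e \<in> measurable \<mu> (count_space E)"
    using VS_cvalued[OF e] unfolding cvalued_def by blast
  let ?M = "borel_of T \<Otimes>\<^sub>M \<mu>"
  have fm: "(\<lambda>z. inv (fst z)) \<in> measurable ?M (borel_of T)" by (rule measurable_inv) simp
  have sm: "snd \<in> measurable ?M BX"
    using measurable_snd[of "borel_of T" \<mu>] measurable_cong_sets[OF refl \<mu>(1)] by blast
  have 1: "(\<lambda>z. \<kappa> (inv (fst z)) (snd z)) \<in> measurable ?M (count_space \<Gamma>)" by (rule measurable_\<kappa>[OF fm sm])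
  have 3: "(\<lambda>z. e (snd z)) \<in> measurable ?M (count_space E)" by (rule measurable_compose[OF measurable_snd E(3)])
  have "(\<lambda>z. (\<lambda>\<gamma> b. (F.nrm (dl (A (inv \<gamma>) base) base - b))\<^sup>2) (\<kappa> (inv (fst z)) (snd z)) (e (snd z))) \<in> borel_measurable ?M"
    by (rule measurable_count_space_pair_compose[OF countable_\<Gamma> E(1) 1 3]) auto
  then have "(\<lambda>(g, C). (F.nrm (dl (A (inv (\<kappa> (inv g) C)) base) base - e C))\<^sup>2) \<in> borel_measurable ?M"
    by (simp add: split_beta')
  from \<mu>.borel_measurable_lebesgue_integral[OF this]
  have m: "(\<lambda>g. \<integral>C. (F.nrm (dl (A (inv (\<kappa> (inv g) C)) base) base - e C))\<^sup>2 \<partial>\<mu>) \<in> borel_measurable (borel_of T)" .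
  have "S.nrm (BB g - e) = sqrt (\<integral>C. (F.nrm (dl (A (inv (\<kappa> (inv g) C)) base) base - e C))\<^sup>2 \<partial>\<mu>)"
    if g: "g \<in> carrier G" for g
  proof -
    have V: "BB g - e \<in> VS" by (intro S.diff_mem BB[OF g] e)
    have "(S.nrm (BB g - e))\<^sup>2 = (\<integral>C. (F.nrm (dl (A (inv (\<kappa> (inv g) C)) base) base - e C))\<^sup>2 \<partial>\<mu>)"
      unfolding S_nrm[OF V] by (rule Bochner_Integration.integral_cong) (auto simp: BB_def space_\<mu>)
    then show ?thesis using S.nrm_nonneg[OF V] by (metis real_sqrt_unique)
  qed
  then show ?thesis
    using m by (subst measurable_cong[where g = "\<lambda>g. sqrt (\<integral>C. (F.nrm (dl (A (inv (\<kappa> (inv g) C)) base) base - e C))\<^sup>2 \<partial>\<mu>)"])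
      (auto simp: topspace_eq)
qed

end

section \<open>Choice of a slow kernel\<close>

text \<open>All finite words in the maps of \<open>F\<close> are applied to the point x.\<close>

lemma countable_closure:
  assumes "countable F" "x \<in> Y" "\<And>f y. \<lbrakk>f \<in> F; y \<in> Y\<rbrakk> \<Longrightarrow> f y \<in> Y"
  shows "\<exists>Z. countable Z \<and> x \<in> Z \<and> Z \<subseteq> Y \<and> (\<forall>f\<in>F. \<forall>z\<in>Z. f z \<in> Z)"
proof (intro exI conjI ballI)
  let ?e = "\<lambda>L. foldr (\<lambda>f. f) L x"
  show "countable (?e ` lists F)" using assms(1) by (intro countable_image countable_lists)
  show "x \<in> ?e ` lists F" by (rule image_eqI[of _ _ "[]"]) auto
  have "?e L \<in> Y" if "L \<in> lists F" for L
    using that assms(2,3) by (induction L) auto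
  then show "?e ` lists F \<subseteq> Y" by blast
  fix f z assume f: "f \<in> F" and "z \<in> ?e ` lists F"
  then obtain L where "L \<in> lists F" "z = ?e L" by blast
  then show "f z \<in> ?e ` lists F" using f by (intro image_eqI[of _ _ "f # L"]) auto
qed

context hilbert_space
begin

lemma affine_isometry:
  assumes U: "U \<in> unitary_group H" and x: "x \<in> carrier H"
  defines "A \<equiv> \<lambda>v. x \<oplus> U v" and "A' \<equiv> \<lambda>w. inv_into (carrier H) U (w \<ominus> x)"
  shows "v \<in> carrier H \<Longrightarrow> A v \<in> carrier H" "v \<in> carrier H \<Longrightarrow> A' v \<in> carrier H"
    "v \<in> carrier H \<Longrightarrow> A (A' v) = v" "v \<in> carrier H \<Longrightarrow> A' (A v) = v"
    "\<lbrakk>v \<in> carrier H; w \<in> carrier H\<rbrakk> \<Longrightarrow> hdist H (A v) (A w) = hdist H v w"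
proof -
  note u = unitary_groupD[OF U]
  show A: "A v \<in> carrier H" if "v \<in> carrier H" for v using that x u(1) by (simp add: A_def)
  have im: "U ` carrier H = carrier H" and inj: "inj_on U (carrier H)" using u(5) by (auto simp: bij_betw_def)
  show A': "A' v \<in> carrier H" if "v \<in> carrier H" for v
    unfolding A'_def using that x im by (intro inv_into_into) auto
  show "A (A' v) = v" if "v \<in> carrier H" for v
  proof -
    have "U (A' v) = v \<ominus> x" unfolding A'_def using that x im by (intro f_inv_into_f) auto
    then show ?thesis using that x by (simp add: A_def a_minus_def M.a_lcomm[of x v] M.r_neg)
  qed
  show "A' (A v) = v" if "v \<in> carrier H" for v
  proof -
    have "A v \<ominus> x = U v" using that x u(1) by (simp add: A_def a_minus_def M.a_comm[of x "U v"] M.a_assoc M.r_neg)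
    then show ?thesis unfolding A'_def using that inj by (simp add: inv_into_f_f)
  qed
  show "hdist H (A v) (A w) = hdist H v w" if "v \<in> carrier H" "w \<in> carrier H" for v w
    unfolding A_def using that x u(1,4) by (simp add: hdist_add_left)
qed

lemma hdist_square:
  assumes "v \<in> carrier H" "w \<in> carrier H"
  shows "(hdist H v w)\<^sup>2 = Re (hinner H v v) + Re (hinner H w w) - 2 * Re (hinner H v w)"
  using assms hinner_commute[of v w]
  by (simp add: hdist_eq hnorm_square hinner_diff hinner_diff_right)

lemma negative_kernel_slow:
  assumes "slow_weights t" "countable I" "I \<subseteq> carrier H"
  shows "negative_kernel I (\<lambda>v w. slow_kernel t (hdist H v w))"
proof -
  interpret slow_weights t by fact
  show ?thesis
  proof
    show "slow_kernel t (hdist H v v) = 0" if "v \<in> I" for v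
      using that assms(3) hdist_zero_iff[of v v] by (auto simp: slow_kernel_zero)
    fix S and c :: "'h \<Rightarrow> real"
    assume S: "finite S" "S \<subseteq> I" and c: "sum c S = 0"
    show "(\<Sum>v\<in>S. \<Sum>w\<in>S. c v * c w * slow_kernel t (hdist H v w)) \<le> 0"
    proof (rule slow_kernel_cond_negative[OF S(1) psd_on_Re_hinner[OF S(1)] c])
      show "S \<subseteq> carrier H" using S assms(3) by blast
      then show "(hdist H v w)\<^sup>2 = Re (hinner H v v) + Re (hinner H w w) - 2 * Re (hinner H v w)" if "v \<in> S" "w \<in> S" for v w
        using that by (intro hdist_square) auto
    qed
  qed (use assms hdist_commute in auto)
qed

end

lemma (in slow_weights) slow_integral:
  assumes "finite_measure M" and r: "r \<in> borel_measurable M"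
    and a: "\<And>j. (\<integral>x. 1 - exp (- t j * (r x)\<^sup>2) \<partial>M) \<le> a j" "summable a"
  shows "integrable M (\<lambda>x. slow_kernel t (r x))" "(\<integral>x. slow_kernel t (r x) \<partial>M) \<le> suminf a"
proof -
  interpret finite_measure M by fact
  let ?f = "\<lambda>j x. 1 - exp (- t j * (r x)\<^sup>2)"
  have i: "integrable M (?f j)" for j
    by (rule integrable_const_bound[where B = 1]) (use term_bounds r in auto)
  have n: "norm (?f j x) = ?f j x" for j x using term_bounds(1)[of j "r x"] by simp
  have s1: "AE x in M. summable (\<lambda>j. norm (?f j x))" unfolding n using summable_terms by simp
  have i0: "0 \<le> (\<integral>x. ?f j x \<partial>M)" for j using term_bounds by (intro integral_nonneg_AE) auto
  have s2: "summable (\<lambda>j. \<integral>x. norm (?f j x) \<partial>M)"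
    unfolding n by (rule summable_comparison_test[OF _ a(2)]) (use i0 a(1) in \<open>auto intro!: exI[of _ 0]\<close>)
  show "integrable M (\<lambda>x. slow_kernel t (r x))"
    unfolding slow_kernel_def by (rule integrable_suminf[OF i s1 s2])
  have "(\<integral>x. slow_kernel t (r x) \<partial>M) = (\<Sum>j. \<integral>x. ?f j x \<partial>M)"
    unfolding slow_kernel_def by (rule integral_suminf[OF i s1 s2])
  also have "\<dots> \<le> suminf a"
    using s2 unfolding n by (intro suminf_le a)
  finally show "(\<integral>x. slow_kernel t (r x) \<partial>M) \<le> suminf a" .
qed

context lcsc_lattice
begin

lemma ex_exhaustion:
  "\<exists>K::nat \<Rightarrow> 'a set. (\<forall>j. compactin T (K j)) \<and> (\<forall>i j. i \<le> j \<longrightarrow> K i \<subseteq> K j) \<and>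
    (\<forall>L. compactin T L \<longrightarrow> (\<exists>j. L \<subseteq> K j))"
proof -
  have "\<forall>n. \<exists>L. compactin T L \<and> VV n \<subseteq> L" using VV_compact by blast
  then obtain k where k: "\<forall>n. compactin T (k n) \<and> VV n \<subseteq> k n" by (rule choice[THEN exE]) blast
  define K where "K j = \<Union>(k ` {..j})" for j :: nat
  have "compactin T (K j)" for j unfolding K_def by (rule compactin_Union) (use k in auto)
  moreover have "K i \<subseteq> K j" if "i \<le> j" for i j unfolding K_def using that by (intro Union_mono image_mono) auto
  moreover have "\<exists>j. L \<subseteq> K j" if L: "compactin T L" for L
  proof -
    obtain N where N: "finite N" "L \<subseteq> (\<Union>n\<in>N. VV n)" by (rule compact_finite_cover[OF L])
    obtain j where j: "\<forall>n\<in>N. n \<le> j" using N(1) finite_nat_set_iff_bounded_le by blast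
    have "VV n \<subseteq> K j" if "n \<in> N" for n
    proof -
      have "k n \<subseteq> K j" unfolding K_def using j that by auto
      then show ?thesis using k by blast
    qed
    then show ?thesis using N(2) by (intro exI[of _ j]) blast
  qed
  ultimately show ?thesis by blast
qed

text \<open>A diagonal choice. On the j-th set of an exhaustion by compact sets the cocycle stays in
  a finite set \<open>F j\<close> up to measure 2^-j, and \<open>t j\<close> is so small that t
  \<rho>^2 \<le> 2^-j on \<open>F j\<close>. On a given compact set all but finitely many terms of
  the kernel then integrate to at most a multiple of 2^-j, and the others to at most the total
  mass.\<close>

lemma ex_slow_weights:
  fixes \<rho> :: "'a \<Rightarrow> real"
  shows "\<exists>t. slow_weights t \<and> (\<forall>L. compactin T L \<longrightarrow> (\<exists>B. \<forall>g\<in>L.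
    integrable \<mu> (\<lambda>C. slow_kernel t (\<rho> (\<kappa> g C))) \<and> (\<integral>C. slow_kernel t (\<rho> (\<kappa> g C)) \<partial>\<mu>) \<le> B))"
proof -
  obtain K :: "nat \<Rightarrow> 'a set" where K: "\<And>j. compactin T (K j)" "\<And>i j. i \<le> j \<Longrightarrow> K i \<subseteq> K j" "\<And>L. compactin T L \<Longrightarrow> \<exists>j. L \<subseteq> K j"
    using ex_exhaustion by blast
  have "\<forall>j. \<exists>F. finite F \<and> F \<subseteq> \<Gamma> \<and> (\<forall>g\<in>K j. measure \<mu> {C \<in> X. \<kappa> g C \<notin> F} \<le> (1/2)^j)"
    using cocycle_tight[OF K(1)] by simp
  then obtain F where F0: "\<forall>j. finite (F j) \<and> F j \<subseteq> \<Gamma> \<and> (\<forall>g\<in>K j. measure \<mu> {C \<in> X. \<kappa> g C \<notin> F j} \<le> (1/2)^j)"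
    by (rule choice[THEN exE]) blast
  have F: "finite (F j)" "F j \<subseteq> \<Gamma>" "\<And>g. g \<in> K j \<Longrightarrow> measure \<mu> {C \<in> X. \<kappa> g C \<notin> F j} \<le> (1/2)^j" for j
    using F0 by auto
  \<comment> \<open>A sum instead of a maximum, which also makes sense for an empty set.\<close>
  define b where "b j = (\<Sum>\<gamma>\<in>F j. (\<rho> \<gamma>)\<^sup>2)" for j
  have b0: "0 \<le> b j" for j unfolding b_def by (rule sum_nonneg) simp
  have b: "(\<rho> \<gamma>)\<^sup>2 \<le> b j" if "\<gamma> \<in> F j" for \<gamma> j
    unfolding b_def using F(1) that by (intro member_le_sum) auto
  \<comment> \<open>The summand 1 in the denominator keeps \<open>t j\<close> below 2^-j, whence
    \<open>t\<close> is summable.\<close>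
  define t where "t j = (1/2)^j / (1 + b j)" for j
  have t: "0 < t j" "t j * b j \<le> (1/2)^j" "t j \<le> (1/2)^j" for j
  proof -
    show "0 < t j" using b0[of j] by (simp add: t_def)
    have "t j * b j = (1/2)^j * (b j / (1 + b j))" by (simp add: t_def)
    also have "\<dots> \<le> (1/2)^j * 1" using b0[of j] by (intro mult_left_mono) auto
    finally show "t j * b j \<le> (1/2)^j" by simp
    have "t j \<le> (1/2)^j / 1" unfolding t_def using b0[of j] by (intro divide_left_mono) auto
    then show "t j \<le> (1/2)^j" by simp
  qed
  have geo: "summable (\<lambda>j. (1/2::real)^j)" by (rule summable_geometric) simp
  interpret slow_weights t
  proof
    show "summable t" by (rule summable_comparison_test[OF _ geo]) (use t in \<open>auto intro!: exI[of _ 0] simp: less_imp_le\<close>)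
  qed (rule t(1))
  have "\<exists>B. \<forall>g\<in>L. integrable \<mu> (\<lambda>C. slow_kernel t (\<rho> (\<kappa> g C))) \<and> (\<integral>C. slow_kernel t (\<rho> (\<kappa> g C)) \<partial>\<mu>) \<le> B"
    if L: "compactin T L" for L
  proof -
    obtain i where i: "L \<subseteq> K i" using K(3)[OF L] by blast
    define m where "m = measure \<mu> X"
    \<comment> \<open>From index i on \<open>L\<close> lies in \<open>K j\<close>, so the estimate
      by \<open>F j\<close> is available; the earlier terms are bounded by 1 pointwise.\<close>
    define a where "a j = (if j < i then m else (1/2)^j * (1 + m))" for j
    have sa: "summable a"
    proof -
      have "summable (\<lambda>j. (1/2)^j * (1 + m))" by (rule summable_mult2[OF geo])
      then have "summable (\<lambda>j. a (j + i))"
        by (subst (asm) summable_iff_shift[of _ i, symmetric]) (simp add: a_def)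
      then show ?thesis by (simp add: summable_iff_shift)
    qed
    have "integrable \<mu> (\<lambda>C. slow_kernel t (\<rho> (\<kappa> g C))) \<and> (\<integral>C. slow_kernel t (\<rho> (\<kappa> g C)) \<partial>\<mu>) \<le> suminf a"
      if g: "g \<in> L" for g
    proof -
      have gc: "g \<in> carrier G" using L g by (auto simp: compactin_def topspace_eq)
      have \<kappa>m: "(\<lambda>C. \<kappa> g C) \<in> measurable \<mu> (count_space \<Gamma>)"
        unfolding measurable_\<mu>_eq by (rule measurable_\<kappa>) (use gc in \<open>simp_all add: topspace_eq\<close>)
      have rm: "(\<lambda>C. \<rho> (\<kappa> g C)) \<in> borel_measurable \<mu>" by (rule measurable_compose[OF \<kappa>m]) simp
      have it: "integrable \<mu> (\<lambda>C. 1 - exp (- t j * (\<rho> (\<kappa> g C))\<^sup>2))" for j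
        by (rule \<mu>.integrable_const_bound[where B = 1]) (use term_bounds rm in auto)
      have "(\<integral>C. 1 - exp (- t j * (\<rho> (\<kappa> g C))\<^sup>2) \<partial>\<mu>) \<le> a j" for j
      proof (cases "j < i")
        case True
        have "(\<integral>C. 1 - exp (- t j * (\<rho> (\<kappa> g C))\<^sup>2) \<partial>\<mu>) \<le> (\<integral>C. 1 \<partial>\<mu>)"
          by (intro integral_mono it) (use term_bounds in auto)
        then show ?thesis using True by (simp add: a_def m_def space_\<mu>)
      next
        case False
        let ?D = "{C \<in> X. \<kappa> g C \<notin> F j}"
        have "{C \<in> space \<mu>. \<kappa> g C \<notin> F j} \<in> sets \<mu>"
        proof -
          have "(\<lambda>C. \<kappa> g C) -` (\<Gamma> - F j) \<inter> space \<mu> \<in> sets \<mu>" by (rule measurable_sets[OF \<kappa>m]) simp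
          moreover have "(\<lambda>C. \<kappa> g C) -` (\<Gamma> - F j) \<inter> space \<mu> = {C \<in> space \<mu>. \<kappa> g C \<notin> F j}"
            using \<kappa>_\<Gamma>[OF gc] by (auto simp: space_\<mu>)
          ultimately show ?thesis by simp
        qed
        then have D: "?D \<in> sets \<mu>" by (simp add: space_\<mu>)
        have gK: "g \<in> K j" using i g K(2)[of i j] False by auto
        have "(\<integral>C. 1 - exp (- t j * (\<rho> (\<kappa> g C))\<^sup>2) \<partial>\<mu>) \<le> (\<integral>C. indicator ?D C + (1/2)^j \<partial>\<mu>)"
        proof (intro integral_mono it)
          show "integrable \<mu> (\<lambda>C. indicator ?D C + (1/2)^j :: real)" using D by (simp add: less_top[symmetric])
          fix C assume C: "C \<in> space \<mu>"
          show "1 - exp (- t j * (\<rho> (\<kappa> g C))\<^sup>2) \<le> indicator ?D C + (1/2)^j"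
          proof (cases "\<kappa> g C \<in> F j")
            case True
            have "1 - exp (- t j * (\<rho> (\<kappa> g C))\<^sup>2) \<le> t j * (\<rho> (\<kappa> g C))\<^sup>2" by (rule term_bounds)
            also have "\<dots> \<le> t j * b j" using b[OF True] t(1)[of j] by (intro mult_left_mono) auto
            also have "\<dots> \<le> (1/2)^j" by (rule t)
            finally show ?thesis using True by simp
          next
            case False
            then have "indicator ?D C = (1::real)" using C by (simp add: space_\<mu>)
            then show ?thesis
              using term_bounds(3)[of j "\<rho> (\<kappa> g C)"] zero_le_power[of "1/2::real" j] by linarith
          qed
        qed
        also have "\<dots> = measure \<mu> ?D + (1/2)^j * m"
        proof -
          have "?D \<inter> X = ?D" by blast
          then show ?thesis using D by (simp add: m_def space_\<mu> less_top[symmetric])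
        qed
        also have "\<dots> \<le> (1/2)^j * (1 + m)" using F(3)[OF gK] by (simp add: algebra_simps)
        finally show ?thesis using False by (simp add: a_def)
      qed
      from slow_integral[OF \<mu>.finite_measure_axioms rm this sa] show ?thesis by blast
    qed
    then show ?thesis by blast
  qed
  then show ?thesis using slow_weights_axioms by blast
qed

end

text \<open>The cocycle on \<Gamma> may live on any type: what is induced from it is separable, so
  it fits the type on which the property of the group is assumed.\<close>

theorem (in lcsc_lattice) lattice_TTT:
  assumes TTT: "property_TTT TYPE('h \<Rightarrow> complex) G T"
  shows "property_TTT TYPE('k) (G\<lparr>carrier := \<Gamma>\<rparr>) (subtopology T \<Gamma>)"
  unfolding property_TTT_def relative_property_TTT_def
proof (intro allI impI)
  fix H :: "'k hilbert" and b \<pi>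
  assume Hs: "hilbert_space H" and w: "wq_cocycle (G\<lparr>carrier := \<Gamma>\<rparr>) (subtopology T \<Gamma>) H b \<pi>"
  interpret H: hilbert_space H by (rule Hs)
  note d = w[unfolded wq_cocycle_def]
  have bm: "b \<in> measurable (borel_of (subtopology T \<Gamma>)) (borel_of (htopology H))"
    and \<pi>m: "\<pi> \<in> measurable (borel_of (subtopology T \<Gamma>)) (borel_of (unitary_sot H))" using d by auto
  have bc: "b \<gamma> \<in> carrier H" if "\<gamma> \<in> \<Gamma>" for \<gamma>
    using measurable_space[OF bm, of \<gamma>] that by (simp add: subtopology_\<Gamma>)
  have \<pi>U: "\<pi> \<gamma> \<in> unitary_group H" if "\<gamma> \<in> \<Gamma>" for \<gamma>
    using measurable_space[OF \<pi>m, of \<gamma>] that by (simp add: subtopology_\<Gamma> H.topspace_unitary_sot)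
  note u = H.unitary_groupD[OF \<pi>U]
  obtain c0 where c0: "\<forall>\<alpha>\<in>\<Gamma>. \<forall>\<beta>\<in>\<Gamma>. hnorm H (b (\<alpha> \<otimes> \<beta>) \<ominus>\<^bsub>H\<^esub> b \<alpha> \<ominus>\<^bsub>H\<^esub> \<pi> \<alpha> (b \<beta>)) \<le> c0"
    using d by auto
  define c where "c = max c0 0"
  have c: "0 \<le> c" "\<And>\<alpha> \<beta>. \<lbrakk>\<alpha> \<in> \<Gamma>; \<beta> \<in> \<Gamma>\<rbrakk> \<Longrightarrow> hdist H (b (\<alpha> \<otimes> \<beta>)) (b \<alpha> \<oplus>\<^bsub>H\<^esub> \<pi> \<alpha> (b \<beta>)) \<le> c"
  proof -
    fix \<alpha> \<beta> assume ab: "\<alpha> \<in> \<Gamma>" "\<beta> \<in> \<Gamma>"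
    have "hnorm H (b (\<alpha> \<otimes> \<beta>) \<ominus>\<^bsub>H\<^esub> b \<alpha> \<ominus>\<^bsub>H\<^esub> \<pi> \<alpha> (b \<beta>)) \<le> c0" using c0 ab by blast
    then show "hdist H (b (\<alpha> \<otimes> \<beta>)) (b \<alpha> \<oplus>\<^bsub>H\<^esub> \<pi> \<alpha> (b \<beta>)) \<le> c"
      using H.hnorm_diff_diff[OF bc[OF \<Gamma>_closed(1)[OF ab]] bc[OF ab(1)] u(1)[OF ab(1) bc[OF ab(2)]]] by (simp add: c_def)
  qed (simp add: c_def)
  \<comment> \<open>The affine isometries of the almost action; they send the origin to the values
    of \<open>b\<close>.\<close>
  define A where "A \<alpha> = (\<lambda>v. b \<alpha> \<oplus>\<^bsub>H\<^esub> \<pi> \<alpha> v)" for \<alpha>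
  define A' where "A' \<alpha> = (\<lambda>w. inv_into (carrier H) (\<pi> \<alpha>) (w \<ominus>\<^bsub>H\<^esub> b \<alpha>))" for \<alpha>
  have aff: "A \<alpha> v \<in> carrier H" "A' \<alpha> v \<in> carrier H" "A \<alpha> (A' \<alpha> v) = v" "A' \<alpha> (A \<alpha> v) = v"
    "w \<in> carrier H \<Longrightarrow> hdist H (A \<alpha> v) (A \<alpha> w) = hdist H v w"
    if a: "\<alpha> \<in> \<Gamma>" and v: "v \<in> carrier H" for \<alpha> v w
    unfolding A_def A'_def using H.affine_isometry[OF \<pi>U[OF a] bc[OF a]] v by blast+
  have A0: "A \<alpha> \<zero>\<^bsub>H\<^esub> = b \<alpha>" if \<alpha>: "\<alpha> \<in> \<Gamma>" for \<alpha>
  proof -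
    have z: "hdist H \<zero>\<^bsub>H\<^esub> \<zero>\<^bsub>H\<^esub> = 0" using H.hdist_zero_iff by simp
    have "hdist H (\<pi> \<alpha> \<zero>\<^bsub>H\<^esub>) \<zero>\<^bsub>H\<^esub> = 0"
      using u(3)[OF \<alpha> H.M.zero_closed] z by (simp add: H.hnorm_eq_hdist u(1)[OF \<alpha>])
    then have "\<pi> \<alpha> \<zero>\<^bsub>H\<^esub> = \<zero>\<^bsub>H\<^esub>" using H.hdist_zero_iff u(1)[OF \<alpha>] by simp
    then show ?thesis using bc[OF \<alpha>] by (simp add: A_def)
  qed
  \<comment> \<open>Countability of \<open>I\<close> gives separability of the induced space;
    stability under the inverses as well makes every \<open>A \<alpha>\<close> a permutation of
    \<open>I\<close>.\<close>
  have "\<exists>I. countable I \<and> \<zero>\<^bsub>H\<^esub> \<in> I \<and> I \<subseteq> carrier H \<and> (\<forall>f\<in>A ` \<Gamma> \<union> A' ` \<Gamma>. \<forall>z\<in>I. f z \<in> I)"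
  proof (rule countable_closure)
    show "f z \<in> carrier H" if "f \<in> A ` \<Gamma> \<union> A' ` \<Gamma>" "z \<in> carrier H" for f z
      using that aff(1,2) by blast
  qed (simp_all add: countable_\<Gamma>)
  then obtain I where I: "countable I" "\<zero>\<^bsub>H\<^esub> \<in> I" "I \<subseteq> carrier H"
    and I': "\<forall>f\<in>A ` \<Gamma> \<union> A' ` \<Gamma>. \<forall>z\<in>I. f z \<in> I" by (elim exE conjE)
  have IA: "A \<alpha> v \<in> I \<and> A' \<alpha> v \<in> I" if "\<alpha> \<in> \<Gamma>" "v \<in> I" for \<alpha> v
    using I'[THEN bspec, THEN bspec, OF UnI1, OF imageI, OF that] I'[THEN bspec, THEN bspec, OF UnI2, OF imageI, OF that] by (rule conjI)
  \<comment> \<open>The inverse is there because the induced cocycle at g involves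
    \<open>inv (\<kappa> (inv g) C)\<close>.\<close>
  define \<rho> where "\<rho> \<gamma> = hnorm H (b (inv \<gamma>))" for \<gamma>
  obtain t where sw: "slow_weights t" and tb: "\<And>L. compactin T L \<Longrightarrow> \<exists>B. \<forall>g\<in>L.
      integrable \<mu> (\<lambda>C. slow_kernel t (\<rho> (\<kappa> g C))) \<and> (\<integral>C. slow_kernel t (\<rho> (\<kappa> g C)) \<partial>\<mu>) \<le> B"
    using ex_slow_weights[of \<rho>] by blast
  interpret slow_weights t by (rule sw)
  define \<psi> where "\<psi> v w = slow_kernel t (hdist H v w)" for v w
  obtain \<G> where \<G>: "countable \<G>" "\<G> \<subseteq> Pow X" "Int_stable \<G>" "X \<in> \<G>" "sets \<mu> = sigma_sets X \<G>"
    using ex_generator by blast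
  have NK: "negative_kernel I \<psi>"
    using H.negative_kernel_slow[OF sw I(1,3)] by (simp add: \<psi>_def[abs_def])
  interpret NK: negative_kernel I \<psi> by (rule NK)
  have "induced G T \<Gamma> I \<psi> \<zero>\<^bsub>H\<^esub> \<G> A A'"
  proof (intro induced.intro kernel_sections.intro lcsc_lattice_axioms NK \<mu>.finite_measure_axioms
      kernel_sections_axioms.intro induced_axioms.intro)
    show "NK.kernel_pair (A \<gamma>) (A' \<gamma>)" if "\<gamma> \<in> \<Gamma>" for \<gamma>
      unfolding NK.kernel_pair_def \<psi>_def using aff(3-5)[OF that] IA[OF that] I(3) by (auto simp: subset_eq)
  qed (use I \<G> in \<open>auto simp: space_\<mu>\<close>)
  then interpret D: induced G T \<Gamma> I \<psi> "\<zero>\<^bsub>H\<^esub>" \<G> A A' .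
  have \<psi>\<rho>: "\<psi> (A (inv \<gamma>) \<zero>\<^bsub>H\<^esub>) \<zero>\<^bsub>H\<^esub> = slow_kernel t (\<rho> \<gamma>)" if "\<gamma> \<in> \<Gamma>" for \<gamma>
    using that \<Gamma>_closed by (simp add: A0 \<psi>_def \<rho>_def H.hnorm_eq_hdist bc)
  have ic: "(\<integral>C. \<psi> (A (inv (\<kappa> (inv g) C)) \<zero>\<^bsub>H\<^esub>) \<zero>\<^bsub>H\<^esub> \<partial>\<mu>) = (\<integral>C. slow_kernel t (\<rho> (\<kappa> (inv g) C)) \<partial>\<mu>)"
    and ii: "integrable \<mu> (\<lambda>C. \<psi> (A (inv (\<kappa> (inv g) C)) \<zero>\<^bsub>H\<^esub>) \<zero>\<^bsub>H\<^esub>) \<longleftrightarrow> integrable \<mu> (\<lambda>C. slow_kernel t (\<rho> (\<kappa> (inv g) C)))"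
    if g: "g \<in> carrier G" for g
    by (rule Bochner_Integration.integral_cong, simp, rule \<psi>\<rho>[OF \<kappa>_\<Gamma>], use g in \<open>simp_all add: space_\<mu>\<close>)
       (rule Bochner_Integration.integrable_cong, simp, rule \<psi>\<rho>[OF \<kappa>_\<Gamma>], use g in \<open>simp_all add: space_\<mu>\<close>)
  have loc: "\<exists>B. \<forall>g\<in>L. integrable \<mu> (\<lambda>C. slow_kernel t (\<rho> (\<kappa> (inv g) C))) \<and> (\<integral>C. slow_kernel t (\<rho> (\<kappa> (inv g) C)) \<partial>\<mu>) \<le> B"
    if L: "compactin T L" for L
    using tb[OF compactin_inv_image[OF L]] by auto
  have int: "integrable \<mu> (\<lambda>C. slow_kernel t (\<rho> (\<kappa> (inv g) C)))" if "g \<in> carrier G" for g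
    using loc[of "{g}"] that by (auto simp: topspace_eq)
  have BV: "D.BB g \<in> D.VS" if "g \<in> carrier G" for g
    by (rule D.BB_VS[OF that]) (use int ii that in blast)
  have Bn: "(D.S.nrm (D.BB g))\<^sup>2 = 2 * (\<integral>C. slow_kernel t (\<rho> (\<kappa> (inv g) C)) \<partial>\<mu>)" if "g \<in> carrier G" for g
    using D.BB_S_nrm[OF that BV[OF that]] ic[OF that] by simp
  have "\<exists>(H' :: ('h \<Rightarrow> complex) hilbert) b' \<pi>'. hilbert_space H' \<and>
    b' \<in> measurable (borel_of T) (borel_of (htopology H')) \<and> \<pi>' \<in> measurable (borel_of T) (borel_of (unitary_sot H')) \<and>
    (\<forall>g\<in>space (borel_of T). hnorm H' (b' g) = D.S.nrm (D.BB g)) \<and>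
    (\<forall>g\<in>space (borel_of T). \<forall>x\<in>space (borel_of T). \<forall>y\<in>space (borel_of T).
      hnorm H' (b' y \<ominus>\<^bsub>H'\<^esub> b' g \<ominus>\<^bsub>H'\<^esub> \<pi>' g (b' x)) = D.S.nrm (D.BB y - D.BB g - D.TT g (D.BB x)))"
  proof (rule D.S.ex_hilbert_model[OF D.countable_DS D.DS_VS D.DS_dense])
    show "D.BB g \<in> D.VS" "D.S.isometry_pair (D.TT g) (D.TT' g)" if "g \<in> space (borel_of T)" for g
      using that BV D.TT_isometry by (simp_all add: topspace_eq)
    show "(\<lambda>g. D.S.nrm (D.BB g - d)) \<in> borel_measurable (borel_of T)" if "d \<in> D.DS" for d
      by (rule D.measurable_BB_diff[OF BV]) (use that D.DS_VS in auto)
    show "(\<lambda>g. D.S.nrm (D.TT g d - e)) \<in> borel_measurable (borel_of T)" if "d \<in> D.DS" "e \<in> D.DS" for d e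
      by (rule D.measurable_TT_diff) (use that D.DS_VS in auto)
  qed
  then obtain H' :: "('h \<Rightarrow> complex) hilbert" and b' \<pi>' where H': "hilbert_space H'"
    and b': "b' \<in> measurable (borel_of T) (borel_of (htopology H'))" and \<pi>': "\<pi>' \<in> measurable (borel_of T) (borel_of (unitary_sot H'))"
    and n1: "\<And>g. g \<in> carrier G \<Longrightarrow> hnorm H' (b' g) = D.S.nrm (D.BB g)"
    and n2: "\<And>g x y. \<lbrakk>g \<in> carrier G; x \<in> carrier G; y \<in> carrier G\<rbrakk> \<Longrightarrow>
      hnorm H' (b' y \<ominus>\<^bsub>H'\<^esub> b' g \<ominus>\<^bsub>H'\<^esub> \<pi>' g (b' x)) = D.S.nrm (D.BB y - D.BB g - D.TT g (D.BB x))"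
    unfolding space_BG by blast
  have "wq_cocycle G T H' b' \<pi>'"
    unfolding wq_cocycle_def
  proof (intro conjI allI impI b' \<pi>')
    fix L assume L: "compactin T L"
    then have Lc: "g \<in> carrier G" if "g \<in> L" for g using that by (auto simp: compactin_def topspace_eq)
    obtain B where B: "\<And>g. g \<in> L \<Longrightarrow> (\<integral>C. slow_kernel t (\<rho> (\<kappa> (inv g) C)) \<partial>\<mu>) \<le> B" using loc[OF L] by blast
    have "hnorm H' (b' g) \<le> sqrt (2 * B)" if g: "g \<in> L" for g
    proof -
      have "(hnorm H' (b' g))\<^sup>2 \<le> 2 * B" using B[OF g] by (simp add: n1[OF Lc[OF g]] Bn[OF Lc[OF g]])
      then show ?thesis by (rule real_le_rsqrt)
    qed
    then show "\<exists>C. \<forall>g\<in>L. hnorm H' (b' g) \<le> C" by blast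
  next
    \<comment> \<open>At the origin the composite of two maps and the map of the product differ by a
      distance of at most c, and the kernel is monotone in the distance.\<close>
    have "hnorm H' (b' (g \<otimes> h) \<ominus>\<^bsub>H'\<^esub> b' g \<ominus>\<^bsub>H'\<^esub> \<pi>' g (b' h)) \<le> sqrt (2 * slow_kernel t c * measure \<mu> X)"
      if g: "g \<in> carrier G" and h: "h \<in> carrier G" for g h
      unfolding n2[OF g h m_closed[OF g h]]
    proof (rule real_le_rsqrt, rule D.BB_quasi_cocycle[OF g h BV])
      fix \<alpha> \<beta> assume ab: "\<alpha> \<in> \<Gamma>" "\<beta> \<in> \<Gamma>"
      have "hdist H (A (\<alpha> \<otimes> \<beta>) \<zero>\<^bsub>H\<^esub>) (A \<alpha> (A \<beta> \<zero>\<^bsub>H\<^esub>)) \<le> c"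
        using c(2)[OF ab] by (simp add: A0 ab \<Gamma>_closed) (simp add: A_def)
      then show "\<psi> (A (\<alpha> \<otimes> \<beta>) \<zero>\<^bsub>H\<^esub>) (A \<alpha> (A \<beta> \<zero>\<^bsub>H\<^esub>)) \<le> slow_kernel t c"
        unfolding \<psi>_def by (rule slow_kernel_mono[OF H.hdist_nonneg])
    qed
    then show "\<exists>C. \<forall>g\<in>carrier G. \<forall>h\<in>carrier G. hnorm H' (b' (g \<otimes> h) \<ominus>\<^bsub>H'\<^esub> b' g \<ominus>\<^bsub>H'\<^esub> \<pi>' g (b' h)) \<le> C" by blast
  qed
  then have "\<exists>m. \<forall>g\<in>carrier G. hnorm H' (b' g) \<le> m"
    using TTT H' unfolding property_TTT_def relative_property_TTT_def by blast
  then obtain m where m: "\<And>g. g \<in> carrier G \<Longrightarrow> D.S.nrm (D.BB g) \<le> m" using n1 by auto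
  have slow_bound: "(\<integral>C. slow_kernel t (\<rho> (\<kappa> g C)) \<partial>\<mu>) \<le> m\<^sup>2" and slow_int: "integrable \<mu> (\<lambda>C. slow_kernel t (\<rho> (\<kappa> g C)))"
    if g: "g \<in> carrier G" for g
  proof -
    have ig: "inv g \<in> carrier G" using g by simp
    have "(D.S.nrm (D.BB (inv g)))\<^sup>2 \<le> m\<^sup>2" using m[OF ig] D.S.nrm_nonneg[OF BV[OF ig]] by (intro power_mono)
    moreover have "0 \<le> (\<integral>C. slow_kernel t (\<rho> (\<kappa> g C)) \<partial>\<mu>)" by (intro integral_nonneg_AE) (simp add: slow_kernel_nonneg)
    ultimately show "(\<integral>C. slow_kernel t (\<rho> (\<kappa> g C)) \<partial>\<mu>) \<le> m\<^sup>2" using Bn[OF ig] g by simp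
    show "integrable \<mu> (\<lambda>C. slow_kernel t (\<rho> (\<kappa> g C)))" using int[OF ig] g by simp
  qed
  \<comment> \<open>The norm of \<open>b\<close> is subadditive and symmetric only up to constants.
    This supremum has both properties exactly, since a displacement by a product is a succession of
    two displacements, and it differs from the norm of \<open>b\<close> by a bounded amount.\<close>
  define len where "len \<alpha> = (SUP \<eta>\<in>\<Gamma>. hdist H (b (\<eta> \<otimes> \<alpha>)) (b \<eta>))" for \<alpha>
  have up: "hdist H (b (\<eta> \<otimes> \<alpha>)) (b \<eta>) \<le> c + hnorm H (b \<alpha>)" if l: "\<eta> \<in> \<Gamma>" and a: "\<alpha> \<in> \<Gamma>" for \<eta> \<alpha>
  proof -
    have "hdist H (b \<eta> \<oplus>\<^bsub>H\<^esub> \<pi> \<eta> (b \<alpha>)) (b \<eta> \<oplus>\<^bsub>H\<^esub> \<zero>\<^bsub>H\<^esub>) = hnorm H (b \<alpha>)"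
      using H.hdist_add_left[OF u(1)[OF l bc[OF a]] H.M.zero_closed bc[OF l]] u(3)[OF l bc[OF a]] u(1)[OF l bc[OF a]]
      by (simp add: H.hnorm_eq_hdist)
    then show ?thesis
      using c(2)[OF l a] H.hdist_triangle[of "b (\<eta> \<otimes> \<alpha>)" "b \<eta> \<oplus>\<^bsub>H\<^esub> \<pi> \<eta> (b \<alpha>)" "b \<eta>"]
        bc[OF l] bc[OF \<Gamma>_closed(1)[OF l a]] u(1)[OF l bc[OF a]] by simp
  qed
  have ne: "\<Gamma> \<noteq> {}" using \<Gamma>_closed by blast
  have bdd: "bdd_above ((\<lambda>\<eta>. hdist H (b (\<eta> \<otimes> \<alpha>)) (b \<eta>)) ` \<Gamma>)" if "\<alpha> \<in> \<Gamma>" for \<alpha>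
    using up that by (intro bdd_aboveI[of _ "c + hnorm H (b \<alpha>)"]) auto
  have len_upper: "hdist H (b (\<eta> \<otimes> \<alpha>)) (b \<eta>) \<le> len \<alpha>" if "\<eta> \<in> \<Gamma>" "\<alpha> \<in> \<Gamma>" for \<eta> \<alpha>
    unfolding len_def by (rule cSUP_upper[OF that(1) bdd[OF that(2)]])
  have len_le: "len \<alpha> \<le> c + hnorm H (b \<alpha>)" if "\<alpha> \<in> \<Gamma>" for \<alpha>
    unfolding len_def using up that by (intro cSUP_least[OF ne]) auto
  have len_add: "len (\<alpha> \<otimes> \<beta>) \<le> len \<alpha> + len \<beta>" if a: "\<alpha> \<in> \<Gamma>" and b: "\<beta> \<in> \<Gamma>" for \<alpha> \<beta>
    unfolding len_def[of "\<alpha> \<otimes> \<beta>"]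
  proof (rule cSUP_least[OF ne])
    fix \<eta> assume l: "\<eta> \<in> \<Gamma>"
    have la: "\<eta> \<otimes> \<alpha> \<in> \<Gamma>" using l a \<Gamma>_closed by blast
    have e: "\<eta> \<otimes> (\<alpha> \<otimes> \<beta>) = (\<eta> \<otimes> \<alpha>) \<otimes> \<beta>" using l a b \<Gamma>_carrier by (simp add: m_assoc)
    have "hdist H (b ((\<eta> \<otimes> \<alpha>) \<otimes> \<beta>)) (b \<eta>) \<le> hdist H (b ((\<eta> \<otimes> \<alpha>) \<otimes> \<beta>)) (b (\<eta> \<otimes> \<alpha>)) + hdist H (b (\<eta> \<otimes> \<alpha>)) (b \<eta>)"
      by (intro H.hdist_triangle bc la l \<Gamma>_closed(1)[OF la b])
    then show "hdist H (b (\<eta> \<otimes> (\<alpha> \<otimes> \<beta>))) (b \<eta>) \<le> len \<alpha> + len \<beta>"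
      unfolding e using len_upper[OF la b] len_upper[OF l a] by linarith
  qed
  have len_inv_le: "len (inv \<alpha>) \<le> len \<alpha>" if a: "\<alpha> \<in> \<Gamma>" for \<alpha>
    unfolding len_def[of "inv \<alpha>"]
  proof (rule cSUP_least[OF ne])
    fix \<eta> assume l: "\<eta> \<in> \<Gamma>"
    have la: "\<eta> \<otimes> inv \<alpha> \<in> \<Gamma>" using l a \<Gamma>_closed by blast
    have "(\<eta> \<otimes> inv \<alpha>) \<otimes> \<alpha> = \<eta>" using l a \<Gamma>_carrier by (simp add: m_assoc)
    then show "hdist H (b (\<eta> \<otimes> inv \<alpha>)) (b \<eta>) \<le> len \<alpha>"
      using len_upper[OF la a] by (simp add: H.hdist_commute)
  qed
  have len_inv: "len (inv \<alpha>) = len \<alpha>" if a: "\<alpha> \<in> \<Gamma>" for \<alpha>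
    using len_inv_le[OF a] len_inv_le[OF \<Gamma>_closed(2)[OF a]] a \<Gamma>_carrier by simp
  have tight: "\<exists>R. \<forall>g\<in>carrier G. measure \<mu> {C \<in> X. len (\<kappa> g C) > R} \<le> e" if e: "e > 0" for e
  proof -
    \<comment> \<open>So large that Markov's inequality with the bound m^2 gives at most e; the
      added 1 keeps the threshold positive when m = 0.\<close>
    obtain r where r: "r > 0" "slow_kernel t r \<ge> (m\<^sup>2 + 1) / e" using slow_kernel_unbounded by blast
    have q: "0 < (m\<^sup>2 + 1) / e" using e by (simp add: add_nonneg_pos)
    have sr: "0 < slow_kernel t r" using r q by linarith
    have "measure \<mu> {C \<in> X. len (\<kappa> g C) > c + r} \<le> e" if g: "g \<in> carrier G" for g
    proof -
      have D: "{C \<in> X. slow_kernel t r \<le> slow_kernel t (\<rho> (\<kappa> g C))} \<in> sets \<mu>"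
      proof -
        have [measurable]: "(\<lambda>C. slow_kernel t (\<rho> (\<kappa> g C))) \<in> borel_measurable \<mu>"
          by (rule borel_measurable_integrable[OF slow_int[OF g]])
        have "{C \<in> space \<mu>. slow_kernel t r \<le> slow_kernel t (\<rho> (\<kappa> g C))} \<in> sets \<mu>" by measurable
        then show ?thesis by (simp add: space_\<mu>)
      qed
      have "{C \<in> X. len (\<kappa> g C) > c + r} \<subseteq> {C \<in> X. slow_kernel t r \<le> slow_kernel t (\<rho> (\<kappa> g C))}"
      proof
        fix C assume "C \<in> {C \<in> X. len (\<kappa> g C) > c + r}"
        then have C: "C \<in> X" "len (\<kappa> g C) > c + r" by auto
        have k: "\<kappa> g C \<in> \<Gamma>" by (rule \<kappa>_\<Gamma>[OF g C(1)])
        \<comment> \<open>\<open>len_le\<close> is applied to the inverse, where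
          \<open>\<rho>\<close> takes the norm of \<open>b\<close>.\<close>
        have "c + r < c + \<rho> (\<kappa> g C)"
          using C(2) len_le[OF \<Gamma>_closed(2)[OF k]] len_inv[OF k] by (simp add: \<rho>_def)
        then show "C \<in> {C \<in> X. slow_kernel t r \<le> slow_kernel t (\<rho> (\<kappa> g C))}"
          using C(1) r by (auto intro: slow_kernel_mono)
      qed
      then have "measure \<mu> {C \<in> X. len (\<kappa> g C) > c + r} \<le> measure \<mu> {C \<in> X. slow_kernel t r \<le> slow_kernel t (\<rho> (\<kappa> g C))}"
        using D by (intro \<mu>.finite_measure_mono)
      also have "\<dots> \<le> m\<^sup>2 / slow_kernel t r"
        by (rule markov_le[OF slow_int[OF g] slow_kernel_nonneg slow_bound[OF g] sr])
      also have "\<dots> \<le> m\<^sup>2 / ((m\<^sup>2 + 1) / e)" by (rule divide_left_mono[OF r(2) _ mult_pos_pos[OF sr q]]) simp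
      also have "\<dots> = e * (m\<^sup>2 / (m\<^sup>2 + 1))" using e by simp
      also have "\<dots> \<le> e * 1"
      proof (rule mult_left_mono)
        have "0 < m\<^sup>2 + 1" by (simp add: add_nonneg_pos)
        then show "m\<^sup>2 / (m\<^sup>2 + 1) \<le> 1" by (simp add: divide_le_eq_1)
      qed (use e in simp)
      finally show ?thesis by simp
    qed
    then show ?thesis by blast
  qed
  obtain B where B: "\<And>\<gamma>. \<gamma> \<in> \<Gamma> \<Longrightarrow> len \<gamma> \<le> B"
    using tight_length_bounded[of len, OF len_add len_inv tight] by blast
  have "hnorm H (b \<gamma>) \<le> B + hnorm H (b \<one>)" if g: "\<gamma> \<in> \<Gamma>" for \<gamma>
  proof -
    \<comment> \<open>The identity is one of the elements over which the supremum \<open>len\<close>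
      is taken.\<close>
    have "hdist H (b \<gamma>) (b \<one>) \<le> B"
      using len_upper[OF \<Gamma>_closed(3) g] B[OF g] \<Gamma>_carrier[OF g] by simp
    then show ?thesis
      using H.hdist_triangle[of "b \<gamma>" "b \<one>" "\<zero>\<^bsub>H\<^esub>"] bc[OF g] bc[OF \<Gamma>_closed(3)] by (simp add: H.hnorm_eq_hdist)
  qed
  then show "\<exists>C. \<forall>g\<in>carrier (G\<lparr>carrier := \<Gamma>\<rparr>). hnorm H (b g) \<le> C" by auto
qed

theorem theorem1:
  fixes G :: "('a, 'm) monoid_scheme" and T :: "'a topology" and \<Gamma> :: "'a set"
  assumes "lcsc_group G T"
    and "lattice_in G T \<Gamma>"
  shows "property_TTT TYPE('h \<Rightarrow> complex) G T \<longleftrightarrow>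
    property_TTT TYPE('h \<Rightarrow> complex) (G\<lparr>carrier := \<Gamma>\<rparr>) (subtopology T \<Gamma>)"
proof -
  interpret lcsc_lattice G T \<Gamma>
    using assms by (intro lcsc_lattice.intro lcsc_lattice_axioms.intro)
  show ?thesis using TTT_of_lattice lattice_TTT by blast
qed

end
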